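(* There is an algorithm for Feedback Vertex Set by CVD running in time $2^{{\mathcal O}(k)} n^{{\mathcal O}(1)}$ that, given an $n$-vertex graph $G$ and integer $k$, either returns a minimum feedback vertex set of $G$ or concludes that there is no chordal vertex deletion set of size $k$ in $G$.
   Context: Feedback Vertex Set by CVD: given a graph $G$ and integers $k,\ell$, with parameter $k$ being the size of a chordal vertex deletion set of $G$ (a vertex set whose deletion leaves a chordal graph), which is not given as input, decide whether there is a set $X$ of at most $\ell$ vertices such that $G - X$ is a forest. *)

theory Defs
  imports Main
begin

section \<open>Graphs, chordality and feedback vertex sets\<close>

record 'a graph =
  verts :: "'a set"
  edges :: "'a set set"

definition simple_graph :: "'a graph \<Rightarrow> bool" where
  "simple_graph G \<longleftrightarrow>
     finite (verts G) \<and> (\<forall>e \<in> edges G. e \<subseteq> verts G \<and> card e = 2)"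

definition delete_verts :: "'a graph \<Rightarrow> 'a set \<Rightarrow> 'a graph" where
  "delete_verts G X = \<lparr>verts = verts G - X, edges = {e \<in> edges G. e \<inter> X = {}}\<rparr>"

definition is_cycle :: "'a graph \<Rightarrow> 'a list \<Rightarrow> bool" where
  "is_cycle G vs \<longleftrightarrow>
     3 \<le> length vs \<and> distinct vs \<and> set vs \<subseteq> verts G \<and>
     (\<forall>i < length vs. {vs ! i, vs ! (Suc i mod length vs)} \<in> edges G)"

definition has_chord :: "'a graph \<Rightarrow> 'a list \<Rightarrow> bool" where
  "has_chord G vs \<longleftrightarrow>
     (\<exists>i < length vs. \<exists>j < length vs.
        i \<noteq> j \<and> j \<noteq> Suc i mod length vs \<and> i \<noteq> Suc j mod length vs \<and>
        {vs ! i, vs ! j} \<in> edges G)"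

definition chordal :: "'a graph \<Rightarrow> bool" where
  "chordal G \<longleftrightarrow> (\<forall>vs. is_cycle G vs \<and> 4 \<le> length vs \<longrightarrow> has_chord G vs)"

definition forest :: "'a graph \<Rightarrow> bool" where
  "forest G \<longleftrightarrow> (\<nexists>vs. is_cycle G vs)"

definition chordal_vertex_deletion_set :: "'a graph \<Rightarrow> 'a set \<Rightarrow> bool" where
  "chordal_vertex_deletion_set G S \<longleftrightarrow> S \<subseteq> verts G \<and> chordal (delete_verts G S)"

definition feedback_vertex_set :: "'a graph \<Rightarrow> 'a set \<Rightarrow> bool" where
  "feedback_vertex_set G X \<longleftrightarrow> X \<subseteq> verts G \<and> forest (delete_verts G X)"

definition minimum_feedback_vertex_set :: "'a graph \<Rightarrow> 'a set \<Rightarrow> bool" where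
  "minimum_feedback_vertex_set G X \<longleftrightarrow>
     feedback_vertex_set G X \<and> (\<forall>Y. feedback_vertex_set G Y \<longrightarrow> card X \<le> card Y)"

section \<open>The machine model\<close>

text \<open>
  Algorithms are programs of a deterministic first-order call-by-value language over binary
  trees, in the style of N. D. Jones's languages WHILE and F. The running time is the number of
  evaluation steps. Values can only be built by pairing, taken apart by projection, and tested
  for being a leaf; there is no equality test on trees and no arithmetic. With trees represented
  by pointers to shared cells, each step therefore takes time bounded by a constant depending
  only on the program and allocates boundedly many cells, so this running time agrees up to a
  polynomial with running time on Turing machines. The class of time bounds
  $2^{O(k)} n^{O(1)}$ is invariant under such a change of model.
\<close>

datatype tree = Leaf | Node tree tree

text \<open>
  Variables are de Bruijn indices into the environment. \<open>ECall f es\<close> calls the \<open>f\<close>-th function of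
  the program; its body is evaluated in the environment consisting of the argument values.
\<close>

datatype expr =
    EVar nat
  | ELeaf
  | ENode expr expr
  | ELeft expr
  | ERight expr
  | EIf expr expr expr
  | ELet expr expr
  | ECall nat "expr list"

type_synonym program = "expr list"

primrec left :: "tree \<Rightarrow> tree" where
  "left Leaf = Leaf"
| "left (Node l r) = l"

primrec right :: "tree \<Rightarrow> tree" where
  "right Leaf = Leaf"
| "right (Node l r) = r"

text \<open>
  \<open>eval P env e v t\<close>: in environment \<open>env\<close>, expression \<open>e\<close> evaluates to \<open>v\<close> in exactly \<open>t\<close> steps.
  Diverging evaluations, unbound variables and calls of undefined functions have no result.
  In conditionals, \<open>Leaf\<close> is false and every other tree is true.
\<close>

inductive
  eval :: "program \<Rightarrow> tree list \<Rightarrow> expr \<Rightarrow> tree \<Rightarrow> nat \<Rightarrow> bool" and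
  evals :: "program \<Rightarrow> tree list \<Rightarrow> expr list \<Rightarrow> tree list \<Rightarrow> nat \<Rightarrow> bool"
  for P :: program
where
  eval_var: "i < length env \<Longrightarrow> eval P env (EVar i) (env ! i) 1"
| eval_leaf: "eval P env ELeaf Leaf 1"
| eval_node: "eval P env e1 v1 t1 \<Longrightarrow> eval P env e2 v2 t2 \<Longrightarrow>
    eval P env (ENode e1 e2) (Node v1 v2) (t1 + t2 + 1)"
| eval_left: "eval P env e v t \<Longrightarrow> eval P env (ELeft e) (left v) (t + 1)"
| eval_right: "eval P env e v t \<Longrightarrow> eval P env (ERight e) (right v) (t + 1)"
| eval_if_true: "eval P env e v t \<Longrightarrow> v \<noteq> Leaf \<Longrightarrow> eval P env e1 v1 t1 \<Longrightarrow>
    eval P env (EIf e e1 e2) v1 (t + t1 + 1)"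
| eval_if_false: "eval P env e Leaf t \<Longrightarrow> eval P env e2 v2 t2 \<Longrightarrow>
    eval P env (EIf e e1 e2) v2 (t + t2 + 1)"
| eval_let: "eval P env e1 v1 t1 \<Longrightarrow> eval P (v1 # env) e2 v2 t2 \<Longrightarrow>
    eval P env (ELet e1 e2) v2 (t1 + t2 + 1)"
| eval_call: "f < length P \<Longrightarrow> evals P env es vs t1 \<Longrightarrow> eval P vs (P ! f) v t2 \<Longrightarrow>
    eval P env (ECall f es) v (t1 + t2 + 1)"
| evals_nil: "evals P env [] [] 0"
| evals_cons: "eval P env e v t1 \<Longrightarrow> evals P env es vs t2 \<Longrightarrow>
    evals P env (e # es) (v # vs) (t1 + t2)"

inductive_cases eval_elims:
  "eval P env (EVar i) v t"
  "eval P env ELeaf v t"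
  "eval P env (ENode e1 e2) v t"
  "eval P env (ELeft e) v t"
  "eval P env (ERight e) v t"
  "eval P env (EIf e e1 e2) v t"
  "eval P env (ELet e1 e2) v t"
  "eval P env (ECall f es) v t"
  "evals P env [] vs t"
  "evals P env (e # es) vs t"

lemma eval_deterministic:
  "eval P env e v t \<Longrightarrow> eval P env e v' t' \<Longrightarrow> v' = v \<and> t' = t"
  "evals P env es vs u \<Longrightarrow> evals P env es vs' u' \<Longrightarrow> vs' = vs \<and> u' = u"
proof (induction arbitrary: v' t' and vs' u' rule: eval_evals.inducts)
  case eval_var then show ?case by (elim eval_elims(1)) simp
next
  case eval_leaf then show ?case by (elim eval_elims(2)) simp
next
  case eval_node from eval_node.prems show ?case by (rule eval_elims(3)) (metis Suc_eq_plus1 eval_node.IH)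
next
  case eval_left from eval_left.prems show ?case by (rule eval_elims(4)) (metis Suc_eq_plus1 eval_left.IH)
next
  case eval_right from eval_right.prems show ?case by (rule eval_elims(5)) (metis Suc_eq_plus1 eval_right.IH)
next
  case eval_if_true from eval_if_true.prems show ?case
    by (rule eval_elims(6)) (metis Suc_eq_plus1 eval_if_true.IH eval_if_true.hyps)+
next
  case eval_if_false from eval_if_false.prems show ?case
    by (rule eval_elims(6)) (metis Suc_eq_plus1 eval_if_false.IH)+
next
  case eval_let from eval_let.prems show ?case by (rule eval_elims(7)) (metis Suc_eq_plus1 eval_let.IH)
next
  case eval_call from eval_call.prems show ?case by (rule eval_elims(8)) (metis Suc_eq_plus1 eval_call.IH)
next
  case evals_nil then show ?case by (elim eval_elims(9)) simp
next
  case evals_cons from evals_cons.prems show ?case by (rule eval_elims(10)) (metis evals_cons.IH)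
qed

definition runs :: "program \<Rightarrow> tree \<Rightarrow> tree \<Rightarrow> nat \<Rightarrow> bool" where
  "runs P x y t \<longleftrightarrow> P \<noteq> [] \<and> eval P [x] (P ! 0) y t"

section \<open>Encoding of inputs and answers\<close>

text \<open>
  The graph is given by its adjacency matrix, its vertices being numbered \<open>0, \<dots>, n - 1\<close>.
  Numbers are written in unary: a vertex number then has length at most \<open>n\<close>, and converting the
  parameter \<open>k\<close> from binary to unary costs time $2^{O(k)}$ only.
\<close>

primrec enc_nat :: "nat \<Rightarrow> tree" where
  "enc_nat 0 = Leaf"
| "enc_nat (Suc m) = Node Leaf (enc_nat m)"

definition enc_bool :: "bool \<Rightarrow> tree" where
  "enc_bool b = (if b then Node Leaf Leaf else Leaf)"

primrec enc_list :: "('a \<Rightarrow> tree) \<Rightarrow> 'a list \<Rightarrow> tree" where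
  "enc_list f [] = Leaf"
| "enc_list f (x # xs) = Node (f x) (enc_list f xs)"

definition adjacency_matrix :: "nat graph \<Rightarrow> bool list list" where
  "adjacency_matrix G =
     (let n = card (verts G) in map (\<lambda>i. map (\<lambda>j. {i, j} \<in> edges G) [0..<n]) [0..<n])"

definition enc_input :: "nat graph \<Rightarrow> nat \<Rightarrow> tree" where
  "enc_input G k = Node (enc_list (enc_list enc_bool) (adjacency_matrix G)) (enc_nat k)"

datatype answer = No_CVD_Set | FVS "nat list"

primrec enc_answer :: "answer \<Rightarrow> tree" where
  "enc_answer No_CVD_Set = Leaf"
| "enc_answer (FVS xs) = Node Leaf (enc_list enc_nat xs)"

lemma enc_nat_inject: "enc_nat m = enc_nat n \<longleftrightarrow> m = n"
proof (induction m arbitrary: n)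
  case 0
  show ?case by (cases n) auto
next
  case (Suc m)
  then show ?case by (cases n) auto
qed

lemma enc_list_inject:
  assumes "\<And>x y. f x = f y \<longleftrightarrow> x = y"
  shows "enc_list f xs = enc_list f ys \<longleftrightarrow> xs = ys"
proof (induction xs arbitrary: ys)
  case Nil
  show ?case by (cases ys) auto
next
  case (Cons x xs)
  then show ?case by (cases ys) (auto simp: assms)
qed

lemma enc_answer_inject: "enc_answer a = enc_answer b \<longleftrightarrow> a = b"
  by (cases a; cases b) (auto simp: enc_list_inject enc_nat_inject)

text \<open>
  ``Size \<open>k\<close>'' is read as size at most \<open>k\<close>; the two readings agree for \<open>k\<close> up to the number of
  vertices, because chordality is inherited by induced subgraphs, and for larger \<open>k\<close> this
  reading asks more of the algorithm.
\<close>

primrec correct_answer :: "nat graph \<Rightarrow> nat \<Rightarrow> answer \<Rightarrow> bool" where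
  "correct_answer G k No_CVD_Set \<longleftrightarrow>
     (\<nexists>S. chordal_vertex_deletion_set G S \<and> card S \<le> k)"
| "correct_answer G k (FVS xs) \<longleftrightarrow>
     distinct xs \<and> minimum_feedback_vertex_set G (set xs)"

end

theory Submission
  imports Defs "HOL-Library.Z2"
begin

text \<open>
  If \<open>G\<close> has a chordal deletion set \<open>M\<close> with \<open>k\<close> elements, then \<open>G\<close> has at most \<open>2\<^sup>k (n + 1)\<close> maximal cliques,
  and every weighting of the vertices has a balanced separator made of \<open>M\<close> and one maximal clique. As
  in the approximation of treewidth by Robertson and Seymour, one decomposes \<open>G\<close> recursively: guess the
  clique and the split of the small part \<open>Q\<close> of the boundary, replace the unknown \<open>M\<close> by minimum
  vertex cuts, and recurse into components, whose boundaries are covered by two cliques and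
  \<open>O(k)\<close> further vertices. If some step fails, there is no such \<open>M\<close>. Otherwise the result is an
  elimination order all of whose scopes are covered by three cliques and \<open>O(k)\<close> vertices. As a forest
  meets a clique in at most two vertices, it leaves only \<open>2\<^bsup>O(k)\<^esup> n\<^bsup>O(1)\<^esup>\<close> traces on a scope.

  Connectivity is handled in the spirit of Cut and Count: a set \<open>F\<close> induces a forest iff one can choose
  roots \<open>R \<subseteq> F\<close> such that edges and roots together are as many as the vertices and the number of
  two-colourings of \<open>F\<close> that are constant along edges and trivial on \<open>R\<close> is odd. Partial solutions
  become vectors over the field with two elements, indexed by boundary colourings, and Gaussian
  elimination keeps only a basis of them in each table; this is deterministic.

  The machine model enters through functions that are computable in time polynomial in the size of their
  argument. The exponential dependence on \<open>k\<close> enters only through an additional argument \<open>p\<close> of size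
  \<open>2\<^bsup>O(k)\<^esup> n\<^bsup>O(1)\<^esup>\<close>, at which all intermediate results are cut off.
\<close>

text \<open>Two obstacles shape the proof. The deletion set is never found; it only certifies that
  small cuts exist. So every property that a decomposition step must have is tested by the program
  itself, and chordality is used solely to show that some guess passes the tests. Moreover,
  balancing alone would let a boundary collect more and more cliques. Therefore a task with two
  boundary cliques is cut in such a way that each child sees at most one of them, besides the newly
  guessed clique. Remembering how a partial forest connects its boundary would cost
  \<open>k^O(k)\<close> partitions. Colourings with two colours cost only \<open>2^O(k)\<close>, but
  parities summed over all solutions may cancel, which is usually prevented by random weights. Here
  solutions are never summed: each partial solution has its own vector, and a coordinate vanishes on
  a whole family of vectors iff it vanishes on a basis of their span. The tables yield only the
  sizes of induced forests; a vertex-by-vertex self-reduction recovers a largest one.\<close>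

primrec nodes :: "tree \<Rightarrow> nat" where
  "nodes Leaf = 0"
| "nodes (Node l r) = Suc (nodes l + nodes r)"

section \<open>Encodings of data types as trees, and their sizes\<close>

class enc =
  fixes enc :: "'a \<Rightarrow> tree"
  assumes enc_inject: "enc x = enc y \<longleftrightarrow> x = y"

text \<open>Only inner nodes count, so a unary number is its own size and an empty list costs
  nothing.\<close>

definition sz :: "'a::enc \<Rightarrow> nat" where
  "sz x = nodes (enc x)"

instantiation unit :: enc
begin
definition enc_unit :: "unit \<Rightarrow> tree" where "enc_unit x = Leaf"
instance by standard simp
end

instantiation nat :: enc
begin
definition enc_nat_class [simp]: "enc = enc_nat"
instance by standard (simp add: enc_nat_inject)
end

instantiation bool :: enc
begin
definition enc_bool_class [simp]: "enc = enc_bool"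
instance by standard (auto simp: enc_bool_def)
end

instantiation list :: (enc) enc
begin
definition enc_list_class [simp]: "enc = enc_list enc"
instance by standard (simp add: enc_list_inject enc_inject)
end

instantiation prod :: (enc, enc) enc
begin
definition enc_prod_class [simp]: "enc p = Node (enc (fst p)) (enc (snd p))"
instance by standard (simp add: enc_inject prod_eq_iff)
end

text \<open>Chosen to agree with \<open>enc_answer\<close>: \<open>None\<close> is encoded like
  \<open>No_CVD_Set\<close> and \<open>Some xs\<close> like \<open>FVS xs\<close>, so the output of
  the final program needs no conversion.\<close>

instantiation option :: (enc) enc
begin
definition enc_option_class [simp]:
  "enc z = (case z of None \<Rightarrow> Leaf | Some x \<Rightarrow> Node Leaf (enc x))"
instance by standard (auto simp: enc_inject split: option.splits)
end

lemma sz_nat [simp]: "sz (m :: nat) = m" by (induction m) (simp_all add: sz_def)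
lemma sz_bool_le: "sz (b :: bool) \<le> 1" by (simp add: sz_def enc_bool_def)
lemma sz_Nil [simp]: "sz [] = 0" by (simp add: sz_def)
lemma sz_Cons [simp]: "sz (x # xs) = Suc (sz x + sz xs)" by (simp add: sz_def)
lemma sz_Pair [simp]: "sz (x, y) = Suc (sz x + sz y)" by (simp add: sz_def)
lemma sz_prod: "sz p = Suc (sz (fst p) + sz (snd p))" by (simp add: sz_def)
lemma sz_Some [simp]: "sz (Some x) = Suc (sz x)" by (simp add: sz_def)

lemma sz_append [simp]: "sz (xs @ ys) = sz xs + sz ys" by (induction xs) auto
lemma sz_rev [simp]: "sz (rev xs) = sz xs" by (induction xs) auto
lemma sz_filter_le: "sz (filter P xs) \<le> sz xs" by (induction xs) auto
lemma sz_fst_le: "sz (fst p) \<le> sz p" by (simp add: sz_prod)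
lemma sz_snd_le: "sz (snd p) \<le> sz p" by (simp add: sz_prod)
lemma length_le_sz: "length xs \<le> sz xs" by (induction xs) auto
lemma sz_mem_le: "x \<in> set xs \<Longrightarrow> sz x \<le> sz xs" by (induction xs) auto
lemma sz_list_le:
  "(\<And>x. x \<in> set xs \<Longrightarrow> sz x \<le> b) \<Longrightarrow> length xs \<le> a \<Longrightarrow> sz xs \<le> a * Suc b"
proof (induction xs arbitrary: a)
  case (Cons x xs)
  then obtain a' where a: "a = Suc a'" "length xs \<le> a'" by (cases a) auto
  then have "sz xs \<le> a' * Suc b" using Cons by auto
  then show ?case using a Cons.prems(1)[of x] by simp
qed simp
lemma sz_take_le: "sz (take i xs) \<le> sz xs"
  by (metis append_take_drop_id le_add1 sz_append)

section \<open>Relocation of programs\<close>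

text \<open>Calls name functions by their position, so a program placed behind \<open>d\<close>
  functions has all its calls moved by \<open>d\<close>; variables are local to a body and stay as
  they are.\<close>

primrec shift :: "nat \<Rightarrow> expr \<Rightarrow> expr" where
  "shift d (EVar i) = EVar i"
| "shift d ELeaf = ELeaf"
| "shift d (ENode a b) = ENode (shift d a) (shift d b)"
| "shift d (ELeft a) = ELeft (shift d a)"
| "shift d (ERight a) = ERight (shift d a)"
| "shift d (EIf a b c) = EIf (shift d a) (shift d b) (shift d c)"
| "shift d (ELet a b) = ELet (shift d a) (shift d b)"
| "shift d (ECall f es) = ECall (d + f) (map (shift d) es)"

lemma eval_program_append:
  "eval P env e v t \<Longrightarrow> eval (P @ Q) env e v t"
  "evals P env es vs u \<Longrightarrow> evals (P @ Q) env es vs u"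
proof (induction rule: eval_evals.inducts)
  case (eval_call f env es vs t1 v t2)
  then show ?case by (intro eval_evals.eval_call) (auto simp: nth_append)
qed (blast intro: eval_evals.intros)+

lemma eval_program_shift:
  "eval P env e v t \<Longrightarrow> eval (Q @ map (shift (length Q)) P) env (shift (length Q) e) v t"
  "evals P env es vs u \<Longrightarrow> evals (Q @ map (shift (length Q)) P) env (map (shift (length Q)) es) vs u"
proof (induction rule: eval_evals.inducts)
  case (eval_call f env es vs t1 v t2)
  then show ?case unfolding shift.simps by (intro eval_evals.eval_call) simp_all
qed (simp_all only: shift.simps list.map, (blast intro: eval_evals.intros)+)

text \<open>Indices count from the front of the environment, so values appended behind it are
  invisible. This lets code written for one argument run under further let-bindings.\<close>

lemma eval_env_append:
  "eval P env e v t \<Longrightarrow> eval P (env @ env') e v t"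
  "evals P env es vs u \<Longrightarrow> evals P (env @ env') es vs u"
proof (induction rule: eval_evals.inducts)
  case (eval_var i env)
  then show ?case using eval_evals.eval_var[of i "env @ env'" P] by (simp add: nth_append)
next
  case (eval_let env e1 v1 t1 e2 v2 t2)
  then show ?case unfolding append_Cons by (blast intro: eval_evals.eval_let)
qed (blast intro: eval_evals.intros)+

lemma eval_env_cons: "eval P [x] e v t \<Longrightarrow> eval P (x # env) e v t"
  using eval_env_append(1)[of P "[x]" e v t env] by simp

lemma eval_var_0: "eval P (x # env) (EVar 0) x 1"
  using eval_var[of 0 "x # env" P] by simp
lemma eval_var_1: "eval P (x # y # env) (EVar (Suc 0)) y 1"
  using eval_var[of 1 "x # y # env" P] by simp
lemma eval_var_2: "eval P (x # y # z # env) (EVar 2) z 1"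
  using eval_var[of 2 "x # y # z # env" P] by simp

section \<open>Polynomially bounded functions\<close>

text \<open>The measure is a parameter because the final algorithm is polynomial in
  \<open>2^k\<close> times the input size rather than in the input size. The successor keeps the
  base positive, so that exponents can be raised when two bounds are added.\<close>

definition pbounded :: "('a \<Rightarrow> nat) \<Rightarrow> ('a \<Rightarrow> nat) \<Rightarrow> bool" where
  "pbounded \<mu> g \<longleftrightarrow> (\<exists>A c. \<forall>x. g x \<le> A * Suc (\<mu> x) ^ c)"

lemma pboundedI: "(\<And>x. g x \<le> A * Suc (\<mu> x) ^ c) \<Longrightarrow> pbounded \<mu> g"
  by (auto simp: pbounded_def)

lemma pbounded_mono: "pbounded \<mu> g \<Longrightarrow> (\<And>x. f x \<le> g x) \<Longrightarrow> pbounded \<mu> f"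
  unfolding pbounded_def by (meson le_trans)

lemma pbounded_const: "pbounded \<mu> (\<lambda>x. a)"
  by (rule pboundedI[of _ a _ 0]) simp

lemma pbounded_id: "pbounded \<mu> \<mu>"
  by (rule pboundedI[of _ 1 _ 1]) simp

lemma pbounded_add: assumes "pbounded \<mu> f" "pbounded \<mu> g" shows "pbounded \<mu> (\<lambda>x. f x + g x)"
proof -
  from assms obtain A c B d where f: "\<And>x. f x \<le> A * Suc (\<mu> x) ^ c" and g: "\<And>x. g x \<le> B * Suc (\<mu> x) ^ d"
    by (auto simp: pbounded_def)
  show ?thesis
  proof (rule pboundedI[of _ "A + B" _ "c + d"])
    fix x
    have "A * Suc (\<mu> x) ^ c \<le> A * Suc (\<mu> x) ^ (c + d)" "B * Suc (\<mu> x) ^ d \<le> B * Suc (\<mu> x) ^ (c + d)"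
      by (intro mult_le_mono2 power_increasing; simp)+
    then show "f x + g x \<le> (A + B) * Suc (\<mu> x) ^ (c + d)"
      using f[of x] g[of x] unfolding add_mult_distrib by linarith
  qed
qed

lemma pbounded_mult: assumes "pbounded \<mu> f" "pbounded \<mu> g" shows "pbounded \<mu> (\<lambda>x. f x * g x)"
proof -
  from assms obtain A c B d where f: "\<And>x. f x \<le> A * Suc (\<mu> x) ^ c" and g: "\<And>x. g x \<le> B * Suc (\<mu> x) ^ d"
    by (auto simp: pbounded_def)
  show ?thesis
  proof (rule pboundedI[of _ "A * B" _ "c + d"])
    fix x show "f x * g x \<le> A * B * Suc (\<mu> x) ^ (c + d)"
      using mult_mono[OF f[of x] g[of x]] by (simp add: power_add ac_simps del: power_Suc)
  qed
qed

lemma pbounded_power: "pbounded \<mu> f \<Longrightarrow> pbounded \<mu> (\<lambda>x. f x ^ m)"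
  by (induction m) (auto intro: pbounded_const pbounded_mult)

lemma pbounded_Suc: "pbounded \<mu> f \<Longrightarrow> pbounded \<mu> (\<lambda>x. Suc (f x))"
  using pbounded_add[OF _ pbounded_const[of _ 1], of \<mu> f] by simp

lemma pbounded_compose:
  assumes "pbounded \<nu> g" "pbounded \<mu> (\<lambda>x. \<nu> (f x))" shows "pbounded \<mu> (\<lambda>x. g (f x))"
proof -
  from assms(1) obtain A c where g: "\<And>y. g y \<le> A * Suc (\<nu> y) ^ c" by (auto simp: pbounded_def)
  have "pbounded \<mu> (\<lambda>x. A * Suc (\<nu> (f x)) ^ c)"
    by (intro pbounded_mult pbounded_const pbounded_power pbounded_Suc assms(2))
  then show ?thesis by (rule pbounded_mono) (rule g)
qed

lemmas pbounded_intros = pbounded_const pbounded_id pbounded_add pbounded_mult pbounded_power pbounded_Suc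

section \<open>Computable functions with a time bound\<close>

definition implements :: "program \<Rightarrow> expr \<Rightarrow> ('a::enc \<Rightarrow> 'b::enc) \<Rightarrow> ('a \<Rightarrow> nat) \<Rightarrow> bool" where
  "implements P e f T \<longleftrightarrow> (\<forall>x. \<exists>t \<le> T x. eval P [enc x] e (enc (f x)) t)"

lemma implementsI: "(\<And>x. \<exists>t \<le> T x. eval P [enc x] e (enc (f x)) t) \<Longrightarrow> implements P e f T"
  by (simp add: implements_def)

lemma implementsE:
  assumes "implements P e f T"
  obtains t where "t \<le> T x" "eval P [enc x] e (enc (f x)) t"
  using assms by (auto simp: implements_def)

lemma implements_append: "implements P e f T \<Longrightarrow> implements (P @ Q) e f T"
  unfolding implements_def by (meson eval_program_append(1))

text \<open>Two implementations may always be assumed to live in one program, which is how code is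
  composed below: the second program is relocated behind the first.\<close>

lemma implements_join:
  assumes "implements P e f T" "implements Q e' g U"
  obtains R e1 e2 where "implements R e1 f T" "implements R e2 g U"
proof -
  have "implements (P @ map (shift (length P)) Q) e f T"
    using assms(1) by (rule implements_append)
  moreover have "implements (P @ map (shift (length P)) Q) (shift (length P) e') g U"
    using assms(2) unfolding implements_def by (meson eval_program_shift(1))
  ultimately show ?thesis by (rule that)
qed

text \<open>Values are shared on the machine, so the output size is not controlled by the running time and
  has to be bounded separately.\<close>

definition feasible :: "('a::enc \<Rightarrow> nat) \<Rightarrow> ('a \<Rightarrow> 'b::enc) \<Rightarrow> bool" where
  "feasible \<mu> f \<longleftrightarrow> (\<exists>P e T. implements P e f T \<and> pbounded \<mu> T) \<and> pbounded \<mu> (\<lambda>x. sz (f x))"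

abbreviation ptime :: "('a::enc \<Rightarrow> 'b::enc) \<Rightarrow> bool" where
  "ptime \<equiv> feasible sz"

lemma feasibleI:
  "implements P e f T \<Longrightarrow> pbounded \<mu> T \<Longrightarrow> pbounded \<mu> (\<lambda>x. sz (f x)) \<Longrightarrow> feasible \<mu> f"
  by (auto simp: feasible_def)

lemma feasible_pbounded: "feasible \<mu> f \<Longrightarrow> pbounded \<mu> (\<lambda>x. sz (f x))"
  by (simp add: feasible_def)

lemma feasible_id: assumes "pbounded \<mu> sz" shows "feasible \<mu> (\<lambda>x. x)"
proof (rule feasibleI)
  show "implements [] (EVar 0) (\<lambda>x. x) (\<lambda>x. 1)"
    by (rule implementsI) (use eval_var_0 in blast)
qed (use assms in \<open>auto intro: pbounded_intros\<close>)

text \<open>Only the inner function may exceed polynomial time in the size of its argument. In this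
  way one exponential preprocessing step is followed by a polynomial algorithm; the size bound in
  \<open>feasible\<close> makes the time of the outer function controllable.\<close>

lemma feasible_compose:
  assumes g: "ptime g" and f: "feasible \<mu> f"
  shows "feasible \<mu> (\<lambda>x. g (f x))"
proof -
  obtain P e T where 1: "implements P e f T" "pbounded \<mu> T" using f by (auto simp: feasible_def)
  obtain Q e' U where 2: "implements Q e' g U" "pbounded sz U" using g by (auto simp: feasible_def)
  obtain R e1 e2 where R: "implements R e1 f T" "implements R e2 g U"
    using implements_join[OF 1(1) 2(1)] .
  show ?thesis
  proof (rule feasibleI)
    show "implements R (ELet e1 e2) (\<lambda>x. g (f x)) (\<lambda>x. T x + U (f x) + 1)"
    proof (rule implementsI)
      fix x
      obtain t where t: "t \<le> T x" "eval R [enc x] e1 (enc (f x)) t" using R(1) by (rule implementsE)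
      obtain u where u: "u \<le> U (f x)" "eval R [enc (f x)] e2 (enc (g (f x))) u" using R(2) by (rule implementsE)
      show "\<exists>t \<le> T x + U (f x) + 1. eval R [enc x] (ELet e1 e2) (enc (g (f x))) t"
        using eval_let[OF t(2) eval_env_cons[OF u(2)]] t(1) u(1) by (intro exI[of _ "t + u + 1"]) auto
    qed
    show "pbounded \<mu> (\<lambda>x. T x + U (f x) + 1)"
      by (intro pbounded_intros 1 pbounded_compose[OF 2(2)] feasible_pbounded f)
    show "pbounded \<mu> (\<lambda>x. sz (g (f x)))"
      by (rule pbounded_compose[OF feasible_pbounded[OF g] feasible_pbounded[OF f]])
  qed
qed

lemma feasible_Pair:
  assumes f: "feasible \<mu> f" and g: "feasible \<mu> g"
  shows "feasible \<mu> (\<lambda>x. (f x, g x))"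
proof -
  obtain P e T where 1: "implements P e f T" "pbounded \<mu> T" using f by (auto simp: feasible_def)
  obtain Q e' U where 2: "implements Q e' g U" "pbounded \<mu> U" using g by (auto simp: feasible_def)
  obtain R e1 e2 where R: "implements R e1 f T" "implements R e2 g U"
    using implements_join[OF 1(1) 2(1)] .
  show ?thesis
  proof (rule feasibleI)
    show "implements R (ENode e1 e2) (\<lambda>x. (f x, g x)) (\<lambda>x. T x + U x + 1)"
    proof (rule implementsI)
      fix x
      obtain t where t: "t \<le> T x" "eval R [enc x] e1 (enc (f x)) t" using R(1) by (rule implementsE)
      obtain u where u: "u \<le> U x" "eval R [enc x] e2 (enc (g x)) u" using R(2) by (rule implementsE)
      show "\<exists>t \<le> T x + U x + 1. eval R [enc x] (ENode e1 e2) (enc (f x, g x)) t"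
        using eval_node[OF t(2) u(2)] t(1) u(1) by (intro exI[of _ "t + u + 1"]) auto
    qed
    show "pbounded \<mu> (\<lambda>x. T x + U x + 1)" by (intro pbounded_intros 1 2)
    show "pbounded \<mu> (\<lambda>x. sz (f x, g x))"
      unfolding sz_Pair by (intro pbounded_intros feasible_pbounded f g)
  qed
qed

lemma feasible_If:
  assumes b: "feasible \<mu> b" and f: "feasible \<mu> f" and g: "feasible \<mu> g"
  shows "feasible \<mu> (\<lambda>x. if b x then f x else g x)"
proof -
  obtain P e T where 1: "implements P e (\<lambda>x. (f x, g x)) T" "pbounded \<mu> T"
    using feasible_Pair[OF f g] by (auto simp: feasible_def)
  obtain Q e' U where 2: "implements Q e' b U" "pbounded \<mu> U" using b by (auto simp: feasible_def)
  obtain R e1 e2 where R: "implements R e1 (\<lambda>x. (f x, g x)) T" "implements R e2 b U"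
    using implements_join[OF 1(1) 2(1)] .
  \<comment> \<open>Both branches are computed as one pair, so that only two programs have to be
    joined. The branch not taken costs time as well, but stays within the bound.\<close>
  let ?e = "EIf e2 (ELeft e1) (ERight e1)"
  show ?thesis
  proof (rule feasibleI)
    show "implements R ?e (\<lambda>x. if b x then f x else g x) (\<lambda>x. T x + U x + 2)"
    proof (rule implementsI)
      fix x
      obtain t where t: "t \<le> T x" "eval R [enc x] e1 (enc (f x, g x)) t" using R(1) by (rule implementsE)
      obtain u where u: "u \<le> U x" "eval R [enc x] e2 (enc (b x)) u" using R(2) by (rule implementsE)
      have l: "eval R [enc x] (ELeft e1) (enc (f x)) (t + 1)" using eval_left[OF t(2)] by simp
      have r: "eval R [enc x] (ERight e1) (enc (g x)) (t + 1)" using eval_right[OF t(2)] by simp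
      have "eval R [enc x] ?e (enc (if b x then f x else g x)) (u + (t + 1) + 1)"
      proof (cases "b x")
        case True
        then show ?thesis using eval_if_true[OF u(2) _ l] by (simp add: enc_bool_def)
      next
        case False
        then show ?thesis using eval_if_false[OF _ r] u(2) by (simp add: enc_bool_def)
      qed
      then show "\<exists>t \<le> T x + U x + 2. eval R [enc x] ?e (enc (if b x then f x else g x)) t"
        using t(1) u(1) by (intro exI[of _ "u + (t + 1) + 1"]) auto
    qed
    show "pbounded \<mu> (\<lambda>x. T x + U x + 2)" by (intro pbounded_intros 1 2)
    have "pbounded \<mu> (\<lambda>x. sz (f x) + sz (g x))" by (intro pbounded_intros feasible_pbounded f g)
    then show "pbounded \<mu> (\<lambda>x. sz (if b x then f x else g x))" by (rule pbounded_mono) auto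
  qed
qed

text \<open>Loops are calls of a tail recursive function with the arguments context, list and state.\<close>

lemma feasible_fold:
  assumes h: "ptime h" and l: "feasible \<mu> l" and s: "feasible \<mu> s" and id: "pbounded \<mu> sz"
    and B: "pbounded \<mu> B"
    and state: "\<And>x i. sz (fold (\<lambda>y s. h (x, y, s)) (take i (l x)) (s x)) \<le> B x"
  shows "feasible \<mu> (\<lambda>x. fold (\<lambda>y s. h (x, y, s)) (l x) (s x))"
proof -
  obtain P1 e1 T1 where 1: "implements P1 e1 (\<lambda>x. (x, l x, s x)) T1" "pbounded \<mu> T1"
    using feasible_Pair[OF feasible_id[OF id] feasible_Pair[OF l s]] by (auto simp: feasible_def)
  obtain P2 e2 T2 where 2: "implements P2 e2 h T2" "pbounded sz T2" using h by (auto simp: feasible_def)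
  obtain P el eh where P: "implements P el (\<lambda>x. (x, l x, s x)) T1" "implements P eh h T2"
    using implements_join[OF 1(1) 2(1)] .
  \<comment> \<open>The loop function has the environment context, remaining list, state. It is
    stored at index \<open>length P\<close>, behind the functions that the loop step may
    call.\<close>
  define body where "body = EIf (EVar (Suc 0))
    (ECall (length P) [EVar 0, ERight (EVar (Suc 0)),
       ELet (ENode (EVar 0) (ENode (ELeft (EVar (Suc 0))) (EVar 2))) eh]) (EVar 2)"
  let ?R = "P @ [body]"
  obtain A c where T2: "\<And>z. T2 z \<le> A * Suc (sz z) ^ c" using 2(2) unfolding pbounded_def by blast
  \<comment> \<open>Bounds \<open>T2 (x, y, s)\<close> for every round: \<open>y\<close> is at most
    as large as the whole list and the state at most \<open>B x\<close>. Two of the three successors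
    come from the pairings, the third from the form of the polynomial bound.\<close>
  define step where "step x = A * Suc (Suc (Suc (sz x + sz (l x) + B x))) ^ c" for x
  have Rl: "implements ?R el (\<lambda>x. (x, l x, s x)) T1" and Rh: "implements ?R eh h T2"
    using P by (auto intro: implements_append)
  \<comment> \<open>The constant 20 is a generous allowance for the fixed overhead of one round, and
    once more for the last test of the list.\<close>
  have loop: "\<exists>t \<le> length ys * (step x + 20) + 20. eval ?R [enc x, enc ys, enc z] body
      (enc (fold (\<lambda>y s. h (x, y, s)) ys z)) t"
    if "\<And>i. sz (fold (\<lambda>y s. h (x, y, s)) (take i ys) z) \<le> B x" "sz ys \<le> sz (l x)" for x ys z
    using that
  proof (induction ys arbitrary: z)
    case Nil
    have "eval P' [enc x, Leaf, enc z] (EIf (EVar (Suc 0)) e' (EVar 2)) (enc z) (1 + 1 + 1)" for P' e'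
      by (rule eval_if_false; rule eval_var_1 eval_var_2)
    then have "eval ?R [enc x, enc ([]::'b list), enc z] body (enc z) 3"
      unfolding body_def by (simp add: numeral_3_eq_3)
    then show ?case by (intro exI[of _ 3]) auto
  next
    case (Cons y ys)
    have 1: "sz (fold (\<lambda>y s. h (x, y, s)) (take i ys) (h (x, y, z))) \<le> B x" for i
      using Cons.prems(1)[of "Suc i"] by simp
    obtain t where t: "t \<le> length ys * (step x + 20) + 20"
      "eval ?R [enc x, enc ys, enc (h (x, y, z))] body (enc (fold (\<lambda>y s. h (x, y, s)) ys (h (x, y, z)))) t"
      using Cons.IH[OF 1] Cons.prems(2) by auto
    obtain u where u: "u \<le> T2 (x, y, z)" "eval ?R [enc (x, y, z)] eh (enc (h (x, y, z))) u"
      using Rh by (rule implementsE)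
    let ?env = "[enc x, enc (y # ys), enc z]"
    have v0: "eval ?R ?env (EVar 0) (enc x) 1" and v1: "eval ?R ?env (EVar (Suc 0)) (enc (y # ys)) 1"
      and v2: "eval ?R ?env (EVar 2) (enc z) 1" by (rule eval_var_0 eval_var_1 eval_var_2)+
    have tup: "eval ?R ?env (ENode (EVar 0) (ENode (ELeft (EVar (Suc 0))) (EVar 2))) (enc (x, y, z)) (1 + (1 + 1 + 1 + 1) + 1)"
      using eval_node[OF v0 eval_node[OF eval_left[OF v1] v2]] by simp
    have tl: "eval ?R ?env (ERight (EVar (Suc 0))) (enc ys) (1 + 1)"
      using eval_right[OF v1] by simp
    have args: "evals ?R ?env [EVar 0, ERight (EVar (Suc 0)),
       ELet (ENode (EVar 0) (ENode (ELeft (EVar (Suc 0))) (EVar 2))) eh]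
        [enc x, enc ys, enc (h (x, y, z))] (1 + ((1 + 1) + ((1 + (1 + 1 + 1 + 1) + 1 + u + 1) + 0)))"
      by (intro evals_cons evals_nil v0 tl eval_let[OF tup] eval_env_cons[OF u(2)])
    have "eval ?R [enc x, enc ys, enc (h (x, y, z))] (?R ! length P)
        (enc (fold (\<lambda>y s. h (x, y, s)) (y # ys) z)) t"
      using t(2) by (simp add: nth_append)
    from eval_if_true[OF v1 _ eval_call[OF _ args this], where ?e2.0 = "EVar 2"]
    have "eval ?R ?env body (enc (fold (\<lambda>y s. h (x, y, s)) (y # ys) z))
       (1 + ((1 + ((1 + 1) + ((1 + (1 + 1 + 1 + 1) + 1 + u + 1) + 0))) + t + 1) + 1)"
      by (simp add: body_def[symmetric])
    moreover have "u \<le> step x"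
    proof -
      have "sz z \<le> B x" using Cons.prems(1)[of 0] by simp
      moreover have "sz y \<le> sz (l x)" using Cons.prems(2) by simp
      ultimately have "T2 (x, y, z) \<le> step x" unfolding step_def
        by (intro order.trans[OF T2] mult_le_mono power_mono) auto
      then show ?thesis using u(1) by simp
    qed
    ultimately show ?case using t(1) by (intro exI conjI) (auto simp: algebra_simps)
  qed
  let ?e = "ELet el (ECall (length P) [ELeft (EVar 0), ELeft (ERight (EVar 0)), ERight (ERight (EVar 0))])"
  let ?T = "\<lambda>x. T1 x + (sz (l x) * (step x + 20) + 20) + 20"
  show ?thesis
  proof (rule feasibleI)
    show "implements ?R ?e (\<lambda>x. fold (\<lambda>y s. h (x, y, s)) (l x) (s x)) ?T"
    proof (rule implementsI)
      fix x
      let ?r = "fold (\<lambda>y s. h (x, y, s)) (l x) (s x)"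
      obtain t where t: "t \<le> T1 x" "eval ?R [enc x] el (enc (x, l x, s x)) t" using Rl by (rule implementsE)
      obtain u where u: "u \<le> length (l x) * (step x + 20) + 20"
        "eval ?R [enc x, enc (l x), enc (s x)] body (enc ?r) u"
        using loop[of x "l x" "s x"] state by auto
      have v: "eval ?R [enc (x, l x, s x), enc x] (EVar 0) (enc (x, l x, s x)) 1" by (rule eval_var_0)
      have a: "eval ?R [enc (x, l x, s x), enc x] (ELeft (EVar 0)) (enc x) (1 + 1)"
        using eval_left[OF v] by simp
      have b: "eval ?R [enc (x, l x, s x), enc x] (ELeft (ERight (EVar 0))) (enc (l x)) (1 + 1 + 1)"
        using eval_left[OF eval_right[OF v]] by simp
      have c: "eval ?R [enc (x, l x, s x), enc x] (ERight (ERight (EVar 0))) (enc (s x)) (1 + 1 + 1)"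
        using eval_right[OF eval_right[OF v]] by simp
      have args: "evals ?R [enc (x, l x, s x), enc x]
          [ELeft (EVar 0), ELeft (ERight (EVar 0)), ERight (ERight (EVar 0))]
          [enc x, enc (l x), enc (s x)] ((1 + 1) + ((1 + 1 + 1) + ((1 + 1 + 1) + 0)))"
        by (intro evals_cons a b c evals_nil)
      have "eval ?R [enc x, enc (l x), enc (s x)] (?R ! length P) (enc ?r) u"
        using u(2) by (simp add: nth_append)
      from eval_let[OF t(2) eval_call[OF _ args this]]
      have "eval ?R [enc x] ?e (enc ?r) (t + ((1 + 1) + ((1 + 1 + 1) + ((1 + 1 + 1) + 0)) + u + 1) + 1)"
        by simp
      moreover have "length (l x) * (step x + 20) \<le> sz (l x) * (step x + 20)"
        by (intro mult_le_mono length_le_sz) simp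
      ultimately show "\<exists>t \<le> ?T x. eval ?R [enc x] ?e (enc ?r) t"
        using t(1) u(1) by (intro exI, intro conjI[rotated]) (assumption, linarith)
    qed
    show "pbounded \<mu> ?T" unfolding step_def
      by (intro pbounded_intros 1 feasible_pbounded[OF l] B id)
    show "pbounded \<mu> (\<lambda>x. sz (fold (\<lambda>y s. h (x, y, s)) (l x) (s x)))"
      using B
    proof (rule pbounded_mono)
      show "sz (fold (\<lambda>y s. h (x, y, s)) (l x) (s x)) \<le> B x" for x
        using state[of x "length (l x)"] by simp
    qed
  qed
qed

section \<open>A library of polynomial time functions\<close>

named_theorems pt

lemma ex_leI: "P t \<Longrightarrow> t \<le> T \<Longrightarrow> \<exists>t \<le> T. P t" for t T :: nat
  by blast

text \<open>A type matters only through its encoding. Hence list construction, successor and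
  \<open>Some\<close> are just pairings under another name.\<close>

lemma feasible_retype:
  assumes "feasible \<mu> f" "\<And>x. enc (g x) = enc (f x)" shows "feasible \<mu> g"
  using assms by (simp add: feasible_def implements_def sz_def)

lemma feasible_eq: "feasible \<mu> f \<Longrightarrow> (\<And>x. g x = f x) \<Longrightarrow> feasible \<mu> g"
  by (erule feasible_retype) simp

lemma feasible_const: "feasible \<mu> (\<lambda>x. c)"
proof -
  have tree: "\<exists>e t. \<forall>env. eval [] env e v t" for v
  proof (induction v)
    case Leaf
    show ?case by (blast intro: eval_leaf)
  next
    case (Node l r)
    then show ?case by (blast intro: eval_node)
  qed
  obtain e t where "\<And>env. eval [] env e (enc c) t" using tree[of "enc c"] by blast
  then have "implements [] e (\<lambda>x. c) (\<lambda>x. t)" by (intro implementsI) auto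
  then show ?thesis by (rule feasibleI) (rule pbounded_const)+
qed

lemma feasible_unop:
  assumes f: "feasible \<mu> f"
    and ev: "\<And>P env e x t. eval P env e (enc (f x)) t \<Longrightarrow> eval P env (op e) (enc (g x)) (t + 1)"
    and le: "\<And>x. sz (g x) \<le> sz (f x)"
  shows "feasible \<mu> g"
proof -
  obtain P e T where 1: "implements P e f T" "pbounded \<mu> T" using f by (auto simp: feasible_def)
  show ?thesis
  proof (rule feasibleI)
    show "implements P (op e) g (\<lambda>x. T x + 1)"
    proof (rule implementsI)
      fix x
      obtain t where t: "t \<le> T x" "eval P [enc x] e (enc (f x)) t" using 1(1) by (rule implementsE)
      show "\<exists>t \<le> T x + 1. eval P [enc x] (op e) (enc (g x)) t"
        using ev[OF t(2)] t(1) by (intro exI[of _ "t + 1"]) simp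
    qed
    show "pbounded \<mu> (\<lambda>x. T x + 1)" by (intro pbounded_intros 1)
    show "pbounded \<mu> (\<lambda>x. sz (g x))" by (rule pbounded_mono[OF feasible_pbounded[OF f] le])
  qed
qed

lemma feasible_fst: "feasible \<mu> f \<Longrightarrow> feasible \<mu> (\<lambda>x. fst (f x))"
  by (erule feasible_unop[where op = ELeft]) (use eval_left in \<open>fastforce simp: sz_fst_le\<close>)+

lemma feasible_snd: "feasible \<mu> f \<Longrightarrow> feasible \<mu> (\<lambda>x. snd (f x))"
  by (erule feasible_unop[where op = ERight]) (use eval_right in \<open>fastforce simp: sz_snd_le\<close>)+

lemma pbounded_sz_id: "pbounded sz sz" by (rule pbounded_id)

lemma ptime_const [pt]: "ptime (\<lambda>x. c)" by (rule feasible_const)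
lemma ptime_id [pt]: "ptime (\<lambda>x. x)" by (rule feasible_id[OF pbounded_sz_id])
lemma ptime_Pair [pt]: "ptime f \<Longrightarrow> ptime g \<Longrightarrow> ptime (\<lambda>x. (f x, g x))" by (rule feasible_Pair)
lemma ptime_fst [pt]: "ptime f \<Longrightarrow> ptime (\<lambda>x. fst (f x))" by (rule feasible_fst)
lemma ptime_snd [pt]: "ptime f \<Longrightarrow> ptime (\<lambda>x. snd (f x))" by (rule feasible_snd)
lemma ptime_If [pt]: "ptime b \<Longrightarrow> ptime f \<Longrightarrow> ptime g \<Longrightarrow> ptime (\<lambda>x. if b x then f x else g x)"
  by (rule feasible_If)

lemma ptime_compose2:
  assumes "ptime (\<lambda>p. h (fst p) (snd p))" "ptime f" "ptime g"
  shows "ptime (\<lambda>x. h (f x) (g x))"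
  using feasible_compose[OF assms(1) feasible_Pair[OF assms(2,3)]] by simp

lemma ptime_Cons [pt]: "ptime f \<Longrightarrow> ptime g \<Longrightarrow> ptime (\<lambda>x. f x # g x)"
  by (rule feasible_retype[OF feasible_Pair[of sz f g]]) auto

lemma ptime_Suc [pt]: "ptime f \<Longrightarrow> ptime (\<lambda>x. Suc (f x))"
  by (rule feasible_retype[OF feasible_Pair[OF feasible_const, of sz f "()"]]) (auto simp: enc_unit_def)

lemma ptime_Some [pt]: "ptime f \<Longrightarrow> ptime (\<lambda>x. Some (f x))"
  by (rule feasible_retype[OF feasible_Pair[OF feasible_const, of sz f "()"]]) (auto simp: enc_unit_def)

text \<open>The common source of the case distinctions on lists, numbers and options: a value that
  is not a leaf is the same tree as some pair \<open>q x\<close>, which the branch takes apart by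
  projections.\<close>

lemma ptime_case:
  assumes u: "ptime u" and a: "ptime a" and b: "ptime b"
    and Leaf: "\<And>x. enc (u x) = Leaf \<Longrightarrow> g x = a x"
    and Node: "\<And>x. enc (u x) \<noteq> Leaf \<Longrightarrow> enc (q x) = enc (u x) \<and> g x = b (x, q x)"
  shows "ptime g"
proof -
  obtain P e T where 1: "implements P e (\<lambda>x. (u x, a x)) T" "pbounded sz T"
    using feasible_Pair[OF u a] by (auto simp: feasible_def)
  obtain Q e' U where 2: "implements Q e' b U" "pbounded sz U" using b by (auto simp: feasible_def)
  obtain R e1 e2 where R: "implements R e1 (\<lambda>x. (u x, a x)) T" "implements R e2 b U"
    using implements_join[OF 1(1) 2(1)] .
  obtain A c where U: "\<And>p. U p \<le> A * Suc (sz p) ^ c" using 2(2) unfolding pbounded_def by blast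
  obtain B d where sb: "\<And>p. sz (b p) \<le> B * Suc (sz p) ^ d"
    using feasible_pbounded[OF b] unfolding pbounded_def by blast
  have szq: "sz (x, q x) = Suc (sz x + sz (u x))" if "enc (u x) \<noteq> Leaf" for x
    using Node[OF that] by (simp add: sz_def)
  let ?e = "EIf (ELeft e1) (ELet (ENode (EVar 0) (ELeft e1)) e2) (ERight e1)"
  let ?U = "\<lambda>x. A * Suc (Suc (sz x + sz (u x))) ^ c"
  show ?thesis
  proof (rule feasibleI)
    show "implements R ?e g (\<lambda>x. 2 * T x + ?U x + 10)"
    proof (rule implementsI)
      fix x
      obtain t where t: "t \<le> T x" "eval R [enc x] e1 (enc (u x, a x)) t" using R(1) by (rule implementsE)
      have l: "eval R [enc x] (ELeft e1) (enc (u x)) (t + 1)" using eval_left[OF t(2)] by simp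
      have r: "eval R [enc x] (ERight e1) (enc (a x)) (t + 1)" using eval_right[OF t(2)] by simp
      show "\<exists>t \<le> 2 * T x + ?U x + 10. eval R [enc x] ?e (enc (g x)) t"
      proof (cases "enc (u x) = Leaf")
        case True
        have "eval R [enc x] ?e (enc (g x)) ((t + 1) + (t + 1) + 1)"
          using eval_if_false[OF l[unfolded True] r] Leaf[OF True] by simp
        then show ?thesis using t(1) by (intro exI, intro conjI[rotated]) (assumption, linarith)
      next
        case False
        obtain s where s: "s \<le> U (x, q x)" "eval R [enc (x, q x)] e2 (enc (b (x, q x))) s"
          using R(2) by (rule implementsE)
        have n: "eval R [enc x] (ENode (EVar 0) (ELeft e1)) (enc (x, q x)) (1 + (t + 1) + 1)"
          using eval_node[OF eval_var_0 l] Node[OF False] by simp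
        have "eval R [enc x] ?e (enc (g x)) ((t + 1) + ((1 + (t + 1) + 1) + s + 1) + 1)"
          using eval_if_true[OF l False eval_let[OF n eval_env_cons[OF s(2)]]] Node[OF False] by simp
        moreover have "U (x, q x) \<le> ?U x" using U[of "(x, q x)"] szq[OF False] by simp
        ultimately show ?thesis using t(1) s(1) by (intro exI, intro conjI[rotated]) (assumption, linarith)
      qed
    qed
    show "pbounded sz (\<lambda>x. 2 * T x + ?U x + 10)"
      by (intro pbounded_intros 1 feasible_pbounded u)
    have "pbounded sz (\<lambda>x. sz (a x) + B * Suc (Suc (sz x + sz (u x))) ^ d)"
      by (intro pbounded_intros feasible_pbounded u a)
    then show "pbounded sz (\<lambda>x. sz (g x))"
    proof (rule pbounded_mono)
      show "sz (g x) \<le> sz (a x) + B * Suc (Suc (sz x + sz (u x))) ^ d" for x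
        using Leaf[of x] Node[of x] sb[of "(x, q x)"] szq[of x]
        by (cases "enc (u x) = Leaf") (simp_all add: trans_le_add2)
    qed
  qed
qed

lemma ptime_case_list [pt]:
  assumes "ptime u" "ptime a" "ptime (\<lambda>p. b (fst p) (fst (snd p)) (snd (snd p)))"
  shows "ptime (\<lambda>x. case u x of [] \<Rightarrow> a x | y # ys \<Rightarrow> b x y ys)"
  by (rule ptime_case[OF assms, of _ "\<lambda>x. (hd (u x), tl (u x))"]) (auto split: list.splits)

lemma enc_nat_eq_Leaf: "enc_nat m = Leaf \<longleftrightarrow> m = 0"
  by (cases m) auto

lemma ptime_case_nat [pt]:
  assumes "ptime u" "ptime a" "ptime (\<lambda>p. b (fst p) (snd p))"
  shows "ptime (\<lambda>x. case u x of 0 \<Rightarrow> a x | Suc m \<Rightarrow> b x m)"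
proof -
  have b: "ptime (\<lambda>p. b (fst p) (snd (snd p :: unit \<times> nat)))"
    by (rule ptime_compose2[OF assms(3)]) (intro pt)+
  show ?thesis
    by (rule ptime_case[OF assms(1,2) b, of _ "\<lambda>x. ((), u x - 1)"])
      (auto split: nat.splits simp: enc_unit_def enc_nat_eq_Leaf)
qed

lemma ptime_case_option [pt]:
  assumes "ptime u" "ptime a" "ptime (\<lambda>p. b (fst p) (snd p))"
  shows "ptime (\<lambda>x. case u x of None \<Rightarrow> a x | Some y \<Rightarrow> b x y)"
proof -
  have b: "ptime (\<lambda>p. b (fst p) (snd (snd p :: unit \<times> _)))"
    by (rule ptime_compose2[OF assms(3)]) (intro pt)+
  show ?thesis
    by (rule ptime_case[OF assms(1,2) b, of _ "\<lambda>x. ((), the (u x))"])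
      (auto split: option.splits simp: enc_unit_def)
qed

lemma ptime_tl [pt]: assumes "ptime f" shows "ptime (\<lambda>x. tl (f x))"
proof -
  have "ptime (\<lambda>x. case f x of [] \<Rightarrow> [] | y # ys \<Rightarrow> ys)" by (intro pt assms)
  then show ?thesis by (rule feasible_eq) (simp split: list.split)
qed

lemma ptime_conj [pt]: "ptime f \<Longrightarrow> ptime g \<Longrightarrow> ptime (\<lambda>x. f x \<and> g x)"
  by (rule feasible_eq[OF ptime_If[of f g "\<lambda>_. False"]]) (auto intro: pt)
lemma ptime_disj [pt]: "ptime f \<Longrightarrow> ptime g \<Longrightarrow> ptime (\<lambda>x. f x \<or> g x)"
  by (rule feasible_eq[OF ptime_If[of f "\<lambda>_. True" g]]) (auto intro: pt)
lemma ptime_not [pt]: "ptime f \<Longrightarrow> ptime (\<lambda>x. \<not> f x)"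
  by (rule feasible_eq[OF ptime_If[of f "\<lambda>_. False" "\<lambda>_. True"]]) (auto intro: pt)
lemma ptime_imp [pt]: "ptime f \<Longrightarrow> ptime g \<Longrightarrow> ptime (\<lambda>x. f x \<longrightarrow> g x)"
  by (rule feasible_eq[OF ptime_If[of f g "\<lambda>_. True"]]) (auto intro: pt)

section \<open>Equality and size of trees by recursive programs\<close>

definition eq_body :: expr where
  "eq_body = EIf (EVar 0)
     (EIf (EVar (Suc 0))
       (EIf (ECall 0 [ELeft (EVar 0), ELeft (EVar (Suc 0))])
         (ECall 0 [ERight (EVar 0), ERight (EVar (Suc 0))]) ELeaf) ELeaf)
     (EIf (EVar (Suc 0)) ELeaf (ENode ELeaf ELeaf))"

text \<open>The two trees are descended in parallel up to the first difference, so the first one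
  alone governs the cost: \<open>2 * nodes a + 1\<close> is the number of its subtrees including
  leaves, and each takes at most 20 steps.\<close>

lemma eval_eq_body:
  "\<exists>t \<le> 20 * (2 * nodes a + 1). eval [eq_body] [a, b] eq_body (enc_bool (a = b)) t"
proof (induction a arbitrary: b)
  case Leaf
  have v: "eval [eq_body] [Leaf, b] (EVar 0) Leaf 1" "eval [eq_body] [Leaf, b] (EVar (Suc 0)) b 1"
    by (rule eval_var_0 eval_var_1)+
  have "eval P env (ENode ELeaf ELeaf) (Node Leaf Leaf) (1 + 1 + 1)" for P env
    by (intro eval_node eval_leaf)
  then have "\<exists>t \<le> 5. eval [eq_body] [Leaf, b] (EIf (EVar (Suc 0)) ELeaf (ENode ELeaf ELeaf)) (enc_bool (Leaf = b)) t"
  proof (cases "b = Leaf")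
    case True
    have "eval [eq_body] [Leaf, b] (EIf (EVar (Suc 0)) ELeaf (ENode ELeaf ELeaf)) (Node Leaf Leaf) (1 + (1 + 1 + 1) + 1)"
      using True v(2) by (intro eval_if_false eval_node eval_leaf) simp
    then show ?thesis using True by (intro exI[of _ 5]) (simp add: enc_bool_def eval_nat_numeral)
  next
    case False
    have "eval [eq_body] [Leaf, b] (EIf (EVar (Suc 0)) ELeaf (ENode ELeaf ELeaf)) Leaf (1 + 1 + 1)"
      by (rule eval_if_true[OF v(2) False eval_leaf])
    then show ?thesis using False by (intro exI[of _ 3]) (auto simp add: enc_bool_def eval_nat_numeral)
  qed
  then obtain t where t: "t \<le> 5" "eval [eq_body] [Leaf, b] (EIf (EVar (Suc 0)) ELeaf (ENode ELeaf ELeaf)) (enc_bool (Leaf = b)) t"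
    by blast
  have "eval [eq_body] [Leaf, b] eq_body (enc_bool (Leaf = b)) (1 + t + 1)"
    by (subst (2) eq_body_def) (rule eval_if_false[OF v(1) t(2)])
  then show ?case using t(1) by (intro exI, intro conjI[rotated]) (assumption, simp)
next
  case (Node l r)
  let ?env = "[Node l r, b]"
  have v: "eval [eq_body] ?env (EVar 0) (Node l r) 1" "eval [eq_body] ?env (EVar (Suc 0)) b 1"
    by (rule eval_var_0 eval_var_1)+
  show ?case
  proof (cases b)
    case Leaf
    have "eval [eq_body] ?env eq_body Leaf (1 + (1 + 1 + 1) + 1)"
      by (subst (2) eq_body_def) (use v Leaf in \<open>intro eval_if_true[OF v(1)] eval_if_false eval_leaf; simp\<close>)
    then show ?thesis using Leaf by (intro exI, intro conjI[rotated]) (simp add: enc_bool_def, simp)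
  next
    case (Node l' r')
    have L: "evals [eq_body] ?env [ELeft (EVar 0), ELeft (EVar (Suc 0))] [l, l'] ((1 + 1) + ((1 + 1) + 0))"
      using eval_left[OF v(1)] eval_left[OF v(2)] Node by (intro evals_cons evals_nil) simp_all
    have R: "evals [eq_body] ?env [ERight (EVar 0), ERight (EVar (Suc 0))] [r, r'] ((1 + 1) + ((1 + 1) + 0))"
      using eval_right[OF v(1)] eval_right[OF v(2)] Node by (intro evals_cons evals_nil) simp_all
    obtain t where t: "t \<le> 20 * (2 * nodes l + 1)" "eval [eq_body] [l, l'] ([eq_body] ! 0) (enc_bool (l = l')) t"
      using Node.IH(1) by auto
    obtain u where u: "u \<le> 20 * (2 * nodes r + 1)" "eval [eq_body] [r, r'] ([eq_body] ! 0) (enc_bool (r = r')) u"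
      using Node.IH(2) by auto
    have cl: "eval [eq_body] ?env (ECall 0 [ELeft (EVar 0), ELeft (EVar (Suc 0))]) (enc_bool (l = l')) (Suc (Suc (Suc (Suc t))) + 1)"
      using eval_call[OF _ L t(2)] by simp
    have cr: "eval [eq_body] ?env (ECall 0 [ERight (EVar 0), ERight (EVar (Suc 0))]) (enc_bool (r = r')) (Suc (Suc (Suc (Suc u))) + 1)"
      using eval_call[OF _ R u(2)] by simp
    let ?in = "EIf (ECall 0 [ELeft (EVar 0), ELeft (EVar (Suc 0))])
         (ECall 0 [ERight (EVar 0), ERight (EVar (Suc 0))]) ELeaf"
    have "\<exists>w \<le> t + u + 12. eval [eq_body] ?env ?in (enc_bool (Node l r = b)) w"
    proof (cases "l = l'")
      case True
      then have "eval [eq_body] ?env ?in (enc_bool (r = r')) (Suc (Suc (Suc (Suc t))) + 1 + (Suc (Suc (Suc (Suc u))) + 1) + 1)"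
        by (intro eval_if_true[OF cl _ cr]) (simp add: enc_bool_def)
      then show ?thesis using True Node by (intro exI, intro conjI[rotated]) (simp, simp)
    next
      case False
      then have "eval [eq_body] ?env ?in Leaf (Suc (Suc (Suc (Suc t))) + 1 + 1 + 1)"
        using cl by (intro eval_if_false[OF _ eval_leaf]) (simp add: enc_bool_def)
      then show ?thesis using False Node by (intro exI, intro conjI[rotated]) (simp add: enc_bool_def, simp)
    qed
    then obtain w where w: "w \<le> t + u + 12" "eval [eq_body] ?env ?in (enc_bool (Node l r = b)) w" by blast
    have "eval [eq_body] ?env eq_body (enc_bool (Node l r = b)) (1 + (1 + w + 1) + 1)"
      by (subst (2) eq_body_def) (intro eval_if_true[OF v(1)] eval_if_true[OF v(2)] w(2); simp add: Node)
    then show ?thesis using w(1) t(1) u(1) by (intro exI, intro conjI[rotated]) (assumption, simp)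
  qed
qed

text \<open>Comparing trees decides equality of values because encodings are injective, which is the
  purpose of the class axiom.\<close>

lemma ptime_eq [pt]: assumes "ptime f" "ptime g" shows "ptime (\<lambda>x. f x = g x)"
proof -
  let ?e = "ECall 0 [ELeft (EVar 0), ERight (EVar 0)]"
  have "ptime (\<lambda>p. fst p = (snd p :: 'b))"
  proof (rule feasibleI)
    show "implements [eq_body] ?e (\<lambda>p. fst p = (snd p :: 'b)) (\<lambda>p. 40 * sz p + 30)"
    proof (rule implementsI)
      fix p :: "'b \<times> 'b"
      obtain t where t: "t \<le> 20 * (2 * nodes (enc (fst p)) + 1)"
        "eval [eq_body] [enc (fst p), enc (snd p)] ([eq_body] ! 0) (enc_bool (enc (fst p) = enc (snd p))) t"
        using eval_eq_body[of "enc (fst p)" "enc (snd p)"] by auto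
      have v: "eval [eq_body] [enc p] (EVar 0) (enc p) 1" by (rule eval_var_0)
      have args: "evals [eq_body] [enc p] [ELeft (EVar 0), ERight (EVar 0)] [enc (fst p), enc (snd p)] ((1 + 1) + ((1 + 1) + 0))"
        using eval_left[OF v] eval_right[OF v] by (intro evals_cons evals_nil) simp_all
      have "eval [eq_body] [enc p] ?e (enc (fst p = snd p)) (((1 + 1) + ((1 + 1) + 0)) + t + 1)"
        using eval_call[OF _ args t(2)] by (simp add: enc_inject)
      then show "\<exists>t \<le> 40 * sz p + 30. eval [eq_body] [enc p] ?e (enc (fst p = snd p)) t"
        using t(1) by (elim ex_leI) (simp add: sz_def)
    qed
    show "pbounded sz (\<lambda>p :: 'b \<times> 'b. 40 * sz p + 30)" by (intro pbounded_intros)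
    show "pbounded sz (\<lambda>p. sz (fst p = (snd p :: 'b)))"
      by (rule pbounded_mono[OF pbounded_const[of _ 1]]) (rule sz_bool_le)
  qed
  then show ?thesis by (rule ptime_compose2) fact+
qed

text \<open>The machine has no addition, so the nodes are counted into an accumulator, first those
  of the right and then those of the left subtree. The program has to measure sizes itself because
  \<open>clip\<close> tests them.\<close>

definition sz_body :: expr where
  "sz_body = EIf (EVar 0)
     (ECall 0 [ELeft (EVar 0), ECall 0 [ERight (EVar 0), ENode ELeaf (EVar (Suc 0))]]) (EVar (Suc 0))"

lemma eval_sz_body:
  "\<exists>t \<le> 20 * (2 * nodes a + 1). eval [sz_body] [a, enc_nat m] sz_body (enc_nat (nodes a + m)) t"
proof (induction a arbitrary: m)
  case Leaf
  have v: "eval [sz_body] [Leaf, enc_nat m] (EVar 0) Leaf 1" "eval [sz_body] [Leaf, enc_nat m] (EVar (Suc 0)) (enc_nat m) 1"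
    by (rule eval_var_0 eval_var_1)+
  have "eval [sz_body] [Leaf, enc_nat m] sz_body (enc_nat m) (1 + 1 + 1)"
    by (subst (2) sz_body_def) (rule eval_if_false[OF v])
  then show ?case by (intro exI, intro conjI[rotated]) (simp, simp)
next
  case (Node l r)
  let ?env = "[Node l r, enc_nat m]"
  have v: "eval [sz_body] ?env (EVar 0) (Node l r) 1" "eval [sz_body] ?env (EVar (Suc 0)) (enc_nat m) 1"
    by (rule eval_var_0 eval_var_1)+
  have l: "eval [sz_body] ?env (ELeft (EVar 0)) l (1 + 1)" and r: "eval [sz_body] ?env (ERight (EVar 0)) r (1 + 1)"
    using eval_left[OF v(1)] eval_right[OF v(1)] by simp_all
  have s: "eval [sz_body] ?env (ENode ELeaf (EVar (Suc 0))) (enc_nat (Suc m)) (1 + 1 + 1)"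
    using eval_node[OF eval_leaf v(2)] by simp
  obtain u where u: "u \<le> 20 * (2 * nodes r + 1)"
    "eval [sz_body] [r, enc_nat (Suc m)] ([sz_body] ! 0) (enc_nat (nodes r + Suc m)) u" using Node.IH(2)[of "Suc m"] by auto
  obtain t where t: "t \<le> 20 * (2 * nodes l + 1)"
    "eval [sz_body] [l, enc_nat (nodes r + Suc m)] ([sz_body] ! 0) (enc_nat (nodes l + (nodes r + Suc m))) t"
    using Node.IH(1)[of "nodes r + Suc m"] by auto
  have args: "evals [sz_body] ?env [ERight (EVar 0), ENode ELeaf (EVar (Suc 0))] [r, enc_nat (Suc m)] ((1 + 1) + ((1 + 1 + 1) + 0))"
    by (intro evals_cons evals_nil r s)
  have cr: "eval [sz_body] ?env (ECall 0 [ERight (EVar 0), ENode ELeaf (EVar (Suc 0))]) (enc_nat (nodes r + Suc m)) (((1 + 1) + ((1 + 1 + 1) + 0)) + u + 1)"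
    by (rule eval_call[OF _ args u(2)]) simp
  have args': "evals [sz_body] ?env [ELeft (EVar 0), ECall 0 [ERight (EVar 0), ENode ELeaf (EVar (Suc 0))]]
     [l, enc_nat (nodes r + Suc m)] ((1 + 1) + ((((1 + 1) + ((1 + 1 + 1) + 0)) + u + 1) + 0))"
    by (intro evals_cons evals_nil l cr)
  have cl: "eval [sz_body] ?env (ECall 0 [ELeft (EVar 0), ECall 0 [ERight (EVar 0), ENode ELeaf (EVar (Suc 0))]])
     (enc_nat (nodes l + (nodes r + Suc m))) (((1 + 1) + ((((1 + 1) + ((1 + 1 + 1) + 0)) + u + 1) + 0)) + t + 1)"
    by (rule eval_call[OF _ args' t(2)]) simp
  have "eval [sz_body] ?env sz_body (enc_nat (nodes l + (nodes r + Suc m)))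
     (1 + (((1 + 1) + ((((1 + 1) + ((1 + 1 + 1) + 0)) + u + 1) + 0)) + t + 1) + 1)"
    by (subst (2) sz_body_def) (rule eval_if_true[OF v(1) _ cl], simp)
  moreover have "nodes l + (nodes r + Suc m) = nodes (Node l r) + m" by simp
  ultimately show ?case using t(1) u(1) by (intro ex_leI) (simp only:, simp)
qed

lemma ptime_sz [pt]: assumes "ptime f" shows "ptime (\<lambda>x. sz (f x))"
proof -
  let ?e = "ECall 0 [EVar 0, ELeaf]"
  have "ptime (\<lambda>p. sz (p :: 'b))"
  proof (rule feasibleI)
    show "implements [sz_body] ?e (\<lambda>p. sz (p :: 'b)) (\<lambda>p. 40 * sz p + 30)"
    proof (rule implementsI)
      fix p :: "'b"
      obtain t where t: "t \<le> 20 * (2 * nodes (enc p) + 1)"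
        "eval [sz_body] [enc p, enc_nat 0] ([sz_body] ! 0) (enc_nat (nodes (enc p) + 0)) t"
        using eval_sz_body[of "enc p" 0] by auto
      have "eval [sz_body] [enc p] ELeaf (enc_nat 0) 1" using eval_leaf by simp
      then have args: "evals [sz_body] [enc p] [EVar 0, ELeaf] [enc p, enc_nat 0] (1 + (1 + 0))"
        by (intro evals_cons evals_nil eval_var_0)
      have "eval [sz_body] [enc p] ?e (enc (sz p)) ((1 + (1 + 0)) + t + 1)"
        using eval_call[OF _ args t(2)] by (simp add: sz_def)
      then show "\<exists>t \<le> 40 * sz p + 30. eval [sz_body] [enc p] ?e (enc (sz p)) t"
        using t(1) by (intro exI, intro conjI[rotated]) (assumption, simp add: sz_def)
    qed
    show "pbounded sz (\<lambda>p :: 'b. 40 * sz p + 30)" by (intro pbounded_intros)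
    show "pbounded sz (\<lambda>p :: 'b. sz (sz p))" by (simp add: pbounded_id)
  qed
  then show ?thesis by (rule feasible_compose) fact
qed

section \<open>Loops, unary arithmetic and list functions\<close>

lemma ptime_fold:
  assumes h: "ptime (\<lambda>p. h (fst p) (fst (snd p)) (snd (snd p)))" and l: "ptime l" and s: "ptime s"
    and B: "pbounded sz B" and state: "\<And>x i. sz (fold (h x) (take i (l x)) (s x)) \<le> B x"
  shows "ptime (\<lambda>x. fold (h x) (l x) (s x))"
  using feasible_fold[OF h l s pbounded_sz_id B] state by (simp add: fold_def)

definition clip :: "nat \<Rightarrow> 'a::enc \<Rightarrow> 'a \<Rightarrow> 'a" where
  "clip p d s = (if sz s \<le> p then s else d)"

lemma clip_id: "sz s \<le> p \<Longrightarrow> clip p d s = s" by (simp add: clip_def)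

lemma ptime_pboundedE:
  assumes "ptime f" obtains A c where "\<And>x. sz (f x) \<le> A * Suc (sz x) ^ c"
  using feasible_pbounded[OF assms] unfolding pbounded_def by blast

text \<open>A unary number is literally a list of units, so counting loops are folds over
  lists.\<close>

lemma enc_units: "enc (replicate m ()) = enc m"
  by (induction m) (auto simp: enc_unit_def)

lemma ptime_units [pt]: "ptime f \<Longrightarrow> ptime (\<lambda>x. replicate (f x) ())"
  by (erule feasible_retype) (rule enc_units)

lemma take_units: "take i (replicate m ()) = replicate (min i m) ()"
  by (simp add: min_def)

lemma ptime_pred: "ptime f \<Longrightarrow> ptime (\<lambda>x. f x - Suc 0)"
  by (rule feasible_eq[OF ptime_case_nat[where a = "\<lambda>x. 0" and b = "\<lambda>x m. m"]])
    (assumption | intro pt | simp split: nat.split)+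

lemma fold_pred: "fold (\<lambda>_ m. m - Suc 0) (replicate n ()) m = m - n"
  by (induction n arbitrary: m) auto

lemma ptime_diff [pt]: assumes "ptime f" "ptime g" shows "ptime (\<lambda>x. f x - g x :: nat)"
proof -
  have "ptime (\<lambda>x. fold (\<lambda>_ m. m - Suc 0) (replicate (g x) ()) (f x))"
    by (rule ptime_fold[OF _ _ _ feasible_pbounded[OF assms(1)]])
      ((intro pt ptime_pred assms)+, unfold take_units fold_pred, simp)
  then show ?thesis unfolding fold_pred .
qed

lemma ptime_le [pt]: assumes "ptime f" "ptime g" shows "ptime (\<lambda>x. (f x :: nat) \<le> g x)"
proof -
  have "ptime (\<lambda>x. f x - g x = 0)" by (intro pt assms)
  then show ?thesis by (rule feasible_eq) simp
qed

lemma fold_Suc: "fold (\<lambda>_. Suc) (replicate n ()) m = m + n"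
  by (induction n arbitrary: m) auto

lemma ptime_add [pt]: assumes "ptime f" "ptime g" shows "ptime (\<lambda>x. f x + g x :: nat)"
proof -
  have "pbounded sz (\<lambda>x. f x + g x)"
    using pbounded_add[OF assms[THEN feasible_pbounded]] by simp
  then have "ptime (\<lambda>x. fold (\<lambda>_. Suc) (replicate (g x) ()) (f x))"
    by (rule ptime_fold[rotated 3]) (unfold take_units fold_Suc, simp, (intro pt assms)+)
  then show ?thesis unfolding fold_Suc .
qed

lemma fold_add: "fold (\<lambda>_ s. s + k) (replicate n ()) m = m + n * k"
  by (induction n arbitrary: m) auto

lemma ptime_mult [pt]: assumes "ptime f" "ptime g" shows "ptime (\<lambda>x. f x * g x :: nat)"
proof -
  have "pbounded sz (\<lambda>x. f x * g x)"
    using pbounded_mult[OF assms[THEN feasible_pbounded]] by simp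
  then have "ptime (\<lambda>x. fold (\<lambda>_ s. s + g x) (replicate (f x) ()) 0)"
    by (rule ptime_fold[rotated 3])
      (unfold take_units fold_add, simp, (intro pt feasible_compose[OF assms(2)] assms)+)
  then show ?thesis unfolding fold_add by simp
qed

lemma ptime_power [pt]: "ptime f \<Longrightarrow> ptime (\<lambda>x. (f x :: nat) ^ c)"
  by (induction c) (auto intro: pt)

lemma ptime_clip [pt]:
  "ptime p \<Longrightarrow> ptime d \<Longrightarrow> ptime s \<Longrightarrow> ptime (\<lambda>x. clip (p x) (d x) (s x))"
  unfolding clip_def by (intro pt)

lemma ptime_rev [pt]: assumes "ptime l" shows "ptime (\<lambda>x. rev (l x))"
proof -
  have "ptime (\<lambda>x. fold (\<lambda>y s. y # s) (l x) [])"
    by (rule ptime_fold[OF _ _ _ feasible_pbounded[OF assms]])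
      (auto intro!: pt assms simp: fold_Cons_rev sz_take_le)
  then show ?thesis by (simp add: fold_Cons_rev)
qed

lemma ptime_append [pt]: assumes "ptime l" "ptime k" shows "ptime (\<lambda>x. l x @ k x)"
proof -
  have "pbounded sz (\<lambda>x. sz (l x) + sz (k x))"
    using pbounded_add[OF assms[THEN feasible_pbounded]] by simp
  then have "ptime (\<lambda>x. fold (\<lambda>y s. y # s) (rev (l x)) (k x))"
    by (rule ptime_fold[rotated 3])
      (auto intro!: pt assms simp: fold_Cons_rev order.trans[OF sz_take_le])
  then show ?thesis by (simp add: fold_Cons_rev)
qed

lemma ptime_map [pt]:
  assumes h: "ptime (\<lambda>p. h (fst p) (snd p))" and l: "ptime l"
  shows "ptime (\<lambda>x. map (h x) (l x))"
proof -
  obtain A c where A: "\<And>p. sz (h (fst p) (snd p)) \<le> A * Suc (sz p) ^ c"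
    using ptime_pboundedE[OF h] by blast
  \<comment> \<open>At most \<open>sz (l x)\<close> entries, each the image of a pair
    \<open>(x, y)\<close> with \<open>y\<close> no larger than the list.\<close>
  define B where "B x = sz (l x) * Suc (A * Suc (Suc (sz x + sz (l x))) ^ c)" for x
  have f: "fold (\<lambda>y s. h x y # s) ys zs = rev (map (h x) ys) @ zs" for x ys zs
    by (induction ys arbitrary: zs) auto
  have B: "sz (map (h x) (take i (l x))) \<le> B x" for x i
    unfolding B_def
  proof (rule sz_list_le)
    show "length (map (h x) (take i (l x))) \<le> sz (l x)"
      using length_le_sz[of "l x"] by simp
    fix z assume "z \<in> set (map (h x) (take i (l x)))"
    then obtain y where y: "z = h x y" "y \<in> set (l x)" by (auto dest: in_set_takeD)
    have "sz z \<le> A * Suc (sz (x, y)) ^ c" using A[of "(x, y)"] y by simp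
    also have "\<dots> \<le> A * Suc (Suc (sz x + sz (l x))) ^ c"
      using sz_mem_le[OF y(2)] by (intro mult_le_mono2 power_mono) auto
    finally show "sz z \<le> A * Suc (Suc (sz x + sz (l x))) ^ c" .
  qed
  have "ptime (\<lambda>x. rev (fold (\<lambda>y s. h x y # s) (l x) []))"
  proof (rule ptime_rev, rule ptime_fold)
    have "ptime (\<lambda>p. h (fst p) (fst (snd p :: _ \<times> 'c list)))"
      by (rule ptime_compose2[OF h]) (intro pt)+
    then show "ptime (\<lambda>p. h (fst p) (fst (snd p)) # (snd (snd p) :: 'c list))"
      by (intro pt)
    show "pbounded sz B" unfolding B_def by (intro pbounded_intros feasible_pbounded l)
  qed (use l B in \<open>auto intro: pt simp: f\<close>)
  then show ?thesis by (simp add: f)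
qed

lemma ptime_filter [pt]:
  assumes h: "ptime (\<lambda>p. P (fst p) (snd p))" and l: "ptime l"
  shows "ptime (\<lambda>x. filter (P x) (l x))"
proof -
  have f: "fold (\<lambda>y s. if P x y then y # s else s) ys zs = rev (filter (P x) ys) @ zs" for x ys zs
    by (induction ys arbitrary: zs) auto
  have "ptime (\<lambda>x. rev (fold (\<lambda>y s. if P x y then y # s else s) (l x) []))"
  proof (rule ptime_rev, rule ptime_fold[OF _ _ _ feasible_pbounded[OF l]])
    have "ptime (\<lambda>p. P (fst p) (fst (snd p :: _ \<times> 'b list)))"
      by (rule ptime_compose2[OF h]) (intro pt)+
    then show "ptime (\<lambda>p. if P (fst p) (fst (snd p)) then fst (snd p) # snd (snd p) else (snd (snd p) :: 'b list))"
      by (intro pt)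
    show "sz (fold (\<lambda>y s. if P x y then y # s else s) (take i (l x)) []) \<le> sz (l x)" for x i
      unfolding f using order.trans[OF sz_filter_le sz_take_le] by simp
  qed (intro pt l)+
  then show ?thesis by (simp add: f)
qed

lemma ptime_Bex [pt]:
  assumes h: "ptime (\<lambda>p. P (fst p) (snd p))" and l: "ptime l"
  shows "ptime (\<lambda>x. \<exists>y \<in> set (l x). P x y)"
proof -
  have "ptime (\<lambda>x. filter (P x) (l x) \<noteq> [])" by (intro pt assms)
  then show ?thesis by (rule feasible_eq) (auto simp: filter_empty_conv)
qed

lemma ptime_Ball [pt]:
  assumes h: "ptime (\<lambda>p. P (fst p) (snd p))" and l: "ptime l"
  shows "ptime (\<lambda>x. \<forall>y \<in> set (l x). P x y)"
proof -
  have "ptime (\<lambda>x. filter (\<lambda>y. \<not> P x y) (l x) = [])" by (intro pt assms)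
  then show ?thesis by (rule feasible_eq) (auto simp: filter_empty_conv)
qed

lemma ptime_mem [pt]: assumes "ptime f" "ptime l" shows "ptime (\<lambda>x. f x \<in> set (l x))"
proof -
  have "ptime (\<lambda>p. f (fst p) = snd p)" by (intro pt feasible_compose[OF assms(1)])
  then have "ptime (\<lambda>x. \<exists>y \<in> set (l x). f x = y)" by (rule ptime_Bex) fact
  then show ?thesis by (rule feasible_eq) auto
qed

lemma ptime_concat [pt]: assumes l: "ptime l" shows "ptime (\<lambda>x. concat (l x))"
proof -
  have f: "fold (\<lambda>y s. y @ s) ys zs = concat (rev ys) @ zs" for ys and zs :: "'b list"
    by (induction ys arbitrary: zs) auto
  have sz: "sz (concat ys) \<le> sz ys" for ys :: "'b list list" by (induction ys) auto
  have sz_c: "sz (concat (rev ys)) \<le> sz ys" for ys :: "'b list list" using sz[of "rev ys"] by simp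
  have "ptime (\<lambda>x. fold (\<lambda>y s. y @ s) (rev (l x)) [])"
  proof (rule ptime_fold[OF _ _ _ feasible_pbounded[OF l]])
    show "sz (fold (\<lambda>y s. y @ s) (take i (rev (l x))) []) \<le> sz (l x)" for x i
      unfolding f using order.trans[OF sz_c sz_take_le, of i "rev (l x)"] by simp
  qed (intro pt l)+
  then show ?thesis by (simp add: f)
qed

lemma ptime_length [pt]: assumes l: "ptime l" shows "ptime (\<lambda>x. length (l x))"
proof -
  have f: "fold (\<lambda>y s. Suc s) ys n = length ys + n" for ys :: "'b list" and n
    by (induction ys arbitrary: n) auto
  have "ptime (\<lambda>x. fold (\<lambda>y s. Suc s) (l x) 0)"
  proof (rule ptime_fold[OF _ _ _ feasible_pbounded[OF l]])
    show "sz (fold (\<lambda>y s. Suc s) (take i (l x)) 0) \<le> sz (l x)" for x i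
      unfolding f using length_le_sz[of "l x"] by simp
  qed (intro pt l)+
  then show ?thesis by (simp add: f)
qed

text \<open>\<open>remdups\<close> keeps last occurrences. Hence, working from the back, an entry is
  kept iff it is not yet in the result.\<close>

lemma remdups_fold: "remdups xs = fold (\<lambda>y s. if y \<in> set s then s else y # s) (rev xs) []"
proof (induction xs)
  case (Cons x xs)
  then have "x \<in> set (fold (\<lambda>y s. if y \<in> set s then s else y # s) (rev xs) []) \<longleftrightarrow> x \<in> set xs"
    by (metis set_remdups)
  then show ?case using Cons by (simp add: fold_append)
qed simp

lemma ptime_remdups [pt]: assumes l: "ptime l" shows "ptime (\<lambda>x. remdups (l x))"
proof -
  have sz: "sz (remdups ys) \<le> sz ys" for ys :: "'b list" by (induction ys) auto
  have "ptime (\<lambda>x. fold (\<lambda>y s. if y \<in> set s then s else y # s) (rev (l x)) [])"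
  proof (rule ptime_fold[OF _ _ _ feasible_pbounded[OF l]])
    show "sz (fold (\<lambda>y s. if y \<in> set s then s else y # s) (take i (rev (l x))) []) \<le> sz (l x)" for x i
      using remdups_fold[of "rev (take i (rev (l x)))"] sz[of "rev (take i (rev (l x)))"]
        sz_take_le[of i "rev (l x)"] by simp
  qed (intro pt l)+
  then show ?thesis by (simp add: remdups_fold)
qed

lemma ptime_upt [pt]: assumes l: "ptime l" shows "ptime (\<lambda>x. [0..<l x])"
proof -
  \<comment> \<open>The state contains its own counter: the next number is the length of the list
    built so far.\<close>
  have f: "fold (\<lambda>_ s. length s # s) (replicate n ()) [] = rev [0..<n]" for n
    by (induction n) (simp_all add: replicate_append_same[symmetric])
  have sz: "sz (fold (\<lambda>_ s. length s # s) (replicate n ()) []) \<le> m * Suc m" if "n \<le> m" for n m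
    unfolding f sz_rev by (rule sz_list_le) (use that in auto)
  have "pbounded sz (\<lambda>x. l x * Suc (l x))"
    using feasible_pbounded[OF l] by (intro pbounded_intros) auto
  then have "ptime (\<lambda>x. rev (fold (\<lambda>_ s. length s # s) (replicate (l x) ()) []))"
    by (intro ptime_rev, elim ptime_fold[rotated 3]) (unfold take_units, rule sz, simp, (intro pt l)+)
  then show ?thesis unfolding f rev_rev_ident .
qed

text \<open>A default makes list access a total function with a computable value outside the range,
  where \<open>nth\<close> is unspecified.\<close>

definition nthd :: "'a \<Rightarrow> 'a list \<Rightarrow> nat \<Rightarrow> 'a" where
  "nthd d xs i = (if i < length xs then xs ! i else d)"

lemma ptime_nthd [pt]:
  assumes "ptime l" "ptime i" shows "ptime (\<lambda>x. nthd d (l x) (i x))"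
proof -
  have f: "fold (\<lambda>_. tl) (replicate n ()) xs = drop n xs" for n and xs :: "'b list"
    by (induction n arbitrary: xs) (auto simp: drop_Suc)
  have sz: "sz (drop n xs) \<le> sz xs" for n and xs :: "'b list"
    by (metis append_take_drop_id le_add2 sz_append)
  have "ptime (\<lambda>x. case fold (\<lambda>_. tl) (replicate (i x) ()) (l x) of [] \<Rightarrow> d | y # ys \<Rightarrow> y)"
    by (intro ptime_case_list, rule ptime_fold[OF _ _ _ feasible_pbounded[OF assms(1)]])
      ((intro pt assms)+, unfold take_units f, rule sz, (intro pt)+)
  then show ?thesis
    unfolding f by (rule feasible_eq) (auto simp: nthd_def Cons_nth_drop_Suc[symmetric])
qed

text \<open>Clipping makes a loop polynomial for free; that the clipping never takes effect where it matters
  is then part of the correctness proof.\<close>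

lemma ptime_fold_clip [pt]:
  assumes h: "ptime (\<lambda>q. h (fst q) (fst (snd q)) (snd (snd q)))" and l: "ptime l" and s: "ptime s"
    and p: "ptime p" and d: "ptime d"
  shows "ptime (\<lambda>x. fold (\<lambda>y s. clip (p x) (d x) (h x y s)) (l x) (s x))"
proof (rule ptime_fold)
  have 1: "ptime (\<lambda>q :: 'a \<times> 'b \<times> 'c. p (fst q))" and 2: "ptime (\<lambda>q :: 'a \<times> 'b \<times> 'c. d (fst q))"
    by (auto intro!: feasible_compose[OF p] feasible_compose[OF d] pt)
  show "ptime (\<lambda>q. clip (p (fst q)) (d (fst q)) (h (fst q) (fst (snd q)) (snd (snd q))))"
    by (intro ptime_clip h 1 2)
  show "pbounded sz (\<lambda>x. sz (s x) + p x + sz (d x))"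
    using feasible_pbounded[OF p] feasible_pbounded[OF s] feasible_pbounded[OF d]
    by (intro pbounded_intros) auto
  have *: "sz (fold (\<lambda>y s. clip (p x) (d x) (h x y s)) ys z) \<le> sz z + p x + sz (d x)" for x ys z
    by (cases ys rule: rev_cases) (auto simp: clip_def)
  show "sz (fold (\<lambda>y s. clip (p x) (d x) (h x y s)) (take i (l x)) (s x)) \<le> sz (s x) + p x + sz (d x)" for x i
    by (rule *)
qed fact+

section \<open>Components and chordal graphs\<close>

text \<open>The closure is reflexive also outside \<open>U\<close>: the component of a vertex not in
  \<open>U\<close> is its singleton, which is why membership in \<open>U\<close> recurs as a
  hypothesis.\<close>

definition component :: "('a \<Rightarrow> 'a \<Rightarrow> bool) \<Rightarrow> 'a set \<Rightarrow> 'a \<Rightarrow> 'a set" where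
  "component E U x = {y. (x, y) \<in> {(a, b). a \<in> U \<and> b \<in> U \<and> E a b}\<^sup>*}"

definition connected_in :: "('a \<Rightarrow> 'a \<Rightarrow> bool) \<Rightarrow> 'a set \<Rightarrow> bool" where
  "connected_in E D \<longleftrightarrow> (\<forall>y \<in> D. component E D y = D)"

definition clique_in :: "('a \<Rightarrow> 'a \<Rightarrow> bool) \<Rightarrow> 'a set \<Rightarrow> bool" where
  "clique_in E K \<longleftrightarrow> (\<forall>x \<in> K. \<forall>y \<in> K. x \<noteq> y \<longrightarrow> E x y)"

text \<open>An induced cycle in cyclic order. With indices ordered as \<open>i < j\<close>, the edge
  that closes the cycle is the pair of \<open>0\<close> and \<open>length q - 1\<close>.\<close>

definition hole :: "('a \<Rightarrow> 'a \<Rightarrow> bool) \<Rightarrow> 'a list \<Rightarrow> bool" where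
  "hole E q \<longleftrightarrow> distinct q \<and> 4 \<le> length q \<and>
     (\<forall>j < length q. \<forall>i < j. E (q ! i) (q ! j) \<longleftrightarrow> j = Suc i \<or> i = 0 \<and> j = length q - 1)"

definition chordal_on :: "('a \<Rightarrow> 'a \<Rightarrow> bool) \<Rightarrow> 'a set \<Rightarrow> bool" where
  "chordal_on E H \<longleftrightarrow> (\<nexists>q. set q \<subseteq> H \<and> hole E q)"

definition maximal_cliques :: "('a \<Rightarrow> 'a \<Rightarrow> bool) \<Rightarrow> 'a set \<Rightarrow> 'a set set" where
  "maximal_cliques E H = {C. C \<subseteq> H \<and> clique_in E C \<and> (\<forall>u \<in> H - C. \<exists>c \<in> C. \<not> E u c)}"

lemma chordal_on_subset: "chordal_on E H \<Longrightarrow> H' \<subseteq> H \<Longrightarrow> chordal_on E H'"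
  unfolding chordal_on_def by blast

lemma clique_in_subset: "clique_in E K \<Longrightarrow> K' \<subseteq> K \<Longrightarrow> clique_in E K'"
  unfolding clique_in_def by blast

lemma component_self: "x \<in> component E U x"
  by (simp add: component_def)

lemma component_least:
  assumes "x \<in> X" "\<And>y z. y \<in> X \<Longrightarrow> y \<in> U \<Longrightarrow> z \<in> U \<Longrightarrow> E y z \<Longrightarrow> z \<in> X"
  shows "component E U x \<subseteq> X"
proof
  fix y assume "y \<in> component E U x"
  then have "(x, y) \<in> {(a, b). a \<in> U \<and> b \<in> U \<and> E a b}\<^sup>*" by (simp add: component_def)
  then show "y \<in> X" by (induction rule: rtrancl_induct) (use assms in auto)
qed

lemma component_subset: "x \<in> U \<Longrightarrow> component E U x \<subseteq> U"
  by (rule component_least)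

lemma component_closed:
  assumes "y \<in> component E U x" "x \<in> U" "z \<in> U" "E y z" shows "z \<in> component E U x"
proof -
  have "y \<in> U" using component_subset[OF assms(2)] assms(1) by blast
  then have "(y, z) \<in> {(a, b). a \<in> U \<and> b \<in> U \<and> E a b}" using assms by simp
  moreover have "(x, y) \<in> {(a, b). a \<in> U \<and> b \<in> U \<and> E a b}\<^sup>*"
    using assms(1) by (simp add: component_def)
  ultimately have "(x, z) \<in> {(a, b). a \<in> U \<and> b \<in> U \<and> E a b}\<^sup>*"
    by (rule rtrancl_into_rtrancl[rotated])
  then show ?thesis by (simp add: component_def)
qed

lemma component_mono: assumes "x \<in> U" "U \<subseteq> U'" shows "component E U x \<subseteq> component E U' x"
  by (rule component_least[OF component_self])
     (use assms in \<open>blast intro: component_closed\<close>)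

lemma component_walk:
  assumes "y \<in> component E U x" "x \<in> U"
  shows "\<exists>p. p \<noteq> [] \<and> hd p = x \<and> last p = y \<and> set p \<subseteq> U \<and> successively E p"
proof -
  have "(x, y) \<in> {(a, b). a \<in> U \<and> b \<in> U \<and> E a b}\<^sup>*" using assms by (simp add: component_def)
  then show ?thesis
  proof (induction rule: rtrancl_induct)
    case base
    then show ?case using assms(2) by (intro exI[of _ "[x]"]) auto
  next
    case (step y z)
    then obtain p where "p \<noteq> []" "hd p = x" "last p = y" "set p \<subseteq> U" "successively E p" by blast
    then show ?case using step(2) by (intro exI[of _ "p @ [z]"]) (auto simp: successively_append_iff)
  qed
qed

locale undirected =
  fixes E :: "'a \<Rightarrow> 'a \<Rightarrow> bool"
  assumes sym: "E x y \<Longrightarrow> E y x" and irrefl: "\<not> E x x"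
begin

lemma component_sym:
  assumes "y \<in> component E U x" shows "x \<in> component E U y"
proof -
  have "{(a, b). a \<in> U \<and> b \<in> U \<and> E a b}\<inverse> = {(a, b). a \<in> U \<and> b \<in> U \<and> E a b}"
    using sym by auto
  moreover have "(y, x) \<in> ({(a, b). a \<in> U \<and> b \<in> U \<and> E a b}\<^sup>*)\<inverse>"
    using assms unfolding component_def by blast
  ultimately show ?thesis unfolding component_def by (simp add: rtrancl_converse[symmetric])
qed

lemma component_eq:
  assumes "y \<in> component E U x" shows "component E U y = component E U x"
  using assms component_sym[OF assms] unfolding component_def by (auto intro: rtrancl_trans)

lemma connected_component:
  assumes x: "x \<in> U" shows "connected_in E (component E U x)"
  unfolding connected_in_def
proof
  let ?D = "component E U x"
  fix y assume y: "y \<in> ?D"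
  show "component E ?D y = ?D"
  proof
    show "component E ?D y \<subseteq> ?D" by (rule component_subset[OF y])
    have "component E U y \<subseteq> component E ?D y"
    proof (rule component_least[OF component_self])
      fix z w assume zw: "z \<in> component E ?D y" "z \<in> U" "w \<in> U" "E z w"
      then have "z \<in> ?D" using component_subset[OF y] by blast
      then have "w \<in> ?D" using component_closed zw x by fast
      then show "w \<in> component E ?D y" using component_closed zw y by fast
    qed
    then show "?D \<subseteq> component E ?D y" using component_eq[OF y] by simp
  qed
qed

text \<open>A vertex \<open>v\<close> of \<open>D\<close> with the most neighbours in \<open>S\<close> is complete to \<open>S\<close>: otherwise a shortest
  path from \<open>v\<close> to a neighbour of a missing \<open>s\<close> closes up to a hole with \<open>s\<close> and some other
  vertex of \<open>S\<close>.\<close>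

lemma complete_vertex:
  assumes fin: "finite D" "finite S" and conn: "connected_in E D" and ne: "D \<noteq> {}"
    and chord: "chordal_on E (D \<union> S)" and S: "clique_in E S" "S \<inter> D = {}"
    and nb: "\<And>s. s \<in> S \<Longrightarrow> \<exists>d \<in> D. E s d"
  shows "\<exists>v \<in> D. \<forall>s \<in> S. E v s"
proof -
  let ?N = "\<lambda>v. {s \<in> S. E v s}"
  have "Max ((\<lambda>v. card (?N v)) ` D) \<in> (\<lambda>v. card (?N v)) ` D" using fin ne by (intro Max_in) auto
  then obtain v where v: "v \<in> D" "card (?N v) = Max ((\<lambda>v. card (?N v)) ` D)" by auto
  have vmax: "card (?N w) \<le> card (?N v)" if "w \<in> D" for w
    unfolding v(2) using fin that by (intro Max_ge) auto
  have "E v s" if s: "s \<in> S" for s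
  proof (rule ccontr)
    assume nvs: "\<not> E v s"
    \<comment> \<open>Walks in \<open>D\<close> from \<open>v\<close> to a neighbour of
      \<open>s\<close>. Minimal length of \<open>p\<close> will give that only its end sees
      \<open>s\<close>, that it has no chord and that no vertex repeats: in each case a piece could
      be cut out.\<close>
    define W where "W p \<longleftrightarrow> p \<noteq> [] \<and> hd p = v \<and> set p \<subseteq> D \<and> successively E p \<and> E (last p) s" for p
    obtain d where "d \<in> D" "E s d" using nb[OF s] by blast
    moreover have "d \<in> component E D v" using conn v(1) \<open>d \<in> D\<close> by (simp add: connected_in_def)
    ultimately have "\<exists>p. W p" using component_walk[of d E D v] v(1) sym unfolding W_def by metis
    then obtain p where p: "W p" and least: "\<And>q. W q \<Longrightarrow> length p \<le> length q"
      using ex_has_least_nat[of W _ length] by blast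
    have pne: "p \<noteq> []" and p0: "p ! 0 = v" and pD: "set p \<subseteq> D" and succ: "successively E p"
      and plast: "E (p ! (length p - 1)) s"
      using p by (auto simp: W_def hd_conv_nth last_conv_nth)
    have lenp: "2 \<le> length p"
    proof (rule ccontr)
      assume "\<not> 2 \<le> length p"
      moreover have "length p \<noteq> 0" using pne by simp
      ultimately have "length p = 1" by linarith
      then show False using plast p0 nvs by simp
    qed
    have edge: "E (p ! i) (p ! Suc i)" if "Suc i < length p" for i
      using succ that by (simp add: successively_conv_nth)
    have only_last: "i = length p - 1" if "i < length p" "E (p ! i) s" for i
    proof -
      have "successively E (take (Suc i) p @ drop (Suc i) p)" using succ by simp
      then have "successively E (take (Suc i) p)" using successively_append_iff by blast
      moreover have "hd (take (Suc i) p) = v" using pne p0 by (cases p) auto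
      moreover have "last (take (Suc i) p) = p ! i" using that by (simp add: take_Suc_conv_app_nth)
      ultimately have "W (take (Suc i) p)"
        using that pne set_take_subset[of "Suc i" p] pD unfolding W_def by auto
      from least[OF this] show ?thesis using that by simp
    qed
    have shortcut: False if ij: "i < j" "j < length p" "E (p ! i) (p ! j)" "j \<noteq> Suc i" for i j
    proof -
      let ?q = "take (Suc i) p @ drop j p"
      have "successively E (take (Suc i) p @ drop (Suc i) p)" "successively E (take j p @ drop j p)"
        using succ by simp_all
      then have "successively E (take (Suc i) p)" "successively E (drop j p)"
        using successively_append_iff by blast+
      moreover have "last (take (Suc i) p) = p ! i" using ij by (simp add: take_Suc_conv_app_nth)
      moreover have "hd (drop j p) = p ! j" using ij by (simp add: hd_drop_conv_nth)
      ultimately have "successively E ?q" using ij by (simp add: successively_append_iff)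
      moreover have "hd ?q = v" using pne p0 by (cases p) auto
      moreover have "last ?q = last p" using ij by simp
      ultimately have "W ?q"
        using p pne pD set_take_subset[of "Suc i" p] set_drop_subset[of j p] unfolding W_def by auto
      from least[OF this] show False using ij by simp
    qed
    have diff: "p ! i \<noteq> p ! j" if ij: "i < j" "j < length p" for i j
    proof
      assume eq: "p ! i = p ! j"
      let ?q = "take (Suc i) p @ drop (Suc j) p"
      have "successively E (take (Suc i) p @ drop (Suc i) p)" "successively E (take (Suc j) p @ drop (Suc j) p)"
        using succ by simp_all
      then have "successively E (take (Suc i) p)" "successively E (drop (Suc j) p)"
        using successively_append_iff by blast+
      moreover have li: "last (take (Suc i) p) = p ! i" using ij by (simp add: take_Suc_conv_app_nth)
      moreover have "Suc j < length p \<Longrightarrow> hd (drop (Suc j) p) = p ! Suc j" by (simp add: hd_drop_conv_nth)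
      moreover have "E (p ! j) (hd (drop (Suc j) p))" if "drop (Suc j) p \<noteq> []"
        using edge[of j] that by (simp add: hd_drop_conv_nth)
      ultimately have "successively E ?q" using eq edge[of j]
        by (cases "Suc j < length p") (simp_all add: successively_append_iff)
      moreover have "hd ?q = v" using pne p0 by (cases p) auto
      moreover have "last ?q = last p"
      proof (cases "Suc j < length p")
        case False
        then have "j = length p - 1" using ij by simp
        then show ?thesis using li eq False pne by (simp add: last_conv_nth)
      qed simp
      ultimately have "W ?q"
        using p pne pD set_take_subset[of "Suc i" p] set_drop_subset[of "Suc j" p] unfolding W_def by auto
      from least[OF this] show False using ij by simp
    qed
    let ?u = "p ! (length p - 1)"
    have uD: "?u \<in> D" using pD pne by auto
    \<comment> \<open>The end of the path sees \<open>s\<close> while \<open>v\<close> does not. As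
      \<open>v\<close> has the most neighbours in \<open>S\<close>, it must see some
      \<open>x\<close> that the end misses.\<close>
    have "\<not> ?N v \<subseteq> ?N ?u"
    proof
      assume "?N v \<subseteq> ?N ?u"
      moreover have "s \<in> ?N ?u" "s \<notin> ?N v" using plast nvs s by auto
      ultimately have "?N v \<subset> ?N ?u" by blast
      then have "card (?N v) < card (?N ?u)" using fin by (intro psubset_card_mono) auto
      then show False using vmax[OF uD] by simp
    qed
    then obtain x where x: "x \<in> S" "E v x" "\<not> E ?u x" by auto
    \<comment> \<open>Starting at the last neighbour of \<open>x\<close> makes \<open>x\<close> see
      only the first vertex of the remaining path. This is not the end of the path, so at least two
      vertices remain and the cycle through \<open>x\<close> and \<open>s\<close> has length at
      least four.\<close>
    define j where "j = Max {i. i < length p \<and> E (p ! i) x}"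
    have jset: "finite {i. i < length p \<and> E (p ! i) x}" "0 \<in> {i. i < length p \<and> E (p ! i) x}"
      using x p0 pne by auto
    have "j \<in> {i. i < length p \<and> E (p ! i) x}"
      unfolding j_def by (rule Max_in) (use jset in auto)
    then have j: "j < length p" "E (p ! j) x" by auto
    have jmax: "\<not> E (p ! i) x" if "j < i" "i < length p" for i
    proof
      assume "E (p ! i) x"
      then have "i \<le> j" unfolding j_def using jset that by (intro Max_ge) auto
      then show False using that by simp
    qed
    have jlt: "j < length p - 1" using j x(3) pne by (cases "j = length p - 1") auto
    define q where "q = x # drop j p @ [s]"
    define L where "L = length p - j"
    have lenq: "length q = L + 2" using j by (simp add: q_def L_def)
    have L2: "2 \<le> L" using jlt by (simp add: L_def)
    have q0: "q ! 0 = x" by (simp add: q_def)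
    have qm: "q ! Suc i = p ! (j + i)" if "i < L" for i
      using that by (simp add: q_def L_def nth_append)
    have qs: "q ! Suc L = s" using j by (simp add: q_def L_def nth_append)
    have xs: "x \<noteq> s" using x nvs by auto
    have Exs: "E x s" using S(1) x(1) s xs by (auto simp: clique_in_def)
    have dp: "distinct p"
    proof -
      have "p ! i \<noteq> p ! j" if "i < length p" "j < length p" "i \<noteq> j" for i j
        using diff[of i j] diff[of j i] that by (metis nat_neq_iff)
      then show ?thesis by (simp add: distinct_conv_nth)
    qed
    have "distinct q" using dp S(2) x(1) s pD xs set_drop_subset[of j p] by (auto simp: q_def)
    moreover have "E (q ! a) (q ! b) \<longleftrightarrow> b = Suc a \<or> a = 0 \<and> b = length q - 1"
      if ab: "b < length q" "a < b" for a b
    proof -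
      consider "b = Suc L" "a = 0" | a' where "b = Suc L" "a = Suc a'" "a' < L"
        | b' where "b = Suc b'" "b' < L" "a = 0" | a' b' where "b = Suc b'" "b' < L" "a = Suc a'" "a' < b'"
        using ab lenq by (cases a; cases b) (auto simp: less_Suc_eq)
      then show ?thesis
      proof cases
        case 1
        then show ?thesis using q0 qs Exs lenq by simp
      next
        case (2 a')
        have *: "j + a' < length p" using 2 j by (simp add: L_def)
        have "E (p ! (j + a')) s \<longleftrightarrow> j + a' = length p - 1"
          using only_last[OF *] plast by auto
        also have "\<dots> \<longleftrightarrow> a' = L - 1" unfolding L_def using j * by arith
        finally have "E (p ! (j + a')) s \<longleftrightarrow> a' = L - 1" .
        then show ?thesis using 2 qs qm[of a'] lenq L2 by auto
      next
        case (3 b')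
        have *: "j + b' < length p" using 3 j by (simp add: L_def)
        have "E x (p ! (j + b')) \<longleftrightarrow> b' = 0"
          using jmax[of "j + b'"] j(2) sym * by (cases b') auto
        then show ?thesis using 3 q0 qm[of b'] lenq L2 by auto
      next
        case (4 a' b')
        have *: "j + b' < length p" using 4 j by (simp add: L_def)
        have "E (p ! (j + a')) (p ! (j + b')) \<longleftrightarrow> b' = Suc a'"
          using shortcut[of "j + a'" "j + b'"] edge[of "j + a'"] 4 * by auto
        then show ?thesis using 4 qm[of a'] qm[of b'] lenq by auto
      qed
    qed
    ultimately have "hole E q" using lenq L2 by (auto simp: hole_def)
    moreover have "set q \<subseteq> D \<union> S" using pD x(1) s set_drop_subset[of j p] by (auto simp: q_def)
    ultimately show False using chord by (auto simp: chordal_on_def)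
  qed
  then show ?thesis using v(1) by blast
qed

text \<open>One step of a descent. As \<open>D\<close> is a component of \<open>H - K\<close>, its
  neighbourhood \<open>S\<close> is part of the clique \<open>K\<close>, and some \<open>v\<close>
  in \<open>D\<close> is complete to \<open>S\<close>. Replacing \<open>K\<close> by
  \<open>insert v S\<close> splits what is left of \<open>D\<close> into smaller components, while
  everything outside \<open>D\<close> stays unrelated to \<open>D\<close>.\<close>

lemma clique_descent:
  assumes fin: "finite H" and chord: "chordal_on E H" and K: "K \<subseteq> H" "clique_in E K"
    and x: "x \<in> H - K"
  defines "D \<equiv> component E (H - K) x"
  defines "S \<equiv> {s \<in> H - D. \<exists>d \<in> D. E s d}"
  obtains v where "v \<in> D" "insert v S \<subseteq> H" "clique_in E (insert v S)"
    "\<forall>y \<in> D - {v}. component E (H - insert v S) y \<subset> D"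
    "\<forall>y \<in> H - insert v S - D. component E (H - insert v S) y \<inter> D = {} \<and>
       (\<forall>d \<in> D. \<forall>z \<in> component E (H - insert v S) y. \<not> E d z)"
proof -
  have DH: "D \<subseteq> H - K" unfolding D_def by (rule component_subset[OF x])
  have SK: "S \<subseteq> K"
  proof
    fix s assume s: "s \<in> S"
    show "s \<in> K"
    proof (rule ccontr)
      assume "s \<notin> K"
      then have "s \<in> H - K" using s by (simp add: S_def)
      obtain d where "d \<in> D" "E d s" using s sym by (auto simp: S_def)
      then have "s \<in> D" unfolding D_def using component_closed x \<open>s \<in> H - K\<close> by fast
      then show False using s by (simp add: S_def)
    qed
  qed
  have Sc: "clique_in E S" using K(2) SK by (rule clique_in_subset)
  have "\<exists>v \<in> D. \<forall>s \<in> S. E v s"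
  proof (rule complete_vertex)
    show "finite D" "finite S" using fin DH by (auto simp: S_def intro: finite_subset)
    show "connected_in E D" unfolding D_def by (rule connected_component[OF x])
    show "D \<noteq> {}" unfolding D_def using component_self by fast
    show "chordal_on E (D \<union> S)" using chord by (rule chordal_on_subset) (use DH in \<open>auto simp: S_def\<close>)
    show "clique_in E S" by (rule Sc)
    show "S \<inter> D = {}" by (auto simp: S_def)
    show "\<exists>d \<in> D. E s d" if "s \<in> S" for s using that by (simp add: S_def)
  qed
  then obtain v where v: "v \<in> D" "\<forall>s \<in> S. E v s" by blast
  have cl: "clique_in E (insert v S)" using Sc v sym by (auto simp: clique_in_def)
  show ?thesis
  proof (rule that[OF v(1) _ cl])
    show "insert v S \<subseteq> H" using v(1) DH by (auto simp: S_def)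
    show "\<forall>y \<in> D - {v}. component E (H - insert v S) y \<subset> D"
    proof
    fix y assume y: "y \<in> D - {v}"
    have "component E (H - insert v S) y \<subseteq> D - {v}"
    proof (rule component_least[OF y])
      fix a b assume "a \<in> D - {v}" "b \<in> H - insert v S" "E a b"
      then show "b \<in> D - {v}" using sym by (auto simp: S_def)
    qed
    then show "component E (H - insert v S) y \<subset> D" using v(1) by blast
    qed
    show "\<forall>y \<in> H - insert v S - D. component E (H - insert v S) y \<inter> D = {} \<and>
       (\<forall>d \<in> D. \<forall>z \<in> component E (H - insert v S) y. \<not> E d z)"
    proof
    fix y assume y: "y \<in> H - insert v S - D"
    have 1: "component E (H - insert v S) y \<subseteq> H - insert v S - D"
    proof (rule component_least)
      fix a b assume "a \<in> H - insert v S - D" "b \<in> H - insert v S" "E a b"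
      then show "b \<in> H - insert v S - D" by (auto simp: S_def)
    qed (use y in simp)
    then have "\<not> E d z" if "d \<in> D" "z \<in> component E (H - insert v S) y" for d z
      using that sym by (auto simp: S_def)
    then show "component E (H - insert v S) y \<inter> D = {} \<and>
       (\<forall>d \<in> D. \<forall>z \<in> component E (H - insert v S) y. \<not> E d z)" using 1 by blast
    qed
  qed
qed

text \<open>If every clique left a bad component, the smallest bad component over all cliques could
  be attacked by a descent step: a bad component inside it would be smaller, and one outside it
  would be disjoint from it and without edges to it, which is excluded for two bad sets. The
  abstract \<open>bad\<close> serves both the balancing of a weight and the separation of two
  cliques.\<close>

lemma clique_separator:
  assumes fin: "finite H" and chord: "chordal_on E H"
    and bad: "\<And>D D'. bad D \<Longrightarrow> bad D' \<Longrightarrow> D \<subseteq> H \<Longrightarrow> D' \<subseteq> H \<Longrightarrow> D' \<inter> D = {} \<Longrightarrow>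
      (\<And>d d'. d \<in> D \<Longrightarrow> d' \<in> D' \<Longrightarrow> \<not> E d d') \<Longrightarrow> False"
  obtains K where "K \<subseteq> H" "clique_in E K" "\<And>x. x \<in> H - K \<Longrightarrow> \<not> bad (component E (H - K) x)"
proof -
  define P where "P = (\<lambda>(K, x). K \<subseteq> H \<and> clique_in E K \<and> x \<in> H - K \<and> bad (component E (H - K) x))"
  show ?thesis
  proof (cases "\<exists>z. P z")
    case False
    have "clique_in E {}" by (simp add: clique_in_def)
    then show ?thesis using False that[of "{}"] by (auto simp: P_def)
  next
    case True
  then obtain z where z: "P z" "\<And>z'. P z' \<Longrightarrow> card (component E (H - fst z) (snd z)) \<le> card (component E (H - fst z') (snd z'))"
    using ex_has_least_nat[of P _ "\<lambda>z. card (component E (H - fst z) (snd z))"] by blast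
  obtain K x where Kx: "P (K, x)" and least: "\<And>K' x'. P (K', x') \<Longrightarrow>
      card (component E (H - K) x) \<le> card (component E (H - K') x')"
  proof (rule that)
    show "P (fst z, snd z)" using z(1) by simp
    show "P (K', x') \<Longrightarrow> card (component E (H - fst z) (snd z)) \<le> card (component E (H - K') x')" for K' x'
      using z(2)[of "(K', x')"] by simp
  qed
    let ?D = "component E (H - K) x"
    have K: "K \<subseteq> H" "clique_in E K" "x \<in> H - K" "bad ?D" using Kx by (auto simp: P_def)
    have DH: "?D \<subseteq> H" using component_subset[OF K(3)] by blast
    let ?S = "{s \<in> H - ?D. \<exists>d \<in> ?D. E s d}"
    obtain v where v: "v \<in> ?D" "insert v ?S \<subseteq> H" "clique_in E (insert v ?S)"
      and small: "\<forall>y \<in> ?D - {v}. component E (H - insert v ?S) y \<subset> ?D"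
      and far: "\<forall>y \<in> H - insert v ?S - ?D. component E (H - insert v ?S) y \<inter> ?D = {} \<and>
       (\<forall>d \<in> ?D. \<forall>z \<in> component E (H - insert v ?S) y. \<not> E d z)"
      by (rule clique_descent[OF fin chord K(1-3)])
    show ?thesis
    proof (rule that[OF v(2,3)])
      let ?K = "insert v {s \<in> H - ?D. \<exists>d \<in> ?D. E s d}"
      fix y assume y: "y \<in> H - ?K"
      let ?D' = "component E (H - ?K) y"
      have D'H: "?D' \<subseteq> H" using component_subset[OF y] by blast
      show "\<not> bad ?D'"
      proof
        assume b: "bad ?D'"
        show False
        proof (cases "y \<in> ?D")
          case True
          have "y \<in> ?D - {v}" using True y by simp
          from bspec[OF small this] have "?D' \<subset> ?D" .
          then have "card ?D' < card ?D"
            using DH fin by (intro psubset_card_mono) (auto intro: finite_subset)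
          moreover have "P (?K, y)" using v y b by (simp add: P_def)
          ultimately show False using least[of ?K y] by simp
        next
          case False
          have "y \<in> H - ?K - ?D" using y False by simp
          from bspec[OF far this] show False by (intro bad[OF K(4) b DH D'H]) auto
        qed
      qed
    qed
  qed
qed

text \<open>A smallest component left by any clique must be a single vertex, since the descent would
  otherwise shrink it. The neighbours of this vertex then form a clique.\<close>

lemma simplicial_vertex:
  assumes fin: "finite H" and chord: "chordal_on E H" and ne: "H \<noteq> {}"
  obtains v where "v \<in> H" "clique_in E {s \<in> H. E v s}"
proof -
  define P where "P = (\<lambda>(K, x). K \<subseteq> H \<and> clique_in E K \<and> x \<in> H - K)"
  have "\<exists>z. P z" using ne by (auto simp: P_def clique_in_def)
  then obtain z where z: "P z" "\<And>z'. P z' \<Longrightarrow> card (component E (H - fst z) (snd z)) \<le> card (component E (H - fst z') (snd z'))"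
    using ex_has_least_nat[of P _ "\<lambda>z. card (component E (H - fst z) (snd z))"] by blast
  obtain K x where Kx: "P (K, x)" and least: "\<And>K' x'. P (K', x') \<Longrightarrow>
      card (component E (H - K) x) \<le> card (component E (H - K') x')"
  proof (rule that)
    show "P (fst z, snd z)" using z(1) by simp
    show "P (K', x') \<Longrightarrow> card (component E (H - fst z) (snd z)) \<le> card (component E (H - K') x')" for K' x'
      using z(2)[of "(K', x')"] by simp
  qed
  let ?D = "component E (H - K) x"
  let ?S = "{s \<in> H - ?D. \<exists>d \<in> ?D. E s d}"
  have K: "K \<subseteq> H" "clique_in E K" "x \<in> H - K" using Kx by (auto simp: P_def)
  have DH: "?D \<subseteq> H" using component_subset[OF K(3)] by blast
  obtain v where v: "v \<in> ?D" "insert v ?S \<subseteq> H" "clique_in E (insert v ?S)"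
      and small: "\<forall>y \<in> ?D - {v}. component E (H - insert v ?S) y \<subset> ?D"
    by (rule clique_descent[OF fin chord K(1-3)])
  have "?D = {v}"
  proof (rule ccontr)
    assume "?D \<noteq> {v}"
    then obtain y where y: "y \<in> ?D - {v}" using v(1) by blast
    from bspec[OF small this] have "component E (H - insert v ?S) y \<subset> ?D" .
    then have "card (component E (H - insert v ?S) y) < card ?D"
      using DH fin by (intro psubset_card_mono) (auto intro: finite_subset)
    moreover have "P (insert v ?S, y)" using v y DH by (auto simp: P_def)
    ultimately show False using least[of "insert v ?S" y] by simp
  qed
  then have "{s \<in> H. E v s} \<subseteq> insert v ?S" using sym by auto
  then show ?thesis using that[of v] v DH clique_in_subset by blast
qed

text \<open>The only maximal clique through a simplicial vertex is its closed neighbourhood; all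
  others are maximal cliques of the rest. The successor comes from the empty graph, whose only
  maximal clique is empty.\<close>

lemma card_maximal_cliques_chordal:
  assumes "finite H" "chordal_on E H"
  shows "finite (maximal_cliques E H) \<and> card (maximal_cliques E H) \<le> Suc (card H)"
  using assms
proof (induction "card H" arbitrary: H)
  case 0
  then have "maximal_cliques E H = {{}}" by (auto simp: maximal_cliques_def clique_in_def)
  then show ?case by simp
next
  case (Suc m)
  then have "H \<noteq> {}" by auto
  then obtain v where v: "v \<in> H" "clique_in E {s \<in> H. E v s}"
    using simplicial_vertex Suc.prems by metis
  have sub: "maximal_cliques E H \<subseteq> insert (insert v {s \<in> H. E v s}) (maximal_cliques E (H - {v}))"
  proof
    fix C assume C: "C \<in> maximal_cliques E H"
    show "C \<in> insert (insert v {s \<in> H. E v s}) (maximal_cliques E (H - {v}))"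
    proof (cases "v \<in> C")
      case True
      have "C \<subseteq> insert v {s \<in> H. E v s}" using C True by (auto simp: maximal_cliques_def clique_in_def)
      moreover have "u \<in> C" if u: "u \<in> H" "E v u" for u
      proof (rule ccontr)
        assume "u \<notin> C"
        then obtain c where "c \<in> C" "\<not> E u c" using C u by (auto simp: maximal_cliques_def)
        note c = this
        have ne: "c \<noteq> u" using c(1) \<open>u \<notin> C\<close> by auto
        have cv: "c = v \<or> c \<in> {s \<in> H. E v s}" using c(1) \<open>C \<subseteq> insert v {s \<in> H. E v s}\<close> by blast
        have uN: "u \<in> {s \<in> H. E v s}" using u by simp
        have "c = v \<or> E u c"
          using cv
        proof
          assume "c \<in> {s \<in> H. E v s}"
          then show ?thesis using v(2) uN ne unfolding clique_in_def by (metis (no_types, lifting))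
        qed simp
        then show False using sym[OF u(2)] c(2) by blast
      qed
      ultimately have "C = insert v {s \<in> H. E v s}" using True by auto
      then show ?thesis by simp
    next
      case False
      then show ?thesis using C by (auto simp: maximal_cliques_def)
    qed
  qed
  have IH: "finite (maximal_cliques E (H - {v}))" "card (maximal_cliques E (H - {v})) \<le> Suc (card (H - {v}))"
    using Suc.hyps(1)[of "H - {v}"] Suc.prems Suc.hyps(2) v(1) chordal_on_subset[of E H "H - {v}"] by auto
  then have "card (maximal_cliques E H) \<le> card (insert (insert v {s \<in> H. E v s}) (maximal_cliques E (H - {v})))"
    using sub by (intro card_mono) auto
  also have "\<dots> \<le> Suc (card (maximal_cliques E (H - {v})))"
    using IH(1) by (simp add: card_insert_if)
  also have "\<dots> \<le> Suc (card H)" using IH(2) v(1) Suc.prems(1) card_gt_0_iff[of H] by auto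
  finally show ?case using IH(1) finite_subset[OF sub] by auto
qed

text \<open>A maximal clique is determined by its trace on \<open>M\<close>, one of at most
  \<open>2^k\<close> sets, and by its part outside, which is a maximal clique of the chordal graph
  on the common neighbours of that trace.\<close>

lemma card_maximal_cliques:
  assumes fin: "finite V" and M: "M \<subseteq> V" "card M \<le> k" and chord: "chordal_on E (V - M)"
  shows "finite (maximal_cliques E V)" "card (maximal_cliques E V) \<le> 2 ^ k * Suc (card V)"
proof -
  let ?H = "\<lambda>M'. {u \<in> V - M. \<forall>w \<in> M'. E u w}"
  let ?T = "SIGMA M' : Pow M. maximal_cliques E (?H M')"
  have finM: "finite M" using fin M finite_subset by blast
  have H: "finite (maximal_cliques E (?H M')) \<and> card (maximal_cliques E (?H M')) \<le> Suc (card V)" for M'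
  proof -
    have "finite (maximal_cliques E (?H M')) \<and> card (maximal_cliques E (?H M')) \<le> Suc (card (?H M'))"
    proof (rule card_maximal_cliques_chordal)
      show "finite (?H M')" using fin by simp
      show "chordal_on E (?H M')" by (rule chordal_on_subset[OF chord]) blast
    qed
    moreover have "card (?H M') \<le> card V" using fin by (intro card_mono) auto
    ultimately show ?thesis by simp
  qed
  have finT: "finite ?T" using finM H by auto
  have inj: "inj_on (\<lambda>C. (C \<inter> M, C - M)) (maximal_cliques E V)" by (auto simp: inj_on_def)
  have img: "(\<lambda>C. (C \<inter> M, C - M)) ` maximal_cliques E V \<subseteq> ?T"
  proof safe
    fix C assume C: "C \<in> maximal_cliques E V"
    have "C - M \<subseteq> ?H (C \<inter> M)" using C by (auto simp: maximal_cliques_def clique_in_def)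
    moreover have "clique_in E (C - M)" using C by (auto simp: maximal_cliques_def clique_in_def)
    moreover have "\<exists>c \<in> C - M. \<not> E u c" if u: "u \<in> ?H (C \<inter> M) - (C - M)" for u
    proof -
      have "u \<in> V - C" using u by auto
      then obtain c where "c \<in> C" "\<not> E u c" using C unfolding maximal_cliques_def by blast
      then show ?thesis using u by auto
    qed
    ultimately show "C - M \<in> maximal_cliques E (?H (C \<inter> M))" by (auto simp: maximal_cliques_def)
  qed
  show "finite (maximal_cliques E V)" using finite_imageD[OF finite_subset[OF img finT] inj] .
  have "card (maximal_cliques E V) = card ((\<lambda>C. (C \<inter> M, C - M)) ` maximal_cliques E V)"
    using inj by (simp add: card_image)
  also have "\<dots> \<le> card ?T" by (rule card_mono[OF finT img])
  also have "\<dots> = (\<Sum>M' \<in> Pow M. card (maximal_cliques E (?H M')))"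
    using finM H by (subst card_SigmaI) auto
  also have "\<dots> \<le> (\<Sum>M' \<in> Pow M. Suc (card V))" using H by (intro sum_mono) blast
  also have "\<dots> = 2 ^ card M * Suc (card V)" using finM by (simp add: card_Pow)
  also have "\<dots> \<le> 2 ^ k * Suc (card V)" using M by (intro mult_le_mono1 power_increasing) auto
  finally show "card (maximal_cliques E V) \<le> 2 ^ k * Suc (card V)" .
qed

end

text \<open>A hole is a cycle without a chord. The work lies in translating successors modulo the
  length into ordered pairs of indices.\<close>

lemma chordal_on_delete_verts:
  assumes G: "chordal (delete_verts G M)" and E: "\<And>x y. E x y \<longleftrightarrow> x \<in> verts G \<and> y \<in> verts G \<and> {x, y} \<in> edges G"
  shows "chordal_on E (verts G - M)"
  unfolding chordal_on_def
proof
  assume "\<exists>q. set q \<subseteq> verts G - M \<and> hole E q"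
  then obtain q where q: "set q \<subseteq> verts G - M" "hole E q" by blast
  have d: "distinct q" "4 \<le> length q" and e: "\<And>i j. j < length q \<Longrightarrow> i < j \<Longrightarrow>
     E (q ! i) (q ! j) \<longleftrightarrow> j = Suc i \<or> i = 0 \<and> j = length q - 1"
    using q(2) by (auto simp: hole_def)
  have inV: "q ! i \<in> verts G \<and> q ! i \<notin> M" if "i < length q" for i
    using q(1) that nth_mem by blast
  let ?G = "delete_verts G M"
  have edge: "{q ! i, q ! j} \<in> edges ?G \<longleftrightarrow> j = Suc i \<or> i = 0 \<and> j = length q - 1"
    if "j < length q" "i < j" for i j
    using e[OF that] inV[of i] inV[of j] that by (auto simp: E delete_verts_def)
  have "is_cycle ?G q"
    unfolding is_cycle_def
  proof (intro conjI allI impI)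
    show "set q \<subseteq> verts ?G" using q(1) by (simp add: delete_verts_def)
    fix i assume i: "i < length q"
    show "{q ! i, q ! (Suc i mod length q)} \<in> edges ?G"
    proof (cases "Suc i < length q")
      case True
      then show ?thesis using edge[of "Suc i" i] by simp
    next
      case False
      then have "Suc i = length q" using i by simp
      then show ?thesis using edge[of i 0] d(2) i by (auto simp: insert_commute)
    qed
  qed (use d in auto)
  then have "has_chord ?G q" using G d(2) by (auto simp: chordal_def)
  then obtain i j where ij: "i < length q" "j < length q" "i \<noteq> j" "j \<noteq> Suc i mod length q"
    "i \<noteq> Suc j mod length q" "{q ! i, q ! j} \<in> edges ?G"
    by (auto simp: has_chord_def)
  have no: False if "i < j" "j < length q" "j \<noteq> Suc i mod length q"
    "i \<noteq> Suc j mod length q" "{q ! i, q ! j} \<in> edges ?G" for i j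
  proof -
    have "j = Suc i \<or> i = 0 \<and> j = length q - 1" using edge[OF that(2,1)] that(5) by simp
    then show False using that d(2) by (cases "length q") auto
  qed
  show False
    using no[of i j] no[of j i] ij by (metis insert_commute linorder_neqE_nat)
qed

section \<open>Minimum vertex cuts\<close>

definition edge :: "bool list list \<Rightarrow> nat \<Rightarrow> nat \<Rightarrow> bool" where
  "edge m i j = nthd False (nthd [] m i) j"

lemma ptime_edge [pt]: "ptime m \<Longrightarrow> ptime i \<Longrightarrow> ptime j \<Longrightarrow> ptime (\<lambda>x. edge (m x) (i x) (j x))"
  unfolding edge_def by (intro pt)

type_synonym matching = "(nat \<times> nat) list"

text \<open>Every vertex of \<open>U - B\<close> gets a left copy and every vertex of \<open>U - A\<close> a right copy. Given a vertex
  cover of \<open>cut_rel\<close>, the vertices with both copies covered, missing copies counting as covered, form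
  a cut between \<open>A\<close> and \<open>B\<close>, and the minimum cuts correspond to the minimum covers. So Koenig's theorem on
  bipartite graphs applies.\<close>

definition cut_rel :: "bool list list \<Rightarrow> nat \<Rightarrow> nat \<Rightarrow> bool" where
  "cut_rel m l r \<longleftrightarrow> l = r \<or> edge m l r"

text \<open>The start of the search: an unmatched left vertex is reached by the empty alternating
  path, whose exchange changes nothing.\<close>

definition exposed :: "nat list \<Rightarrow> matching \<Rightarrow> (nat \<times> matching) list" where
  "exposed Ls M = map (\<lambda>l. (l, M)) (filter (\<lambda>l. l \<notin> set (map fst M)) Ls)"

text \<open>A right vertex that is unmatched in the stored matching passes the filter vacuously, and
  the step is then an augmentation. Otherwise its partner must not have been reached yet.\<close>

definition alternations :: "bool list list \<Rightarrow> nat list \<Rightarrow> (nat \<times> matching) list \<Rightarrow> (nat \<times> matching \<times> nat) list" where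
  "alternations m Rs Re = concat (map (\<lambda>x. map (\<lambda>r. (fst x, snd x, r))
     (filter (\<lambda>r. cut_rel m (fst x) r \<and> (\<forall>e \<in> set (snd x). snd e = r \<longrightarrow> fst e \<notin> set (map fst Re))) Rs)) Re)"

text \<open>A state consists of a matching and of the left vertices reached so far by alternating paths,
  each stored with the matching that the exchange along its path produces. This makes the
  augmentation itself a single step and avoids any reasoning about alternating paths.\<close>

definition match_step ::
  "bool list list \<Rightarrow> nat list \<Rightarrow> nat list \<Rightarrow> matching \<times> (nat \<times> matching) list \<Rightarrow> matching \<times> (nat \<times> matching) list" where
  "match_step m Ls Rs s = (case alternations m Rs (snd s) of [] \<Rightarrow> s
    | c # cs \<Rightarrow> (case filter (\<lambda>e. snd e = snd (snd c)) (fst (snd c)) of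
        [] \<Rightarrow> ((fst c, snd (snd c)) # filter (\<lambda>e. snd e \<noteq> snd (snd c)) (fst (snd c)),
               exposed Ls ((fst c, snd (snd c)) # filter (\<lambda>e. snd e \<noteq> snd (snd c)) (fst (snd c))))
      | e # es \<Rightarrow> (fst s, (fst e, (fst c, snd (snd c)) # filter (\<lambda>e. snd e \<noteq> snd (snd c)) (fst (snd c))) # snd s)))"

text \<open>The number of rounds exceeds every value of \<open>potential\<close>, which rises
  whenever the search can continue; so the loop ends with a search that is stuck.\<close>

definition match_loop ::
  "nat \<Rightarrow> bool list list \<Rightarrow> nat list \<Rightarrow> nat list \<Rightarrow> matching \<times> (nat \<times> matching) list" where
  "match_loop p m Ls Rs = fold (\<lambda>_ s. clip p ([], []) (match_step m Ls Rs s))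
     (replicate ((length Ls + 1) * (length Ls + 1)) ()) ([], exposed Ls [])"

text \<open>The cover is the one of Koenig: left copies that are not reached, and right copies
  related to a reached left one. Vertices in \<open>A\<close> have no right copy and vertices in
  \<open>B\<close> no left copy.\<close>

definition min_cut :: "nat \<Rightarrow> bool list list \<Rightarrow> nat list \<Rightarrow> nat list \<Rightarrow> nat list \<Rightarrow> nat list" where
  "min_cut p m U A B =
     (let Re = snd (match_loop p m (filter (\<lambda>v. v \<notin> set B) U) (filter (\<lambda>v. v \<notin> set A) U))
      in filter (\<lambda>v. (v \<in> set A \<or> (\<exists>x \<in> set Re. cut_rel m (fst x) v)) \<and> (v \<in> set B \<or> v \<notin> set (map fst Re))) U)"

lemma ptime_min_cut [pt]:
  assumes "ptime p" "ptime m" "ptime U" "ptime A" "ptime B"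
  shows "ptime (\<lambda>x. min_cut (p x) (m x) (U x) (A x) (B x))"
proof -
  have cut_rel: "ptime (\<lambda>x. cut_rel (m x) (i x) (j x))" if "ptime m" "ptime i" "ptime j"
    for m :: "'y::enc \<Rightarrow> _" and i j
    unfolding cut_rel_def by (intro pt that)
  have exposed: "ptime (\<lambda>x. exposed (l x) (M x))" if "ptime l" "ptime M" for l and M :: "'y::enc \<Rightarrow> _"
    unfolding exposed_def by (intro pt that feasible_compose[OF that(2)])
  have alternations: "ptime (\<lambda>x. alternations (m x) (R x) (Re x))" if "ptime m" "ptime R" "ptime Re"
    for m :: "'y::enc \<Rightarrow> _" and R Re
    unfolding alternations_def
    by (intro pt cut_rel that feasible_compose[OF that(1)] feasible_compose[OF that(2)] feasible_compose[OF that(3)])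
  have step: "ptime (\<lambda>x. match_step (m x) (L x) (R x) (s x))" if "ptime m" "ptime L" "ptime R" "ptime s"
    for m :: "'y::enc \<Rightarrow> _" and L R s
    unfolding match_step_def
    by (intro pt alternations exposed that feasible_compose[OF that(2)] feasible_compose[OF that(4)])
  have loop: "ptime (\<lambda>x. match_loop (p x) (m x) (L x) (R x))" if "ptime p" "ptime m" "ptime L" "ptime R"
    for m :: "'y::enc \<Rightarrow> _" and L R p
    unfolding match_loop_def
    by (intro pt step exposed that that[THEN feasible_compose])
  have "ptime (\<lambda>x. (\<lambda>Re. filter (\<lambda>v. (v \<in> set (A x) \<or> (\<exists>y \<in> set Re. cut_rel (m x) (fst y) v)) \<and>
      (v \<in> set (B x) \<or> v \<notin> set (map fst Re))) (U x))
      (snd (match_loop (p x) (m x) (filter (\<lambda>v. v \<notin> set (B x)) (U x)) (filter (\<lambda>v. v \<notin> set (A x)) (U x)))))"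
    by (rule ptime_compose2[where f = "\<lambda>x. x"])
      (intro pt cut_rel loop assms assms[THEN feasible_compose])+
  then show ?thesis by (simp add: min_cut_def Let_def)
qed

section \<open>Koenig's theorem for the alternating search\<close>

definition is_matching :: "('a \<Rightarrow> 'b \<Rightarrow> bool) \<Rightarrow> 'a set \<Rightarrow> 'b set \<Rightarrow> ('a \<times> 'b) list \<Rightarrow> bool" where
  "is_matching B L R M \<longleftrightarrow> distinct (map fst M) \<and> distinct (map snd M) \<and>
     (\<forall>e \<in> set M. fst e \<in> L \<and> snd e \<in> R \<and> B (fst e) (snd e))"

text \<open>This is all that is remembered of an alternating path: the matching after the exchange
  covers the same right vertices, leaves the reached vertex free, and agrees with the current
  matching at left vertices not reached at all.\<close>

definition match_inv :: "bool list list \<Rightarrow> nat list \<Rightarrow> nat list \<Rightarrow> matching \<times> (nat \<times> matching) list \<Rightarrow> bool" where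
  "match_inv m Ls Rs s \<longleftrightarrow> is_matching (cut_rel m) (set Ls) (set Rs) (fst s) \<and> distinct (map fst (snd s)) \<and>
     (\<forall>l \<in> set Ls. l \<notin> fst ` set (fst s) \<longrightarrow> l \<in> fst ` set (snd s)) \<and>
     (\<forall>x \<in> set (snd s). is_matching (cut_rel m) (set Ls) (set Rs) (snd x) \<and> fst x \<in> set Ls \<and>
        fst x \<notin> fst ` set (snd x) \<and> snd ` set (snd x) = snd ` set (fst s) \<and>
        (\<forall>e \<in> set (fst s). fst e \<notin> fst ` set (snd s) \<longrightarrow> e \<in> set (snd x)))"

text \<open>Lexicographic: an augmentation restarts the search, so one more matching edge outweighs
  the longest possible list of reached vertices.\<close>

definition potential :: "nat list \<Rightarrow> matching \<times> (nat \<times> matching) list \<Rightarrow> nat" where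
  "potential Ls s = length (fst s) * (length Ls + 1) + length (snd s)"

lemma is_matching_length:
  assumes "is_matching B L R M" shows "length M = card (fst ` set M)" "length M = card (snd ` set M)"
proof -
  have "distinct (map fst M)" "distinct (map snd M)" using assms by (auto simp: is_matching_def)
  from this[THEN distinct_card] show "length M = card (fst ` set M)" "length M = card (snd ` set M)" by auto
qed

lemma is_matching_exchange:
  assumes M: "is_matching B L R M" and l: "l \<in> L" "l \<notin> fst ` set M" and r: "r \<in> R" "B l r"
  shows "is_matching B L R ((l, r) # filter (\<lambda>e. snd e \<noteq> r) M)"
  using assms by (auto simp: is_matching_def distinct_map inj_on_def)

lemma exposed_fst [simp]: "map fst (exposed Ls M) = filter (\<lambda>l. l \<notin> fst ` set M) Ls"
  by (simp add: exposed_def comp_def)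

lemma match_inv_exposed:
  assumes "distinct Ls" "is_matching (cut_rel m) (set Ls) (set Rs) M"
  shows "match_inv m Ls Rs (M, exposed Ls M)"
proof -
  have "fst ` set (exposed Ls M) = {l \<in> set Ls. l \<notin> fst ` set M}"
    by (metis exposed_fst set_filter set_map)
  then show ?thesis using assms by (auto simp: match_inv_def) (force simp: exposed_def image_iff)+
qed

text \<open>If \<open>r\<close> is free in the stored matching, adding the edge gives a larger
  matching than the current one, because both cover the same right vertices before the step.
  Otherwise the exchange at \<open>r\<close> frees its former partner, which is new by the filter in
  \<open>alternations\<close>.\<close>

lemma match_step_inv:
  assumes Ls: "distinct Ls" and inv: "match_inv m Ls Rs s" and ne: "alternations m Rs (snd s) \<noteq> []"
  shows "match_inv m Ls Rs (match_step m Ls Rs s) \<and> potential Ls s < potential Ls (match_step m Ls Rs s)"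
proof -
  obtain M Re where s: "s = (M, Re)" by force
  obtain c cs where c: "alternations m Rs Re = c # cs" using ne s by (cases "alternations m Rs Re") auto
  obtain l Ml r where clr: "c = (l, Ml, r)" by (cases c) auto
  let ?Mn = "(l, r) # filter (\<lambda>e. snd e \<noteq> r) Ml"
  have "c \<in> set (alternations m Rs Re)" by (simp add: c)
  then have lMl: "(l, Ml) \<in> set Re" and r: "r \<in> set Rs" "cut_rel m l r"
    and free: "\<And>e. e \<in> set Ml \<Longrightarrow> snd e = r \<Longrightarrow> fst e \<notin> fst ` set Re"
    by (auto simp: alternations_def clr)
  have M: "is_matching (cut_rel m) (set Ls) (set Rs) M" and dRe: "distinct (map fst Re)"
    and cov: "\<And>l. l \<in> set Ls \<Longrightarrow> l \<notin> fst ` set M \<Longrightarrow> l \<in> fst ` set Re"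
    and each: "\<And>x. x \<in> set Re \<Longrightarrow> is_matching (cut_rel m) (set Ls) (set Rs) (snd x) \<and> fst x \<in> set Ls \<and>
        fst x \<notin> fst ` set (snd x) \<and> snd ` set (snd x) = snd ` set M \<and>
        (\<forall>e \<in> set M. fst e \<notin> fst ` set Re \<longrightarrow> e \<in> set (snd x))"
    using inv by (auto simp: match_inv_def s)
  have Ml: "is_matching (cut_rel m) (set Ls) (set Rs) Ml" "l \<in> set Ls" "l \<notin> fst ` set Ml"
    "snd ` set Ml = snd ` set M" "\<And>e. e \<in> set M \<Longrightarrow> fst e \<notin> fst ` set Re \<Longrightarrow> e \<in> set Ml"
    using each[OF lMl] by auto
  have Mn: "is_matching (cut_rel m) (set Ls) (set Rs) ?Mn"
    using is_matching_exchange[OF Ml(1-3) r] .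
  have ReL: "length Re \<le> length Ls"
  proof -
    have "length Re = card (fst ` set Re)" using distinct_card[OF dRe] by simp
    also have "\<dots> \<le> card (set Ls)" using each by (intro card_mono) auto
    also have "\<dots> \<le> length Ls" by (rule card_length)
    finally show ?thesis .
  qed
  show ?thesis
  proof (cases "filter (\<lambda>e. snd e = r) Ml")
    case Nil
    then have "r \<notin> snd ` set Ml" by (auto simp: filter_empty_conv)
    then have "filter (\<lambda>e. snd e \<noteq> r) Ml = Ml" by (auto simp: filter_id_conv)
    moreover have "length Ml = length M"
      using is_matching_length(2)[OF Ml(1)] is_matching_length(2)[OF M] Ml(4) by simp
    ultimately have "length ?Mn = Suc (length M)" by simp
    then have "potential Ls (M, Re) < potential Ls (?Mn, exposed Ls ?Mn)"
      using ReL by (simp add: potential_def)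
    moreover have "match_step m Ls Rs s = (?Mn, exposed Ls ?Mn)"
      using c clr Nil by (simp add: match_step_def s)
    ultimately show ?thesis using match_inv_exposed[OF Ls Mn] by (simp add: s)
  next
    case (Cons e es)
    then have "e \<in> set (filter (\<lambda>e. snd e = r) Ml)" by simp
    then have e: "e \<in> set Ml" "snd e = r" by auto
    have eq: "match_step m Ls Rs s = (M, (fst e, ?Mn) # Re)"
      using c clr Cons by (simp add: match_step_def s)
    have uniq: "x = e" if "x \<in> set Ml" "snd x = r" for x
      using Ml(1) that e by (auto simp: is_matching_def distinct_map inj_on_def)
    have rM: "r \<in> snd ` set M" using e Ml(4) by auto
    have 1: "snd ` set ?Mn = snd ` set M"
    proof -
      have "snd ` set ?Mn = insert r (snd ` set Ml)" by auto
      then show ?thesis using rM Ml(4) by auto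
    qed
    have 2: "fst e \<notin> fst ` set ?Mn"
    proof -
      have "fst e \<noteq> l" using Ml(3) e by auto
      moreover have ne: "fst x \<noteq> fst e" if "x \<in> set Ml" "snd x \<noteq> r" for x
        using Ml(1) that e by (auto simp: is_matching_def distinct_map inj_on_def)
      ultimately show ?thesis using ne by fastforce
    qed
    have 3: "x \<in> set ?Mn" if "x \<in> set M" "fst x \<notin> fst ` set ((fst e, ?Mn) # Re)" for x
    proof -
      have "x \<in> set Ml" using Ml(5) that by auto
      moreover have "snd x \<noteq> r" using uniq[of x] calculation that(2) by auto
      ultimately show ?thesis by simp
    qed
    have 4: "fst e \<in> set Ls" using Ml(1) e by (auto simp: is_matching_def)
    have 5: "fst e \<notin> fst ` set Re" using free e by blast
    have "match_inv m Ls Rs (M, (fst e, ?Mn) # Re)"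
      unfolding match_inv_def fst_conv snd_conv
    proof (intro conjI ballI impI)
      show "distinct (map fst ((fst e, ?Mn) # Re))" using dRe 5 by simp
      show "a \<in> fst ` set ((fst e, ?Mn) # Re)" if "a \<in> set Ls" "a \<notin> fst ` set M" for a
        using cov[OF that] by simp
      fix x assume "x \<in> set ((fst e, ?Mn) # Re)"
      then have x: "x = (fst e, ?Mn) \<or> x \<in> set Re" unfolding list.set by blast
      show "is_matching (cut_rel m) (set Ls) (set Rs) (snd x)"
        using x by (elim disjE) (simp_all only: snd_conv Mn each)
      show "fst x \<in> set Ls" using x by (elim disjE) (simp_all only: fst_conv 4 each)
      show "fst x \<notin> fst ` set (snd x)"
        using x by (elim disjE) (simp_all only: fst_conv snd_conv 2 each not_False_eq_True)
      show "snd ` set (snd x) = snd ` set M"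
        using x by (elim disjE) (simp_all only: snd_conv 1 each)
      fix y assume y: "y \<in> set M" "fst y \<notin> fst ` set ((fst e, ?Mn) # Re)"
      then have "fst y \<notin> fst ` set Re" unfolding list.set image_insert by blast
      then show "y \<in> set (snd x)"
        using x y 3[OF y] each[of x] by (elim disjE) (simp only: snd_conv, blast)
    qed (rule M)
    then show ?thesis unfolding eq unfolding s potential_def by simp
  qed
qed

lemma potential_bound:
  assumes "match_inv m Ls Rs s" "distinct Ls"
  shows "length (fst s) \<le> length Ls" "length (snd s) \<le> length Ls"
    "potential Ls s < (length Ls + 1) * (length Ls + 1)"
proof -
  have "length (fst s) = card (fst ` set (fst s))"
    using assms(1) is_matching_length(1)[of "cut_rel m" "set Ls" "set Rs" "fst s"] by (simp add: match_inv_def)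
  also have "\<dots> \<le> card (set Ls)"
    using assms by (intro card_mono) (auto simp: match_inv_def is_matching_def)
  finally show 1: "length (fst s) \<le> length Ls" using distinct_card[OF assms(2)] by simp
  have "length (snd s) = card (fst ` set (snd s))"
    using assms(1) distinct_card[of "map fst (snd s)"] by (simp add: match_inv_def)
  also have "\<dots> \<le> card (set Ls)" using assms(1) by (intro card_mono) (auto simp: match_inv_def)
  finally show 2: "length (snd s) \<le> length Ls" using distinct_card[OF assms(2)] by simp
  have "length (fst s) * (length Ls + 1) \<le> length Ls * (length Ls + 1)" using 1 by (rule mult_le_mono1)
  then show "potential Ls s < (length Ls + 1) * (length Ls + 1)"
    unfolding potential_def using 2 by (simp add: algebra_simps)
qed

text \<open>At most \<open>n\<close> reached vertices carry a matching each, and a matching has at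
  most \<open>n\<close> pairs of numbers below \<open>n\<close>; hence the cube.\<close>

lemma sz_match_state:
  assumes inv: "match_inv m Ls Rs s" "distinct Ls" and n: "set Ls \<subseteq> {..<n}" "set Rs \<subseteq> {..<n}"
  shows "sz s \<le> 16 * (n + 2) ^ 3"
proof -
  have "length Ls \<le> n" using distinct_card[OF inv(2)] card_mono[OF _ n(1)] by simp
  then have len: "length (fst s) \<le> n" "length (snd s) \<le> n" using potential_bound[OF inv] by auto
  have pair: "sz e \<le> 2 * n" if "fst e < n" "snd e < n" for e :: "nat \<times> nat"
    using that by (simp add: sz_prod)
  have mat: "sz M \<le> n * Suc (2 * n)"
    if "is_matching (cut_rel m) (set Ls) (set Rs) M" for M
  proof (rule sz_list_le)
    show "length M \<le> n"
    proof -
      have "length M = card (fst ` set M)" using is_matching_length(1)[OF that] .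
      also have "\<dots> \<le> card {..<n}" using that n(1) by (intro card_mono) (auto simp: is_matching_def)
      finally show ?thesis by simp
    qed
    fix e assume "e \<in> set M"
    then have "fst e < n" "snd e < n" using that n by (auto simp: is_matching_def)
    then show "sz e \<le> 2 * n" by (rule pair)
  qed
  have 1: "sz (fst s) \<le> n * Suc (2 * n)" using inv(1) mat by (simp add: match_inv_def)
  have 2: "sz (snd s) \<le> n * Suc (n + n * Suc (2 * n))"
  proof (rule sz_list_le[OF _ len(2)])
    fix x assume "x \<in> set (snd s)"
    then have "sz (snd x) \<le> n * Suc (2 * n)" "fst x < n" using inv(1) mat n by (auto simp: match_inv_def)
    then show "sz x \<le> n + n * Suc (2 * n)" by (simp add: sz_prod)
  qed
  have "Suc (n * Suc (2 * n) + n * Suc (n + n * Suc (2 * n))) \<le> 16 * (n + 2) ^ 3"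
    by (simp add: power3_eq_cube algebra_simps)
  then show ?thesis using 1 2 by (simp add: sz_prod)
qed

text \<open>The state is always small enough to escape clipping. After \<open>i\<close> rounds the
  search is stuck or the potential is at least \<open>i\<close>, and the number of rounds is out of
  its range.\<close>

lemma match_loop_correct:
  assumes Ls: "distinct Ls" and n: "set Ls \<subseteq> {..<n}" "set Rs \<subseteq> {..<n}" and p: "16 * (n + 2) ^ 3 \<le> p"
  shows "match_inv m Ls Rs (match_loop p m Ls Rs) \<and> alternations m Rs (snd (match_loop p m Ls Rs)) = []"
proof -
  let ?f = "\<lambda>(_::unit) s. clip p ([], []) (match_step m Ls Rs s)"
  define S where "S i = fold ?f (replicate i ()) ([], exposed Ls [])" for i
  have S_Suc: "S (Suc i) = clip p ([], []) (match_step m Ls Rs (S i))" for i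
  proof -
    have "replicate (Suc i) () = replicate i () @ [()]" by (simp add: replicate_append_same)
    then show ?thesis unfolding S_def by (simp only: fold_append) simp
  qed
  have step: "match_inv m Ls Rs (S (Suc i)) \<and> (alternations m Rs (snd (S i)) = [] \<longrightarrow> S (Suc i) = S i) \<and>
     (alternations m Rs (snd (S i)) \<noteq> [] \<longrightarrow> potential Ls (S i) < potential Ls (S (Suc i)))"
    if inv: "match_inv m Ls Rs (S i)" for i
  proof -
    have m: "match_inv m Ls Rs (match_step m Ls Rs (S i))"
      using match_step_inv[OF Ls inv] inv
      by (cases "alternations m Rs (snd (S i)) = []") (auto simp: match_step_def)
    have "S (Suc i) = match_step m Ls Rs (S i)" unfolding S_Suc
      by (rule clip_id) (use sz_match_state[OF m Ls n] p in simp)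
    then show ?thesis using m match_step_inv[OF Ls inv] by (auto simp: match_step_def)
  qed
  have base: "match_inv m Ls Rs (S 0)"
    unfolding S_def using match_inv_exposed[OF Ls, of m Rs "[]"] by (simp add: is_matching_def)
  have inv: "match_inv m Ls Rs (S i)" for i by (induction i) (use base step in blast)+
  have progress: "alternations m Rs (snd (S i)) = [] \<or> i \<le> potential Ls (S i)" for i
  proof (induction i)
    case (Suc i)
    then show ?case using step[OF inv[of i]] by (cases "alternations m Rs (snd (S i)) = []") auto
  qed simp
  have "match_loop p m Ls Rs = S ((length Ls + 1) * (length Ls + 1))"
    by (simp add: match_loop_def S_def)
  then show ?thesis using inv progress potential_bound(3)[OF inv Ls] by (metis not_less)
qed

text \<open>Weak duality: every matching edge is sent to a vertex that covers it, and disjoint edges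
  go to different vertices.\<close>

lemma matching_le_cover:
  assumes M: "is_matching B L R M" and fin: "finite P" "finite Q"
    and cover: "\<And>l r. l \<in> L \<Longrightarrow> r \<in> R \<Longrightarrow> B l r \<Longrightarrow> l \<in> P \<or> r \<in> Q"
  shows "length M \<le> card P + card Q"
proof -
  have d: "distinct (map fst M)" "distinct (map snd M)" using M by (auto simp: is_matching_def)
  have inj: "inj_on (\<lambda>e. if fst e \<in> P then Inl (fst e) else Inr (snd e)) (set M)"
    using d by (auto simp: inj_on_def distinct_map split: if_splits)
  have "length M = card (set M)" using d(1) by (simp add: distinct_card distinct_map)
  also have "\<dots> \<le> card (P <+> Q)"
    using fin M cover by (intro card_inj_on_le[OF inj]) (auto simp: is_matching_def)
  also have "\<dots> = card P + card Q" using fin by (rule card_Plus)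
  finally show ?thesis .
qed

text \<open>Strong duality: the stuck search yields a cover no larger than the matching, while every
  separation \<open>X0\<close>, \<open>Z0\<close> yields some cover, which is no smaller than the
  matching. Comparing covers with cuts vertex by vertex turns minimality of the cover into
  minimality of the cut.\<close>

lemma min_cut_correct:
  fixes U A B :: "nat list" and m :: "bool list list" and p n :: nat
  assumes U: "distinct U" "set U \<subseteq> {..<n}" and p: "16 * (n + 2) ^ 3 \<le> p"
  defines "Z \<equiv> min_cut p m U A B"
  shows "\<exists>X. X \<subseteq> set U - set Z \<and> (set A \<inter> set U) - set Z \<subseteq> X \<and> X \<inter> set B = {} \<and>
      (\<forall>x \<in> X. \<forall>u \<in> set U - set Z. edge m x u \<longrightarrow> u \<in> X)"
    and "\<And>X0 Z0. finite Z0 \<Longrightarrow> set A \<inter> set U \<subseteq> X0 \<union> Z0 \<Longrightarrow> X0 \<inter> set B = {} \<Longrightarrow>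
      (\<And>x u. x \<in> X0 \<Longrightarrow> x \<in> set U \<Longrightarrow> u \<in> set U \<Longrightarrow> edge m x u \<Longrightarrow> u \<in> X0 \<union> Z0) \<Longrightarrow> length Z \<le> card Z0"
    and "set Z \<subseteq> set U" "distinct Z"
proof -
  define Ls where "Ls = filter (\<lambda>v. v \<notin> set B) U"
  define Rs where "Rs = filter (\<lambda>v. v \<notin> set A) U"
  define s where "s = match_loop p m Ls Rs"
  define Rd where "Rd = fst ` set (snd s)"
  have d: "distinct Ls" "set Ls \<subseteq> {..<n}" "set Rs \<subseteq> {..<n}" using U by (auto simp: Ls_def Rs_def)
  have inv: "match_inv m Ls Rs s" and stuck: "alternations m Rs (snd s) = []"
    using match_loop_correct[OF d p, of m] by (auto simp: s_def)
  have RdL: "Rd \<subseteq> set Ls" using inv by (auto simp: Rd_def match_inv_def)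
  define Q where "Q = {r \<in> set Rs. \<exists>l \<in> Rd. cut_rel m l r}"
  define P where "P = set Ls - Rd"
  have Z: "Z = filter (\<lambda>v. (v \<in> set A \<or> (\<exists>l \<in> Rd. cut_rel m l v)) \<and> (v \<in> set B \<or> v \<notin> Rd)) U"
    by (simp add: Z_def min_cut_def Let_def Rd_def s_def Ls_def Rs_def)
  have ZP: "v \<in> set Z \<longleftrightarrow> v \<in> set U \<and> (v \<in> set A \<or> v \<in> Q) \<and> (v \<in> set B \<or> v \<in> P)" for v
    using RdL unfolding Z Q_def P_def Ls_def Rs_def by auto
  show ZU: "set Z \<subseteq> set U" and "distinct Z" using U(1) by (auto simp: Z)
  have self: "cut_rel m v v" for v by (simp add: cut_rel_def)
  show "\<exists>X. X \<subseteq> set U - set Z \<and> (set A \<inter> set U) - set Z \<subseteq> X \<and> X \<inter> set B = {} \<and>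
      (\<forall>x \<in> X. \<forall>u \<in> set U - set Z. edge m x u \<longrightarrow> u \<in> X)"
  proof (intro exI[of _ "{v \<in> set U - set Z. v \<in> set A \<or> v \<in> Q}"] conjI ballI impI)
    fix x u assume x: "x \<in> {v \<in> set U - set Z. v \<in> set A \<or> v \<in> Q}" and u: "u \<in> set U - set Z" "edge m x u"
    then have "x \<in> Rd" using ZP unfolding P_def Ls_def by auto
    then have "u \<in> set A \<or> u \<in> Q" using u by (auto simp: Q_def Rs_def cut_rel_def)
    then show "u \<in> {v \<in> set U - set Z. v \<in> set A \<or> v \<in> Q}" using u by simp
  qed (use ZP in auto)
  have cut: "card P + card Q \<le> length (fst s)"
  proof -
    have M: "is_matching (cut_rel m) (set Ls) (set Rs) (fst s)" using inv by (simp add: match_inv_def)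
    have "P \<subseteq> fst ` set (fst s)" using inv by (auto simp: match_inv_def P_def Rd_def)
    then have "P \<subseteq> fst ` {e \<in> set (fst s). fst e \<notin> Rd}" by (auto simp: P_def)
    then have 1: "card P \<le> card {e \<in> set (fst s). fst e \<notin> Rd}" by (intro surj_card_le) auto
    \<comment> \<open>Since the search is stuck, \<open>r\<close> is matched in the stored matching,
      to a reached vertex. The current matching covers \<open>r\<close> too. Were its partner there
      not reached, that edge would also be in the stored matching and \<open>r\<close> would have
      two partners.\<close>
    have "Q \<subseteq> snd ` {e \<in> set (fst s). fst e \<in> Rd}"
    proof
      fix r assume "r \<in> Q"
      then obtain x where x: "x \<in> set (snd s)" "r \<in> set Rs" "cut_rel m (fst x) r"
        by (auto simp: Q_def Rd_def)
      have "(fst x, snd x, r) \<notin> set (alternations m Rs (snd s))" using stuck by simp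
      then obtain e where e: "e \<in> set (snd x)" "snd e = r" "fst e \<in> Rd"
        using x by (force simp: alternations_def Rd_def)
      have x': "is_matching (cut_rel m) (set Ls) (set Rs) (snd x)" "snd ` set (snd x) = snd ` set (fst s)"
        "\<And>e. e \<in> set (fst s) \<Longrightarrow> fst e \<notin> Rd \<Longrightarrow> e \<in> set (snd x)"
        using inv x(1) by (auto simp: match_inv_def Rd_def)
      have "r \<in> snd ` set (fst s)" using x'(2) e by auto
      then obtain e' where e': "e' \<in> set (fst s)" "snd e' = r" by auto
      have "fst e' \<in> Rd"
      proof (rule ccontr)
        assume "fst e' \<notin> Rd"
        then have "e' \<in> set (snd x)" using x'(3) e' by simp
        then have "e' = e" using x'(1) e e' by (auto simp: is_matching_def distinct_map inj_on_def)
        then show False using e \<open>fst e' \<notin> Rd\<close> by simp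
      qed
      then show "r \<in> snd ` {e \<in> set (fst s). fst e \<in> Rd}" using e' by auto
    qed
    then have 2: "card Q \<le> card {e \<in> set (fst s). fst e \<in> Rd}" by (intro surj_card_le) auto
    have "card {e \<in> set (fst s). fst e \<notin> Rd} + card {e \<in> set (fst s). fst e \<in> Rd} = card (set (fst s))"
      by (subst card_Un_disjoint[symmetric]) (auto intro: arg_cong[where f = card])
    also have "\<dots> = length (fst s)" using M by (simp add: is_matching_def distinct_map distinct_card)
    finally show ?thesis using 1 2 by simp
  qed
  have cards: "card S = (\<Sum>v \<in> set U. of_bool (v \<in> S))" if "S \<subseteq> set U" for S
  proof -
    have "set U \<inter> {v. v \<in> S} = S" using that by auto
    then show ?thesis by (simp add: sum.If_cases of_bool_def)
  qed
  fix X0 Z0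
  assume X0: "finite Z0" "set A \<inter> set U \<subseteq> X0 \<union> Z0" "X0 \<inter> set B = {}"
    "\<And>x u. x \<in> X0 \<Longrightarrow> x \<in> set U \<Longrightarrow> u \<in> set U \<Longrightarrow> edge m x u \<Longrightarrow> u \<in> X0 \<union> Z0"
  \<comment> \<open>The cover given by a separation: an edge out of a left copy in \<open>X0\<close>
    ends at a right copy in \<open>X0\<close> or \<open>Z0\<close>.\<close>
  define P0 where "P0 = {v \<in> set Ls. v \<notin> X0 - Z0}"
  define Q0 where "Q0 = {v \<in> set Rs. v \<in> X0 \<union> Z0}"
  have "length (fst s) \<le> card P0 + card Q0"
  proof (rule matching_le_cover)
    show "is_matching (cut_rel m) (set Ls) (set Rs) (fst s)" using inv by (simp add: match_inv_def)
    show "l \<in> P0 \<or> r \<in> Q0" if "l \<in> set Ls" "r \<in> set Rs" "cut_rel m l r" for l r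
      using that X0(4)[of l r] by (auto simp: P0_def Q0_def cut_rel_def Ls_def Rs_def)
  qed (auto simp: P0_def Q0_def)
  with cut have PQ: "card P + card Q \<le> card P0 + card Q0" by simp
  \<comment> \<open>Vertices counted by \<open>a\<close> have two copies and those counted by
    \<open>c\<close> have none. A vertex with two copies costs one in every cover, and a second one
    iff it is in the cut; a vertex without copies is in every cut for free. So the sizes of cover
    and cut differ by the constant \<open>a - c\<close>.\<close>
  define a where "a = (\<Sum>v \<in> set U. of_bool (v \<notin> set A \<and> v \<notin> set B) :: nat)"
  define c where "c = card (set A \<inter> set B \<inter> set U)"
  have "card P + card Q + c = a + card (set Z)"
  proof -
    have sub: "P \<subseteq> set U" "Q \<subseteq> set U" "set A \<inter> set B \<inter> set U \<subseteq> set U"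
      by (auto simp: P_def Q_def Ls_def Rs_def)
    show ?thesis unfolding a_def c_def cards[OF sub(1)] cards[OF sub(2)] cards[OF sub(3)] cards[OF ZU]
        sum.distrib[symmetric]
    proof (rule sum.cong)
      fix v assume v: "v \<in> set U"
      have "v \<in> P \<or> v \<in> Q" if "v \<notin> set A" "v \<notin> set B"
        using v that self[of v] by (auto simp: P_def Q_def Ls_def Rs_def)
      moreover have "v \<notin> P" if "v \<in> set B" using that by (auto simp: P_def Ls_def)
      moreover have "v \<notin> Q" if "v \<in> set A" using that by (auto simp: Q_def Rs_def)
      ultimately show "of_bool (v \<in> P) + of_bool (v \<in> Q) + of_bool (v \<in> set A \<inter> set B \<inter> set U) =
        (of_bool (v \<notin> set A \<and> v \<notin> set B) + of_bool (v \<in> set Z) :: nat)"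
        using v unfolding ZP by auto
    qed simp
  qed
  moreover have "card P0 + card Q0 + c \<le> a + card (Z0 \<inter> set U)"
  proof -
    have sub: "P0 \<subseteq> set U" "Q0 \<subseteq> set U" "set A \<inter> set B \<inter> set U \<subseteq> set U" "Z0 \<inter> set U \<subseteq> set U"
      by (auto simp: P0_def Q0_def Ls_def Rs_def)
    show ?thesis unfolding a_def c_def cards[OF sub(1)] cards[OF sub(2)] cards[OF sub(3)] cards[OF sub(4)]
        sum.distrib[symmetric]
      by (rule sum_mono) (use X0(2,3) in \<open>auto simp: P0_def Q0_def Ls_def Rs_def\<close>)
  qed
  moreover have "card (Z0 \<inter> set U) \<le> card Z0" using X0(1) by (intro card_mono) auto
  moreover have "length Z = card (set Z)" using \<open>distinct Z\<close> by (simp add: distinct_card)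
  ultimately show "length Z \<le> card Z0" using PQ by simp
qed

section \<open>Cliques, components and splittings of lists\<close>

definition clique_step :: "bool list list \<Rightarrow> nat \<Rightarrow> nat list list \<Rightarrow> nat list list" where
  "clique_step m v L = remdups (filter (\<lambda>C. \<forall>u \<in> set [0..<Suc v]. u \<in> set C \<or> (\<exists>c \<in> set C. \<not> edge m u c))
     (L @ map (\<lambda>C. v # filter (\<lambda>c. edge m v c) C) L))"

definition cliques :: "nat \<Rightarrow> bool list list \<Rightarrow> nat list list" where
  "cliques p m = fold (\<lambda>v L. clip p [] (clique_step m v L)) [0..<length m] [[]]"

lemma ptime_cliques [pt]:
  assumes "ptime p" "ptime m" shows "ptime (\<lambda>x. cliques (p x) (m x))"
proof -
  have step: "ptime (\<lambda>x. clique_step (m x) (v x) (L x))" if "ptime m" "ptime v" "ptime L"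
    for m :: "'y::enc \<Rightarrow> _" and v L
    unfolding clique_step_def by (intro pt that that[THEN feasible_compose])
  show ?thesis unfolding cliques_def by (intro pt step assms assms[THEN feasible_compose])
qed

text \<open>The descending order makes a list determined by its set, so that \<open>remdups\<close>
  indeed identifies equal cliques.\<close>

definition canonical :: "nat \<Rightarrow> nat list \<Rightarrow> bool" where
  "canonical v C \<longleftrightarrow> C = filter (\<lambda>u. u \<in> set C) (rev [0..<v])"

lemma canonical_subset: "canonical v C \<Longrightarrow> set C \<subseteq> {..<v}"
  unfolding canonical_def by (metis atLeastLessThan_upt atLeast0LessThan filter_is_subset set_rev)

lemma canonical_distinct: "canonical v C \<Longrightarrow> distinct C"
  unfolding canonical_def by (metis distinct_filter distinct_rev distinct_upt)

lemma canonical_inj: "canonical v C \<Longrightarrow> canonical v C' \<Longrightarrow> set C = set C' \<Longrightarrow> C = C'"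
  unfolding canonical_def by metis

lemma canonical_Suc: "canonical v C \<Longrightarrow> canonical (Suc v) C"
proof -
  assume C: "canonical v C"
  then have "v \<notin> set C" using canonical_subset by blast
  then show ?thesis using C by (simp add: canonical_def)
qed

lemma canonical_extend: assumes "canonical v C" shows "canonical (Suc v) (v # filter P C)"
proof -
  have sub: "set C \<subseteq> {..<v}" by (rule canonical_subset[OF assms])
  have "filter (\<lambda>u. u = v \<or> u \<in> set C \<and> P u) (rev [0..<v]) = filter P (filter (\<lambda>u. u \<in> set C) (rev [0..<v]))"
    unfolding filter_filter by (rule filter_cong) auto
  also have "\<dots> = filter P C" using assms by (simp add: canonical_def)
  finally show ?thesis unfolding canonical_def by simp
qed

lemma sz_nat_list_le: assumes "set xs \<subseteq> {..<n}" "distinct xs" shows "sz xs \<le> n * Suc n"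
proof (rule sz_list_le)
  show "length xs \<le> n" using distinct_card[OF assms(2)] card_mono[OF _ assms(1)] by simp
qed (use assms(1) in auto)

definition cliques_inv :: "bool list list \<Rightarrow> nat \<Rightarrow> nat list list \<Rightarrow> bool" where
  "cliques_inv m v L \<longleftrightarrow> distinct L \<and> (\<forall>C \<in> set L. canonical v C \<and> clique_in (edge m) (set C))"

lemma clique_step_inv:
  assumes "undirected (edge m)" "cliques_inv m v L" shows "cliques_inv m (Suc v) (clique_step m v L)"
proof -
  interpret undirected "edge m" by fact
  have "clique_in (edge m) (set (v # filter (edge m v) C))" if "clique_in (edge m) (set C)" for C
    using that sym by (auto simp: clique_in_def)
  then show ?thesis using assms(2)
    by (auto simp: cliques_inv_def clique_step_def canonical_Suc intro: canonical_extend)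
qed

text \<open>For a maximal clique \<open>X\<close> containing \<open>v\<close>, extend
  \<open>X - {v}\<close> to a maximal clique \<open>C\<close> of the earlier vertices. Maximality of
  \<open>X\<close> forces it to be \<open>v\<close> together with all neighbours of \<open>v\<close>
  in \<open>C\<close>.\<close>

lemma clique_step_complete:
  assumes "undirected (edge m)" and inv: "cliques_inv m v L"
    and L: "set ` set L = maximal_cliques (edge m) {..<v}"
  shows "set ` set (clique_step m v L) = maximal_cliques (edge m) {..<Suc v}"
proof -
  interpret undirected "edge m" by fact
  let ?max = "\<lambda>C. \<forall>u \<in> {..<Suc v}. u \<in> C \<or> (\<exists>c \<in> C. \<not> edge m u c)"
  have max: "maximal_cliques (edge m) {..<Suc v} = {C. C \<subseteq> {..<Suc v} \<and> clique_in (edge m) C \<and> ?max C}"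
    by (auto simp: maximal_cliques_def)
  have inv': "cliques_inv m (Suc v) (clique_step m v L)" by (rule clique_step_inv[OF assms(1) inv])
  have setL: "set (clique_step m v L) = {C \<in> set L. ?max (set C)} \<union>
      {C \<in> (\<lambda>C. v # filter (edge m v) C) ` set L. ?max (set C)}"
    unfolding clique_step_def by (simp add: lessThan_atLeast0 del: upt_Suc)
  show ?thesis
  proof
    show "set ` set (clique_step m v L) \<subseteq> maximal_cliques (edge m) {..<Suc v}"
    proof safe
      fix C assume C: "C \<in> set (clique_step m v L)"
      then have "set C \<subseteq> {..<Suc v}" "clique_in (edge m) (set C)"
        using inv' canonical_subset by (auto simp: cliques_inv_def)
      moreover have "?max (set C)" using C unfolding setL by blast
      ultimately show "set C \<in> maximal_cliques (edge m) {..<Suc v}" unfolding max by blast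
    qed
    show "maximal_cliques (edge m) {..<Suc v} \<subseteq> set ` set (clique_step m v L)"
    proof
      fix X assume "X \<in> maximal_cliques (edge m) {..<Suc v}"
      then have X: "X \<subseteq> {..<Suc v}" "clique_in (edge m) X" "?max X" unfolding max by auto
      show "X \<in> set ` set (clique_step m v L)"
      proof (cases "v \<in> X")
        case False
        then have "X \<subseteq> {..<v}" using X(1) less_Suc_eq by auto
        then have "X \<in> maximal_cliques (edge m) {..<v}" using X by (auto simp: maximal_cliques_def)
        then obtain C where "C \<in> set L" "X = set C" using L by auto
        then show ?thesis using X(3) unfolding setL by blast
      next
        case True
        define Y where "Y = X - {v}"
        have Y: "Y \<subseteq> {..<v}" "clique_in (edge m) Y" "\<And>y. y \<in> Y \<Longrightarrow> edge m v y" "X = insert v Y"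
          using X True less_Suc_eq by (auto simp: Y_def clique_in_def)
        define S where "S = {C. C \<subseteq> {..<v} \<and> clique_in (edge m) C \<and> Y \<subseteq> C}"
        have "finite S" unfolding S_def by (rule finite_subset[of _ "Pow {..<v}"]) auto
        moreover have "Y \<in> S" using Y by (simp add: S_def)
        ultimately obtain C where C: "C \<in> S" "Y \<subseteq> C" "\<And>D. D \<in> S \<Longrightarrow> C \<subseteq> D \<Longrightarrow> C = D"
          using finite_has_maximal2[of S Y] by auto
        have "C \<in> maximal_cliques (edge m) {..<v}"
        proof -
          have "\<exists>c \<in> C. \<not> edge m u c" if u: "u \<in> {..<v} - C" for u
          proof (rule ccontr)
            assume "\<not> (\<exists>c \<in> C. \<not> edge m u c)"
            then have "insert u C \<in> S" using C(1) u sym by (auto simp: S_def clique_in_def)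
            then show False using C(3)[of "insert u C"] u by auto
          qed
          then show ?thesis using C(1) by (auto simp: S_def maximal_cliques_def)
        qed
        then obtain L0 where L0: "L0 \<in> set L" "C = set L0" using L by auto
        have "X = set (v # filter (edge m v) L0)"
        proof
          show "X \<subseteq> set (v # filter (edge m v) L0)" using Y L0 C(2) by auto
          show "set (v # filter (edge m v) L0) \<subseteq> X"
          proof
            fix u assume u: "u \<in> set (v # filter (edge m v) L0)"
            show "u \<in> X"
            proof (rule ccontr)
              assume "u \<notin> X"
              then have uu: "u \<in> C" "edge m v u" "u \<noteq> v" using u L0 True by auto
              then have "u \<in> {..<Suc v}" using C(1) by (auto simp: S_def)
              then obtain c where c: "c \<in> X" "\<not> edge m u c" using X(3) \<open>u \<notin> X\<close> by blast
              have "c \<noteq> v" using c uu sym by auto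
              then have "c \<in> C" using c Y C(2) by auto
              moreover have "c \<noteq> u" using c \<open>u \<notin> X\<close> by auto
              ultimately have "edge m u c" using C(1) uu by (auto simp: S_def clique_in_def)
              then show False using c by simp
            qed
          qed
        qed
        then show ?thesis using X(3) L0(1) unfolding setL by blast
      qed
    qed
  qed
qed

text \<open>A clipped round continues with the empty list, which is sound, so soundness survives
  clipping.\<close>

lemma cliques_sound:
  assumes "undirected (edge m)" "C \<in> set (cliques p m)"
  shows "clique_in (edge m) (set C)" "canonical (length m) C"
proof -
  have "cliques_inv m v (fold (\<lambda>v L. clip p [] (clique_step m v L)) [0..<v] [[]])" for v
  proof (induction v)
    case 0
    show ?case by (simp add: cliques_inv_def canonical_def clique_in_def)
  next
    case (Suc v)
    then show ?case using clique_step_inv[OF assms(1) Suc] by (auto simp: clip_def cliques_inv_def)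
  qed
  then have "cliques_inv m (length m) (cliques p m)" by (simp add: cliques_def)
  then show "clique_in (edge m) (set C)" "canonical (length m) C"
    using assms(2) by (auto simp: cliques_inv_def)
qed

text \<open>Keeping only maximal cliques after each vertex is what bounds the intermediate lists: an
  initial segment of the vertices inherits the deletion set, so the counting bound applies to it and
  the clipping never takes effect.\<close>

lemma cliques_complete:
  assumes und: "undirected (edge m)" and p: "2 ^ k * (length m + 2) ^ 3 \<le> p"
    and M: "M \<subseteq> {..<length m}" "card M \<le> k" and chord: "chordal_on (edge m) ({..<length m} - M)"
    and K: "K \<subseteq> {..<length m}" "clique_in (edge m) K"
  shows "\<exists>C \<in> set (cliques p m). K \<subseteq> set C"
proof -
  interpret undirected "edge m" by fact
  let ?n = "length m"
  have "v \<le> ?n \<Longrightarrow> cliques_inv m v (fold (\<lambda>v L. clip p [] (clique_step m v L)) [0..<v] [[]]) \<and>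
      set ` set (fold (\<lambda>v L. clip p [] (clique_step m v L)) [0..<v] [[]]) = maximal_cliques (edge m) {..<v}" for v
  proof (induction v)
    case 0
    have "maximal_cliques (edge m) {..<0} = {{}}" by (auto simp: maximal_cliques_def clique_in_def)
    then show ?case by (simp add: cliques_inv_def canonical_def clique_in_def)
  next
    case (Suc v)
    let ?L = "fold (\<lambda>v L. clip p [] (clique_step m v L)) [0..<v] [[]]"
    let ?L' = "clique_step m v ?L"
    have L: "cliques_inv m v ?L" "set ` set ?L = maximal_cliques (edge m) {..<v}" using Suc by auto
    have inv: "cliques_inv m (Suc v) ?L'" by (rule clique_step_inv[OF und L(1)])
    have max: "set ` set ?L' = maximal_cliques (edge m) {..<Suc v}"
      by (rule clique_step_complete[OF und L])
    have "length ?L' = card (set ` set ?L')"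
    proof -
      have "inj_on set (set ?L')" using inv canonical_inj by (auto simp: inj_on_def cliques_inv_def)
      then have "card (set ` set ?L') = card (set ?L')" by (rule card_image)
      then show ?thesis using inv by (simp add: cliques_inv_def distinct_card)
    qed
    also have "\<dots> \<le> 2 ^ k * Suc (card {..<Suc v})" unfolding max
    proof (rule card_maximal_cliques(2)[of _ "M \<inter> {..<Suc v}"])
      have "card (M \<inter> {..<Suc v}) \<le> card M" using M(1) by (intro card_mono) (auto intro: finite_subset)
      then show "card (M \<inter> {..<Suc v}) \<le> k" using M(2) by simp
      show "chordal_on (edge m) ({..<Suc v} - M \<inter> {..<Suc v})"
        by (rule chordal_on_subset[OF chord]) (use Suc.prems in auto)
    qed auto
    also have "\<dots> \<le> 2 ^ k * Suc ?n" using Suc.prems by (intro mult_le_mono2) simp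
    finally have len: "length ?L' \<le> 2 ^ k * Suc ?n" .
    have "sz ?L' \<le> 2 ^ k * Suc ?n * Suc (?n * Suc ?n)"
    proof (rule sz_list_le[OF _ len])
      fix C assume "C \<in> set ?L'"
      then have "canonical (Suc v) C" using inv by (simp add: cliques_inv_def)
      then show "sz C \<le> ?n * Suc ?n"
        using canonical_subset[of "Suc v" C] canonical_distinct[of "Suc v" C] Suc.prems
        by (intro sz_nat_list_le) auto
    qed
    also have "\<dots> \<le> 2 ^ k * (?n + 2) ^ 3"
    proof -
      have "Suc ?n * Suc (?n * Suc ?n) \<le> (?n + 2) ^ 3" by (simp add: power3_eq_cube algebra_simps)
      then show ?thesis unfolding mult.assoc by (rule mult_le_mono2)
    qed
    finally have "clip p [] ?L' = ?L'" using p by (intro clip_id) simp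
    then show ?case using inv max by simp
  qed
  then have max: "set ` set (cliques p m) = maximal_cliques (edge m) {..<?n}" by (simp add: cliques_def)
  define S where "S = {C. C \<subseteq> {..<?n} \<and> clique_in (edge m) C \<and> K \<subseteq> C}"
  have "finite S" unfolding S_def by (rule finite_subset[of _ "Pow {..<?n}"]) auto
  moreover have "K \<in> S" using K by (simp add: S_def)
  ultimately obtain C where C: "C \<in> S" "K \<subseteq> C" "\<And>D. D \<in> S \<Longrightarrow> C \<subseteq> D \<Longrightarrow> C = D"
    using finite_has_maximal2[of S K] by auto
  have "\<exists>c \<in> C. \<not> edge m u c" if u: "u \<in> {..<?n} - C" for u
  proof (rule ccontr)
    assume "\<not> (\<exists>c \<in> C. \<not> edge m u c)"
    then have "insert u C \<in> S" using C(1) u sym by (auto simp: S_def clique_in_def)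
    then show False using C(3)[of "insert u C"] u by auto
  qed
  then have "C \<in> maximal_cliques (edge m) {..<?n}" using C(1) by (auto simp: S_def maximal_cliques_def)
  then have "C \<in> set ` set (cliques p m)" using max by simp
  then show ?thesis using C(2) by blast
qed

section \<open>Components by iterated neighbourhoods, and splittings of a set\<close>

definition reach :: "bool list list \<Rightarrow> nat list \<Rightarrow> nat \<Rightarrow> nat list" where
  "reach m U v = fold (\<lambda>_ R. filter (\<lambda>u. u \<in> set R \<or> (\<exists>w \<in> set R. edge m w u)) U) U [v]"

text \<open>Reached vertices are listed in the order of \<open>U\<close>, so all start vertices in
  one component produce the same list.\<close>

definition comps :: "bool list list \<Rightarrow> nat list \<Rightarrow> nat list list" where
  "comps m U = remdups (map (\<lambda>v. reach m U v) U)"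

lemma ptime_comps [pt]:
  assumes "ptime m" "ptime U" shows "ptime (\<lambda>x. comps (m x) (U x))"
proof -
  have reach: "ptime (\<lambda>x. reach (m x) (U x) (v x))" if m: "ptime m" and U: "ptime U" and v: "ptime v"
    for m :: "'y::enc \<Rightarrow> _" and U v
    unfolding reach_def
  proof (rule ptime_fold)
    show "pbounded sz (\<lambda>x. sz (U x) + sz [v x])"
      by (intro pbounded_intros feasible_pbounded pt U v)
    have *: "sz (fold (\<lambda>_ R. filter (\<lambda>u. u \<in> set R \<or> (\<exists>w \<in> set R. edge m w u)) U) xs ys) \<le> sz U + sz ys"
      for m :: "bool list list" and U xs ys :: "nat list"
      by (cases xs rule: rev_cases) (auto intro: trans_le_add1 sz_filter_le)
    show "sz (fold (\<lambda>_ R. filter (\<lambda>u. u \<in> set R \<or> (\<exists>w \<in> set R. edge (m x) w u)) (U x)) (take i (U x)) [v x])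
      \<le> sz (U x) + sz [v x]" for x i by (rule *)
  qed (intro pt that that[THEN feasible_compose])+
  show ?thesis unfolding comps_def by (intro pt reach assms assms[THEN feasible_compose])
qed

lemma reach_eq:
  assumes v: "v \<in> set U"
  shows "reach m U v = filter (\<lambda>u. u \<in> component (edge m) (set U) v) U"
proof -
  let ?f = "\<lambda>R. filter (\<lambda>u. u \<in> set R \<or> (\<exists>w \<in> set R. edge m w u)) U"
  let ?C = "component (edge m) (set U) v"
  define R where "R i = (?f ^^ i) [v]" for i
  have R_Suc: "R (Suc i) = ?f (R i)" for i by (simp add: R_def)
  have fold: "fold (\<lambda>_. f) xs ys = (f ^^ length xs) ys" for f and xs ys :: "nat list"
    by (induction xs arbitrary: ys) (simp_all add: funpow_swap1)
  have reach: "reach m U v = R (length U)" unfolding reach_def R_def by (rule fold)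
  have sub: "set (R i) \<subseteq> ?C \<and> v \<in> set (R i)" for i
  proof (induction i)
    case 0
    show ?case using component_self by (simp add: R_def)
  next
    case (Suc i)
    then show ?case unfolding R_Suc using v by (auto intro: component_closed)
  qed
  have RU: "set (R i) \<subseteq> set U" for i using sub component_subset[OF v] by blast
  \<comment> \<open>Each round adds a vertex or changes nothing from then on, so
    \<open>length U\<close> rounds reach the whole component.\<close>
  have prog: "set (R (Suc i)) = set (R i) \<or> Suc i \<le> card (set (R i))" for i
  proof (induction i)
    case 0
    show ?case by (simp add: R_def)
  next
    case (Suc i)
    have mono: "set (R i) \<subseteq> set (R (Suc i))" using RU[of i] unfolding R_Suc by auto
    show ?case
    proof (cases "set (R (Suc i)) = set (R i)")
      case True
      then have "R (Suc (Suc i)) = R (Suc i)" unfolding R_Suc[of "Suc i"] R_Suc[of i] True by simp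
      then show ?thesis by simp
    next
      case False
      then have "card (set (R i)) < card (set (R (Suc i)))" using mono by (intro psubset_card_mono) auto
      then show ?thesis using Suc False by simp
    qed
  qed
  let ?N = "length U"
  have "set (R (Suc ?N)) = set (R ?N)"
  proof -
    have "card (set (R ?N)) \<le> card (set U)" using RU by (intro card_mono) auto
    also have "\<dots> \<le> ?N" by (rule card_length)
    finally show ?thesis using prog[of ?N] by auto
  qed
  then have closed: "w \<in> set (R ?N)" if "u \<in> set (R ?N)" "w \<in> set U" "edge m u w" for u w
    using that unfolding R_Suc by auto
  have "?C \<subseteq> set (R ?N)"
    by (rule component_least) (use sub closed in auto)
  then have set: "set (R ?N) = ?C" using sub by blast
  obtain N' where N': "?N = Suc N'" using v by (cases U) auto
  have "R ?N = filter (\<lambda>u. u \<in> set (R ?N)) U" unfolding N' R_Suc by (rule filter_cong) auto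
  then show ?thesis unfolding reach set by simp
qed

lemma comps_mem:
  "D \<in> set (comps m U) \<longleftrightarrow> (\<exists>v \<in> set U. D = filter (\<lambda>u. u \<in> component (edge m) (set U) v) U)"
  by (auto simp: comps_def reach_eq)

lemma set_filter_component:
  "v \<in> set U \<Longrightarrow> set (filter (\<lambda>u. u \<in> component (edge m) (set U) v) U) = component (edge m) (set U) v"
  using component_subset[of v "set U" "edge m"] by auto

lemma comps_partition:
  assumes "undirected (edge m)" and U: "distinct U"
  shows "distinct (concat (comps m U))" "set (concat (comps m U)) = set U"
    "[] \<notin> set (comps m U)"
proof -
  interpret undirected "edge m" by fact
  have set: "set D = component (edge m) (set U) v" if D: "D \<in> set (comps m U)" and v: "v \<in> set D" for D v
  proof -
    obtain w where w: "w \<in> set U" "D = filter (\<lambda>u. u \<in> component (edge m) (set U) w) U"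
      using D unfolding comps_mem by blast
    then have "set D = component (edge m) (set U) w" using set_filter_component by simp
    then show ?thesis using component_eq[of v "set U" w] v by simp
  qed
  show "[] \<notin> set (comps m U)"
  proof
    assume "[] \<in> set (comps m U)"
    then obtain w where "w \<in> set U" "[] = filter (\<lambda>u. u \<in> component (edge m) (set U) w) U"
      unfolding comps_mem by blast
    then have "component (edge m) (set U) w = {}" using set_filter_component by (metis list.set(1))
    then show False using component_self by fast
  qed
  show "set (concat (comps m U)) = set U"
  proof
    show "set (concat (comps m U)) \<subseteq> set U" by (auto simp: comps_mem)
    show "set U \<subseteq> set (concat (comps m U))"
    proof
      fix x assume "x \<in> set U"
      then have "filter (\<lambda>u. u \<in> component (edge m) (set U) x) U \<in> set (comps m U)"
        "x \<in> set (filter (\<lambda>u. u \<in> component (edge m) (set U) x) U)"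
        using component_self[of x "edge m" "set U"] unfolding comps_mem by auto
      then show "x \<in> set (concat (comps m U))" unfolding set_concat by blast
    qed
  qed
  show "distinct (concat (comps m U))"
  proof (rule distinct_concat)
    show "distinct (comps m U)" by (simp add: comps_def)
    show "distinct D" if "D \<in> set (comps m U)" for D using that U by (auto simp: comps_mem)
    show "set D \<inter> set D' = {}" if D: "D \<in> set (comps m U)" "D' \<in> set (comps m U)" "D \<noteq> D'" for D D'
    proof (rule ccontr)
      assume "set D \<inter> set D' \<noteq> {}"
      then obtain v where "v \<in> set D" "v \<in> set D'" by blast
      then have "set D = set D'" using set D by blast
      moreover have "D = filter (\<lambda>u. u \<in> set D) U" if "D \<in> set (comps m U)" for D
        using that set_filter_component by (auto simp: comps_mem cong: filter_cong)
      ultimately show False using D by metis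
    qed
  qed
qed

definition splits :: "nat \<Rightarrow> nat list \<Rightarrow> (nat list \<times> nat list) list" where
  "splits p Q = fold (\<lambda>q acc. clip p []
     (concat (map (\<lambda>s. [s, (q # fst s, snd s), (fst s, q # snd s)]) acc))) Q [([], [])]"

lemma ptime_splits [pt]:
  assumes "ptime p" "ptime Q" shows "ptime (\<lambda>x. splits (p x) (Q x))"
  unfolding splits_def by (intro pt assms)

text \<open>Each element goes to the first part, to the second or to neither. This gives
  \<open>3 ^ i\<close> pairs after \<open>i\<close> elements, each of quadratic size.\<close>

lemma splits_complete:
  assumes Q: "distinct Q" "set Q \<subseteq> {..<n}" and p: "3 ^ length Q * (2 * (n + 2) ^ 2) \<le> p"
    and Q12: "Q1 \<subseteq> set Q" "Q2 \<subseteq> set Q" "Q1 \<inter> Q2 = {}"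
  shows "\<exists>s \<in> set (splits p Q). set (fst s) = Q1 \<and> set (snd s) = Q2"
proof -
  let ?f = "\<lambda>q acc. clip p [] (concat (map (\<lambda>s. [s, (q # fst s, snd s), (fst s, q # snd s)]) acc))"
  let ?S = "\<lambda>i. fold ?f (take i Q) [([], [])]"
  have "length (?S i) = 3 ^ i \<and>
    (\<forall>s \<in> set (?S i). distinct (fst s) \<and> distinct (snd s) \<and> set (fst s) \<subseteq> set (take i Q) \<and> set (snd s) \<subseteq> set (take i Q)) \<and>
    (\<forall>X Y. X \<subseteq> set (take i Q) \<longrightarrow> Y \<subseteq> set (take i Q) \<longrightarrow> X \<inter> Y = {} \<longrightarrow>
       (\<exists>s \<in> set (?S i). set (fst s) = X \<and> set (snd s) = Y))" if "i \<le> length Q" for i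
    using that
  proof (induction i)
    case (Suc i)
    let ?q = "Q ! i"
    let ?T = "concat (map (\<lambda>s. [s, (?q # fst s, snd s), (fst s, ?q # snd s)]) (?S i))"
    have take: "take (Suc i) Q = take i Q @ [?q]" using Suc.prems by (simp add: take_Suc_conv_app_nth)
    have qn: "?q \<notin> set (take i Q)"
      using distinct_take[OF Q(1), of "Suc i"] unfolding take by simp
    have IH: "length (?S i) = 3 ^ i"
      "\<And>s. s \<in> set (?S i) \<Longrightarrow> distinct (fst s) \<and> distinct (snd s) \<and> set (fst s) \<subseteq> set (take i Q) \<and> set (snd s) \<subseteq> set (take i Q)"
      "\<And>X Y. X \<subseteq> set (take i Q) \<Longrightarrow> Y \<subseteq> set (take i Q) \<Longrightarrow> X \<inter> Y = {} \<Longrightarrow>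
       \<exists>s \<in> set (?S i). set (fst s) = X \<and> set (snd s) = Y"
      using Suc by auto
    have len: "length ?T = 3 ^ Suc i"
    proof -
      have "length (concat (map (\<lambda>s. [s, (?q # fst s, snd s), (fst s, ?q # snd s)]) xs)) = 3 * length xs"
        for xs :: "(nat list \<times> nat list) list" by (induction xs) auto
      then show ?thesis using IH(1) by simp
    qed
    have el: "distinct (fst s) \<and> distinct (snd s) \<and> set (fst s) \<subseteq> set (take (Suc i) Q) \<and> set (snd s) \<subseteq> set (take (Suc i) Q)"
      if "s \<in> set ?T" for s
      using that IH(2) qn unfolding take by fastforce
    have "sz ?T \<le> 3 ^ Suc i * Suc (Suc (n * Suc n + n * Suc n))"
    proof (rule sz_list_le)
      fix s assume "s \<in> set ?T"
      then have s: "distinct (fst s)" "distinct (snd s)" "set (fst s) \<subseteq> {..<n}" "set (snd s) \<subseteq> {..<n}"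
        using el[of s] Q(2) set_take_subset[of "Suc i" Q] by auto
      show "sz s \<le> Suc (n * Suc n + n * Suc n)"
        unfolding sz_prod using sz_nat_list_le[OF s(3,1)] sz_nat_list_le[OF s(4,2)] by simp
    qed (simp add: len)
    also have "\<dots> \<le> 3 ^ length Q * (2 * (n + 2) ^ 2)"
      using Suc.prems by (intro mult_le_mono power_increasing) (auto simp: power2_eq_square)
    finally have T: "?S (Suc i) = ?T"
      unfolding take using p by (simp add: clip_id)
    have "\<exists>s \<in> set ?T. set (fst s) = X \<and> set (snd s) = Y"
      if XY: "X \<subseteq> set (take (Suc i) Q)" "Y \<subseteq> set (take (Suc i) Q)" "X \<inter> Y = {}" for X Y
    proof -
      have "X - {?q} \<subseteq> set (take i Q)" "Y - {?q} \<subseteq> set (take i Q)" "(X - {?q}) \<inter> (Y - {?q}) = {}"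
        using XY unfolding take by auto
      from IH(3)[OF this] obtain s where s: "s \<in> set (?S i)" "set (fst s) = X - {?q}" "set (snd s) = Y - {?q}"
        by blast
      consider "?q \<in> X" | "?q \<in> Y" | "?q \<notin> X" "?q \<notin> Y" by blast
      then show ?thesis
      proof cases
        case 1
        then have "?q \<notin> Y" using XY by auto
        then show ?thesis using 1 s by (intro bexI[of _ "(?q # fst s, snd s)"]) auto
      next
        case 2
        then have "?q \<notin> X" using XY by auto
        then show ?thesis using 2 s by (intro bexI[of _ "(fst s, ?q # snd s)"]) auto
      next
        case 3
        then show ?thesis using s by (intro bexI[of _ s]) auto
      qed
    qed
    then show ?case unfolding T using len el by blast
  qed simp
  from this[of "length Q"] show ?thesis using Q12 unfolding splits_def by simp
qed

section \<open>Decomposition along cliques plus few vertices\<close>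

text \<open>A task \<open>(C, K1, K2, Q)\<close> asks to order the vertex set \<open>C\<close>, whose outer neighbourhood is covered
  by the cliques \<open>K1\<close>, \<open>K2\<close> and the small set \<open>Q\<close>. If there is only one clique, \<open>Q\<close> may be larger.\<close>

type_synonym task = "nat list \<times> nat list \<times> nat list \<times> nat list"

text \<open>With a single boundary clique, it may remain next to the new one, and only
  \<open>Q\<close> must be balanced. With two of them, a child may keep at most one, so the cliques
  themselves have to be separated.\<close>

definition terminals :: "nat list \<Rightarrow> nat list \<Rightarrow> nat list \<Rightarrow> nat list" where
  "terminals K2 K Q = (if K2 = [] then Q else K @ Q)"

text \<open>Each of the two cuts parts one group of terminals from all other terminals; the third
  group is what lies behind neither cut.\<close>

definition separator ::
  "nat \<Rightarrow> bool list list \<Rightarrow> nat list \<Rightarrow> nat list \<Rightarrow> nat list \<Rightarrow> nat list \<Rightarrow> nat list \<Rightarrow> nat list \<Rightarrow> nat list \<Rightarrow> nat list" where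
  "separator p m C K1 K2 Q K Q1 Q2 =
     min_cut p m (filter (\<lambda>v. v \<notin> set K) (C @ K1 @ K2 @ Q)) (terminals K2 K1 Q1)
       (filter (\<lambda>v. v \<notin> set (terminals K2 K1 Q1)) (terminals K2 (K1 @ K2) Q)) @
     min_cut p m (filter (\<lambda>v. v \<notin> set K) (C @ K1 @ K2 @ Q)) (terminals K2 K2 Q2)
       (filter (\<lambda>v. v \<notin> set (terminals K2 K2 Q2)) (terminals K2 (K1 @ K2) Q))"

text \<open>The first vertex of \<open>C\<close> is added so that every task outputs at least one
  vertex; this bounds the number of rounds by the number of vertices.\<close>

definition bag_part :: "nat list \<Rightarrow> nat list \<Rightarrow> nat list \<Rightarrow> nat list" where
  "bag_part C K Z = filter (\<lambda>v. v \<in> set K \<or> v \<in> set Z \<or> (case C of [] \<Rightarrow> False | c # cs \<Rightarrow> v = c)) C"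

definition neighbours :: "bool list list \<Rightarrow> nat list \<Rightarrow> nat list \<Rightarrow> nat list" where
  "neighbours m D W = filter (\<lambda>u. \<exists>d \<in> set D. edge m d u) W"

definition old_clique :: "nat list \<Rightarrow> nat list \<Rightarrow> nat list \<Rightarrow> nat list \<Rightarrow> nat list \<Rightarrow> nat list" where
  "old_clique K1 K2 K Z N = filter (\<lambda>u. (u \<in> set K1 \<or> u \<in> set K2) \<and> u \<notin> set K \<and> u \<notin> set Z) N"

definition child :: "bool list list \<Rightarrow> nat list \<Rightarrow> nat list \<Rightarrow> nat list \<Rightarrow> nat list \<Rightarrow> nat list \<Rightarrow> nat list \<Rightarrow> nat list \<Rightarrow> task" where
  "child m K1 K2 Q K Z Y D =
     (D, filter (\<lambda>u. u \<in> set K) (neighbours m D (K1 @ K2 @ Q @ Y)),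
      old_clique K1 K2 K Z (neighbours m D (K1 @ K2 @ Q @ Y)),
      filter (\<lambda>u. u \<notin> set K \<and> u \<notin> set (old_clique K1 K2 K Z (neighbours m D (K1 @ K2 @ Q @ Y))))
        (neighbours m D (K1 @ K2 @ Q @ Y)))"

text \<open>A separator adds at most \<open>2 k\<close> vertices to \<open>Q\<close>, and at most \<open>k\<close> vertices of \<open>Q\<close> belong to a chordal
  deletion set and escape the balancing; hence the unit \<open>3 k + 1\<close>.\<close>

definition q_limit :: "nat \<Rightarrow> nat list \<Rightarrow> nat" where
  "q_limit k K2 = (if K2 = [] then 4 * (3 * k + 1) else 3 * (3 * k + 1))"

definition child_ok :: "nat \<Rightarrow> nat list \<Rightarrow> nat list \<Rightarrow> task \<Rightarrow> bool" where
  "child_ok k K1 K2 t \<longleftrightarrow>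
     ((\<forall>u \<in> set (fst (snd (snd t))). u \<notin> set K1) \<or> (\<forall>u \<in> set (fst (snd (snd t))). u \<notin> set K2)) \<and>
     length (snd (snd (snd t))) \<le> q_limit k (fst (snd (snd t)))"

definition attempt ::
  "nat \<Rightarrow> bool list list \<Rightarrow> task \<Rightarrow> nat list \<times> nat list \<times> nat list \<Rightarrow> nat list \<times> nat list \<times> nat list" where
  "attempt p m t c = (\<lambda>Z. (fst c, Z, bag_part (fst t) (fst c) Z))
     (separator p m (fst t) (fst (snd t)) (fst (snd (snd t))) (snd (snd (snd t)))
        (fst c) (fst (snd c)) (snd (snd c)))"

definition children :: "bool list list \<Rightarrow> task \<Rightarrow> nat list \<times> nat list \<times> nat list \<Rightarrow> task list" where
  "children m t a = map (child m (fst (snd t)) (fst (snd (snd t))) (snd (snd (snd t))) (fst a) (fst (snd a)) (snd (snd a)))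
     (comps m (filter (\<lambda>v. v \<notin> set (snd (snd a))) (fst t)))"

text \<open>The conditions are tested instead of deduced. Thus any accepted attempt keeps the
  invariant of the order, and a deletion set is needed only to show that some attempt is
  accepted.\<close>

definition acceptable :: "nat \<Rightarrow> bool list list \<Rightarrow> task \<Rightarrow> nat list \<times> nat list \<times> nat list \<Rightarrow> bool" where
  "acceptable k m t a \<longleftrightarrow> length (fst (snd a)) \<le> 2 * k \<and>
     (\<forall>ch \<in> set (children m t a). child_ok k (fst (snd t)) (fst (snd (snd t))) ch)"

definition attempts ::
  "nat \<Rightarrow> bool list list \<Rightarrow> nat list list \<Rightarrow> task \<Rightarrow> (nat list \<times> nat list \<times> nat list) list" where
  "attempts p m clq t = map (attempt p m t) (concat (map (\<lambda>K. map (Pair K) (splits p (snd (snd (snd t))))) clq))"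

definition order_step ::
  "nat \<Rightarrow> bool list list \<Rightarrow> nat \<Rightarrow> nat list list \<Rightarrow> (task list \<times> nat list) option \<Rightarrow> (task list \<times> nat list) option" where
  "order_step p m k clq st = (case st of None \<Rightarrow> None | Some s \<Rightarrow>
     (case fst s of [] \<Rightarrow> Some s | t # ts \<Rightarrow>
       (case filter (acceptable k m t) (attempts p m clq t) of [] \<Rightarrow> None
        | a # as \<Rightarrow> Some (children m t a @ ts, snd s @ snd (snd a)))))"

text \<open>The fold runs one round per vertex, as many as there can be tasks. The empty graph
  starts without a task because tasks have nonempty vertex sets.\<close>

definition elimination_order :: "nat \<Rightarrow> bool list list \<Rightarrow> nat \<Rightarrow> nat list option" where
  "elimination_order p m k = (case fold (\<lambda>_ st. clip p None (order_step p m k (cliques p m) st)) [0..<length m]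
       (Some (if m = [] then [] else [([0..<length m], [], [], [])], []))
     of None \<Rightarrow> None | Some s \<Rightarrow> Some (snd s))"

lemma ptime_elimination_order [pt]:
  assumes "ptime p" "ptime m" "ptime k" shows "ptime (\<lambda>x. elimination_order (p x) (m x) (k x))"
proof -
  have terminals: "ptime (\<lambda>x. terminals (f x) (g x) (h x))" if "ptime f" "ptime g" "ptime h"
    for f g h :: "'y::enc \<Rightarrow> _"
    unfolding terminals_def by (intro pt that)
  have separator: "ptime (\<lambda>x. separator (p x) (m x) (a x) (b x) (c x) (d x) (e x) (f x) (g x))"
    if "ptime p" "ptime m" "ptime a" "ptime b" "ptime c" "ptime d" "ptime e" "ptime f" "ptime g"
    for p and m :: "'y::enc \<Rightarrow> _" and a b c d e f g
    unfolding separator_def by (intro pt terminals that that[THEN feasible_compose])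
  have bag: "ptime (\<lambda>x. bag_part (f x) (g x) (h x))" if "ptime f" "ptime g" "ptime h"
    for f g h :: "'y::enc \<Rightarrow> _"
    unfolding bag_part_def by (intro pt that that[THEN feasible_compose])
  have nb: "ptime (\<lambda>x. neighbours (f x) (g x) (h x))" if "ptime f" "ptime g" "ptime h"
    for f :: "'y::enc \<Rightarrow> _" and g h
    unfolding neighbours_def by (intro pt that that[THEN feasible_compose])
  have old: "ptime (\<lambda>x. old_clique (a x) (b x) (c x) (d x) (e x))"
    if "ptime a" "ptime b" "ptime c" "ptime d" "ptime e" for a b c d and e :: "'y::enc \<Rightarrow> _"
    unfolding old_clique_def by (intro pt that that[THEN feasible_compose])
  have child: "ptime (\<lambda>x. child (m x) (a x) (b x) (c x) (d x) (e x) (f x) (g x))"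
    if "ptime m" "ptime a" "ptime b" "ptime c" "ptime d" "ptime e" "ptime f" "ptime g"
    for m :: "'y::enc \<Rightarrow> _" and a b c d e f g
    unfolding child_def by (intro pt nb old that that[THEN feasible_compose])
  have children: "ptime (\<lambda>x. children (m x) (t x) (a x))" if "ptime m" "ptime t" "ptime a"
    for m :: "'y::enc \<Rightarrow> _" and t a
    unfolding children_def by (intro pt child that that[THEN feasible_compose])
  have child_ok: "ptime (\<lambda>x. child_ok (k x) (a x) (b x) (t x))" if "ptime k" "ptime a" "ptime b" "ptime t"
    for k :: "'y::enc \<Rightarrow> _" and a b t
    unfolding child_ok_def q_limit_def by (intro pt that that[THEN feasible_compose])
  have acceptable: "ptime (\<lambda>x. acceptable (k x) (m x) (t x) (a x))" if "ptime k" "ptime m" "ptime t" "ptime a"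
    for k :: "'y::enc \<Rightarrow> _" and m t a
    unfolding acceptable_def by (intro pt children child_ok that that[THEN feasible_compose])
  have attempt: "ptime (\<lambda>x. attempt (p x) (m x) (t x) (c x))" if "ptime p" "ptime m" "ptime t" "ptime c"
    for p :: "'y::enc \<Rightarrow> _" and m t c
    unfolding attempt_def by (intro pt bag separator that)
  have attempts: "ptime (\<lambda>x. attempts (p x) (m x) (c x) (t x))" if "ptime p" "ptime m" "ptime c" "ptime t"
    for p :: "'y::enc \<Rightarrow> _" and m c t
    unfolding attempts_def by (intro pt attempt that that[THEN feasible_compose])
  have step: "ptime (\<lambda>x. order_step (p x) (m x) (k x) (c x) (s x))"
    if "ptime p" "ptime m" "ptime k" "ptime c" "ptime s"
    for p :: "'y::enc \<Rightarrow> _" and m k c s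
    unfolding order_step_def
    by (intro pt attempts acceptable children that that[THEN feasible_compose])
  show ?thesis unfolding elimination_order_def
    by (intro pt step assms assms[THEN feasible_compose])
qed

text \<open>The bound \<open>15 k + 5\<close> accounts for \<open>Q\<close>, the two cuts of a separator and one further vertex.\<close>

definition thin :: "bool list list \<Rightarrow> nat \<Rightarrow> nat set \<Rightarrow> bool" where
  "thin m k B \<longleftrightarrow> (\<exists>K1 K2 K3 R. clique_in (edge m) K1 \<and> clique_in (edge m) K2 \<and> clique_in (edge m) K3 \<and>
     finite R \<and> card R \<le> 15 * k + 5 \<and> B \<subseteq> K1 \<union> K2 \<union> K3 \<union> R)"

text \<open>The sets bounded here contain the scopes of the tables when the vertices are eliminated in the
  reverse order.\<close>

definition thin_order :: "bool list list \<Rightarrow> nat \<Rightarrow> nat list \<Rightarrow> bool" where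
  "thin_order m k out \<longleftrightarrow> (\<forall>i < length out. \<exists>B. thin m k B \<and>
     (\<forall>D. connected_in (edge m) D \<longrightarrow> out ! i \<in> D \<longrightarrow> D \<inter> set (take i out) = {} \<longrightarrow>
        {u \<in> set (take i out). \<exists>d \<in> D. edge m d u} \<subseteq> B))"

definition task_ok :: "bool list list \<Rightarrow> nat \<Rightarrow> nat list \<Rightarrow> task \<Rightarrow> bool" where
  "task_ok m k out = (\<lambda>(C, K1, K2, Q). C \<noteq> [] \<and> distinct (K1 @ K2 @ Q) \<and> set (K1 @ K2 @ Q) \<subseteq> set out \<and>
     (\<forall>c \<in> set C. \<forall>u. edge m c u \<longrightarrow> u \<notin> set C \<longrightarrow> u \<in> set (K1 @ K2 @ Q)) \<and>
     clique_in (edge m) (set K1) \<and> clique_in (edge m) (set K2) \<and> length Q \<le> q_limit k K2)"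

definition order_inv :: "bool list list \<Rightarrow> nat \<Rightarrow> task list \<times> nat list \<Rightarrow> bool" where
  "order_inv m k s \<longleftrightarrow> distinct (snd s @ concat (map fst (fst s))) \<and>
     set (snd s @ concat (map fst (fst s))) = {..<length m} \<and>
     (\<forall>t \<in> set (fst s). task_ok m k (snd s) t) \<and> thin_order m k (snd s)"

text \<open>For thinness, consider a connected \<open>D\<close> through a new vertex that avoids all
  earlier ones. It cannot leave \<open>C\<close>, because the outer neighbours of \<open>C\<close>
  lie in \<open>K1\<close>, \<open>K2\<close> and \<open>Q\<close> and have been output before.
  Hence its earlier neighbours lie in these three sets or in \<open>Y\<close>, and \<open>Y\<close>
  is covered by \<open>K\<close>, \<open>Z\<close> and one vertex.\<close>

lemma order_inv_step:
  assumes und: "undirected (edge m)" and inv: "order_inv m k (t # ts, out)"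
    and K: "clique_in (edge m) (set (fst a))" and Y: "snd (snd a) = bag_part (fst t) (fst a) (fst (snd a))"
    and acc: "acceptable k m t a"
  shows "order_inv m k (children m t a @ ts, out @ snd (snd a))" "snd (snd a) \<noteq> []"
proof -
  interpret undirected "edge m" by fact
  obtain C K1 K2 Q where t: "t = (C, K1, K2, Q)" by (cases t) auto
  obtain K Z Y where a: "a = (K, Z, Y)" by (cases a) auto
  have Ydef: "Y = bag_part C K Z" using Y by (simp add: a t)
  have ok: "C \<noteq> []" "distinct (K1 @ K2 @ Q)" "set (K1 @ K2 @ Q) \<subseteq> set out"
    "\<And>c u. c \<in> set C \<Longrightarrow> edge m c u \<Longrightarrow> u \<notin> set C \<Longrightarrow> u \<in> set (K1 @ K2 @ Q)"
    "clique_in (edge m) (set K1)" "clique_in (edge m) (set K2)" "length Q \<le> q_limit k K2"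
    using inv by (auto simp: order_inv_def task_ok_def t)
  have dist: "distinct (out @ C @ concat (map fst ts))" "set (out @ C @ concat (map fst ts)) = {..<length m}"
    using inv by (auto simp: order_inv_def t)
  have dC: "distinct C" using dist by simp
  obtain c0 C' where C': "C = c0 # C'" using ok(1) by (cases C) auto
  have YC: "set Y \<subseteq> set C" "distinct Y" using dC by (auto simp: Ydef bag_part_def)
  have "c0 \<in> set Y" by (simp add: Ydef bag_part_def C')
  then show "snd (snd a) \<noteq> []" by (auto simp: a)
  have YKZ: "set Y \<subseteq> set K \<union> set Z \<union> {c0}" by (auto simp: Ydef bag_part_def C')
  let ?R = "filter (\<lambda>v. v \<notin> set Y) C"
  have cs: "distinct (concat (comps m ?R))" "set (concat (comps m ?R)) = set C - set Y" "[] \<notin> set (comps m ?R)"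
    using comps_partition[OF und, of ?R] dC by auto
  have fsts: "map fst (children m t a) = comps m ?R"
    by (simp add: children_def t a child_def comp_def)
  have Zlen: "length Z \<le> 2 * k" using acc by (simp add: acceptable_def a)
  show "order_inv m k (children m t a @ ts, out @ snd (snd a))"
    unfolding order_inv_def
  proof (intro conjI)
    show "distinct (snd (children m t a @ ts, out @ snd (snd a)) @
      concat (map fst (fst (children m t a @ ts, out @ snd (snd a)))))"
      using dist(1) cs YC unfolding fst_conv snd_conv map_append fsts by (auto simp: a)
    show "set (snd (children m t a @ ts, out @ snd (snd a)) @
      concat (map fst (fst (children m t a @ ts, out @ snd (snd a))))) = {..<length m}"
      using dist(2) cs(2) YC unfolding fst_conv snd_conv map_append concat_append fsts set_append
      by (auto simp: a)
    show "\<forall>t' \<in> set (fst (children m t a @ ts, out @ snd (snd a))). task_ok m k (snd (children m t a @ ts, out @ snd (snd a))) t'"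
    proof
      fix t' assume "t' \<in> set (fst (children m t a @ ts, out @ snd (snd a)))"
      then consider "t' \<in> set ts" | "t' \<in> set (children m t a)" by auto
      then show "task_ok m k (snd (children m t a @ ts, out @ snd (snd a))) t'"
      proof cases
        case 1
        then have "task_ok m k out t'" using inv by (simp add: order_inv_def)
        then show ?thesis by (auto simp: task_ok_def)
      next
        case 2
        then obtain D where D: "D \<in> set (comps m ?R)" "t' = child m K1 K2 Q K Z Y D"
          by (auto simp: children_def t a)
        let ?N = "neighbours m D (K1 @ K2 @ Q @ Y)"
        let ?o = "old_clique K1 K2 K Z ?N"
        let ?q = "filter (\<lambda>u. u \<notin> set K \<and> u \<notin> set ?o) ?N"
        have t': "t' = (D, filter (\<lambda>u. u \<in> set K) ?N, ?o, ?q)" by (simp add: D child_def)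
        have cok: "(\<forall>u \<in> set ?o. u \<notin> set K1) \<or> (\<forall>u \<in> set ?o. u \<notin> set K2)" "length ?q \<le> q_limit k ?o"
          using acc 2 unfolding acceptable_def by (auto simp: child_ok_def t t')
        have dN: "distinct (K1 @ K2 @ Q @ Y)" using ok(2,3) YC dist(1) by auto
        have "D \<noteq> []" using D(1) cs(3) by auto
        moreover have "distinct (filter (\<lambda>u. u \<in> set K) ?N @ ?o @ ?q)"
        proof -
          have gen: "distinct (filter (\<lambda>u. u \<in> A) N @ filter P N @ filter (\<lambda>u. u \<notin> A \<and> u \<notin> set (filter P N)) N)"
            if "distinct N" "\<And>u. P u \<Longrightarrow> u \<notin> A" for A P and N :: "nat list"
            using that by auto
          have "distinct ?N" unfolding neighbours_def by (rule distinct_filter[OF dN])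
          then show ?thesis unfolding old_clique_def by (rule gen) blast
        qed
        moreover have "set (filter (\<lambda>u. u \<in> set K) ?N @ ?o @ ?q) \<subseteq> set (out @ Y)"
          using ok(3) unfolding neighbours_def old_clique_def by auto
        moreover have "u \<in> set (filter (\<lambda>u. u \<in> set K) ?N @ ?o @ ?q)"
          if d: "d \<in> set D" "edge m d u" "u \<notin> set D" for d u
        proof -
          obtain v where v: "v \<in> set ?R" "set D = component (edge m) (set ?R) v"
            using D(1) set_filter_component unfolding comps_mem by metis
          have dC: "d \<in> set C" using d(1) component_subset[OF v(1), of "edge m"] v(2) by auto
          have "u \<in> set K1 \<or> u \<in> set K2 \<or> u \<in> set Q \<or> u \<in> set Y"
          proof (cases "u \<in> set C")
            case True
            have "u \<in> set Y"
            proof (rule ccontr)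
              assume "u \<notin> set Y"
              then have "u \<in> set ?R" using True by simp
              then have "u \<in> component (edge m) (set ?R) v"
                using component_closed[of d "edge m" "set ?R" v u] d(1,2) v by simp
              then show False using d(3) v(2) by simp
            qed
            then show ?thesis by simp
          next
            case False
            then show ?thesis using ok(4)[OF dC d(2)] by auto
          qed
          then have "u \<in> set ?N" using d by (auto simp: neighbours_def)
          then show ?thesis by auto
        qed
        moreover have "clique_in (edge m) (set (filter (\<lambda>u. u \<in> set K) ?N))"
          by (rule clique_in_subset[OF K]) (auto simp: a)
        moreover have "clique_in (edge m) (set ?o)"
        proof (cases "\<forall>u \<in> set ?o. u \<notin> set K1")
          case True
          then show ?thesis by (intro clique_in_subset[OF ok(6)]) (auto simp: old_clique_def)
        next
          case False
          then have "\<forall>u \<in> set ?o. u \<notin> set K2" using cok(1) by blast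
          then show ?thesis by (intro clique_in_subset[OF ok(5)]) (auto simp: old_clique_def)
        qed
        ultimately show ?thesis using cok(2) unfolding t' task_ok_def by (auto simp: a)
      qed
    qed
    show "thin_order m k (snd (children m t a @ ts, out @ snd (snd a)))"
      unfolding thin_order_def snd_conv
    proof (intro allI impI)
      fix i assume i: "i < length (out @ snd (snd a))"
      show "\<exists>B. thin m k B \<and> (\<forall>D. connected_in (edge m) D \<longrightarrow> (out @ snd (snd a)) ! i \<in> D \<longrightarrow>
        D \<inter> set (take i (out @ snd (snd a))) = {} \<longrightarrow>
        {u \<in> set (take i (out @ snd (snd a))). \<exists>d \<in> D. edge m d u} \<subseteq> B)"
      proof (cases "i < length out")
        case True
        then show ?thesis using inv by (simp add: order_inv_def thin_order_def nth_append)
      next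
        case False
        let ?B = "set K1 \<union> set K2 \<union> set K \<union> (set Q \<union> set Z \<union> {c0})"
        have "card (set Q \<union> set Z \<union> {c0}) \<le> length Q + length Z + 1"
          by (intro order.trans[OF card_Un_le] add_mono card_length) (simp_all add: card_length)
        also have "\<dots> \<le> 15 * k + 5" using ok(7) Zlen by (simp add: q_limit_def split: if_splits)
        finally have "thin m k ?B" unfolding thin_def
          using ok(5,6) K by (intro exI[of _ "set K1"] exI[of _ "set K2"] exI[of _ "set K"]
              exI[of _ "set Q \<union> set Z \<union> {c0}"]) (simp add: a)
        moreover have "{u \<in> set (take i (out @ Y)). \<exists>d \<in> D. edge m d u} \<subseteq> ?B"
          if D: "connected_in (edge m) D" "(out @ Y) ! i \<in> D" "D \<inter> set (take i (out @ Y)) = {}" for D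
        proof -
          let ?y = "(out @ Y) ! i"
          have y: "?y \<in> set Y" using False i by (auto simp: nth_append a)
          have out: "D \<inter> set out = {}" using D(3) False by auto
          have "component (edge m) D ?y \<subseteq> set C"
          proof (rule component_least)
            show "?y \<in> set C" using y YC by auto
            fix c u assume "c \<in> set C" "u \<in> D" "edge m c u"
            then show "u \<in> set C" using ok(3) ok(4)[of c u] out by auto
          qed
          then have DC: "D \<subseteq> set C" using D(1,2) by (simp add: connected_in_def)
          show ?thesis
          proof
            fix u assume u: "u \<in> {u \<in> set (take i (out @ Y)). \<exists>d \<in> D. edge m d u}"
            then obtain d where d: "d \<in> D" "edge m d u" by blast
            have "u \<in> set out \<or> u \<in> set Y" using u False by (auto dest: in_set_takeD)
            then show "u \<in> ?B"
            proof
              assume uo: "u \<in> set out"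
              then have "u \<notin> set C" using dist(1) by auto
              then show ?thesis using ok(4)[of d u] d DC by auto
            next
              assume "u \<in> set Y"
              then show ?thesis using YKZ by auto
            qed
          qed
        qed
        ultimately show ?thesis by (auto simp: a)
      qed
    qed
  qed
qed

text \<open>The tasks have disjoint nonempty vertex sets, so there are at most
  \<open>length m\<close> of them, each of quadratic size.\<close>

lemma sz_order_state:
  assumes inv: "order_inv m k s" shows "sz (Some s) \<le> 16 * (length m + 2) ^ 3"
proof -
  let ?n = "length m"
  obtain ts out where s: "s = (ts, out)" by force
  have d: "distinct (out @ concat (map fst ts))" "set (out @ concat (map fst ts)) = {..<?n}"
    using inv by (auto simp: order_inv_def s)
  have len: "length (out @ concat (map fst ts)) = ?n"
    using distinct_card[OF d(1)] unfolding d(2) by simp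
  have ne: "fst t \<noteq> []" if "t \<in> set ts" for t using inv that by (auto simp: order_inv_def s task_ok_def)
  then have "length ts \<le> length (concat (map fst ts))"
  proof (induction ts)
    case (Cons t ts)
    then have "fst t \<noteq> []" by simp
    then show ?case using Cons by (cases "fst t") auto
  qed simp
  then have lts: "length ts \<le> ?n" using len by simp
  have out: "sz out \<le> ?n * Suc ?n" using d by (intro sz_nat_list_le) auto
  have task: "sz t \<le> 4 * (?n * Suc ?n) + 3" if t: "t \<in> set ts" for t
  proof -
    obtain C K1 K2 Q where tt: "t = (C, K1, K2, Q)" by (cases t) auto
    have ok: "distinct (K1 @ K2 @ Q)" "set (K1 @ K2 @ Q) \<subseteq> set out"
      using inv t by (auto simp: order_inv_def s task_ok_def tt)
    have Cin: "C \<in> set (map fst ts)" using t tt by force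
    have dc: "distinct (concat (map fst ts))" using d(1) by simp
    have "set C \<subseteq> set (concat (map fst ts))" using Cin unfolding set_concat by blast
    then have "set C \<subseteq> {..<?n}" unfolding d(2)[symmetric] by auto
    moreover have "distinct C" using Cin dc unfolding distinct_concat_iff by blast
    moreover note sz_nat_list_le
    ultimately have "sz C \<le> ?n * Suc ?n" by blast
    moreover have "sz K \<le> ?n * Suc ?n" if "K \<in> {K1, K2, Q}" for K
      by (rule sz_nat_list_le) (use that ok d(2) in auto)
    from this[of K1] this[of K2] this[of Q]
    have "sz K1 \<le> ?n * Suc ?n" "sz K2 \<le> ?n * Suc ?n" "sz Q \<le> ?n * Suc ?n" by simp_all
    ultimately show ?thesis by (simp add: tt)
  qed
  have "sz ts \<le> ?n * Suc (4 * (?n * Suc ?n) + 3)"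
    by (rule sz_list_le[OF task lts])
  then have "sz (Some s) \<le> Suc (Suc (?n * Suc (4 * (?n * Suc ?n) + 3) + ?n * Suc ?n))"
    using out by (simp add: s)
  also have "\<dots> \<le> 16 * (?n + 2) ^ 3" by (simp add: power3_eq_cube algebra_simps)
  finally show ?thesis .
qed

lemma order_step_inv:
  assumes und: "undirected (edge m)" and inv: "order_inv m k s"
    and step: "order_step p m k (cliques p m) (Some s) = Some s'"
  shows "order_inv m k s'" "fst s = [] \<and> s' = s \<or> fst s \<noteq> [] \<and> length (snd s) < length (snd s')"
proof -
  obtain ts out where s: "s = (ts, out)" by force
  have "order_inv m k s' \<and> (fst s = [] \<and> s' = s \<or> fst s \<noteq> [] \<and> length (snd s) < length (snd s'))"
  proof (cases ts)
    case Nil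
    then show ?thesis using step inv by (auto simp: s order_step_def)
  next
    case (Cons t ts')
    then obtain a as where a: "filter (acceptable k m t) (attempts p m (cliques p m) t) = a # as"
      "s' = (children m t a @ ts', out @ snd (snd a))"
      using step by (auto simp: s order_step_def split: list.splits)
    then have "a \<in> set (filter (acceptable k m t) (attempts p m (cliques p m) t))" by simp
    then have acc: "acceptable k m t a" and att: "a \<in> set (attempts p m (cliques p m) t)" by auto
    then obtain K sp where K: "K \<in> set (cliques p m)" "a = attempt p m t (K, sp)"
      by (auto simp: attempts_def)
    have "clique_in (edge m) (set (fst a))" "snd (snd a) = bag_part (fst t) (fst a) (fst (snd a))"
      using cliques_sound[OF und K(1)] by (auto simp: K(2) attempt_def)
    then show ?thesis using order_inv_step[OF und _ _ _ acc] inv by (auto simp: a(2) s Cons)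
  qed
  then show "order_inv m k s'" "fst s = [] \<and> s' = s \<or> fst s \<noteq> [] \<and> length (snd s) < length (snd s')" by auto
qed

lemma edge_less: assumes "undirected (edge m)" "edge m c u" shows "c < length m" "u < length m"
proof -
  have less: "edge m c u \<Longrightarrow> c < length m" for c u by (auto simp: edge_def nthd_def split: if_splits)
  interpret undirected "edge m" by fact
  show "c < length m" "u < length m" using less[OF assms(2)] less[OF sym[OF assms(2)]] by auto
qed

lemma order_inv_init:
  assumes "undirected (edge m)"
  shows "order_inv m k (if m = [] then [] else [([0..<length m], [], [], [])], [])"
  using edge_less[OF assms]
  by (auto simp: order_inv_def task_ok_def thin_order_def q_limit_def clique_in_def)

text \<open>Clipping yields \<open>None\<close>, which persists; so a returned order comes from
  rounds that were all accepted. Every round with a task outputs a vertex, hence no task is left at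
  the end.\<close>

theorem elimination_order_thin:
  assumes und: "undirected (edge m)" and p: "16 * (length m + 2) ^ 3 \<le> p"
    and ord: "elimination_order p m k = Some out"
  shows "thin_order m k out" "distinct out" "set out = {..<length m}"
proof -
  let ?f = "\<lambda>_ st. clip p None (order_step p m k (cliques p m) st)"
  let ?init = "(if m = [] then [] else [([0..<length m], [], [], [])], [])"
  let ?S = "\<lambda>i. fold ?f [0..<i] (Some ?init)"
  have S: "order_inv m k s \<and> (fst s = [] \<or> i \<le> length (snd s))" if "?S i = Some s" for i s
    using that
  proof (induction i arbitrary: s)
    case 0
    then show ?case using order_inv_init[OF und, of k] by auto
  next
    case (Suc i)
    then have "clip p None (order_step p m k (cliques p m) (?S i)) = Some s" by simp
    then have *: "order_step p m k (cliques p m) (?S i) = Some s" by (auto simp: clip_def split: if_splits)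
    then obtain s0 where s0: "?S i = Some s0" by (cases "?S i") (auto simp: order_step_def)
    have IH: "order_inv m k s0" "fst s0 = [] \<or> i \<le> length (snd s0)" using Suc.IH[OF s0] by auto
    have "order_step p m k (cliques p m) (Some s0) = Some s" using * s0 by simp
    from order_step_inv[OF und IH(1) this] IH(2) show ?case by auto
  qed
  obtain s where s: "?S (length m) = Some s" "out = snd s"
    using ord by (auto simp: elimination_order_def split: option.splits)
  have inv: "order_inv m k s" and fin: "fst s = [] \<or> length m \<le> length (snd s)" using S[OF s(1)] by auto
  have d: "distinct (snd s @ concat (map fst (fst s)))" "set (snd s @ concat (map fst (fst s))) = {..<length m}"
    using inv by (auto simp: order_inv_def)
  have len: "length (snd s @ concat (map fst (fst s))) = length m"
    using distinct_card[OF d(1)] unfolding d(2) by simp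
  have "concat (map fst (fst s)) = []"
    using fin len by (cases "concat (map fst (fst s))") auto
  then show "thin_order m k out" "distinct out" "set out = {..<length m}"
    using inv d by (auto simp: s(2) order_inv_def)
qed

subsection \<open>Existence of separators\<close>

text \<open>Take \<open>A\<close> maximal of weight at most \<open>h\<close>. Any further member
  \<open>D\<close> would push the weight above \<open>h\<close>, so what remains beside
  \<open>A\<close> and \<open>D\<close> weighs less than \<open>h\<close>; \<open>D\<close> alone is
  the second group.\<close>

lemma three_groups:
  fixes w :: "'a \<Rightarrow> nat"
  assumes fin: "finite \<D>" and small: "\<And>D. D \<in> \<D> \<Longrightarrow> w D \<le> h" and total: "sum w \<D> \<le> 2 * h"
  shows "\<exists>A B. A \<subseteq> \<D> \<and> B \<subseteq> \<D> \<and> A \<inter> B = {} \<and> sum w A \<le> h \<and> sum w B \<le> h \<and> sum w (\<D> - A - B) \<le> h"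
proof -
  define S where "S = {A. A \<subseteq> \<D> \<and> sum w A \<le> h}"
  have "finite S" unfolding S_def by (rule finite_subset[of _ "Pow \<D>"]) (use fin in auto)
  moreover have "{} \<in> S" by (simp add: S_def)
  ultimately obtain A where A: "A \<in> S" "\<And>B. B \<in> S \<Longrightarrow> A \<subseteq> B \<Longrightarrow> A = B"
    using finite_has_maximal2[of S "{}"] by auto
  have AD: "A \<subseteq> \<D>" "sum w A \<le> h" using A(1) by (auto simp: S_def)
  have finA: "finite A" using AD fin finite_subset by blast
  show ?thesis
  proof (cases "A = \<D>")
    case True
    then show ?thesis using AD by (intro exI[of _ A] exI[of _ "{}"]) auto
  next
    case False
    then obtain D where D: "D \<in> \<D>" "D \<notin> A" using AD by blast
    have "sum w (insert D A) > h"
    proof (rule ccontr)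
      assume "\<not> sum w (insert D A) > h"
      then have "insert D A \<in> S" using D AD by (simp add: S_def)
      then show False using A(2)[of "insert D A"] D by auto
    qed
    moreover have "sum w \<D> = sum w (\<D> - insert D A) + sum w (insert D A)"
      by (rule sum.subset_diff) (use fin D AD in auto)
    moreover have "\<D> - insert D A = \<D> - A - {D}" by auto
    ultimately have "sum w (\<D> - A - {D}) \<le> h" using total by simp
    then show ?thesis using AD D small[OF D(1)] by (intro exI[of _ A] exI[of _ "{D}"]) auto
  qed
qed

context undirected
begin

lemma closed_component_union:
  assumes "\<And>x. x \<in> X \<longleftrightarrow> x \<in> U \<and> P (component E U x)"
    and "x \<in> X" "u \<in> U" "E x u"
  shows "u \<in> X"
proof -
  have x: "x \<in> U" "P (component E U x)" using assms(1)[of x] assms(2) by auto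
  have "u \<in> component E U x" by (rule component_closed[OF component_self[of x E U] x(1) assms(3,4)])
  then have "component E U u = component E U x" by (rule component_eq)
  then show ?thesis using x assms(1)[of u] assms(3) by simp
qed

text \<open>Two disjoint sets cannot both contain more than half of \<open>2 * h\<close> vertices,
  so some clique leaves only components with at most \<open>h\<close> vertices of \<open>Q\<close>;
  these are collected into three groups.\<close>

lemma one_clique_groups:
  assumes fin: "finite H" and chord: "chordal_on E H" and Q: "finite Q" "card Q \<le> 2 * h"
  obtains K X1 X2 where "K \<subseteq> H" "clique_in E K" "X1 \<subseteq> H - K" "X2 \<subseteq> H - K"
    "\<forall>x \<in> X1. \<forall>u \<in> H - K. E x u \<longrightarrow> u \<in> X1" "\<forall>x \<in> X2. \<forall>u \<in> H - K. E x u \<longrightarrow> u \<in> X2"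
    "X1 \<inter> X2 = {}" "card (Q \<inter> X1) \<le> h" "card (Q \<inter> X2) \<le> h" "card (Q \<inter> (H - K - X1 - X2)) \<le> h"
proof -
  define bad where "bad D \<longleftrightarrow> h < card (D \<inter> Q)" for D
  obtain K where K: "K \<subseteq> H" "clique_in E K" "\<And>x. x \<in> H - K \<Longrightarrow> \<not> bad (component E (H - K) x)"
  proof (rule clique_separator[OF fin chord, of bad])
    fix D D' assume b: "bad D" "bad D'" and D: "D \<subseteq> H" "D' \<subseteq> H" "D' \<inter> D = {}"
    have "card (D \<inter> Q) + card (D' \<inter> Q) = card ((D \<inter> Q) \<union> (D' \<inter> Q))"
      using Q(1) D(3) by (intro card_Un_disjoint[symmetric]) auto
    also have "\<dots> \<le> card Q" using Q(1) by (intro card_mono) auto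
    finally show False using b Q(2) by (simp add: bad_def)
  qed auto
  let ?c = "component E (H - K)"
  let ?D = "?c ` (H - K)"
  have disj: "D \<inter> D' = {}" if D: "D \<in> ?D" "D' \<in> ?D" "D \<noteq> D'" for D D'
  proof (rule ccontr)
    assume "D \<inter> D' \<noteq> {}"
    then obtain x where x: "x \<in> D" "x \<in> D'" by blast
    obtain y y' where y: "D = ?c y" "D' = ?c y'" using D by auto
    have "?c x = D" "?c x = D'" using x component_eq[of x "H - K" y] component_eq[of x "H - K" y'] unfolding y by simp_all
    then show False using D(3) by simp
  qed
  have sum: "sum (\<lambda>D. card (D \<inter> Q)) ?D \<le> 2 * h"
  proof -
    have "sum (\<lambda>D. card (D \<inter> Q)) ?D = card (\<Union>D \<in> ?D. D \<inter> Q)"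
      using fin Q(1) disj by (intro card_UN_disjoint[symmetric]) auto
    also have "\<dots> \<le> card Q" using Q(1) by (intro card_mono) auto
    finally show ?thesis using Q(2) by simp
  qed
  have "\<exists>A B. A \<subseteq> ?D \<and> B \<subseteq> ?D \<and> A \<inter> B = {} \<and> sum (\<lambda>D. card (D \<inter> Q)) A \<le> h \<and>
    sum (\<lambda>D. card (D \<inter> Q)) B \<le> h \<and> sum (\<lambda>D. card (D \<inter> Q)) (?D - A - B) \<le> h"
    by (rule three_groups[OF _ _ sum]) (use fin K(3) in \<open>auto simp: bad_def not_less\<close>)
  then obtain A B where AB: "A \<subseteq> ?D" "B \<subseteq> ?D" "A \<inter> B = {}" "sum (\<lambda>D. card (D \<inter> Q)) A \<le> h"
    "sum (\<lambda>D. card (D \<inter> Q)) B \<le> h" "sum (\<lambda>D. card (D \<inter> Q)) (?D - A - B) \<le> h"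
    by blast
  have weight: "card (Q \<inter> {x \<in> H - K. ?c x \<in> F}) \<le> sum (\<lambda>D. card (D \<inter> Q)) F" if "F \<subseteq> ?D" for F
  proof -
    have finF: "finite F" using that fin finite_subset by blast
    have "Q \<inter> {x \<in> H - K. ?c x \<in> F} \<subseteq> (\<Union>D \<in> F. D \<inter> Q)" using component_self by fast
    then have "card (Q \<inter> {x \<in> H - K. ?c x \<in> F}) \<le> card (\<Union>D \<in> F. D \<inter> Q)"
      using finF Q(1) by (intro card_mono) auto
    also have "\<dots> \<le> sum (\<lambda>D. card (D \<inter> Q)) F" by (rule card_UN_le[OF finF])
    finally show ?thesis .
  qed
  let ?X = "\<lambda>F. {x \<in> H - K. ?c x \<in> F}"
  show ?thesis
  proof (rule that[OF K(1,2), of "?X A" "?X B"])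
    show "\<forall>x \<in> ?X A. \<forall>u \<in> H - K. E x u \<longrightarrow> u \<in> ?X A" "\<forall>x \<in> ?X B. \<forall>u \<in> H - K. E x u \<longrightarrow> u \<in> ?X B"
      using closed_component_union[of "?X A" "H - K" "\<lambda>D. D \<in> A"]
        closed_component_union[of "?X B" "H - K" "\<lambda>D. D \<in> B"] by auto
    show "?X A \<inter> ?X B = {}" using AB(3) by auto
    show "card (Q \<inter> ?X A) \<le> h" "card (Q \<inter> ?X B) \<le> h"
      using weight[OF AB(1)] weight[OF AB(2)] AB(4,5) by auto
    have "H - K - ?X A - ?X B = ?X (?D - A - B)" by auto
    moreover have "?D - A - B \<subseteq> ?D" by blast
    ultimately show "card (Q \<inter> (H - K - ?X A - ?X B)) \<le> h"
      using order.trans[OF weight AB(6)] by simp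
  qed auto
qed

text \<open>Two disjoint sets without edges between them cannot both meet the same clique. So if
  both are bad, neither meets both \<open>K1\<close> and \<open>K2\<close>, and each must hold more
  than half of \<open>Q\<close>, which is impossible. Components that meet neither clique may be
  heavy: a child there loses both old cliques and is allowed a larger \<open>Q\<close>.\<close>

lemma two_clique_groups:
  assumes fin: "finite H" and chord: "chordal_on E H" and Q: "finite Q"
    and K12: "clique_in E K1" "clique_in E K2"
  obtains K X1 X2 where "K \<subseteq> H" "clique_in E K" "X1 \<subseteq> H - K" "X2 \<subseteq> H - K"
    "\<forall>x \<in> X1. \<forall>u \<in> H - K. E x u \<longrightarrow> u \<in> X1" "\<forall>x \<in> X2. \<forall>u \<in> H - K. E x u \<longrightarrow> u \<in> X2"
    "X1 \<inter> X2 = {}" "2 * card (Q \<inter> X1) \<le> card Q" "2 * card (Q \<inter> X2) \<le> card Q"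
    "K1 \<inter> (H - K) \<subseteq> X1" "K2 \<inter> (H - K) \<subseteq> X2" "X1 \<inter> K2 = {}" "X2 \<inter> K1 = {}"
proof -
  define bad where "bad D \<longleftrightarrow> D \<inter> K1 \<noteq> {} \<and> D \<inter> K2 \<noteq> {} \<or>
    (D \<inter> K1 \<noteq> {} \<or> D \<inter> K2 \<noteq> {}) \<and> card Q < 2 * card (D \<inter> Q)" for D
  obtain K where K: "K \<subseteq> H" "clique_in E K" "\<And>x. x \<in> H - K \<Longrightarrow> \<not> bad (component E (H - K) x)"
  proof (rule clique_separator[OF fin chord, of bad])
    fix D D' assume b: "bad D" "bad D'" and D: "D \<subseteq> H" "D' \<subseteq> H" "D' \<inter> D = {}"
      and E: "\<And>d d'. d \<in> D \<Longrightarrow> d' \<in> D' \<Longrightarrow> \<not> E d d'"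
    have no: "\<not> (D \<inter> L \<noteq> {} \<and> D' \<inter> L \<noteq> {})" if L: "clique_in E L" for L
    proof
      assume "D \<inter> L \<noteq> {} \<and> D' \<inter> L \<noteq> {}"
      then obtain x y where xy: "x \<in> D" "x \<in> L" "y \<in> D'" "y \<in> L" by blast
      then have "x \<noteq> y" using D(3) by auto
      then show False using L E[OF xy(1,3)] xy unfolding clique_in_def by blast
    qed
    have "card Q < 2 * card (D \<inter> Q)" "card Q < 2 * card (D' \<inter> Q)"
      using b no[OF K12(1)] no[OF K12(2)] unfolding bad_def by blast+
    moreover have "card (D \<inter> Q) + card (D' \<inter> Q) = card ((D \<inter> Q) \<union> (D' \<inter> Q))"
      using Q D(3) by (intro card_Un_disjoint[symmetric]) auto
    moreover have "\<dots> \<le> card Q" using Q by (intro card_mono) auto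
    ultimately show False by simp
  qed auto
  let ?c = "component E (H - K)"
  let ?X = "\<lambda>L. {x \<in> H - K. ?c x \<inter> L \<noteq> {}}"
  have ok: "\<not> (?c x \<inter> K1 \<noteq> {} \<and> ?c x \<inter> K2 \<noteq> {})"
    "?c x \<inter> K1 \<noteq> {} \<or> ?c x \<inter> K2 \<noteq> {} \<Longrightarrow> 2 * card (?c x \<inter> Q) \<le> card Q" if "x \<in> H - K" for x
    using K(3)[OF that] by (auto simp: bad_def not_less)
  \<comment> \<open>What \<open>K\<close> leaves of a clique lies in one component, so each of the
    two sides is in fact a single component.\<close>
  have same: "?X L \<subseteq> ?c x" if L: "clique_in E L" and x: "x \<in> ?X L" for L x
  proof
    fix y assume y: "y \<in> ?X L"
    obtain a b where ab: "a \<in> ?c x" "a \<in> L" "b \<in> ?c y" "b \<in> L" using x y by blast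
    have HK: "a \<in> H - K" "b \<in> H - K" using ab x y component_subset[of _ "H - K" E] by blast+
    have "b \<in> ?c x"
    proof (cases "a = b")
      case False
      then have "E a b" using L ab unfolding clique_in_def by blast
      then show ?thesis using component_closed[OF ab(1) _ HK(2)] x by simp
    qed (use ab in simp)
    then have "?c b = ?c x" by (rule component_eq)
    moreover have "?c b = ?c y" using ab(3) by (rule component_eq)
    ultimately show "y \<in> ?c x" using component_self by fast
  qed
  have half: "2 * card (Q \<inter> ?X L) \<le> card Q" if L: "clique_in E L" "L = K1 \<or> L = K2" for L
  proof (cases "?X L = {}")
    case False
    then obtain x where x: "x \<in> ?X L" by blast
    then have "card (Q \<inter> ?X L) \<le> card (?c x \<inter> Q)" using same[OF L(1) x] Q by (intro card_mono) auto
    moreover have "2 * card (?c x \<inter> Q) \<le> card Q" using ok(2)[of x] x L(2) by blast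
    ultimately show ?thesis by simp
  next
    case True
    then have "Q \<inter> ?X L = {}" by blast
    then show ?thesis by simp
  qed
  show ?thesis
  proof (rule that[OF K(1,2), of "?X K1" "?X K2"])
    show "\<forall>x \<in> ?X K1. \<forall>u \<in> H - K. E x u \<longrightarrow> u \<in> ?X K1" "\<forall>x \<in> ?X K2. \<forall>u \<in> H - K. E x u \<longrightarrow> u \<in> ?X K2"
      using closed_component_union[of "?X K1" "H - K" "\<lambda>D. D \<inter> K1 \<noteq> {}"]
        closed_component_union[of "?X K2" "H - K" "\<lambda>D. D \<inter> K2 \<noteq> {}"] by auto
    show "?X K1 \<inter> ?X K2 = {}" using ok(1) by blast
    show "2 * card (Q \<inter> ?X K1) \<le> card Q" "2 * card (Q \<inter> ?X K2) \<le> card Q"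
      using half K12 by auto
    show "K1 \<inter> (H - K) \<subseteq> ?X K1" "K2 \<inter> (H - K) \<subseteq> ?X K2"
      using component_self by fast+
    show "?X K1 \<inter> K2 = {}" "?X K2 \<inter> K1 = {}" using ok(1) component_self by fast+
  qed auto
qed

end

lemma length_le_card_distinct: "distinct xs \<Longrightarrow> set xs \<subseteq> A \<Longrightarrow> finite A \<Longrightarrow> length xs \<le> card A"
  by (metis card_mono distinct_card)

text \<open>The pairs \<open>X1\<close>, \<open>M\<close> and \<open>X2\<close>, \<open>M\<close>
  are separations of the terminals, so both minimum cuts have at most \<open>k\<close> vertices.
  From there on only the computed cuts matter: each component lies on one side of each of them,
  which limits the terminals that it can see.\<close>

lemma acceptable_attempt:
  fixes C K1 K2 Q K Q1 Q2 :: "nat list" and X1 X2 M :: "nat set"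
  assumes und: "undirected (edge m)" and p: "16 * (length m + 2) ^ 3 \<le> p"
    and d: "distinct (C @ K1 @ K2 @ Q)" "set (C @ K1 @ K2 @ Q) \<subseteq> {..<length m}"
    and C: "C \<noteq> []" and Q: "length Q \<le> q_limit k K2"
    and M: "finite M" "card M \<le> k"
  defines "H \<equiv> set (C @ K1 @ K2 @ Q) - M"
  assumes closed: "\<And>x u. x \<in> X1 \<Longrightarrow> u \<in> H - set K \<Longrightarrow> edge m x u \<Longrightarrow> u \<in> X1"
      "\<And>x u. x \<in> X2 \<Longrightarrow> u \<in> H - set K \<Longrightarrow> edge m x u \<Longrightarrow> u \<in> X2"
    and disj: "X1 \<inter> X2 = {}"
    and Q12: "set Q1 = set Q \<inter> X1" "set Q2 = set Q \<inter> X2"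
    and one: "K2 = [] \<Longrightarrow> card (set Q \<inter> X1) \<le> 2 * (3 * k + 1) \<and> card (set Q \<inter> X2) \<le> 2 * (3 * k + 1) \<and>
      card (set Q \<inter> (H - set K - X1 - X2)) \<le> 2 * (3 * k + 1)"
    and two: "K2 \<noteq> [] \<Longrightarrow> 2 * card (set Q \<inter> X1) \<le> length Q \<and> 2 * card (set Q \<inter> X2) \<le> length Q \<and>
      set K1 \<inter> (H - set K) \<subseteq> X1 \<and> set K2 \<inter> (H - set K) \<subseteq> X2 \<and> X1 \<inter> set K2 = {} \<and> X2 \<inter> set K1 = {}"
  shows "acceptable k m (C, K1, K2, Q) (attempt p m (C, K1, K2, Q) (K, Q1, Q2))"
proof -
  interpret undirected "edge m" by fact
  define U where "U = filter (\<lambda>v. v \<notin> set K) (C @ K1 @ K2 @ Q)"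
  define W where "W = terminals K2 (K1 @ K2) Q"
  define A1 where "A1 = terminals K2 K1 Q1"
  define A2 where "A2 = terminals K2 K2 Q2"
  define B1 where "B1 = filter (\<lambda>v. v \<notin> set A1) W"
  define B2 where "B2 = filter (\<lambda>v. v \<notin> set A2) W"
  define Z1 where "Z1 = min_cut p m U A1 B1"
  define Z2 where "Z2 = min_cut p m U A2 B2"
  define Z where "Z = Z1 @ Z2"
  define Y where "Y = bag_part C K Z"
  have att: "attempt p m (C, K1, K2, Q) (K, Q1, Q2) = (K, Z, Y)"
    by (simp add: attempt_def separator_def Z_def Z1_def Z2_def U_def A1_def A2_def B1_def B2_def W_def Y_def)
  have U: "distinct U" "set U \<subseteq> {..<length m}" using d unfolding U_def by auto
  have UH: "u \<in> M \<or> u \<in> H - set K" if "u \<in> set U" for u using that by (auto simp: U_def H_def)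
  have Z1k: "length Z1 \<le> k"
  proof -
    have "length Z1 \<le> card M" unfolding Z1_def
    proof (rule min_cut_correct(2)[OF U p M(1)])
      show "set A1 \<inter> set U \<subseteq> X1 \<union> M"
        using UH two Q12 by (cases "K2 = []") (auto simp: A1_def terminals_def)
      show "X1 \<inter> set B1 = {}"
        using two Q12 by (cases "K2 = []") (auto simp: B1_def A1_def W_def terminals_def)
      show "u \<in> X1 \<union> M" if "x \<in> X1" "x \<in> set U" "u \<in> set U" "edge m x u" for x u
        using UH[OF that(3)] closed(1)[OF that(1) _ that(4)] by auto
    qed
    then show ?thesis using M(2) by simp
  qed
  have Z2k: "length Z2 \<le> k"
  proof -
    have "length Z2 \<le> card M" unfolding Z2_def
    proof (rule min_cut_correct(2)[OF U p M(1)])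
      show "set A2 \<inter> set U \<subseteq> X2 \<union> M"
        using UH two Q12 by (cases "K2 = []") (auto simp: A2_def terminals_def, blast)
      show "X2 \<inter> set B2 = {}"
        using two Q12 by (cases "K2 = []") (auto simp: B2_def A2_def W_def terminals_def)
      show "u \<in> X2 \<union> M" if "x \<in> X2" "x \<in> set U" "u \<in> set U" "edge m x u" for x u
        using UH[OF that(3)] closed(2)[OF that(1) _ that(4)] by auto
    qed
    then show ?thesis using M(2) by simp
  qed
  have Zk: "length Z \<le> 2 * k" using Z1k Z2k by (simp add: Z_def)
  obtain S1 where S1: "S1 \<subseteq> set U - set Z1" "(set A1 \<inter> set U) - set Z1 \<subseteq> S1" "S1 \<inter> set B1 = {}"
    "\<forall>x \<in> S1. \<forall>u \<in> set U - set Z1. edge m x u \<longrightarrow> u \<in> S1"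
    using min_cut_correct(1)[OF U p, of m A1 B1] unfolding Z1_def by blast
  obtain S2 where S2: "S2 \<subseteq> set U - set Z2" "(set A2 \<inter> set U) - set Z2 \<subseteq> S2" "S2 \<inter> set B2 = {}"
    "\<forall>x \<in> S2. \<forall>u \<in> set U - set Z2. edge m x u \<longrightarrow> u \<in> S2"
    using min_cut_correct(1)[OF U p, of m A2 B2] unfolding Z2_def by blast
  obtain c0 C' where C': "C = c0 # C'" using C by (cases C) auto
  have Y: "set Y \<subseteq> set K \<union> set Z \<union> {c0}" "set Y \<subseteq> set C" "set C - set Y \<subseteq> set U - set Z" "distinct Y"
    using d(1) by (auto simp: Y_def bag_part_def C' U_def)
  have "child_ok k K1 K2 (child m K1 K2 Q K Z Y D)" if D: "D \<in> set (comps m (filter (\<lambda>v. v \<notin> set Y) C))" for D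
  proof -
    let ?F = "filter (\<lambda>v. v \<notin> set Y) C"
    define N where "N = neighbours m D (K1 @ K2 @ Q @ Y)"
    define ol where "ol = old_clique K1 K2 K Z N"
    define q where "q = filter (\<lambda>u. u \<notin> set K \<and> u \<notin> set ol) N"
    have ch: "child m K1 K2 Q K Z Y D = (D, filter (\<lambda>u. u \<in> set K) N, ol, q)"
      by (simp add: child_def N_def ol_def q_def)
    obtain v where v: "v \<in> set ?F" "set D = component (edge m) (set ?F) v"
      using D set_filter_component unfolding comps_mem by metis
    have DF: "set D \<subseteq> set ?F" using component_subset[OF v(1), of "edge m"] v(2) by simp
    define R where "R = {u \<in> set K1 \<union> set K2 \<union> set Q. u \<notin> set K \<and> u \<notin> set Z \<and> (\<exists>d \<in> set D. edge m d u)}"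
    have RU: "R \<subseteq> set U - set Z" by (auto simp: R_def U_def)
    \<comment> \<open>\<open>D\<close> is connected and avoids \<open>Z\<close>, so it lies inside
      \<open>S\<close> or outside of it. Inside it sees no terminal of the far side
      \<open>B\<close>, outside none of \<open>A\<close>.\<close>
    have side: "(set D \<inter> S \<noteq> {} \<longrightarrow> R \<inter> B = {}) \<and> (set D \<inter> S = {} \<longrightarrow> R \<inter> A = {})"
      if S: "set A' \<inter> set U - Z' \<subseteq> S" "S \<inter> B = {}" "Z' \<subseteq> set Z" "A = set A'"
        "\<forall>x \<in> S. \<forall>u \<in> set U - Z'. edge m x u \<longrightarrow> u \<in> S" for S A A' B Z'
    proof (intro conjI impI)
      assume "set D \<inter> S \<noteq> {}"
      then obtain d where d: "d \<in> set D" "d \<in> S" by blast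
      have "component (edge m) (set ?F) d \<subseteq> S"
      proof (rule component_least[OF d(2)])
        fix y z assume "y \<in> S" "z \<in> set ?F" "edge m y z"
        then show "z \<in> S" using S(5) Y(3) S(3) by auto
      qed
      moreover have "component (edge m) (set ?F) d = set D" using component_eq d(1) v(2) by simp
      ultimately have DS: "set D \<subseteq> S" by simp
      have "u \<in> S" if "u \<in> R" for u
      proof -
        obtain d where "d \<in> set D" "edge m d u" using \<open>u \<in> R\<close> by (auto simp: R_def)
        then show ?thesis using S(5) DS RU S(3) \<open>u \<in> R\<close> by blast
      qed
      then show "R \<inter> B = {}" using S(2) by blast
    next
      assume DS: "set D \<inter> S = {}"
      show "R \<inter> A = {}"
      proof (rule ccontr)
        assume "R \<inter> A \<noteq> {}"
        then obtain u where u: "u \<in> R" "u \<in> A" by blast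
        then have "u \<in> S" using S(1,3,4) RU by blast
        obtain d where d: "d \<in> set D" "edge m d u" using u by (auto simp: R_def)
        have "d \<in> set U - Z'" using d(1) DF Y(3) S(3) by auto
        then have "d \<in> S" using S(5) \<open>u \<in> S\<close> sym[OF d(2)] by blast
        then show False using d(1) DS by blast
      qed
    qed
    have side1: "set D \<inter> S1 \<noteq> {} \<Longrightarrow> R \<inter> set B1 = {}" "set D \<inter> S1 = {} \<Longrightarrow> R \<inter> set A1 = {}"
      using side[OF S1(2,3) _ refl S1(4)] by (auto simp: Z_def)
    have side2: "set D \<inter> S2 \<noteq> {} \<Longrightarrow> R \<inter> set B2 = {}" "set D \<inter> S2 = {} \<Longrightarrow> R \<inter> set A2 = {}"
      using side[OF S2(2,3) _ refl S2(4)] by (auto simp: Z_def)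
    have olR: "set ol \<subseteq> R \<inter> (set K1 \<union> set K2)"
      using Y(1,2) d(1) by (auto simp: ol_def old_clique_def N_def neighbours_def R_def)
    have qR: "set q \<subseteq> (R \<inter> set Q) \<union> (set Z \<union> {c0})"
    proof
      fix u assume u: "u \<in> set q"
      then have "u \<in> set (K1 @ K2 @ Q @ Y)" "\<exists>d \<in> set D. edge m d u" "u \<notin> set K" "u \<notin> set ol"
        by (auto simp: q_def N_def neighbours_def)
      then show "u \<in> (R \<inter> set Q) \<union> (set Z \<union> {c0})"
        using Y(1) by (auto simp: ol_def old_clique_def N_def neighbours_def R_def)
    qed
    have dN: "distinct (K1 @ K2 @ Q @ Y)" using d(1) Y(2,4) by auto
    have dq: "distinct q" unfolding q_def N_def neighbours_def by (intro distinct_filter dN)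
    \<comment> \<open>Besides old vertices of \<open>Q\<close>, only the \<open>2 * k\<close>
      vertices of the cuts and the added vertex \<open>c0\<close> can enter the new
      \<open>Q\<close>.\<close>
    have qcard: "length q \<le> card (R \<inter> set Q) + (2 * k + 1)"
    proof -
      have "length q \<le> card ((R \<inter> set Q) \<union> (set Z \<union> {c0}))"
        by (rule length_le_card_distinct[OF dq qR]) simp
      also have "\<dots> \<le> card (R \<inter> set Q) + card (set Z \<union> {c0})" by (rule card_Un_le)
      also have "card (set Z \<union> {c0}) \<le> length Z + 1"
        by (rule order.trans[OF card_Un_le]) (simp add: card_length)
      finally show ?thesis using Zk by simp
    qed
    have mono: "card (R \<inter> set Q) \<le> card T" if "R \<inter> set Q \<subseteq> T" "finite T" for T
      by (rule card_mono[OF that(2,1)])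
    have "((\<forall>u \<in> set ol. u \<notin> set K1) \<or> (\<forall>u \<in> set ol. u \<notin> set K2)) \<and> length q \<le> q_limit k ol"
    proof (cases "K2 = []")
      case True
      have BA: "set B1 = set Q - set Q1" "set B2 = set Q - set Q2" "set A1 = set Q1" "set A2 = set Q2"
        using True by (auto simp: A1_def A2_def B1_def B2_def W_def terminals_def)
      note one = one[OF True]
      \<comment> \<open>The extra \<open>k\<close> stands for members of \<open>Q\<close> in
        \<open>M\<close>, which belong to none of the three groups. Together with
        \<open>2 * k + 1\<close> this is exactly \<open>3 * (3 * k + 1)\<close>, the limit for a
        child with two cliques.\<close>
      have "card (R \<inter> set Q) \<le> 2 * (3 * k + 1) + k"
      proof (cases "set D \<inter> S1 = {} \<and> set D \<inter> S2 = {}")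
        case False
        then have "R \<inter> set B1 = {} \<or> R \<inter> set B2 = {}" using side1(1) side2(1) by blast
        then have "R \<inter> set Q \<subseteq> set Q \<inter> X1 \<or> R \<inter> set Q \<subseteq> set Q \<inter> X2"
          unfolding BA Q12 by blast
        then have "card (R \<inter> set Q) \<le> card (set Q \<inter> X1) \<or> card (R \<inter> set Q) \<le> card (set Q \<inter> X2)"
          using mono[of "set Q \<inter> X1"] mono[of "set Q \<inter> X2"] by auto
        then show ?thesis using one by linarith
      next
        case True
        then have "R \<inter> set Q1 = {}" "R \<inter> set Q2 = {}" using side1(2) side2(2) BA by auto
        then have "R \<inter> set Q \<subseteq> (set Q \<inter> (H - set K - X1 - X2)) \<union> M"
          using Q12 by (auto simp: R_def H_def)
        then have "card (R \<inter> set Q) \<le> card ((set Q \<inter> (H - set K - X1 - X2)) \<union> M)"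
          by (rule mono) (use M in simp)
        also have "\<dots> \<le> card (set Q \<inter> (H - set K - X1 - X2)) + card M" by (rule card_Un_le)
        finally show ?thesis using one M(2) by simp
      qed
      then have "length q \<le> q_limit k ol" using qcard by (simp add: q_limit_def)
      then show ?thesis using True by simp
    next
      case False
      note two = two[OF False]
      have lenQ: "length Q \<le> 3 * (3 * k + 1)" using Q False by (simp add: q_limit_def)
      have BA: "set B1 = set K1 \<union> set K2 \<union> set Q - (set K1 \<union> set Q1)" "set A1 = set K1 \<union> set Q1"
         "set B2 = set K1 \<union> set K2 \<union> set Q - (set K2 \<union> set Q2)" "set A2 = set K2 \<union> set Q2"
        using False by (auto simp: A1_def A2_def B1_def B2_def W_def terminals_def)
      have dd: "set K1 \<inter> set K2 = {}" "set K1 \<inter> set Q = {}" "set K2 \<inter> set Q = {}" using d(1) by auto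
      consider "set D \<inter> S1 \<noteq> {}" | "set D \<inter> S2 \<noteq> {}" | "set D \<inter> S1 = {}" "set D \<inter> S2 = {}" by blast
      then show ?thesis
      proof cases
        case 1
        have "R \<inter> set K2 = {}" using side1(1)[OF 1] dd unfolding BA Q12 by blast
        moreover have "R \<inter> set Q \<subseteq> set Q \<inter> X1" using side1(1)[OF 1] dd unfolding BA Q12 by blast
        then have "card (R \<inter> set Q) \<le> card (set Q \<inter> X1)" by (rule mono) simp
        then have "length q \<le> q_limit k ol" using qcard two lenQ by (simp add: q_limit_def)
        ultimately show ?thesis using olR by blast
      next
        case 2
        have "R \<inter> set K1 = {}" using side2(1)[OF 2] dd unfolding BA Q12 by blast
        moreover have "R \<inter> set Q \<subseteq> set Q \<inter> X2" using side2(1)[OF 2] dd unfolding BA Q12 by blast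
        then have "card (R \<inter> set Q) \<le> card (set Q \<inter> X2)" by (rule mono) simp
        then have "length q \<le> q_limit k ol" using qcard two lenQ by (simp add: q_limit_def)
        ultimately show ?thesis using olR by blast
      next
        case 3
        \<comment> \<open>Behind neither cut both old cliques are lost. The whole of
          \<open>Q\<close> may remain, and the larger limit for tasks with one clique leaves room
          for the new vertices.\<close>
        have "R \<inter> (set K1 \<union> set K2) = {}" using side1(2)[OF 3(1)] side2(2)[OF 3(2)] BA by blast
        then have "ol = []" using olR by auto
        moreover have "card (R \<inter> set Q) \<le> length Q"
          by (rule order.trans[OF mono[of "set Q"]]) (auto simp: card_length)
        ultimately show ?thesis using qcard lenQ by (simp add: q_limit_def)
      qed
    qed
    then show ?thesis unfolding ch by (simp add: child_ok_def)
  qed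
  then show ?thesis unfolding att by (auto simp: acceptable_def children_def Zk)
qed

text \<open>The chordal part of the task has a separating clique, and it extends to some listed
  clique \<open>K\<close>. Removing more vertices preserves all requirements on \<open>X1\<close>
  and \<open>X2\<close>. The exponent \<open>12 * k + 4\<close> is the larger of the two limits for
  \<open>Q\<close>.\<close>

lemma acceptable_exists:
  assumes und: "undirected (edge m)" and p: "16 * (length m + 2) ^ 3 \<le> p"
    "2 ^ k * (length m + 2) ^ 3 \<le> p" "3 ^ (12 * k + 4) * (2 * (length m + 2) ^ 2) \<le> p"
    and M: "M \<subseteq> {..<length m}" "card M \<le> k" "chordal_on (edge m) ({..<length m} - M)"
    and d: "distinct (C @ K1 @ K2 @ Q)" "set (C @ K1 @ K2 @ Q) \<subseteq> {..<length m}"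
    and C: "C \<noteq> []" and Q: "length Q \<le> q_limit k K2"
    and cl: "clique_in (edge m) (set K1)" "clique_in (edge m) (set K2)"
  shows "\<exists>a \<in> set (attempts p m (cliques p m) (C, K1, K2, Q)). acceptable k m (C, K1, K2, Q) a"
proof -
  interpret undirected "edge m" by fact
  define H where "H = set (C @ K1 @ K2 @ Q) - M"
  have finH: "finite H" by (simp add: H_def)
  have chH: "chordal_on (edge m) H" by (rule chordal_on_subset[OF M(3)]) (use d(2) in \<open>auto simp: H_def\<close>)
  have finM: "finite M" using M(1) finite_subset by blast
  have dQ: "distinct Q" "set Q \<subseteq> {..<length m}" using d by auto
  have Q4: "length Q \<le> 12 * k + 4" using Q by (simp add: q_limit_def split: if_splits)
  have "3 ^ length Q * (2 * (length m + 2) ^ 2) \<le> 3 ^ (12 * k + 4) * (2 * (length m + 2) ^ 2)"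
    using Q4 by (intro mult_le_mono1 power_increasing) auto
  from order.trans[OF this p(3)] have p3: "3 ^ length Q * (2 * (length m + 2) ^ 2) \<le> p" .
  define good where "good K X1 X2 \<longleftrightarrow>
      (\<forall>x \<in> X1. \<forall>u \<in> H - K. edge m x u \<longrightarrow> u \<in> X1) \<and> (\<forall>x \<in> X2. \<forall>u \<in> H - K. edge m x u \<longrightarrow> u \<in> X2) \<and>
      X1 \<inter> X2 = {} \<and>
      (K2 = [] \<longrightarrow> card (set Q \<inter> X1) \<le> 2 * (3 * k + 1) \<and> card (set Q \<inter> X2) \<le> 2 * (3 * k + 1) \<and>
        card (set Q \<inter> (H - K - X1 - X2)) \<le> 2 * (3 * k + 1)) \<and>
      (K2 \<noteq> [] \<longrightarrow> 2 * card (set Q \<inter> X1) \<le> length Q \<and> 2 * card (set Q \<inter> X2) \<le> length Q \<and>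
        set K1 \<inter> (H - K) \<subseteq> X1 \<and> set K2 \<inter> (H - K) \<subseteq> X2 \<and> X1 \<inter> set K2 = {} \<and> X2 \<inter> set K1 = {})"
    for K X1 X2
  have "\<exists>K X1 X2. K \<subseteq> H \<and> clique_in (edge m) K \<and> good K X1 X2"
  proof (cases "K2 = []")
    case True
    have "card (set Q) \<le> 2 * (2 * (3 * k + 1))"
      using Q True card_length[of Q] by (simp add: q_limit_def)
    from one_clique_groups[OF finH chH finite_set this] obtain K X1 X2 where
      "K \<subseteq> H" "clique_in (edge m) K" "X1 \<subseteq> H - K" "X2 \<subseteq> H - K"
      "\<forall>x \<in> X1. \<forall>u \<in> H - K. edge m x u \<longrightarrow> u \<in> X1" "\<forall>x \<in> X2. \<forall>u \<in> H - K. edge m x u \<longrightarrow> u \<in> X2"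
      "X1 \<inter> X2 = {}" "card (set Q \<inter> X1) \<le> 2 * (3 * k + 1)" "card (set Q \<inter> X2) \<le> 2 * (3 * k + 1)"
      "card (set Q \<inter> (H - K - X1 - X2)) \<le> 2 * (3 * k + 1)" .
    then show ?thesis using True unfolding good_def by blast
  next
    case False
    have cQ: "card (set Q) = length Q" using dQ(1) by (rule distinct_card)
    from two_clique_groups[OF finH chH finite_set[of Q] cl, unfolded cQ] obtain K X1 X2 where
      "K \<subseteq> H" "clique_in (edge m) K" "X1 \<subseteq> H - K" "X2 \<subseteq> H - K"
      "\<forall>x \<in> X1. \<forall>u \<in> H - K. edge m x u \<longrightarrow> u \<in> X1" "\<forall>x \<in> X2. \<forall>u \<in> H - K. edge m x u \<longrightarrow> u \<in> X2"
      "X1 \<inter> X2 = {}" "2 * card (set Q \<inter> X1) \<le> length Q" "2 * card (set Q \<inter> X2) \<le> length Q"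
      "set K1 \<inter> (H - K) \<subseteq> X1" "set K2 \<inter> (H - K) \<subseteq> X2" "X1 \<inter> set K2 = {}" "X2 \<inter> set K1 = {}"
      .
    then show ?thesis using False unfolding good_def by blast
  qed
  then obtain K0 X1 X2 where K0: "K0 \<subseteq> H" "clique_in (edge m) K0" "good K0 X1 X2" by blast
  have "K0 \<subseteq> {..<length m}" using K0(1) d(2) by (auto simp: H_def)
  then obtain K where K: "K \<in> set (cliques p m)" "K0 \<subseteq> set K"
    using cliques_complete[OF und p(2) M] K0(2) by blast
  have "X1 \<inter> X2 = {}" using K0(3) unfolding good_def by blast
  then have "set Q \<inter> X1 \<inter> (set Q \<inter> X2) = {}" by blast
  then have "\<exists>s \<in> set (splits p Q). set (fst s) = set Q \<inter> X1 \<and> set (snd s) = set Q \<inter> X2"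
    by (rule splits_complete[OF dQ p3 Int_lower1 Int_lower1])
  then obtain s where s: "s \<in> set (splits p Q)" "set (fst s) = set Q \<inter> X1" "set (snd s) = set Q \<inter> X2"
    by blast
  let ?t = "(C, K1, K2, Q)"
  have "acceptable k m ?t (attempt p m ?t (K, fst s, snd s))"
  proof (rule acceptable_attempt[OF und p(1) d C Q finM M(2), where ?X1.0 = X1 and ?X2.0 = X2])
    have g: "\<forall>x \<in> X1. \<forall>u \<in> H - K0. edge m x u \<longrightarrow> u \<in> X1" "\<forall>x \<in> X2. \<forall>u \<in> H - K0. edge m x u \<longrightarrow> u \<in> X2"
      using K0(3) unfolding good_def by blast+
    show "u \<in> X1" if "x \<in> X1" "u \<in> set (C @ K1 @ K2 @ Q) - M - set K" "edge m x u" for x u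
      using g(1) that K(2) unfolding H_def by blast
    show "u \<in> X2" if "x \<in> X2" "u \<in> set (C @ K1 @ K2 @ Q) - M - set K" "edge m x u" for x u
      using g(2) that K(2) unfolding H_def by blast
    show "X1 \<inter> X2 = {}" using K0(3) unfolding good_def by blast
    show "card (set Q \<inter> X1) \<le> 2 * (3 * k + 1) \<and> card (set Q \<inter> X2) \<le> 2 * (3 * k + 1) \<and>
      card (set Q \<inter> (set (C @ K1 @ K2 @ Q) - M - set K - X1 - X2)) \<le> 2 * (3 * k + 1)" if "K2 = []"
    proof -
      have g: "card (set Q \<inter> X1) \<le> 2 * (3 * k + 1)" "card (set Q \<inter> X2) \<le> 2 * (3 * k + 1)"
        "card (set Q \<inter> (H - K0 - X1 - X2)) \<le> 2 * (3 * k + 1)"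
        using K0(3) that unfolding good_def by blast+
      have "card (set Q \<inter> (set (C @ K1 @ K2 @ Q) - M - set K - X1 - X2)) \<le> card (set Q \<inter> (H - K0 - X1 - X2))"
        using K(2) unfolding H_def by (intro card_mono) auto
      then show ?thesis using g by simp
    qed
    show "2 * card (set Q \<inter> X1) \<le> length Q \<and> 2 * card (set Q \<inter> X2) \<le> length Q \<and>
      set K1 \<inter> (set (C @ K1 @ K2 @ Q) - M - set K) \<subseteq> X1 \<and> set K2 \<inter> (set (C @ K1 @ K2 @ Q) - M - set K) \<subseteq> X2 \<and>
      X1 \<inter> set K2 = {} \<and> X2 \<inter> set K1 = {}" if "K2 \<noteq> []"
    proof -
      have "2 * card (set Q \<inter> X1) \<le> length Q \<and> 2 * card (set Q \<inter> X2) \<le> length Q \<and>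
        set K1 \<inter> (H - K0) \<subseteq> X1 \<and> set K2 \<inter> (H - K0) \<subseteq> X2 \<and> X1 \<inter> set K2 = {} \<and> X2 \<inter> set K1 = {}"
        using K0(3) that unfolding good_def by blast
      then show ?thesis using K(2) unfolding H_def by blast
    qed
  qed (rule s(2,3))+
  moreover have "attempt p m ?t (K, fst s, snd s) \<in> set (attempts p m (cliques p m) ?t)"
    using K(1) s(1) by (auto simp: attempts_def)
  ultimately show ?thesis by blast
qed

theorem elimination_order_exists:
  assumes und: "undirected (edge m)" and p: "16 * (length m + 2) ^ 3 \<le> p"
    "2 ^ k * (length m + 2) ^ 3 \<le> p" "3 ^ (12 * k + 4) * (2 * (length m + 2) ^ 2) \<le> p"
    and M: "M \<subseteq> {..<length m}" "card M \<le> k" "chordal_on (edge m) ({..<length m} - M)"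
  shows "elimination_order p m k \<noteq> None"
proof -
  let ?f = "\<lambda>_ st. clip p None (order_step p m k (cliques p m) st)"
  let ?init = "(if m = [] then [] else [([0..<length m], [], [], [])], [])"
  let ?S = "\<lambda>i. fold ?f [0..<i] (Some ?init)"
  have "\<exists>s. ?S i = Some s \<and> order_inv m k s" for i
  proof (induction i)
    case 0
    show ?case using order_inv_init[OF und, of k] by auto
  next
    case (Suc i)
    then obtain s where s: "?S i = Some s" "order_inv m k s" by blast
    obtain ts out where so: "s = (ts, out)" by force
    have "\<exists>s'. order_step p m k (cliques p m) (Some s) = Some s'"
    proof (cases ts)
      case Nil
      then show ?thesis by (simp add: order_step_def so)
    next
      case (Cons t ts')
      obtain C K1 K2 Q where t: "t = (C, K1, K2, Q)" by (cases t) auto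
      have ok: "C \<noteq> []" "distinct (K1 @ K2 @ Q)" "set (K1 @ K2 @ Q) \<subseteq> set out"
        "clique_in (edge m) (set K1)" "clique_in (edge m) (set K2)" "length Q \<le> q_limit k K2"
        and d: "distinct (out @ C @ concat (map fst ts'))" "set (out @ C @ concat (map fst ts')) = {..<length m}"
        using s(2) by (auto simp: order_inv_def task_ok_def so Cons t)
      have "distinct (C @ K1 @ K2 @ Q)" using ok(2,3) d(1) by auto
      moreover have "set (C @ K1 @ K2 @ Q) \<subseteq> {..<length m}" unfolding d(2)[symmetric] using ok(3) by auto
      ultimately obtain a where "a \<in> set (attempts p m (cliques p m) t)" "acceptable k m t a"
        using acceptable_exists[OF und p M _ _ ok(1,6,4,5)] t by blast
      then have "filter (acceptable k m t) (attempts p m (cliques p m) t) \<noteq> []"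
        by (auto simp: filter_empty_conv)
      then show ?thesis by (auto simp: order_step_def so Cons split: list.split)
    qed
    then obtain s' where s': "order_step p m k (cliques p m) (Some s) = Some s'" by blast
    have inv: "order_inv m k s'" by (rule order_step_inv(1)[OF und s(2) s'])
    have "clip p None (Some s') = Some s'"
      using sz_order_state[OF inv] p(1) by (intro clip_id) simp
    then show ?case using s(1) s' inv by simp
  qed
  then obtain s where "?S (length m) = Some s" by blast
  then show ?thesis by (auto simp: elimination_order_def)
qed

section \<open>Linear algebra over the field with two elements\<close>

text \<open>A vector is a list of coordinates, read as their formal sum over the two-element field. Two
  families of vectors span the same space iff no linear functional \<open>\<phi>\<close> separates them.\<close>

declare add_bit_eq_xor [simp del] mult_bit_eq_and [simp del]

definition sm :: "('a \<Rightarrow> bit) \<Rightarrow> 'a list \<Rightarrow> bit" where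
  "sm \<phi> u = sum_list (map \<phi> u)"

lemma sm_simps [simp]: "sm \<phi> [] = 0" "sm \<phi> (c # u) = \<phi> c + sm \<phi> u" "sm \<phi> (u @ w) = sm \<phi> u + sm \<phi> w"
  by (simp_all add: sm_def)

lemma sm_map: "sm \<phi> (map f u) = sm (\<lambda>c. \<phi> (f c)) u"
  by (simp add: sm_def comp_def)

lemma sm_concat_map: "sm \<phi> (concat (map f u)) = sm (\<lambda>c. sm \<phi> (f c)) u"
  by (induction u) auto

lemma sm_filter: "sm \<phi> (filter P u) = sm (\<lambda>c. if P c then \<phi> c else 0) u"
  by (induction u) auto

lemma sm_sum: "sm (\<lambda>c. \<Sum>x \<in> A. f x c) u = (\<Sum>x \<in> A. sm (f x) u)"
  by (induction u) (auto simp: sum.distrib)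

definition toggle :: "'a \<Rightarrow> 'a list \<Rightarrow> 'a list" where
  "toggle c w = (if c \<in> set w then filter (\<lambda>x. x \<noteq> c) w else c # w)"

text \<open>Normal form of a formal sum over two elements: the coordinates that occur an odd number
  of times, once each.\<close>

definition compress :: "'a list \<Rightarrow> 'a list" where
  "compress u = fold (\<lambda>c w. toggle c w) u []"

lemma ptime_compress [pt]: assumes "ptime u" shows "ptime (\<lambda>x. compress (u x))"
proof -
  have *: "sz (fold (\<lambda>c w. toggle c w) us w) \<le> sz us + sz w" for us w :: "'b list"
  proof (induction us arbitrary: w)
    case (Cons c us)
    have "sz (toggle c w) \<le> Suc (sz c) + sz w" using sz_filter_le[of _ w] by (auto simp: toggle_def le_SucI trans_le_add2)
    then show ?case using Cons[of "toggle c w"] by simp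
  qed simp
  have toggle: "ptime (\<lambda>x. toggle (c x) (w x))" if "ptime c" "ptime w" for c :: "'y::enc \<Rightarrow> 'b" and w
    unfolding toggle_def by (intro pt that that[THEN feasible_compose])
  show ?thesis unfolding compress_def
  proof (rule ptime_fold[OF _ assms _ feasible_pbounded[OF assms]])
    show "sz (fold (\<lambda>c w. toggle c w) (take i (u x)) []) \<le> sz (u x)" for x i
      using *[of "take i (u x)" "[]"] sz_take_le[of i "u x"] by simp
  qed (intro pt toggle)+
qed

lemma bit_add_cancel: "a + (a + b) = (b :: bit)"
  by (cases a; cases b) simp_all

lemma sm_toggle: assumes "distinct w" shows "sm \<phi> (toggle c w) = \<phi> c + sm \<phi> w" "distinct (toggle c w)"
proof -
  show "sm \<phi> (toggle c w) = \<phi> c + sm \<phi> w"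
  proof (cases "c \<in> set w")
    case True
    have "sm \<phi> w = \<phi> c + sm \<phi> (remove1 c w)"
      unfolding sm_def by (rule sum_list_map_remove1[OF True])
    also have "remove1 c w = filter (\<lambda>x. x \<noteq> c) w"
      using assms by (simp add: distinct_remove1_removeAll removeAll_filter_not_eq) (metis (full_types))
    finally show ?thesis using True by (simp only: toggle_def if_True bit_add_cancel)
  qed (simp add: toggle_def)
  show "distinct (toggle c w)" using assms by (simp add: toggle_def)
qed

lemma compress: "sm \<phi> (compress u) = sm \<phi> u" "distinct (compress u)" "set (compress u) \<subseteq> set u"
proof -
  have *: "distinct w \<Longrightarrow> sm \<phi> (fold (\<lambda>c w. toggle c w) u w) = sm \<phi> u + sm \<phi> w \<and>
    distinct (fold (\<lambda>c w. toggle c w) u w) \<and> set (fold (\<lambda>c w. toggle c w) u w) \<subseteq> set u \<union> set w" for w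
  proof (induction u arbitrary: w)
    case (Cons c u)
    have "set (toggle c w) \<subseteq> insert c (set w)" by (auto simp: toggle_def)
    then show ?case using Cons.IH[of "toggle c w"] sm_toggle(1)[OF Cons.prems, of \<phi> c]
      sm_toggle(2)[OF Cons.prems, of c] by (auto simp: ac_simps)
  qed simp
  show "sm \<phi> (compress u) = sm \<phi> u" "distinct (compress u)" "set (compress u) \<subseteq> set u"
    using *[of "[]"] by (auto simp: compress_def)
qed

lemma sm_indicator: "distinct u \<Longrightarrow> sm (\<lambda>x. of_bool (x = c)) u = of_bool (c \<in> set u)"
  by (induction u) auto

lemma mem_compress: "c \<in> set (compress u) \<longleftrightarrow> sm (\<lambda>x. of_bool (x = c)) u = 1"
  using compress(1)[of "\<lambda>x. of_bool (x = c)" u] sm_indicator[OF compress(2), of c u]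
  by (simp add: of_bool_def split: if_splits)

section \<open>Gaussian elimination, with the head of a basis vector as its pivot\<close>

definition reduce_by :: "'a list \<Rightarrow> 'a list \<Rightarrow> 'a list" where
  "reduce_by b w = (case b of [] \<Rightarrow> w | c # cs \<Rightarrow> if c \<in> set w then compress (w @ b) else w)"

definition insert_vec :: "'a list list \<Rightarrow> 'a list \<Rightarrow> 'a list list" where
  "insert_vec B u = (case fold reduce_by B u of [] \<Rightarrow> B | c # w \<Rightarrow> B @ [c # w])"

definition reduce :: "nat \<Rightarrow> 'a::enc list list \<Rightarrow> 'a list list" where
  "reduce p T = fold (\<lambda>u B. clip p [] (insert_vec B (compress u))) T []"

lemma ptime_reduce [pt]: assumes "ptime p" "ptime T" shows "ptime (\<lambda>x. reduce (p x) (T x))"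
proof -
  have red: "ptime (\<lambda>x. reduce_by (b x) (w x))" if "ptime b" "ptime w" for b :: "'y::enc \<Rightarrow> 'b list" and w
    unfolding reduce_by_def by (intro pt that that[THEN feasible_compose])
  have szc: "sz (compress u) \<le> sz u" for u :: "'b list"
  proof -
    have "sz (fold (\<lambda>c w. toggle c w) us w) \<le> sz us + sz w" for us w :: "'b list"
    proof (induction us arbitrary: w)
      case (Cons c us)
      have "sz (toggle c w) \<le> Suc (sz c) + sz w" using sz_filter_le[of _ w] by (auto simp: toggle_def le_SucI trans_le_add2)
      then show ?case using Cons[of "toggle c w"] by simp
    qed simp
    from this[of u "[]"] show ?thesis by (simp add: compress_def)
  qed
  have *: "sz (fold reduce_by B w) \<le> sz B + sz w" for B and w :: "'b list"
  proof (induction B arbitrary: w)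
    case (Cons b B)
    have "sz (reduce_by b w) \<le> sz b + sz w"
      using szc[of "w @ b"] by (auto simp: reduce_by_def split: list.splits)
    then show ?case using Cons[of "reduce_by b w"] by simp
  qed simp
  have folds: "ptime (\<lambda>x. fold reduce_by (B x) (u x))" if B: "ptime B" and u: "ptime u"
    for B :: "'y::enc \<Rightarrow> 'b list list" and u
  proof (rule ptime_fold[OF _ B u])
    show "pbounded sz (\<lambda>x. sz (B x) + sz (u x))" by (intro pbounded_intros feasible_pbounded B u)
    show "sz (fold reduce_by (take i (B x)) (u x)) \<le> sz (B x) + sz (u x)" for x i
      using *[of "take i (B x)" "u x"] sz_take_le[of i "B x"] by simp
  qed (intro pt red)
  have insert: "ptime (\<lambda>x. insert_vec (B x) (u x))" if "ptime B" "ptime u"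
    for B :: "'y::enc \<Rightarrow> 'b list list" and u
    unfolding insert_vec_def by (intro pt folds that that[THEN feasible_compose])
  show ?thesis unfolding reduce_def by (intro pt insert assms assms[THEN feasible_compose])
qed

text \<open>No back substitution is required: later vectors avoid the pivots of earlier ones. This
  already makes the pivots distinct, so there are at most as many vectors as coordinates.\<close>

definition echelon :: "'a set \<Rightarrow> 'a list list \<Rightarrow> bool" where
  "echelon X B \<longleftrightarrow> (\<forall>b \<in> set B. b \<noteq> [] \<and> distinct b \<and> set b \<subseteq> X) \<and>
     (\<forall>j < length B. \<forall>i < j. hd (B ! i) \<notin> set (B ! j))"

lemma echelon_length: assumes "echelon X B" "finite X" shows "length B \<le> card X"
proof -
  have "hd (B ! i) \<noteq> hd (B ! j)" if "i < j" "j < length B" for i j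
    using assms(1) that nth_mem[OF that(2)] by (metis echelon_def hd_in_set)
  then have "distinct (map hd B)"
    by (auto simp: distinct_conv_nth) (metis linorder_neqE_nat)
  moreover have "set (map hd B) \<subseteq> X" using assms(1) by (fastforce simp: echelon_def)
  ultimately have "length (map hd B) \<le> card X" using assms(2) by (intro length_le_card_distinct)
  then show ?thesis by simp
qed

lemma reduce_by_props:
  assumes "distinct w" "set w \<subseteq> X" "distinct b" "set b \<subseteq> X"
  shows "distinct (reduce_by b w)" "set (reduce_by b w) \<subseteq> X" "sm \<phi> b = 0 \<Longrightarrow> sm \<phi> (reduce_by b w) = sm \<phi> w"
    "b \<noteq> [] \<Longrightarrow> hd b \<notin> set (reduce_by b w)"
    "c \<notin> set b \<Longrightarrow> c \<notin> set w \<Longrightarrow> c \<notin> set (reduce_by b w)"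
proof -
  have "hd b \<notin> set (compress (w @ b))" if "b \<noteq> []" "hd b \<in> set w"
    using that assms by (simp add: mem_compress sm_indicator)
  then show "b \<noteq> [] \<Longrightarrow> hd b \<notin> set (reduce_by b w)"
    by (cases b) (auto simp: reduce_by_def)
qed (use assms compress(1)[of \<phi> "w @ b"] compress(2)[of "w @ b"] compress(3)[of "w @ b"] in
     \<open>auto simp: reduce_by_def split: list.splits\<close>)

text \<open>Reducing in list order works because a later basis vector avoids the earlier pivots, so
  subtracting it cannot bring back a pivot that has been eliminated.\<close>

lemma fold_reduce_by:
  assumes "echelon X B" "distinct u" "set u \<subseteq> X"
  shows "distinct (fold reduce_by B u) \<and> set (fold reduce_by B u) \<subseteq> X \<and>
    (\<forall>b \<in> set B. hd b \<notin> set (fold reduce_by B u)) \<and>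
    ((\<forall>b \<in> set B. sm \<phi> b = 0) \<longrightarrow> sm \<phi> (fold reduce_by B u) = sm \<phi> u)"
  using assms(1)
proof (induction B rule: rev_induct)
  case Nil
  then show ?case using assms by simp
next
  case (snoc b B)
  have ech: "echelon X B"
    using snoc.prems unfolding echelon_def by (auto simp: nth_append split: if_splits)
  have b: "b \<noteq> []" "distinct b" "set b \<subseteq> X" using snoc.prems by (auto simp: echelon_def)
  have new: "hd b' \<notin> set b" if "b' \<in> set B" for b'
  proof -
    obtain i where "i < length B" "b' = B ! i" using \<open>b' \<in> set B\<close> by (auto simp: in_set_conv_nth)
    moreover have "hd ((B @ [b]) ! i) \<notin> set ((B @ [b]) ! length B)"
      using snoc.prems \<open>i < length B\<close> unfolding echelon_def by (metis length_append_singleton lessI)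
    ultimately show ?thesis by (simp add: nth_append)
  qed
  let ?w = "fold reduce_by B u"
  have IH: "distinct ?w" "set ?w \<subseteq> X" "\<forall>b \<in> set B. hd b \<notin> set ?w"
    "(\<forall>b \<in> set B. sm \<phi> b = 0) \<longrightarrow> sm \<phi> ?w = sm \<phi> u" using snoc.IH[OF ech] by auto
  note props = reduce_by_props[OF IH(1,2) b(2,3)]
  show ?case using props(1,2) props(4)[OF b(1)] props(5)[OF new] IH(3,4) props(3)[of \<phi>] by auto
qed

text \<open>Equality of spans is phrased through functionals: if \<open>\<phi>\<close> vanishes on
  the basis, reduction does not change its value on the new vector.\<close>

lemma insert_vec_props:
  assumes B: "echelon X B" and u: "distinct u" "set u \<subseteq> X"
  shows "echelon X (insert_vec B u)"
    "(\<exists>b \<in> set (insert_vec B u). sm \<phi> b = 1) \<longleftrightarrow> (\<exists>b \<in> set B. sm \<phi> b = 1) \<or> sm \<phi> u = 1"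
proof -
  let ?w = "fold reduce_by B u"
  have w: "distinct ?w" "set ?w \<subseteq> X" "\<forall>b \<in> set B. hd b \<notin> set ?w"
    "(\<forall>b \<in> set B. sm \<phi> b = 0) \<Longrightarrow> sm \<phi> ?w = sm \<phi> u" using fold_reduce_by[OF B u, of \<phi>] by auto
  have ins: "insert_vec B u = (if ?w = [] then B else B @ [?w])"
    by (simp add: insert_vec_def split: list.split)
  show "echelon X (insert_vec B u)" unfolding ins echelon_def
    using B w(1-3) by (auto simp: echelon_def nth_append less_Suc_eq)
  show "(\<exists>b \<in> set (insert_vec B u). sm \<phi> b = 1) \<longleftrightarrow> (\<exists>b \<in> set B. sm \<phi> b = 1) \<or> sm \<phi> u = 1"
  proof (cases "\<exists>b \<in> set B. sm \<phi> b = 1")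
    case False
    then have "\<forall>b \<in> set B. sm \<phi> b = 0" by (metis bit_not_one_iff)
    from w(4)[OF this] show ?thesis using False unfolding ins by (cases "?w = []") auto
  qed (auto simp: ins)
qed

lemma sz_vectors_le:
  assumes "finite X" "\<And>x. x \<in> X \<Longrightarrow> sz x \<le> s" "\<And>u. u \<in> set B \<Longrightarrow> distinct u \<and> set u \<subseteq> X" "length B \<le> l"
  shows "sz B \<le> l * Suc (card X * Suc s)"
proof (rule sz_list_le[OF _ assms(4)])
  fix u assume "u \<in> set B"
  then have u: "distinct u" "set u \<subseteq> X" using assms(3) by auto
  show "sz u \<le> card X * Suc s"
    by (rule sz_list_le) (use u assms(2) length_le_card_distinct[OF u assms(1)] in auto)
qed

lemma reduce_correct:
  assumes X: "finite X" "\<And>x. x \<in> X \<Longrightarrow> sz x \<le> s" and p: "card X * Suc (card X * Suc s) \<le> p"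
    and T: "\<And>u. u \<in> set T \<Longrightarrow> set u \<subseteq> X"
  shows "(\<exists>u \<in> set (reduce p T). sm \<phi> u = 1) \<longleftrightarrow> (\<exists>u \<in> set T. sm \<phi> u = 1)"
    and "\<And>u. u \<in> set (reduce p T) \<Longrightarrow> distinct u \<and> set u \<subseteq> X"
    and "length (reduce p T) \<le> card X" "sz (reduce p T) \<le> p"
proof -
  let ?f = "\<lambda>u B. clip p [] (insert_vec B (compress u))"
  have clip: "clip p [] B = B \<and> sz B \<le> p" if "echelon X B" for B
  proof -
    have "sz B \<le> card X * Suc (card X * Suc s)"
      by (rule sz_vectors_le[OF X _ echelon_length[OF that X(1)]]) (use that in \<open>auto simp: echelon_def\<close>)
    then show ?thesis using p by (simp add: clip_id)
  qed
  have "echelon X (fold ?f us B) \<and>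
      (\<forall>\<phi>. (\<exists>b \<in> set (fold ?f us B). sm \<phi> b = 1) \<longleftrightarrow> (\<exists>b \<in> set B. sm \<phi> b = 1) \<or> (\<exists>u \<in> set us. sm \<phi> u = 1))"
    if "echelon X B" "\<And>u. u \<in> set us \<Longrightarrow> set u \<subseteq> X" for us B
    using that
  proof (induction us arbitrary: B)
    case (Cons u us)
    have u: "distinct (compress u)" "set (compress u) \<subseteq> X" using compress(2,3)[of u] Cons.prems(2)[of u] by auto
    note ins = insert_vec_props[OF Cons.prems(1) u]
    have eq: "?f u B = insert_vec B (compress u)" using clip[OF ins(1)] by simp
    have IH: "echelon X (fold ?f us (?f u B)) \<and>
      (\<forall>\<phi>. (\<exists>b \<in> set (fold ?f us (?f u B)). sm \<phi> b = 1) \<longleftrightarrow>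
        (\<exists>b \<in> set (?f u B). sm \<phi> b = 1) \<or> (\<exists>u \<in> set us. sm \<phi> u = 1))"
      by (rule Cons.IH) (use ins(1) Cons.prems(2) eq in auto)
    have fold_Cons: "fold ?f (u # us) B = fold ?f us (?f u B)" by simp
    show ?case unfolding fold_Cons using IH unfolding eq ins(2) compress(1) by auto
  qed simp
  from this[of "[]" T] have R: "echelon X (reduce p T)"
    "\<And>\<phi>. (\<exists>b \<in> set (reduce p T). sm \<phi> b = 1) \<longleftrightarrow> (\<exists>u \<in> set T. sm \<phi> u = 1)"
    using T by (auto simp: reduce_def echelon_def)
  show "(\<exists>u \<in> set (reduce p T). sm \<phi> u = 1) \<longleftrightarrow> (\<exists>u \<in> set T. sm \<phi> u = 1)" by (rule R(2))
  show "u \<in> set (reduce p T) \<Longrightarrow> distinct u \<and> set u \<subseteq> X" for u using R(1) by (auto simp: echelon_def)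
  show "length (reduce p T) \<le> card X" by (rule echelon_length[OF R(1) X(1)])
  show "sz (reduce p T) \<le> p" using clip[OF R(1)] by simp
qed

section \<open>Partial solutions and their vectors\<close>

text \<open>A partial solution consists of a set \<open>F\<close> of already decided vertices kept in the forest, a set
  \<open>R \<subseteq> F\<close> of roots, and the kept part \<open>S\<close> of the boundary. It stands for the sum of its coordinates
  over all colourings of \<open>F \<union> S\<close> with two colours that are constant along edges at \<open>F\<close> and give all
  roots the colour \<open>False\<close>. Without boundary the number of these colourings is odd iff every component
  of \<open>F\<close> contains a root; if moreover edges and roots together are as many as the vertices, then \<open>F\<close>
  is a forest with one root per component.\<close>

type_synonym coord = "nat \<times> nat \<times> (nat \<times> bool) list"

text \<open>Working from the back yields sublists in the order of \<open>U\<close>. A new vertex is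
  added to a set only where it closes no triangle.\<close>

definition tf_sets :: "nat \<Rightarrow> bool list list \<Rightarrow> nat list \<Rightarrow> nat list list" where
  "tf_sets p m U = fold (\<lambda>v acc. clip p [] (acc @ map (\<lambda>S. v # S)
     (filter (\<lambda>S. \<not> (\<exists>a \<in> set S. \<exists>b \<in> set S. edge m a b \<and> edge m v a \<and> edge m v b)) acc))) (rev U) [[]]"

definition colourings :: "nat \<Rightarrow> nat list \<Rightarrow> (nat \<times> bool) list list" where
  "colourings p S = fold (\<lambda>s acc. clip p [] (map (\<lambda>\<sigma>. (s, True) # \<sigma>) acc @ map (\<lambda>\<sigma>. (s, False) # \<sigma>) acc)) (rev S) [[]]"

text \<open>The vectors of the partial solutions in which nothing has been decided yet: one for each
  triangle-free part of the boundary, with all its colourings.\<close>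

definition start_vectors :: "nat \<Rightarrow> bool list list \<Rightarrow> nat list \<Rightarrow> coord list list" where
  "start_vectors p m U = map (\<lambda>S. map (\<lambda>\<sigma>. (0, 0, \<sigma>)) (colourings p S)) (tf_sets p m U)"

text \<open>The second vector lives on the smaller boundary \<open>W\<close>. Its colouring must be
  the restriction of the first one, which also forces the kept boundary vertices to agree.\<close>

definition join_vec :: "nat list \<Rightarrow> coord list \<Rightarrow> coord list \<Rightarrow> coord list" where
  "join_vec W u w = concat (map (\<lambda>c. map (\<lambda>d. (fst c + fst d, fst (snd c) + fst (snd d), snd (snd c)))
     (filter (\<lambda>d. snd (snd d) = filter (\<lambda>e. fst e \<in> set W) (snd (snd c))) w)) u)"

definition forget_out :: "nat \<Rightarrow> coord list \<Rightarrow> coord list" where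
  "forget_out v u = filter (\<lambda>c. v \<notin> set (map fst (snd (snd c)))) u"

definition forget_cond :: "bool list list \<Rightarrow> nat \<Rightarrow> coord \<Rightarrow> bool" where
  "forget_cond m v c \<longleftrightarrow> (\<exists>e \<in> set (snd (snd c)). fst e = v \<and>
     (\<forall>e' \<in> set (snd (snd c)). edge m v (fst e') \<longrightarrow> snd e' = snd e))"

text \<open>Edges from \<open>v\<close> to kept boundary vertices are counted now; those to decided
  vertices were counted when the latter were forgotten. The number \<open>r\<close> is 1 if
  \<open>v\<close> becomes a root.\<close>

definition forget_map :: "bool list list \<Rightarrow> nat \<Rightarrow> nat \<Rightarrow> coord \<Rightarrow> coord" where
  "forget_map m v r c = (Suc (fst c), fst (snd c) + length (filter (\<lambda>e. edge m v (fst e)) (snd (snd c))) + r,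
     filter (\<lambda>e. fst e \<noteq> v) (snd (snd c)))"

definition forget_in :: "bool list list \<Rightarrow> nat \<Rightarrow> coord list \<Rightarrow> coord list" where
  "forget_in m v u = map (forget_map m v 0) (filter (forget_cond m v) u)"

definition forget_root :: "bool list list \<Rightarrow> nat \<Rightarrow> coord list \<Rightarrow> coord list" where
  "forget_root m v u = map (forget_map m v 1) (filter (\<lambda>c. forget_cond m v c \<and> (v, False) \<in> set (snd (snd c))) u)"

lemma ptime_start_vectors [pt]:
  assumes "ptime p" "ptime m" "ptime U" shows "ptime (\<lambda>x. start_vectors (p x) (m x) (U x))"
proof -
  have tf: "ptime (\<lambda>x. tf_sets (p x) (m x) (U x))"
    unfolding tf_sets_def by (intro pt assms assms[THEN feasible_compose])
  have col: "ptime (\<lambda>x. colourings (p x) (S x))" if "ptime p" "ptime S" for p :: "'y::enc \<Rightarrow> _" and S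
    unfolding colourings_def by (intro pt that that[THEN feasible_compose])
  show ?thesis unfolding start_vectors_def by (intro pt tf col assms assms[THEN feasible_compose])
qed

lemma ptime_join_vec [pt]:
  assumes "ptime W" "ptime u" "ptime w" shows "ptime (\<lambda>x. join_vec (W x) (u x) (w x))"
  unfolding join_vec_def by (intro pt assms assms[THEN feasible_compose])

lemma ptime_forget_out [pt]:
  assumes "ptime v" "ptime u" shows "ptime (\<lambda>x. forget_out (v x) (u x))"
  unfolding forget_out_def by (intro pt assms assms[THEN feasible_compose])

lemma ptime_forget [pt]:
  assumes "ptime m" "ptime v" "ptime u"
  shows "ptime (\<lambda>x. forget_in (m x) (v x) (u x))" "ptime (\<lambda>x. forget_root (m x) (v x) (u x))"
proof -
  have c: "ptime (\<lambda>x. forget_cond (m x) (v x) (c x))" if "ptime m" "ptime v" "ptime c"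
    for m :: "'y::enc \<Rightarrow> _" and v c
    unfolding forget_cond_def by (intro pt that that[THEN feasible_compose])
  have f: "ptime (\<lambda>x. forget_map (m x) (v x) r (c x))" if "ptime m" "ptime v" "ptime c"
    for m :: "'y::enc \<Rightarrow> _" and v c r
    unfolding forget_map_def by (intro pt that that[THEN feasible_compose])
  show "ptime (\<lambda>x. forget_in (m x) (v x) (u x))" "ptime (\<lambda>x. forget_root (m x) (v x) (u x))"
    unfolding forget_in_def forget_root_def by (intro pt c f assms assms[THEN feasible_compose])+
qed

text \<open>A colouring is given by the set \<open>X\<close> of vertices of colour
  \<open>True\<close>. Edges inside \<open>S\<close> impose nothing yet; they take effect when one
  of their ends is forgotten.\<close>

definition colour_sets :: "bool list list \<Rightarrow> nat set \<Rightarrow> nat set \<Rightarrow> nat set \<Rightarrow> nat set set" where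
  "colour_sets m F R S = {X. X \<subseteq> F \<union> S \<and> X \<inter> R = {} \<and>
     (\<forall>u \<in> F. \<forall>w \<in> F \<union> S. edge m u w \<longrightarrow> (u \<in> X \<longleftrightarrow> w \<in> X))}"

text \<open>Each edge appears once, smaller end first. Edges with both ends in the boundary are left
  to the moment when one end is forgotten.\<close>

definition edge_set :: "bool list list \<Rightarrow> nat set \<Rightarrow> nat set \<Rightarrow> (nat \<times> nat) set" where
  "edge_set m F S = {e. fst e < snd e \<and> edge m (fst e) (snd e) \<and> fst e \<in> F \<union> S \<and> snd e \<in> F \<union> S \<and>
     (fst e \<in> F \<or> snd e \<in> F)}"

definition sublist_of :: "bool list list \<Rightarrow> nat set \<Rightarrow> nat list" where
  "sublist_of m S = filter (\<lambda>u. u \<in> S) [0..<length m]"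

text \<open>The ascending order of the vertices makes equality of coordinates the same as equality
  of boundary colourings.\<close>

definition tag :: "bool list list \<Rightarrow> nat set \<Rightarrow> nat set \<Rightarrow> (nat \<times> bool) list" where
  "tag m S X = map (\<lambda>s. (s, s \<in> X)) (sublist_of m S)"

definition coord_of :: "bool list list \<Rightarrow> nat set \<Rightarrow> nat set \<Rightarrow> nat set \<Rightarrow> nat set \<Rightarrow> coord" where
  "coord_of m F R S X = (card F, card (edge_set m F S) + card R, tag m S X)"

definition val :: "bool list list \<Rightarrow> (coord \<Rightarrow> bit) \<Rightarrow> nat set \<Rightarrow> nat set \<Rightarrow> nat set \<Rightarrow> bit" where
  "val m \<phi> F R S = (\<Sum>X \<in> colour_sets m F R S. \<phi> (coord_of m F R S X))"

text \<open>The local substitute for acyclicity: it passes to subsets, can be checked separately in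
  the parts of a join, follows from acyclicity, and limits the trace on a clique to two
  vertices.\<close>

definition tfree :: "bool list list \<Rightarrow> nat set \<Rightarrow> bool" where
  "tfree m T \<longleftrightarrow> \<not> (\<exists>a \<in> T. \<exists>b \<in> T. \<exists>c \<in> T. edge m a b \<and> edge m a c \<and> edge m b c)"

definition partials :: "bool list list \<Rightarrow> nat set \<Rightarrow> nat set \<Rightarrow> nat set \<Rightarrow> (nat set \<times> nat set \<times> nat set) set" where
  "partials m A D W = {(F, R, S). F \<subseteq> D \<inter> A \<and> R \<subseteq> F \<and> S \<subseteq> W \<inter> A \<and> tfree m (F \<union> S)}"

text \<open>Equality of spans. A table may thus be replaced by a basis, and since joins are bilinear
  and forgetting is linear, they may be applied to basis vectors instead of partial
  solutions.\<close>

definition represents :: "bool list list \<Rightarrow> nat set \<Rightarrow> nat set \<Rightarrow> nat set \<Rightarrow> coord list list \<Rightarrow> bool" where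
  "represents m A D W T \<longleftrightarrow> (\<forall>\<phi>. (\<exists>u \<in> set T. sm \<phi> u = 1) \<longleftrightarrow> (\<exists>(F, R, S) \<in> partials m A D W. val m \<phi> F R S = 1))"

section \<open>Correctness of starting, joining and forgetting\<close>

lemma set_sublist_of: "S \<subseteq> {..<length m} \<Longrightarrow> set (sublist_of m S) = S"
  by (auto simp: sublist_of_def)

lemma distinct_sublist_of [simp]: "distinct (sublist_of m S)"
  by (simp add: sublist_of_def)

lemma tag_fst [simp]: "map fst (tag m S X) = sublist_of m S"
  by (simp add: tag_def comp_def)

lemma filter_tag: "filter (\<lambda>e. fst e \<in> W) (tag m S X) = tag m (S \<inter> W) X"
  by (simp add: tag_def filter_map comp_def sublist_of_def)

lemma filter_tag_neq: "filter (\<lambda>e. fst e \<noteq> v) (tag m S X) = tag m (S - {v}) X"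
proof -
  have "S \<inter> - {v} = S - {v}" by blast
  then show ?thesis using filter_tag[of "- {v}" m S X] by simp
qed

lemma tag_eq_iff:
  assumes "S \<subseteq> {..<length m}" "S' \<subseteq> {..<length m}"
  shows "tag m S X = tag m S' X' \<longleftrightarrow> S = S' \<and> X \<inter> S = X' \<inter> S"
proof
  assume eq: "tag m S X = tag m S' X'"
  then have "sublist_of m S = sublist_of m S'" by (metis tag_fst)
  then have S: "S = S'" using set_sublist_of assms by metis
  have "s \<in> X \<longleftrightarrow> s \<in> X'" if "s \<in> S" for s
    using eq that set_sublist_of[OF assms(1)] unfolding tag_def S by (auto simp: map_eq_conv)
  then show "S = S' \<and> X \<inter> S = X' \<inter> S" using S by auto
next
  assume *: "S = S' \<and> X \<inter> S = X' \<inter> S"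
  then have "s \<in> X \<longleftrightarrow> s \<in> X'" if "s \<in> set (sublist_of m S)" for s
    using that set_sublist_of[OF assms(1)] by auto
  then show "tag m S X = tag m S' X'" using * by (auto simp: tag_def)
qed

lemma finite_colour_sets: "finite F \<Longrightarrow> finite S \<Longrightarrow> finite (colour_sets m F R S)"
  by (rule finite_subset[of _ "Pow (F \<union> S)"]) (auto simp: colour_sets_def)

text \<open>Exchanges the two summations, so that one argument of a bilinear form can be frozen
  while the other is treated as a vector.\<close>

lemma val_sm: "val m (\<lambda>c. sm (f c) w) F R S = sm (\<lambda>d. val m (\<lambda>c. f c d) F R S) w"
  unfolding val_def by (simp add: sm_sum)

lemma tf_sets_correct:
  assumes L: "distinct L" "set L \<subseteq> {..<n}"
    and p: "card {S. S \<subseteq> set L \<and> tfree m S} * Suc (n * Suc n) \<le> p"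
    and und: "undirected (edge m)"
  shows "set (tf_sets p m L) = (\<lambda>S. filter (\<lambda>u. u \<in> S) L) ` {S. S \<subseteq> set L \<and> tfree m S} \<and> distinct (tf_sets p m L)"
  using L p
proof (induction L)
  case Nil
  have "{S. S = {} \<and> tfree m S} = {{}}" by (auto simp: tfree_def)
  then show ?case by (simp add: tf_sets_def)
next
  case (Cons v L)
  interpret undirected "edge m" by (rule und)
  let ?T = "\<lambda>L. {S. S \<subseteq> set L \<and> tfree m S}"
  have finT: "finite (?T L)" for L by (rule finite_subset[of _ "Pow (set L)"]) auto
  have vL: "v \<notin> set L" "distinct L" "set L \<subseteq> {..<n}" using Cons.prems by auto
  have "card (?T L) \<le> card (?T (v # L))" by (intro card_mono finT) auto
  then have "card (?T L) * Suc (n * Suc n) \<le> p" using Cons.prems(3) by (meson le_trans mult_le_mono1)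
  then have IH: "set (tf_sets p m L) = (\<lambda>S. filter (\<lambda>u. u \<in> S) L) ` ?T L" "distinct (tf_sets p m L)"
    using Cons.IH vL by auto
  let ?P = "\<lambda>S. \<not> (\<exists>a \<in> set S. \<exists>b \<in> set S. edge m a b \<and> edge m v a \<and> edge m v b)"
  let ?new = "tf_sets p m L @ map (\<lambda>S. v # S) (filter ?P (tf_sets p m L))"
  have setf: "set (filter (\<lambda>u. u \<in> S) L) = S" if "S \<subseteq> set L" for S using that by auto
  have tf_insert: "tfree m (insert v S) \<longleftrightarrow> tfree m S \<and> \<not> (\<exists>a \<in> S. \<exists>b \<in> S. edge m a b \<and> edge m v a \<and> edge m v b)" for S
    unfolding tfree_def using sym irrefl by blast
  have eqL: "filter (\<lambda>u. u \<in> S) (v # L) = filter (\<lambda>u. u \<in> S) L" if "S \<subseteq> set L" for S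
    using that vL by auto
  have eqv: "filter (\<lambda>u. u \<in> insert v S) (v # L) = v # filter (\<lambda>u. u \<in> S) L" if "S \<subseteq> set L" for S
  proof -
    have "filter (\<lambda>u. u = v \<or> u \<in> S) L = filter (\<lambda>u. u \<in> S) L" using vL by (intro filter_cong) auto
    then show ?thesis by simp
  qed
  have split: "?T (v # L) = ?T L \<union> insert v ` {S \<in> ?T L. tfree m (insert v S)}"
  proof
    show "?T (v # L) \<subseteq> ?T L \<union> insert v ` {S \<in> ?T L. tfree m (insert v S)}"
    proof
      fix S assume S: "S \<in> ?T (v # L)"
      show "S \<in> ?T L \<union> insert v ` {S \<in> ?T L. tfree m (insert v S)}"
      proof (cases "v \<in> S")
        case True
        then have "S = insert v (S - {v})" by auto
        moreover have "tfree m (S - {v})" using S by (auto simp: tfree_def)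
        ultimately have "S - {v} \<in> {S \<in> ?T L. tfree m (insert v S)}" using S by auto
        then show ?thesis using \<open>S = insert v (S - {v})\<close> by blast
      next
        case False
        then show ?thesis using S by auto
      qed
    qed
  qed auto
  have set_new: "set ?new = (\<lambda>S. filter (\<lambda>u. u \<in> S) (v # L)) ` ?T (v # L)"
  proof -
    have 1: "(\<lambda>S. filter (\<lambda>u. u \<in> S) (v # L)) ` ?T L = set (tf_sets p m L)"
      unfolding IH(1) by (rule image_cong[OF refl]) (use eqL in blast)
    have 2: "(\<lambda>S. filter (\<lambda>u. u \<in> S) (v # L)) ` insert v ` {S \<in> ?T L. tfree m (insert v S)} =
       (\<lambda>S. v # S) ` {S \<in> set (tf_sets p m L). ?P S}"
    proof -
      have a: "{S \<in> set (tf_sets p m L). ?P S} = (\<lambda>S. filter (\<lambda>u. u \<in> S) L) ` {S \<in> ?T L. tfree m (insert v S)}"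
      proof -
        have "?P (filter (\<lambda>u. u \<in> S) L) \<longleftrightarrow> tfree m (insert v S)" if "S \<in> ?T L" for S
        proof -
          have S: "S \<subseteq> set L" "tfree m S" using that by auto
          show ?thesis unfolding setf[OF S(1)] tf_insert by (simp only: S(2) simp_thms)
        qed
        then have "{S \<in> ?T L. ?P (filter (\<lambda>u. u \<in> S) L)} = {S \<in> ?T L. tfree m (insert v S)}" by blast
        moreover have "{S \<in> (\<lambda>S. filter (\<lambda>u. u \<in> S) L) ` ?T L. ?P S} = (\<lambda>S. filter (\<lambda>u. u \<in> S) L) ` {S \<in> ?T L. ?P (filter (\<lambda>u. u \<in> S) L)}"
          by blast
        ultimately show ?thesis unfolding IH(1) by (simp only:)
      qed
      show ?thesis unfolding a image_image
        by (rule image_cong[OF refl]) (use eqv in blast)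
    qed
    show ?thesis unfolding split image_Un 1 2 by auto
  qed
  have dist: "distinct ?new"
  proof -
    have "v \<notin> set S" if "S \<in> set (tf_sets p m L)" for S using that vL unfolding IH(1) by auto
    then have "v # S \<notin> set (tf_sets p m L)" for S by (metis list.set_intros(1))
    then show ?thesis using IH(2) by (auto simp: distinct_map inj_on_def)
  qed
  have "sz ?new \<le> card (?T (v # L)) * Suc (n * Suc n)"
  proof (rule sz_list_le)
    have "length ?new = card (set ?new)" using dist by (simp only: distinct_card)
    also have "\<dots> \<le> card (?T (v # L))" unfolding set_new by (intro card_image_le finT)
    finally show "length ?new \<le> card (?T (v # L))" .
    fix S assume "S \<in> set ?new"
    then obtain S' where "S = filter (\<lambda>u. u \<in> S') (v # L)" unfolding set_new by blast
    then show "sz S \<le> n * Suc n" using Cons.prems by (intro sz_nat_list_le) auto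
  qed
  then have "clip p [] ?new = ?new" using Cons.prems(3) by (intro clip_id) simp
  moreover have "tf_sets p m (v # L) = clip p [] ?new" by (simp add: tf_sets_def)
  ultimately show ?case using set_new dist by simp
qed

lemma colourings_correct:
  assumes S: "distinct S" "set S \<subseteq> {..<n}" and p: "2 ^ length S * Suc (n * (n + 2)) \<le> p"
  shows "length (colourings p S) = 2 ^ length S \<and>
    (\<forall>\<sigma> \<in> set (colourings p S). \<exists>X \<subseteq> set S. \<sigma> = map (\<lambda>s. (s, s \<in> X)) S) \<and>
    (\<forall>\<phi>. sm \<phi> (colourings p S) = (\<Sum>X \<in> Pow (set S). \<phi> (map (\<lambda>s. (s, s \<in> X)) S)))"
  using S p
proof (induction S)
  case Nil
  show ?case by (simp add: colourings_def)
next
  case (Cons s S)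
  have "2 ^ length S * Suc (n * (n + 2)) \<le> p"
    by (rule order.trans[OF _ Cons.prems(3)]) (intro mult_le_mono1 power_increasing; simp)
  then have IH: "length (colourings p S) = 2 ^ length S"
    "\<And>\<sigma>. \<sigma> \<in> set (colourings p S) \<Longrightarrow> \<exists>X \<subseteq> set S. \<sigma> = map (\<lambda>s. (s, s \<in> X)) S"
    "\<And>\<phi>. sm \<phi> (colourings p S) = (\<Sum>X \<in> Pow (set S). \<phi> (map (\<lambda>s. (s, s \<in> X)) S))"
    using Cons by auto
  have sS: "s \<notin> set S" using Cons.prems by simp
  let ?c = "colourings p S"
  let ?new = "map (\<lambda>\<sigma>. (s, True) # \<sigma>) ?c @ map (\<lambda>\<sigma>. (s, False) # \<sigma>) ?c"
  have T: "map (\<lambda>x. (x, x \<in> insert s X)) (s # S) = (s, True) # map (\<lambda>s. (s, s \<in> X)) S" for X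
    using sS by auto
  have Fa: "map (\<lambda>x. (x, x \<in> X)) (s # S) = (s, False) # map (\<lambda>s. (s, s \<in> X)) S" if "X \<subseteq> set S" for X
    using sS that by auto
  have el: "\<exists>X \<subseteq> set (s # S). \<sigma> = map (\<lambda>s. (s, s \<in> X)) (s # S)" if sig: "\<sigma> \<in> set ?new" for \<sigma>
  proof -
    consider \<tau> where "\<tau> \<in> set ?c" "\<sigma> = (s, True) # \<tau>" | \<tau> where "\<tau> \<in> set ?c" "\<sigma> = (s, False) # \<tau>"
      using sig by auto
    then show ?thesis
    proof cases
      case (1 \<tau>)
      then obtain X where X: "X \<subseteq> set S" "\<tau> = map (\<lambda>s. (s, s \<in> X)) S" using IH(2) by blast
      show ?thesis by (rule exI[of _ "insert s X"]) (use X 1 T[of X] in auto)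
    next
      case (2 \<tau>)
      then obtain X where X: "X \<subseteq> set S" "\<tau> = map (\<lambda>s. (s, s \<in> X)) S" using IH(2) by blast
      show ?thesis by (rule exI[of _ X]) (use X 2 Fa[of X] in auto)
    qed
  qed
  have "sz ?new \<le> 2 ^ length (s # S) * Suc (n * (n + 2))"
  proof (rule sz_list_le)
    fix \<sigma> assume "\<sigma> \<in> set ?new"
    then obtain X where \<sigma>: "\<sigma> = map (\<lambda>s. (s, s \<in> X)) (s # S)" using el by blast
    have "sz \<sigma> \<le> n * Suc (n + 1)"
    proof (rule sz_list_le)
      show "length \<sigma> \<le> n" using length_le_card_distinct[OF Cons.prems(1,2)] by (simp add: \<sigma>)
      fix e assume "e \<in> set \<sigma>"
      then obtain x where "e = (x, x \<in> X)" "x < n" using Cons.prems(2) unfolding \<sigma> by auto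
      then show "sz e \<le> n + 1" using sz_bool_le[of "x \<in> X"] by simp
    qed
    then show "sz \<sigma> \<le> n * (n + 2)" by simp
  qed (simp add: IH(1))
  then have "clip p [] ?new = ?new" using Cons.prems(3) by (intro clip_id) simp
  then have new: "colourings p (s # S) = ?new" by (simp add: colourings_def)
  have "sm \<phi> ?new = (\<Sum>X \<in> Pow (set (s # S)). \<phi> (map (\<lambda>s. (s, s \<in> X)) (s # S)))" for \<phi>
  proof -
    have Pow: "Pow (set (s # S)) = insert s ` Pow (set S) \<union> Pow (set S)" by (auto simp: Pow_insert)
    have inj: "inj_on (insert s) (Pow (set S))"
      using sS by (intro inj_onI) (metis Pow_iff insert_ident subsetD)
    have "(\<Sum>X \<in> Pow (set (s # S)). \<phi> (map (\<lambda>s. (s, s \<in> X)) (s # S))) =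
       (\<Sum>X \<in> insert s ` Pow (set S). \<phi> (map (\<lambda>s. (s, s \<in> X)) (s # S))) +
       (\<Sum>X \<in> Pow (set S). \<phi> (map (\<lambda>s. (s, s \<in> X)) (s # S)))"
      unfolding Pow by (rule sum.union_disjoint) (use sS in auto)
    also have "(\<Sum>X \<in> insert s ` Pow (set S). \<phi> (map (\<lambda>s. (s, s \<in> X)) (s # S))) =
       (\<Sum>X \<in> Pow (set S). \<phi> ((s, True) # map (\<lambda>s. (s, s \<in> X)) S))"
      unfolding sum.reindex[OF inj] comp_def T ..
    also have "(\<Sum>X \<in> Pow (set S). \<phi> (map (\<lambda>s. (s, s \<in> X)) (s # S))) =
       (\<Sum>X \<in> Pow (set S). \<phi> ((s, False) # map (\<lambda>s. (s, s \<in> X)) S))"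
      by (rule sum.cong[OF refl]) (use Fa in auto)
    finally show ?thesis unfolding sm_simps(3) sm_map IH(3) by simp
  qed
  moreover have "length ?new = 2 ^ length (s # S)" by (simp add: IH(1))
  ultimately show ?case unfolding new using el by blast
qed

lemma represents_start:
  assumes und: "undirected (edge m)" and W: "W \<subseteq> {..<length m}"
    and p: "card {S. S \<subseteq> W \<inter> A \<and> tfree m S} * Suc (length m * Suc (length m)) \<le> p"
    and q: "\<And>S. S \<subseteq> W \<inter> A \<Longrightarrow> tfree m S \<Longrightarrow> 2 ^ card S * Suc (length m * (length m + 2)) \<le> p"
  shows "represents m A {} W (start_vectors p m (sublist_of m (W \<inter> A)))"
    and "\<And>u. u \<in> set (start_vectors p m (sublist_of m (W \<inter> A))) \<Longrightarrow>
       \<exists>S. S \<subseteq> W \<inter> A \<and> tfree m S \<and> set u \<subseteq> {(0, 0, tag m S X) | X. True}"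
proof -
  let ?L = "sublist_of m (W \<inter> A)"
  let ?T = "{S. S \<subseteq> W \<inter> A \<and> tfree m S}"
  have WA: "W \<inter> A \<subseteq> {..<length m}" using W by blast
  have setL: "set ?L = W \<inter> A" by (rule set_sublist_of[OF WA])
  have filt: "filter (\<lambda>u. u \<in> S) ?L = sublist_of m S" if "S \<subseteq> W \<inter> A" for S
    unfolding sublist_of_def filter_filter by (rule filter_cong) (use that in auto)
  have "set (tf_sets p m ?L) = (\<lambda>S. filter (\<lambda>u. u \<in> S) ?L) ` ?T"
    using tf_sets_correct[of ?L "length m" m p] und p WA unfolding setL by simp
  also have "\<dots> = sublist_of m ` ?T" by (rule image_cong[OF refl]) (use filt in blast)
  finally have tf: "set (tf_sets p m ?L) = sublist_of m ` ?T" .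
  have col: "length (colourings p (sublist_of m S)) = 2 ^ length (sublist_of m S) \<and>
    (\<forall>\<sigma> \<in> set (colourings p (sublist_of m S)). \<exists>X \<subseteq> set (sublist_of m S). \<sigma> = map (\<lambda>s. (s, s \<in> X)) (sublist_of m S)) \<and>
    (\<forall>\<phi>. sm \<phi> (colourings p (sublist_of m S)) = (\<Sum>X \<in> Pow (set (sublist_of m S)). \<phi> (map (\<lambda>s. (s, s \<in> X)) (sublist_of m S))))"
    if S: "S \<in> ?T" for S
  proof (rule colourings_correct)
    have sS: "set (sublist_of m S) = S" using S WA by (intro set_sublist_of) auto
    show "set (sublist_of m S) \<subseteq> {..<length m}" unfolding sS using S WA by auto
    have "length (sublist_of m S) = card S" using sS distinct_card[OF distinct_sublist_of] by metis
    then show "2 ^ length (sublist_of m S) * Suc (length m * (length m + 2)) \<le> p" using q S by auto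
  qed simp
  have smv: "sm \<phi> (map (\<lambda>\<sigma>. (0, 0, \<sigma>)) (colourings p (sublist_of m S))) = val m \<phi> {} {} S" if S: "S \<in> ?T" for \<phi> S
  proof -
    have sS: "set (sublist_of m S) = S" using S WA by (intro set_sublist_of) auto
    have "colour_sets m {} {} S = Pow S" by (auto simp: colour_sets_def)
    moreover have "edge_set m {} S = {}" by (auto simp: edge_set_def)
    ultimately show ?thesis using col[OF S] unfolding sm_map val_def coord_of_def tag_def sS by simp
  qed
  show "represents m A {} W (start_vectors p m ?L)"
    unfolding represents_def
  proof
    fix \<phi>
    have "(\<exists>u \<in> set (start_vectors p m ?L). sm \<phi> u = 1) \<longleftrightarrow> (\<exists>S \<in> ?T. val m \<phi> {} {} S = 1)"
      unfolding start_vectors_def set_map tf image_image using smv by auto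
    also have "\<dots> \<longleftrightarrow> (\<exists>(F, R, S) \<in> partials m A {} W. val m \<phi> F R S = 1)"
      by (auto simp: partials_def)
    finally show "(\<exists>u \<in> set (start_vectors p m ?L). sm \<phi> u = 1) \<longleftrightarrow> (\<exists>(F, R, S) \<in> partials m A {} W. val m \<phi> F R S = 1)" .
  qed
  fix u assume "u \<in> set (start_vectors p m ?L)"
  then obtain S where S: "S \<in> ?T" "u = map (\<lambda>\<sigma>. (0, 0, \<sigma>)) (colourings p (sublist_of m S))"
    unfolding start_vectors_def set_map tf by auto
  have "set u \<subseteq> {(0, 0, tag m S X) | X. True}" using col[OF S(1)] unfolding S(2) tag_def by fastforce
  then show "\<exists>S. S \<subseteq> W \<inter> A \<and> tfree m S \<and> set u \<subseteq> {(0, 0, tag m S X) | X. True}" using S(1) by blast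
qed

text \<open>As no edge joins \<open>F1\<close> to \<open>F2\<close> and all neighbours of
  \<open>F2\<close> in \<open>S\<close> are in \<open>S2\<close>, colourings of the union correspond
  to pairs of colourings that agree on \<open>S2\<close>. Each decided edge is counted on exactly
  one side.\<close>

lemma val_join:
  assumes und: "undirected (edge m)"
    and fin: "F1 \<union> F2 \<union> S \<subseteq> {..<length m}" and disj: "F1 \<inter> F2 = {}" "F1 \<inter> S = {}" "F2 \<inter> S = {}"
    and R: "R1 \<subseteq> F1" "R2 \<subseteq> F2"
    and far: "\<And>x y. x \<in> F1 \<Longrightarrow> y \<in> F2 \<Longrightarrow> \<not> edge m x y"
    and nb: "\<And>x y. x \<in> F2 \<Longrightarrow> y \<in> S \<Longrightarrow> edge m x y \<Longrightarrow> y \<in> S2" and S2: "S2 \<subseteq> S"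
  shows "(\<Sum>X \<in> colour_sets m F1 R1 S. \<Sum>Y \<in> colour_sets m F2 R2 S2.
      if X \<inter> S2 = Y \<inter> S2 then \<phi> (card F1 + card F2, card (edge_set m F1 S) + card R1 + (card (edge_set m F2 S2) + card R2), tag m S X) else 0)
    = val m \<phi> (F1 \<union> F2) (R1 \<union> R2) S"
proof -
  interpret undirected "edge m" by (rule und)
  have finite: "finite F1" "finite F2" "finite S" "finite S2"
    using fin S2 finite_subset[OF _ finite_lessThan] by (auto intro: finite_subset)
  let ?C1 = "colour_sets m F1 R1 S"
  let ?C2 = "colour_sets m F2 R2 S2"
  let ?C = "colour_sets m (F1 \<union> F2) (R1 \<union> R2) S"
  have finC: "finite ?C1" "finite ?C2" using finite by (auto intro: finite_colour_sets)
  have cardF: "card (F1 \<union> F2) = card F1 + card F2" using finite disj by (intro card_Un_disjoint) auto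
  have cardR: "card (R1 \<union> R2) = card R1 + card R2"
    using finite R disj by (intro card_Un_disjoint) (auto intro: finite_subset)
  have edges: "card (edge_set m (F1 \<union> F2) S) = card (edge_set m F1 S) + card (edge_set m F2 S2)"
  proof -
    have "edge_set m (F1 \<union> F2) S = edge_set m F1 S \<union> edge_set m F2 S2"
      using far nb S2 sym unfolding edge_set_def by blast
    moreover have "edge_set m F1 S \<inter> edge_set m F2 S2 = {}"
      using disj S2 far sym unfolding edge_set_def by blast
    moreover have "finite (edge_set m F1 S)" "finite (edge_set m F2 S2)"
      by (rule finite_subset[of _ "(F1 \<union> S) \<times> (F1 \<union> S)"], use finite in \<open>force simp: edge_set_def\<close>, use finite in simp)
        (rule finite_subset[of _ "(F2 \<union> S2) \<times> (F2 \<union> S2)"], use finite in \<open>force simp: edge_set_def\<close>, use finite in simp)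
    ultimately show ?thesis by (simp add: card_Un_disjoint)
  qed
  let ?P = "{(X, Y). X \<in> ?C1 \<and> Y \<in> ?C2 \<and> X \<inter> S2 = Y \<inter> S2}"
  let ?g = "\<lambda>X. \<phi> (coord_of m (F1 \<union> F2) (R1 \<union> R2) S X)"
  have "(\<Sum>X \<in> ?C1. \<Sum>Y \<in> ?C2. if X \<inter> S2 = Y \<inter> S2 then \<phi> (card F1 + card F2, card (edge_set m F1 S) + card R1 + (card (edge_set m F2 S2) + card R2), tag m S X) else 0)
     = (\<Sum>X \<in> ?C1. \<Sum>Y \<in> ?C2. if X \<inter> S2 = Y \<inter> S2 then ?g X else 0)"
    by (intro sum.cong refl) (simp add: coord_of_def cardF cardR edges ac_simps)
  also have "\<dots> = (\<Sum>z \<in> ?C1 \<times> ?C2. if fst z \<inter> S2 = snd z \<inter> S2 then ?g (fst z) else 0)"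
    by (simp add: sum.cartesian_product case_prod_beta)
  also have "\<dots> = (\<Sum>z \<in> ?P. ?g (fst z))"
  proof -
    have "?P = {z \<in> ?C1 \<times> ?C2. fst z \<inter> S2 = snd z \<inter> S2}" by auto
    then show ?thesis using finC by (simp add: sum.inter_filter)
  qed
  also have "\<dots> = (\<Sum>X \<in> ?C. ?g X)"
  proof (rule sum.reindex_bij_witness[where i = "\<lambda>X. (X \<inter> (F1 \<union> S), X \<inter> (F2 \<union> S2))" and j = "\<lambda>(X, Y). X \<union> Y"])
    fix z assume z: "z \<in> ?P"
    obtain X Y where XY: "z = (X, Y)" by force
    have X: "X \<subseteq> F1 \<union> S" "X \<inter> R1 = {}" "\<And>u w. u \<in> F1 \<Longrightarrow> w \<in> F1 \<union> S \<Longrightarrow> edge m u w \<Longrightarrow> (u \<in> X \<longleftrightarrow> w \<in> X)"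
      and Y: "Y \<subseteq> F2 \<union> S2" "Y \<inter> R2 = {}" "\<And>u w. u \<in> F2 \<Longrightarrow> w \<in> F2 \<union> S2 \<Longrightarrow> edge m u w \<Longrightarrow> (u \<in> Y \<longleftrightarrow> w \<in> Y)"
      and eq: "X \<inter> S2 = Y \<inter> S2" using z by (auto simp: XY colour_sets_def)
    have 1: "(X \<union> Y) \<inter> (F1 \<union> S) = X" "(X \<union> Y) \<inter> (F2 \<union> S2) = Y" using X(1) Y(1) eq disj S2 by blast+
    then show "((case z of (X, Y) \<Rightarrow> X \<union> Y) \<inter> (F1 \<union> S), (case z of (X, Y) \<Rightarrow> X \<union> Y) \<inter> (F2 \<union> S2)) = z"
      by (simp add: XY)
    have "u \<in> X \<union> Y \<longleftrightarrow> w \<in> X \<union> Y" if uw: "u \<in> F1 \<union> F2" "w \<in> F1 \<union> F2 \<union> S" "edge m u w" for u w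
    proof (cases "u \<in> F1")
      case True
      then have "w \<in> F1 \<union> S" using uw far by blast
      then show ?thesis using X(3)[OF True _ uw(3)] 1 True by blast
    next
      case False
      then have u: "u \<in> F2" using uw by blast
      then have "w \<in> F2 \<union> S2" using uw far sym nb by blast
      then show ?thesis using Y(3)[OF u _ uw(3)] 1 u by blast
    qed
    moreover have "X \<union> Y \<subseteq> F1 \<union> F2 \<union> S" using X(1) Y(1) S2 by blast
    moreover have "(X \<union> Y) \<inter> (R1 \<union> R2) = {}" using X(1,2) Y(1,2) R disj S2 by blast
    ultimately show "(case z of (X, Y) \<Rightarrow> X \<union> Y) \<in> ?C" by (simp add: XY colour_sets_def)
    have "tag m S (X \<union> Y) = tag m S X"
      using fin 1(1) by (subst tag_eq_iff) blast+
    then show "?g (case z of (X, Y) \<Rightarrow> X \<union> Y) = ?g (fst z)" by (simp add: XY coord_of_def)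
  next
    fix X assume X: "X \<in> ?C"
    then have X1: "X \<subseteq> F1 \<union> F2 \<union> S" "X \<inter> (R1 \<union> R2) = {}"
      "\<And>u w. u \<in> F1 \<union> F2 \<Longrightarrow> w \<in> F1 \<union> F2 \<union> S \<Longrightarrow> edge m u w \<Longrightarrow> (u \<in> X \<longleftrightarrow> w \<in> X)"
      by (auto simp: colour_sets_def)
    show "(case (X \<inter> (F1 \<union> S), X \<inter> (F2 \<union> S2)) of (X, Y) \<Rightarrow> X \<union> Y) = X" using X1(1) S2 by auto
    have "X \<inter> (F1 \<union> S) \<in> ?C1" unfolding colour_sets_def using X1(2,3) by auto
    moreover have "X \<inter> (F2 \<union> S2) \<in> ?C2" unfolding colour_sets_def using X1(2,3) S2 by auto
    moreover have "X \<inter> (F1 \<union> S) \<inter> S2 = X \<inter> (F2 \<union> S2) \<inter> S2" using S2 by blast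
    ultimately show "(X \<inter> (F1 \<union> S), X \<inter> (F2 \<union> S2)) \<in> ?P" by simp
  qed
  finally show ?thesis by (simp add: val_def)
qed

text \<open>A functional applied to a join is a bilinear form \<open>\<Phi>\<close> of the two
  vectors. With one vector fixed it is a functional of the other, so the two tables can be exchanged
  for their partial solutions one after the other.\<close>

lemma represents_join:
  assumes und: "undirected (edge m)"
    and T1: "represents m A D1 W1 T1" and T2: "represents m A D2 (set Wl) T2"
    and sub: "D1 \<union> D2 \<union> W1 \<subseteq> {..<length m}" "set Wl \<subseteq> W1"
    and disj: "D1 \<inter> D2 = {}" "D1 \<inter> W1 = {}" "D2 \<inter> W1 = {}"
    and far: "\<And>x y. x \<in> D1 \<Longrightarrow> y \<in> D2 \<Longrightarrow> \<not> edge m x y"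
    and nb: "\<And>x y. x \<in> D2 \<Longrightarrow> y \<in> W1 \<Longrightarrow> edge m x y \<Longrightarrow> y \<in> set Wl"
  shows "represents m A (D1 \<union> D2) W1 (concat (map (\<lambda>u. map (\<lambda>w. join_vec Wl u w) T2) T1))"
  unfolding represents_def
proof
  fix \<phi> :: "coord \<Rightarrow> bit"
  interpret undirected "edge m" by (rule und)
  define \<Phi> where "\<Phi> c d = (if snd (snd d) = filter (\<lambda>e. fst e \<in> set Wl) (snd (snd c))
     then \<phi> (fst c + fst d, fst (snd c) + fst (snd d), snd (snd c)) else 0)" for c d :: coord
  have sm_join: "sm \<phi> (join_vec Wl u w) = sm (\<lambda>c. sm (\<Phi> c) w) u" for u w
    unfolding join_vec_def sm_concat_map sm_map sm_filter \<Phi>_def ..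
  have pair: "val m (\<lambda>d. val m (\<lambda>c. \<Phi> c d) F1 R1 S1) F2 R2 S2 =
      (if S2 = S1 \<inter> set Wl then val m \<phi> (F1 \<union> F2) (R1 \<union> R2) S1 else 0)"
    if 1: "(F1, R1, S1) \<in> partials m A D1 W1" and 2: "(F2, R2, S2) \<in> partials m A D2 (set Wl)" for F1 R1 S1 F2 R2 S2
  proof -
    have p1: "F1 \<subseteq> D1" "R1 \<subseteq> F1" "S1 \<subseteq> W1" and p2: "F2 \<subseteq> D2" "R2 \<subseteq> F2" "S2 \<subseteq> set Wl"
      using 1 2 by (auto simp: partials_def)
    have S: "S2 \<subseteq> {..<length m}" "S1 \<inter> set Wl \<subseteq> {..<length m}" using p1 p2 sub by blast+
    have \<Phi>: "\<Phi> (coord_of m F1 R1 S1 X) (coord_of m F2 R2 S2 Y) =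
       (if S2 = S1 \<inter> set Wl \<and> X \<inter> S2 = Y \<inter> S2 then \<phi> (card F1 + card F2,
          card (edge_set m F1 S1) + card R1 + (card (edge_set m F2 S2) + card R2), tag m S1 X) else 0)" for X Y
      unfolding \<Phi>_def coord_of_def fst_conv snd_conv filter_tag tag_eq_iff[OF S] by auto
    have "val m (\<lambda>d. val m (\<lambda>c. \<Phi> c d) F1 R1 S1) F2 R2 S2 =
      (\<Sum>Y \<in> colour_sets m F2 R2 S2. \<Sum>X \<in> colour_sets m F1 R1 S1. \<Phi> (coord_of m F1 R1 S1 X) (coord_of m F2 R2 S2 Y))"
      by (simp add: val_def)
    also have "\<dots> = (\<Sum>X \<in> colour_sets m F1 R1 S1. \<Sum>Y \<in> colour_sets m F2 R2 S2. \<Phi> (coord_of m F1 R1 S1 X) (coord_of m F2 R2 S2 Y))"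
      by (rule sum.swap)
    finally have eq: "val m (\<lambda>d. val m (\<lambda>c. \<Phi> c d) F1 R1 S1) F2 R2 S2 = \<dots>" .
    show ?thesis
    proof (cases "S2 = S1 \<inter> set Wl")
      case True
      have "(\<Sum>X \<in> colour_sets m F1 R1 S1. \<Sum>Y \<in> colour_sets m F2 R2 S2. \<Phi> (coord_of m F1 R1 S1 X) (coord_of m F2 R2 S2 Y))
         = val m \<phi> (F1 \<union> F2) (R1 \<union> R2) S1"
      proof -
        have "F1 \<union> F2 \<union> S1 \<subseteq> {..<length m}" "F1 \<inter> F2 = {}" "F1 \<inter> S1 = {}" "F2 \<inter> S1 = {}"
          using p1 p2 sub disj by blast+
        then have "(\<Sum>X \<in> colour_sets m F1 R1 S1. \<Sum>Y \<in> colour_sets m F2 R2 S2.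
            if X \<inter> S2 = Y \<inter> S2 then \<phi> (card F1 + card F2, card (edge_set m F1 S1) + card R1 + (card (edge_set m F2 S2) + card R2), tag m S1 X) else 0)
          = val m \<phi> (F1 \<union> F2) (R1 \<union> R2) S1"
          by (rule val_join[OF und _ _ _ _ p1(2) p2(2)]) (use p1 p2 far nb True in blast)+
        then show ?thesis unfolding \<Phi> by (simp only: True simp_thms)
      qed
      then show ?thesis using eq True by simp
    next
      case False
      then show ?thesis using eq unfolding \<Phi> by simp
    qed
  qed
  have "(\<exists>u \<in> set (concat (map (\<lambda>u. map (\<lambda>w. join_vec Wl u w) T2) T1)). sm \<phi> u = 1) \<longleftrightarrow>
      (\<exists>w \<in> set T2. \<exists>u \<in> set T1. sm (\<lambda>c. sm (\<Phi> c) w) u = 1)"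
    by (auto simp: sm_join)
  also have "\<dots> \<longleftrightarrow> (\<exists>w \<in> set T2. \<exists>(F, R, S) \<in> partials m A D1 W1. val m (\<lambda>c. sm (\<Phi> c) w) F R S = 1)"
    using T1 by (simp add: represents_def)
  also have "\<dots> \<longleftrightarrow> (\<exists>(F, R, S) \<in> partials m A D1 W1. \<exists>w \<in> set T2. sm (\<lambda>d. val m (\<lambda>c. \<Phi> c d) F R S) w = 1)"
    unfolding val_sm by blast
  also have "\<dots> \<longleftrightarrow> (\<exists>(F, R, S) \<in> partials m A D1 W1. \<exists>(F', R', S') \<in> partials m A D2 (set Wl).
      val m (\<lambda>d. val m (\<lambda>c. \<Phi> c d) F R S) F' R' S' = 1)"
    using T2 by (simp add: represents_def)
  also have "\<dots> \<longleftrightarrow> (\<exists>(F, R, S) \<in> partials m A (D1 \<union> D2) W1. val m \<phi> F R S = 1)"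
  proof
    assume "\<exists>(F, R, S) \<in> partials m A D1 W1. \<exists>(F', R', S') \<in> partials m A D2 (set Wl).
      val m (\<lambda>d. val m (\<lambda>c. \<Phi> c d) F R S) F' R' S' = 1"
    then obtain F R S F' R' S' where 1: "(F, R, S) \<in> partials m A D1 W1" and 2: "(F', R', S') \<in> partials m A D2 (set Wl)"
      and v: "val m (\<lambda>d. val m (\<lambda>c. \<Phi> c d) F R S) F' R' S' = 1" by blast
    from v have S': "S' = S \<inter> set Wl" and v': "val m \<phi> (F \<union> F') (R \<union> R') S = 1"
      unfolding pair[OF 1 2] by (auto split: if_splits)
    have p: "F \<subseteq> D1 \<inter> A" "R \<subseteq> F" "S \<subseteq> W1 \<inter> A" "tfree m (F \<union> S)" "F' \<subseteq> D2 \<inter> A" "R' \<subseteq> F'" "tfree m (F' \<union> S')"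
      using 1 2 by (auto simp: partials_def)
    have "tfree m (F \<union> F' \<union> S)"
      unfolding tfree_def
    proof
      assume "\<exists>a \<in> F \<union> F' \<union> S. \<exists>b \<in> F \<union> F' \<union> S. \<exists>c \<in> F \<union> F' \<union> S. edge m a b \<and> edge m a c \<and> edge m b c"
      then obtain a b c where abc: "a \<in> F \<union> F' \<union> S" "b \<in> F \<union> F' \<union> S" "c \<in> F \<union> F' \<union> S" "edge m a b" "edge m a c" "edge m b c"
        by blast
      \<comment> \<open>Neighbours of the second part stay in \<open>F'\<close> or
        \<open>S'\<close>. So a triangle that touches \<open>F'\<close> lies entirely in the second
        part, and any other one in the first.\<close>
      have loc: "y \<in> F' \<union> S'" if "x \<in> F'" "y \<in> F \<union> F' \<union> S" "edge m x y" for x y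
        using that p far[of y x] sym nb[of x y] S' by blast
      show False
      proof (cases "a \<in> F' \<or> b \<in> F' \<or> c \<in> F'")
        case True
        then have "a \<in> F' \<union> S' \<and> b \<in> F' \<union> S' \<and> c \<in> F' \<union> S'"
          using loc abc sym by blast
        then show False using p(7) abc unfolding tfree_def by blast
      next
        case False
        then show False using p(4) abc unfolding tfree_def by blast
      qed
    qed
    then have "(F \<union> F', R \<union> R', S) \<in> partials m A (D1 \<union> D2) W1" using p by (auto simp: partials_def)
    then show "\<exists>(F, R, S) \<in> partials m A (D1 \<union> D2) W1. val m \<phi> F R S = 1" using v' by blast
  next
    assume "\<exists>(F, R, S) \<in> partials m A (D1 \<union> D2) W1. val m \<phi> F R S = 1"
    then obtain F R S where p: "F \<subseteq> (D1 \<union> D2) \<inter> A" "R \<subseteq> F" "S \<subseteq> W1 \<inter> A" "tfree m (F \<union> S)" and v: "val m \<phi> F R S = 1"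
      by (auto simp: partials_def)
    have sub_tf: "tfree m T" if "T \<subseteq> F \<union> S" for T using p(4) that unfolding tfree_def by blast
    have 1: "(F \<inter> D1, R \<inter> D1, S) \<in> partials m A D1 W1"
      using p sub_tf[of "F \<inter> D1 \<union> S"] by (auto simp: partials_def)
    have 2: "(F \<inter> D2, R \<inter> D2, S \<inter> set Wl) \<in> partials m A D2 (set Wl)"
      using p sub_tf[of "F \<inter> D2 \<union> S \<inter> set Wl"] by (auto simp: partials_def)
    have "F \<inter> D1 \<union> F \<inter> D2 = F" "R \<inter> D1 \<union> R \<inter> D2 = R" using p by auto
    then have "val m (\<lambda>d. val m (\<lambda>c. \<Phi> c d) (F \<inter> D1) (R \<inter> D1) S) (F \<inter> D2) (R \<inter> D2) (S \<inter> set Wl) = 1"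
      using pair[OF 1 2] v by simp
    then show "\<exists>(F, R, S) \<in> partials m A D1 W1. \<exists>(F', R', S') \<in> partials m A D2 (set Wl).
      val m (\<lambda>d. val m (\<lambda>c. \<Phi> c d) F R S) F' R' S' = 1" using 1 2 by blast
  qed
  finally show "(\<exists>u \<in> set (concat (map (\<lambda>u. map (\<lambda>w. join_vec Wl u w) T2) T1)). sm \<phi> u = 1) \<longleftrightarrow>
    (\<exists>(F, R, S) \<in> partials m A (D1 \<union> D2) W1. val m \<phi> F R S = 1)" .
qed

lemma colour_sets_forget:
  assumes "undirected (edge m)" and v: "v \<notin> F" "v \<notin> S"
  shows "colour_sets m (insert v F) R S = {X \<in> colour_sets m F (R - {v}) (insert v S).
     (v \<in> R \<longrightarrow> v \<notin> X) \<and> (\<forall>s \<in> S. edge m v s \<longrightarrow> (s \<in> X \<longleftrightarrow> v \<in> X))}"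
proof -
  interpret undirected "edge m" by fact
  have "(\<forall>u \<in> insert v F. \<forall>w \<in> insert v F \<union> S. edge m u w \<longrightarrow> (u \<in> X \<longleftrightarrow> w \<in> X)) \<longleftrightarrow>
    (\<forall>u \<in> F. \<forall>w \<in> F \<union> insert v S. edge m u w \<longrightarrow> (u \<in> X \<longleftrightarrow> w \<in> X)) \<and>
    (\<forall>s \<in> S. edge m v s \<longrightarrow> (s \<in> X \<longleftrightarrow> v \<in> X))" for X
    using sym irrefl by blast
  then show ?thesis unfolding colour_sets_def by auto
qed

lemma forget_coord:
  assumes und: "undirected (edge m)" and fin: "insert v (F \<union> S) \<subseteq> {..<length m}"
    and disj: "v \<notin> F" "v \<notin> S" "F \<inter> S = {}" and R: "R \<subseteq> insert v F"
    and X: "\<forall>s \<in> S. edge m v s \<longrightarrow> (s \<in> X \<longleftrightarrow> v \<in> X)"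
  shows "forget_map m v (of_bool (v \<in> R)) (coord_of m F (R - {v}) (insert v S) X) = coord_of m (insert v F) R S X"
    "forget_cond m v (coord_of m F (R - {v}) (insert v S) X)"
proof -
  interpret undirected "edge m" by (rule und)
  have finite: "finite F" "finite S" "finite R"
    using fin R by (auto intro: finite_subset[OF _ finite_lessThan] finite_subset[OF R])
  have setS: "set (sublist_of m (insert v S)) = insert v S" using fin by (intro set_sublist_of) auto
  have "length (filter (\<lambda>e. edge m v (fst e)) (tag m (insert v S) X)) = length (filter (edge m v) (sublist_of m (insert v S)))"
    by (simp add: tag_def filter_map comp_def)
  also have "\<dots> = card (set (filter (edge m v) (sublist_of m (insert v S))))"
    by (subst distinct_card) simp_all
  also have "set (filter (edge m v) (sublist_of m (insert v S))) = {s \<in> S. edge m v s}"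
    using setS irrefl by auto
  finally have deg: "length (filter (\<lambda>e. edge m v (fst e)) (tag m (insert v S) X)) = card {s \<in> S. edge m v s}" .
  have edges: "card (edge_set m (insert v F) S) = card (edge_set m F (insert v S)) + card {s \<in> S. edge m v s}"
  proof -
    let ?N = "(\<lambda>s. if v < s then (v, s) else (s, v)) ` {s \<in> S. edge m v s}"
    have "edge_set m (insert v F) S = edge_set m F (insert v S) \<union> ?N"
    proof
      show "edge_set m (insert v F) S \<subseteq> edge_set m F (insert v S) \<union> ?N"
      proof
        fix e assume e: "e \<in> edge_set m (insert v F) S"
        show "e \<in> edge_set m F (insert v S) \<union> ?N"
        proof (cases "fst e \<in> F \<or> snd e \<in> F")
          case True
          then show ?thesis using e by (auto simp: edge_set_def)
        next
          case False
          then consider "fst e = v" "snd e \<in> S" | "snd e = v" "fst e \<in> S"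
            using e disj irrefl by (auto simp: edge_set_def)
          then show ?thesis
          proof cases
            case 1
            then show ?thesis using e by (intro UnI2 image_eqI[of _ _ "snd e"]) (auto simp: edge_set_def prod_eq_iff)
          next
            case 2
            then show ?thesis using e sym by (intro UnI2 image_eqI[of _ _ "fst e"]) (auto simp: edge_set_def prod_eq_iff)
          qed
        qed
      qed
      show "edge_set m F (insert v S) \<union> ?N \<subseteq> edge_set m (insert v F) S"
        using sym disj by (auto simp: edge_set_def nat_neq_iff split: if_splits)
    qed
    moreover have "edge_set m F (insert v S) \<inter> ?N = {}" using disj by (auto simp: edge_set_def)
    moreover have "finite (edge_set m F (insert v S))"
      by (rule finite_subset[of _ "(F \<union> insert v S) \<times> (F \<union> insert v S)"])
        (use finite in \<open>auto simp: edge_set_def mem_Times_iff\<close>)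
    moreover have "card ?N = card {s \<in> S. edge m v s}"
      using disj by (intro card_image) (auto simp: inj_on_def split: if_splits)
    ultimately show ?thesis using finite by (simp add: card_Un_disjoint)
  qed
  have cR: "card R = card (R - {v}) + of_bool (v \<in> R)"
  proof (cases "v \<in> R")
    case True
    then show ?thesis using card.remove[OF finite(3) True] by simp
  qed simp
  have "insert v S - {v} = S" using disj by auto
  then have tg: "filter (\<lambda>e. fst e \<noteq> v) (tag m (insert v S) X) = tag m S X"
    using filter_tag_neq[of v m "insert v S" X] by simp
  show "forget_map m v (of_bool (v \<in> R)) (coord_of m F (R - {v}) (insert v S) X) = coord_of m (insert v F) R S X"
    unfolding forget_map_def coord_of_def fst_conv snd_conv deg tg edges cR
    using finite disj by simp
  show "forget_cond m v (coord_of m F (R - {v}) (insert v S) X)"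
    unfolding forget_cond_def coord_of_def fst_conv snd_conv tag_def
    using setS X irrefl by auto
qed

text \<open>The three vectors correspond to the fates of \<open>v\<close>: deleted, kept, or kept as
  a root. Each map is linear, so \<open>\<phi>\<close> is pulled back along it to \<open>f0\<close>,
  \<open>f1\<close> or \<open>f2\<close>, and the representation of the old table is applied to the
  pullback.\<close>

lemma represents_forget:
  assumes und: "undirected (edge m)" and T: "represents m A D (insert v W) T"
    and sub: "D \<union> insert v W \<subseteq> {..<length m}" and disj: "v \<notin> D" "v \<notin> W" "D \<inter> W = {}"
  shows "represents m A (insert v D) W (concat (map (\<lambda>u. [forget_out v u, forget_in m v u, forget_root m v u]) T))"
  unfolding represents_def
proof
  fix \<phi> :: "coord \<Rightarrow> bit"
  interpret undirected "edge m" by (rule und)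
  define f0 where "f0 c = (if v \<notin> set (map fst (snd (snd c))) then \<phi> c else 0)" for c :: coord
  define f1 where "f1 c = (if forget_cond m v c then \<phi> (forget_map m v 0 c) else 0)" for c
  define f2 where "f2 c = (if forget_cond m v c \<and> (v, False) \<in> set (snd (snd c)) then \<phi> (forget_map m v 1 c) else 0)" for c
  have sm: "sm \<phi> (forget_out v u) = sm f0 u" "sm \<phi> (forget_in m v u) = sm f1 u" "sm \<phi> (forget_root m v u) = sm f2 u" for u
    unfolding forget_out_def forget_in_def forget_root_def sm_filter sm_map f0_def f1_def f2_def by simp_all
  have setl: "set (sublist_of m S) = S" if "S \<subseteq> insert v W" for S
    using that sub by (intro set_sublist_of) blast
  have v0: "val m f0 F R S = (if v \<in> S then 0 else val m \<phi> F R S)" if "S \<subseteq> insert v W" for F R S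
    unfolding val_def f0_def coord_of_def snd_conv tag_fst setl[OF that] by simp
  have no: "forget_cond m v (coord_of m F R S X) = False" if "v \<notin> S" "S \<subseteq> insert v W" for F R S X
    using that setl[OF that(2)] unfolding forget_cond_def coord_of_def tag_def by auto
  have part: "F \<subseteq> D" "S \<subseteq> insert v W" "v \<notin> F" "finite F" "finite S" "F \<inter> S \<subseteq> {}" if "(F, R, S) \<in> partials m A D (insert v W)" for F R S
  proof -
    show "F \<subseteq> D" "S \<subseteq> insert v W" using that by (auto simp: partials_def)
    moreover have "finite D" "finite (insert v W)" using sub finite_subset[OF _ finite_lessThan] by auto
    ultimately show "v \<notin> F" "finite F" "finite S" "F \<inter> S \<subseteq> {}" using disj
      by (auto intro: finite_subset)
  qed
  have v12: "val m (if r then f2 else f1) F R S = (if v \<in> S then val m \<phi> (insert v F) (if r then insert v R else R) (S - {v}) else 0)"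
    if p: "(F, R, S) \<in> partials m A D (insert v W)" for F R S r
  proof (cases "v \<in> S")
    case False
    then show ?thesis using no[OF False part(2)[OF p]] by (simp add: val_def f1_def f2_def)
  next
    case True
    have RF: "R \<subseteq> F" using p by (simp add: partials_def)
    define S' where "S' = S - {v}"
    define R' where "R' = (if r then insert v R else R)"
    have S: "S = insert v S'" "v \<notin> S'" using True by (auto simp: S'_def)
    have vF: "v \<notin> F" using part(3)[OF p] .
    have R': "R' - {v} = R" "v \<in> R' \<longleftrightarrow> r" "R' \<subseteq> insert v F" using RF vF by (auto simp: R'_def)
    have fin: "insert v (F \<union> S') \<subseteq> {..<length m}" using part(1,2)[OF p] sub S by blast
    have FS: "F \<inter> S' = {}" using part(6)[OF p] S by blast
    have setS: "set (sublist_of m S) = S" by (rule setl[OF part(2)[OF p]])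
    let ?Q = "\<lambda>X. (v \<in> R' \<longrightarrow> v \<notin> X) \<and> (\<forall>s \<in> S'. edge m v s \<longrightarrow> (s \<in> X \<longleftrightarrow> v \<in> X))"
    have f: "(if r then f2 else f1) (coord_of m F R S X) = (if ?Q X then \<phi> (coord_of m (insert v F) R' S' X) else 0)" for X
    proof (cases "\<forall>s \<in> S'. edge m v s \<longrightarrow> (s \<in> X \<longleftrightarrow> v \<in> X)")
      case True
      have 1: "forget_map m v (of_bool (v \<in> R')) (coord_of m F (R' - {v}) (insert v S') X) = coord_of m (insert v F) R' S' X"
        "forget_cond m v (coord_of m F (R' - {v}) (insert v S') X)"
        using forget_coord[OF und fin vF S(2) FS R'(3) True] by auto
      have 2: "(v, False) \<in> set (snd (snd (coord_of m F R S X))) \<longleftrightarrow> v \<notin> X"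
        using setS S unfolding coord_of_def tag_def by auto
      show ?thesis using 1 2 True unfolding R'(1,2) S(1)[symmetric] by (cases r) (simp_all add: f1_def f2_def)
    next
      case False
      then obtain s where s: "s \<in> S'" "edge m v s" "(s \<in> X) \<noteq> (v \<in> X)" by blast
      have "\<not> forget_cond m v (coord_of m F R S X)"
      proof
        assume "forget_cond m v (coord_of m F R S X)"
        then have "\<forall>x \<in> S. edge m v x \<longrightarrow> (x \<in> X) = (v \<in> X)"
          using setS unfolding forget_cond_def coord_of_def tag_def by auto
        then show False using s S by blast
      qed
      then show ?thesis using False by (auto simp: f1_def f2_def)
    qed
    have finC: "finite (colour_sets m F R S)" by (rule finite_colour_sets[OF part(4,5)[OF p]])
    have "val m (if r then f2 else f1) F R S = (\<Sum>X \<in> colour_sets m F R S. if ?Q X then \<phi> (coord_of m (insert v F) R' S' X) else 0)"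
      unfolding val_def by (rule sum.cong[OF refl]) (rule f)
    also have "\<dots> = (\<Sum>X \<in> {X \<in> colour_sets m F R S. ?Q X}. \<phi> (coord_of m (insert v F) R' S' X))"
      using finC by (simp add: sum.inter_filter)
    also have "{X \<in> colour_sets m F R S. ?Q X} = colour_sets m (insert v F) R' S'"
      unfolding colour_sets_forget[OF und vF S(2)] R'(1) S(1)[symmetric] ..
    finally show ?thesis using True by (simp add: val_def R'_def S'_def)
  qed
  have v1: "val m f1 F R S = (if v \<in> S then val m \<phi> (insert v F) R (S - {v}) else 0)"
    and v2: "val m f2 F R S = (if v \<in> S then val m \<phi> (insert v F) (insert v R) (S - {v}) else 0)"
    if p: "(F, R, S) \<in> partials m A D (insert v W)" for F R S
    using v12[OF p, of False] v12[OF p, of True] by simp_all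
  let ?old = "partials m A D (insert v W)"
  have "(\<exists>u \<in> set (concat (map (\<lambda>u. [forget_out v u, forget_in m v u, forget_root m v u]) T)). sm \<phi> u = 1) \<longleftrightarrow>
     (\<exists>u \<in> set T. sm f0 u = 1) \<or> (\<exists>u \<in> set T. sm f1 u = 1) \<or> (\<exists>u \<in> set T. sm f2 u = 1)"
    by (auto simp: sm)
  also have "\<dots> \<longleftrightarrow> (\<exists>(F, R, S) \<in> ?old. val m f0 F R S = 1) \<or> (\<exists>(F, R, S) \<in> ?old. val m f1 F R S = 1) \<or>
     (\<exists>(F, R, S) \<in> ?old. val m f2 F R S = 1)"
    using T by (simp add: represents_def)
  also have "\<dots> \<longleftrightarrow> (\<exists>(F, R, S) \<in> partials m A (insert v D) W. val m \<phi> F R S = 1)"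
  proof
    assume "(\<exists>(F, R, S) \<in> ?old. val m f0 F R S = 1) \<or> (\<exists>(F, R, S) \<in> ?old. val m f1 F R S = 1) \<or>
     (\<exists>(F, R, S) \<in> ?old. val m f2 F R S = 1)"
    then consider (a) F R S where "(F, R, S) \<in> ?old" "val m f0 F R S = 1" | (b) F R S where "(F, R, S) \<in> ?old" "val m f1 F R S = 1"
      | (c) F R S where "(F, R, S) \<in> ?old" "val m f2 F R S = 1" by blast
    then show "\<exists>(F, R, S) \<in> partials m A (insert v D) W. val m \<phi> F R S = 1"
    proof cases
      case a
      then have "v \<notin> S" "val m \<phi> F R S = 1" using v0[OF part(2)[OF a(1)]] by (auto split: if_splits)
      moreover have "(F, R, S) \<in> partials m A (insert v D) W" using a(1) \<open>v \<notin> S\<close> by (auto simp: partials_def)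
      ultimately show ?thesis by blast
    next
      case b
      then have "v \<in> S" "val m \<phi> (insert v F) R (S - {v}) = 1" using v1[OF b(1)] by (auto split: if_splits)
      moreover have "insert v F \<union> (S - {v}) = F \<union> S" using \<open>v \<in> S\<close> by auto
      then have "(insert v F, R, S - {v}) \<in> partials m A (insert v D) W" using b(1) \<open>v \<in> S\<close> by (auto simp: partials_def)
      ultimately show ?thesis by blast
    next
      case c
      then have "v \<in> S" "val m \<phi> (insert v F) (insert v R) (S - {v}) = 1" using v2[OF c(1)] by (auto split: if_splits)
      moreover have "insert v F \<union> (S - {v}) = F \<union> S" using \<open>v \<in> S\<close> by auto
      then have "(insert v F, insert v R, S - {v}) \<in> partials m A (insert v D) W" using c(1) \<open>v \<in> S\<close> by (auto simp: partials_def)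
      ultimately show ?thesis by blast
    qed
  next
    assume "\<exists>(F, R, S) \<in> partials m A (insert v D) W. val m \<phi> F R S = 1"
    then obtain F R S where p: "(F, R, S) \<in> partials m A (insert v D) W" and v: "val m \<phi> F R S = 1" by blast
    have q: "F \<subseteq> insert v D" "F \<subseteq> A" "R \<subseteq> F" "S \<subseteq> W" "S \<subseteq> A" "tfree m (F \<union> S)" using p by (auto simp: partials_def)
    have vS: "v \<notin> S" using q disj by auto
    show "(\<exists>(F, R, S) \<in> ?old. val m f0 F R S = 1) \<or> (\<exists>(F, R, S) \<in> ?old. val m f1 F R S = 1) \<or>
     (\<exists>(F, R, S) \<in> ?old. val m f2 F R S = 1)"
    proof (cases "v \<in> F")
      case False
      then have o: "(F, R, S) \<in> ?old" using q by (auto simp: partials_def)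
      have "val m f0 F R S = 1" using v0[OF part(2)[OF o]] vS v by simp
      then show ?thesis using o by blast
    next
      case True
      have "(F - {v}) \<union> insert v S = F \<union> S" using True by auto
      then have o: "(F - {v}, R - {v}, insert v S) \<in> ?old" using q True by (auto simp: partials_def)
      have eq: "insert v (F - {v}) = F" "insert v S - {v} = S" using True vS by auto
      show ?thesis
      proof (cases "v \<in> R")
        case True
        then have "insert v (R - {v}) = R" by auto
        then have "val m f2 (F - {v}) (R - {v}) (insert v S) = 1" using v2[OF o] v eq by simp
        then show ?thesis using o by blast
      next
        case False
        then have "R - {v} = R" by auto
        then have "val m f1 (F - {v}) (R - {v}) (insert v S) = 1" using v1[OF o] v eq by simp
        then show ?thesis using o by blast
      qed
    qed
  qed
  finally show "(\<exists>u \<in> set (concat (map (\<lambda>u. [forget_out v u, forget_in m v u, forget_root m v u]) T)). sm \<phi> u = 1) \<longleftrightarrow>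
    (\<exists>(F, R, S) \<in> partials m A (insert v D) W. val m \<phi> F R S = 1)" .
qed

subsection \<open>Counting coordinates\<close>

text \<open>Forgetting a vertex adds at most \<open>length m\<close> edges and one root to the
  second number, which explains its bound.\<close>

definition coords :: "bool list list \<Rightarrow> nat set \<Rightarrow> nat set \<Rightarrow> nat set \<Rightarrow> coord set" where
  "coords m A D W = {(a, b, \<sigma>). a \<le> card D \<and> b \<le> card D * Suc (length m) \<and>
     (\<exists>S X. S \<subseteq> W \<inter> A \<and> tfree m S \<and> X \<subseteq> S \<and> \<sigma> = tag m S X)}"

lemma coords_iff: "c \<in> coords m A D W \<longleftrightarrow> fst c \<le> card D \<and> fst (snd c) \<le> card D * Suc (length m) \<and>
     (\<exists>S X. S \<subseteq> W \<inter> A \<and> tfree m S \<and> X \<subseteq> S \<and> snd (snd c) = tag m S X)"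
  unfolding coords_def mem_Collect_eq case_prod_beta ..

lemma tag_Int: "S \<subseteq> {..<length m} \<Longrightarrow> tag m S X = tag m S (X \<inter> S)"
  by (subst tag_eq_iff) auto

lemma start_coords:
  assumes und: "undirected (edge m)" and W: "W \<subseteq> {..<length m}"
    and p: "card {S. S \<subseteq> W \<inter> A \<and> tfree m S} * Suc (length m * Suc (length m)) \<le> p"
    and q: "\<And>S. S \<subseteq> W \<inter> A \<Longrightarrow> tfree m S \<Longrightarrow> 2 ^ card S * Suc (length m * (length m + 2)) \<le> p"
    and u: "u \<in> set (start_vectors p m (sublist_of m (W \<inter> A)))"
  shows "set u \<subseteq> coords m A {} W"
proof -
  obtain S where S: "S \<subseteq> W \<inter> A" "tfree m S" "set u \<subseteq> {(0, 0, tag m S X) | X. True}"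
    using represents_start(2)[OF und W p q u] by blast
  show ?thesis
  proof
    fix x assume "x \<in> set u"
    then obtain X where "x = (0, 0, tag m S X)" using S(3) by blast
    moreover have "tag m S X = tag m S (X \<inter> S)" using S(1) W by (intro tag_Int) auto
    ultimately have x: "x = (0, 0, tag m S (X \<inter> S))" by simp
    show "x \<in> coords m A {} W" unfolding x coords_iff fst_conv snd_conv
      using S(1,2) by (intro conjI exI[of _ S] exI[of _ "X \<inter> S"]) auto
  qed
qed

lemma join_coords:
  assumes u: "set u \<subseteq> coords m A D1 W1" and w: "set w \<subseteq> coords m A D2 W2"
    and D: "D1 \<inter> D2 = {}" "finite D1" "finite D2"
  shows "set (join_vec Wl u w) \<subseteq> coords m A (D1 \<union> D2) W1"
proof
  fix x assume "x \<in> set (join_vec Wl u w)"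
  then obtain c d where c: "c \<in> set u" and d: "d \<in> set w"
    and x: "x = (fst c + fst d, fst (snd c) + fst (snd d), snd (snd c))"
    by (auto simp: join_vec_def)
  have "c \<in> coords m A D1 W1" "d \<in> coords m A D2 W2" using c d u w by auto
  then have 1: "fst c \<le> card D1" "fst (snd c) \<le> card D1 * Suc (length m)"
      "\<exists>S X. S \<subseteq> W1 \<inter> A \<and> tfree m S \<and> X \<subseteq> S \<and> snd (snd c) = tag m S X"
    and 2: "fst d \<le> card D2" "fst (snd d) \<le> card D2 * Suc (length m)"
    unfolding coords_iff by blast+
  have cD: "card (D1 \<union> D2) = card D1 + card D2" using D by (intro card_Un_disjoint) auto
  show "x \<in> coords m A (D1 \<union> D2) W1"
    unfolding x coords_iff fst_conv snd_conv cD add_mult_distrib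
    using 1 add_mono[OF 1(1) 2(1)] add_mono[OF 1(2) 2(2)] by blast
qed

lemma forget_coords:
  assumes und: "undirected (edge m)" and u: "set u \<subseteq> coords m A D (insert v W)" and D: "v \<notin> D" "finite D"
    and W: "insert v W \<subseteq> {..<length m}" "v \<notin> W"
  shows "set (forget_out v u) \<subseteq> coords m A (insert v D) W" "set (forget_in m v u) \<subseteq> coords m A (insert v D) W"
    "set (forget_root m v u) \<subseteq> coords m A (insert v D) W"
proof -
  have cardD: "card (insert v D) = Suc (card D)" using D by simp
  have mono: "tfree m S" if "tfree m T" "S \<subseteq> T" for S T using that unfolding tfree_def by blast
  show "set (forget_out v u) \<subseteq> coords m A (insert v D) W"
  proof
    fix x assume "x \<in> set (forget_out v u)"
    then have x: "x \<in> set u" "v \<notin> set (map fst (snd (snd x)))" by (auto simp: forget_out_def)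
    then obtain a b S X where x': "x = (a, b, tag m S X)" "a \<le> card D" "b \<le> card D * Suc (length m)"
      "S \<subseteq> insert v W \<inter> A" "tfree m S" "X \<subseteq> S" using u unfolding coords_def by blast
    have "set (sublist_of m S) = S" using x'(4) W by (intro set_sublist_of) auto
    then have "v \<notin> S" using x(2) by (simp add: x'(1) del: set_map)
    then show "x \<in> coords m A (insert v D) W" using x' cardD unfolding coords_def by auto
  qed
  have f: "forget_map m v r c \<in> coords m A (insert v D) W" if c: "c \<in> set u" "r \<le> 1" for c r
  proof -
    obtain a b S X where c': "c = (a, b, tag m S X)" "a \<le> card D" "b \<le> card D * Suc (length m)"
      "S \<subseteq> insert v W \<inter> A" "tfree m S" "X \<subseteq> S" using c u unfolding coords_def by blast
    have "length (filter (\<lambda>e. edge m v (fst e)) (tag m S X)) \<le> length (tag m S X)" by simp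
    also have "\<dots> \<le> length m" unfolding tag_def sublist_of_def length_map
      by (rule order.trans[OF length_filter_le]) simp
    finally have deg: "length (filter (\<lambda>e. edge m v (fst e)) (tag m S X)) \<le> length m" .
    have "tag m (S - {v}) X = tag m (S - {v}) (X \<inter> (S - {v}))" using c'(4) W by (intro tag_Int) auto
    moreover have "tfree m (S - {v})" by (rule mono[OF c'(5)]) auto
    moreover have "b + length (filter (\<lambda>e. edge m v (fst e)) (tag m S X)) + r \<le> Suc (card D) * Suc (length m)"
      using c'(3) deg c(2) by simp
    ultimately show ?thesis
      unfolding forget_map_def coords_iff fst_conv snd_conv c'(1) filter_tag_neq cardD
      using c'(2,4) by (intro conjI exI[of _ "S - {v}"] exI[of _ "X \<inter> (S - {v})"]) auto
  qed
  show "set (forget_in m v u) \<subseteq> coords m A (insert v D) W" "set (forget_root m v u) \<subseteq> coords m A (insert v D) W"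
    using f by (auto simp: forget_in_def forget_root_def)
qed

text \<open>The two counters contribute a cubic factor, the kept boundary sets the factor
  \<open>N\<close>, and their colourings the factor \<open>2 ^ s\<close>.\<close>

lemma coords_bounds:
  assumes W: "W \<subseteq> {..<length m}" and D: "D \<subseteq> {..<length m}"
    and N: "card {S. S \<subseteq> W \<and> tfree m S} \<le> N" and s: "\<And>S. S \<subseteq> W \<Longrightarrow> tfree m S \<Longrightarrow> card S \<le> s"
  shows "finite (coords m A D W)" "card (coords m A D W) \<le> (length m + 2) ^ 3 * (N * 2 ^ s)"
    "\<And>x. x \<in> coords m A D W \<Longrightarrow> sz x \<le> 4 * (length m + 2) ^ 2"
proof -
  let ?n = "length m"
  let ?T = "{S. S \<subseteq> W \<and> tfree m S}"
  let ?P = "SIGMA S : ?T. Pow S"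
  have finW: "finite W" using W finite_subset by blast
  have finT: "finite ?T" by (rule finite_subset[of _ "Pow W"]) (use finW in auto)
  have finP: "finite ?P" using finT finW by (intro finite_SigmaI) (auto intro: finite_subset)
  have cD: "card D \<le> ?n" using card_mono[OF finite_lessThan D] by simp
  let ?Y = "{..?n} \<times> {..?n * Suc ?n} \<times> (\<lambda>(S, X). tag m S X) ` ?P"
  have cDn: "card D * Suc ?n \<le> ?n * Suc ?n" by (rule mult_le_mono1[OF cD])
  have sub: "coords m A D W \<subseteq> ?Y"
  proof
    fix x assume "x \<in> coords m A D W"
    then obtain a b S X where x: "x = (a, b, tag m S X)" "a \<le> card D" "b \<le> card D * Suc ?n"
      "S \<subseteq> W \<inter> A" "tfree m S" "X \<subseteq> S" unfolding coords_def by blast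
    have "(S, X) \<in> ?P" using x by auto
    then have "tag m S X \<in> (\<lambda>(S, X). tag m S X) ` ?P" by (rule rev_image_eqI) simp
    then show "x \<in> ?Y" using x cD cDn by auto
  qed
  show "finite (coords m A D W)" by (rule finite_subset[OF sub]) (use finP in blast)
  have "card ((\<lambda>(S, X). tag m S X) ` ?P) \<le> card ?P" by (rule card_image_le[OF finP])
  also have "card ?P = (\<Sum>S \<in> ?T. card (Pow S))" by (rule card_SigmaI) (use finT finW in \<open>auto intro: finite_subset\<close>)
  also have "\<dots> \<le> (\<Sum>S \<in> ?T. 2 ^ s)"
  proof (rule sum_mono)
    fix S assume "S \<in> ?T"
    then show "card (Pow S) \<le> 2 ^ s" using s finW by (subst card_Pow) (auto intro: finite_subset power_increasing)
  qed
  also have "\<dots> = card ?T * 2 ^ s" by simp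
  also have "\<dots> \<le> N * 2 ^ s" using N by simp
  finally have tags: "card ((\<lambda>(S, X). tag m S X) ` ?P) \<le> N * 2 ^ s" .
  have "card (coords m A D W) \<le> card ?Y" by (rule card_mono[OF _ sub]) (use finP in blast)
  also have "\<dots> = Suc ?n * Suc (?n * Suc ?n) * card ((\<lambda>(S, X). tag m S X) ` ?P)"
    by (simp only: card_cartesian_product card_atMost mult.assoc)
  also have "\<dots> \<le> (?n + 2) ^ 3 * (N * 2 ^ s)"
    by (intro mult_le_mono tags) (simp add: power3_eq_cube algebra_simps)
  finally show "card (coords m A D W) \<le> (?n + 2) ^ 3 * (N * 2 ^ s)" .
  fix x assume "x \<in> coords m A D W"
  then obtain a b S X where x: "x = (a, b, tag m S X)" "a \<le> card D" "b \<le> card D * Suc ?n"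
    unfolding coords_def by blast
  have "sz (tag m S X) \<le> ?n * Suc (?n + 1)"
  proof (rule sz_list_le)
    show "length (tag m S X) \<le> ?n" unfolding tag_def sublist_of_def length_map
      by (rule order.trans[OF length_filter_le]) simp
    fix e assume "e \<in> set (tag m S X)"
    then obtain y where "e = (y, y \<in> X)" "y < ?n" unfolding tag_def sublist_of_def by auto
    then show "sz e \<le> ?n + 1" using sz_bool_le[of "y \<in> X"] by simp
  qed
  then have "sz x \<le> Suc (?n + Suc (?n * Suc ?n + ?n * Suc (?n + 1)))" using x cD cDn by simp
  also have "\<dots> \<le> 4 * (?n + 2) ^ 2" by (simp add: power2_eq_square algebra_simps)
  finally show "sz x \<le> 4 * (?n + 2) ^ 2" .
qed

lemma thin_count:
  assumes und: "undirected (edge m)" and B: "thin m k B" and W: "W \<subseteq> insert v B" "W \<subseteq> {..<length m}"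
  shows "card {S. S \<subseteq> W \<and> tfree m S} \<le> (length m + 1) ^ 6 * 2 ^ (15 * k + 6)"
    "\<And>S. S \<subseteq> W \<Longrightarrow> tfree m S \<Longrightarrow> card S \<le> 15 * k + 12"
proof -
  interpret undirected "edge m" by (rule und)
  let ?n = "length m"
  obtain K1 K2 K3 R where K: "clique_in (edge m) K1" "clique_in (edge m) K2" "clique_in (edge m) K3"
    and R: "finite R" "card R \<le> 15 * k + 5" "B \<subseteq> K1 \<union> K2 \<union> K3 \<union> R" using B unfolding thin_def by blast
  \<comment> \<open>The vertex to be eliminated is counted among the exceptional ones, whence
    \<open>15 * k + 6\<close>. Two vertices from each of the three cliques give
    \<open>15 * k + 12\<close> in total.\<close>
  let ?R = "insert v R"
  have cR: "card ?R \<le> 15 * k + 6" using R by (simp add: card_insert_if)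
  have finW: "finite W" using W finite_subset by blast
  have two: "card (S \<inter> K) \<le> 2" if S: "S \<subseteq> W" "tfree m S" and K: "clique_in (edge m) K" for S K
  proof (rule ccontr)
    assume "\<not> card (S \<inter> K) \<le> 2"
    then have "3 \<le> card (S \<inter> K)" by simp
    then obtain T where T: "T \<subseteq> S \<inter> K" "card T = 3" using obtain_subset_with_card_n by metis
    then obtain a b c where abc: "T = {a, b, c}" "a \<noteq> b" "a \<noteq> c" "b \<noteq> c" using card_3_iff by metis
    then have "edge m a b" "edge m a c" "edge m b c" using T K unfolding clique_in_def by auto
    then show False using S(2) T abc unfolding tfree_def by blast
  qed
  have dec: "S = (S \<inter> K1) \<union> (S \<inter> K2) \<union> (S \<inter> K3) \<union> (S \<inter> ?R)" if "S \<subseteq> W" for S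
    using that W(1) R(3) by blast
  show "card S \<le> 15 * k + 12" if S: "S \<subseteq> W" "tfree m S" for S
  proof -
    have "card S \<le> card (S \<inter> K1) + card (S \<inter> K2) + card (S \<inter> K3) + card (S \<inter> ?R)"
      by (subst dec[OF S(1)], intro order.trans[OF card_Un_le] add_mono card_Un_le order_refl)
    moreover have "card (S \<inter> ?R) \<le> card ?R" using R by (intro card_mono) auto
    ultimately show ?thesis using two[OF S K(1)] two[OF S K(2)] two[OF S K(3)] cR by linarith
  qed
  let ?P = "{T. T \<subseteq> {..<?n} \<and> card T \<le> 2}"
  have P: "finite ?P \<and> card ?P \<le> (?n + 1) ^ 2"
  proof -
    \<comment> \<open>The index \<open>?n\<close> stands for no vertex and is removed by the
      intersection; equal indices give singletons.\<close>
    have "?P \<subseteq> (\<lambda>(a, b). {a, b} \<inter> {..<?n}) ` ({..?n} \<times> {..?n})"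
    proof
      fix T assume T: "T \<in> ?P"
      then have "finite T" using finite_subset by blast
      consider "card T = 0" | "card T = 1" | "card T = 2" using T by force
      then show "T \<in> (\<lambda>(a, b). {a, b} \<inter> {..<?n}) ` ({..?n} \<times> {..?n})"
      proof cases
        case 1
        then have "T = {}" using \<open>finite T\<close> by simp
        then show ?thesis by (intro image_eqI[of _ _ "(?n, ?n)"]) auto
      next
        case 2
        then obtain a where "T = {a}" using card_1_singletonE by blast
        then show ?thesis using T by (intro image_eqI[of _ _ "(a, a)"]) auto
      next
        case 3
        then obtain a b where "T = {a, b}" using card_2_iff by metis
        then show ?thesis using T by (intro image_eqI[of _ _ "(a, b)"]) auto
      qed
    qed
    then have "finite ?P" "card ?P \<le> card ({..?n} \<times> {..?n})"
      using finite_subset surj_card_le[of "{..?n} \<times> {..?n}" ?P "\<lambda>(a, b). {a, b} \<inter> {..<?n}"] by auto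
    then show ?thesis by (simp add: card_cartesian_product power2_eq_square)
  qed
  let ?T = "{S. S \<subseteq> W \<and> tfree m S}"
  let ?g = "\<lambda>S. (S \<inter> K1, S \<inter> K2, S \<inter> K3, S \<inter> ?R)"
  have inj: "inj_on ?g ?T"
  proof (rule inj_onI)
    fix S S' assume S: "S \<in> ?T" "S' \<in> ?T" and eq: "?g S = ?g S'"
    have "S = (S \<inter> K1) \<union> (S \<inter> K2) \<union> (S \<inter> K3) \<union> (S \<inter> ?R)" using dec S(1) by blast
    also have "\<dots> = (S' \<inter> K1) \<union> (S' \<inter> K2) \<union> (S' \<inter> K3) \<union> (S' \<inter> ?R)" using eq by simp
    also have "\<dots> = S'" using dec[of S'] S(2) by blast
    finally show "S = S'" .
  qed
  have img: "?g ` ?T \<subseteq> ?P \<times> ?P \<times> ?P \<times> Pow ?R" using two K W(2) by blast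
  have finR: "finite ?R" using R by simp
  have "card ?T \<le> card (?P \<times> ?P \<times> ?P \<times> Pow ?R)"
    by (rule card_inj_on_le[OF inj img]) (use P finR in blast)
  also have "\<dots> = card ?P * (card ?P * (card ?P * 2 ^ card ?R))"
    using finR by (simp add: card_cartesian_product card_Pow del: Pow_insert card_insert_disjoint)
  also have "\<dots> \<le> (?n + 1) ^ 2 * ((?n + 1) ^ 2 * ((?n + 1) ^ 2 * 2 ^ (15 * k + 6)))"
    using P cR by (intro mult_le_mono power_increasing) auto
  also have "\<dots> = (?n + 1) ^ 6 * 2 ^ (15 * k + 6)"
    by (simp add: power_add[symmetric] mult.assoc[symmetric])
  finally show "card ?T \<le> (?n + 1) ^ 6 * 2 ^ (15 * k + 6)" .
qed

section \<open>Bucket elimination\<close>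

type_synonym vtable = "nat list \<times> coord list list"

definition join_step :: "nat \<Rightarrow> vtable \<Rightarrow> coord list list \<Rightarrow> coord list list" where
  "join_step p t cur = reduce p (concat (map (\<lambda>u. map (\<lambda>w. join_vec (fst t) u w) (snd t)) cur))"

definition join_tables :: "nat \<Rightarrow> vtable list \<Rightarrow> coord list list \<Rightarrow> coord list list" where
  "join_tables p ts cur = fold (\<lambda>t cur. clip p [] (join_step p t cur)) ts cur"

text \<open>The remaining neighbours of \<open>v\<close> and of the decided sets that see
  \<open>v\<close>; the latter are known only through the scopes of their tables.\<close>

definition new_scope :: "bool list list \<Rightarrow> nat \<Rightarrow> nat list \<Rightarrow> vtable list \<Rightarrow> nat list" where
  "new_scope m v gone rel = filter (\<lambda>u. u \<noteq> v \<and> u \<notin> set gone \<and> (edge m v u \<or> (\<exists>t \<in> set rel. u \<in> set (fst t)))) [0..<length m]"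

definition eliminate :: "nat \<Rightarrow> bool list list \<Rightarrow> nat list \<Rightarrow> nat \<Rightarrow> nat list \<Rightarrow> vtable list \<Rightarrow> vtable list" where
  "eliminate p m A v gone ts =
     (new_scope m v gone (filter (\<lambda>t. v \<in> set (fst t)) ts),
      reduce p (concat (map (\<lambda>u. [forget_out v u, forget_in m v u, forget_root m v u])
        (join_tables p (filter (\<lambda>t. v \<in> set (fst t)) ts)
          (start_vectors p m (filter (\<lambda>u. (u = v \<or> u \<in> set (new_scope m v gone (filter (\<lambda>t. v \<in> set (fst t)) ts))) \<and> u \<in> set A) [0..<length m])))))) #
     filter (\<lambda>t. v \<notin> set (fst t)) ts"

definition dp_loop :: "nat \<Rightarrow> bool list list \<Rightarrow> nat list \<Rightarrow> nat list \<Rightarrow> vtable list \<times> nat list" where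
  "dp_loop p m A \<pi> = fold (\<lambda>v s. clip p ([], []) (eliminate p m A v (snd s) (fst s), v # snd s)) (rev \<pi>) ([], [])"

text \<open>Equal counters mean that edges and roots together are as many as the vertices.
  Membership of such a coordinate in a duplicate-free vector is its coefficient.\<close>

definition forest_sizes :: "nat \<Rightarrow> bool list list \<Rightarrow> nat list \<Rightarrow> nat list \<Rightarrow> nat list" where
  "forest_sizes p m A \<pi> = map fst (filter (\<lambda>c. fst c = fst (snd c) \<and> snd (snd c) = [])
     (concat (join_tables p (fst (dp_loop p m A \<pi>)) [[(0, 0, [])]])))"

lemma ptime_forest_sizes [pt]:
  assumes "ptime p" "ptime m" "ptime A" "ptime \<pi>"
  shows "ptime (\<lambda>x. forest_sizes (p x) (m x) (A x) (\<pi> x))"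
proof -
  have join: "ptime (\<lambda>x. join_tables (p x) (ts x) (cur x))" if "ptime p" "ptime ts" "ptime cur"
    for p :: "'y::enc \<Rightarrow> _" and ts cur
    unfolding join_tables_def join_step_def by (intro pt that that[THEN feasible_compose])
  have scope: "ptime (\<lambda>x. new_scope (m x) (v x) (g x) (ts x))" if "ptime m" "ptime v" "ptime g" "ptime ts"
    for m :: "'y::enc \<Rightarrow> _" and v g ts
    unfolding new_scope_def by (intro pt that that[THEN feasible_compose])
  have elim: "ptime (\<lambda>x. eliminate (p x) (m x) (A x) (v x) (g x) (ts x))"
    if "ptime p" "ptime m" "ptime A" "ptime v" "ptime g" "ptime ts"
    for p :: "'y::enc \<Rightarrow> _" and m A v g ts
    unfolding eliminate_def by (intro pt join scope that that[THEN feasible_compose])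
  have loop: "ptime (\<lambda>x. dp_loop (p x) (m x) (A x) (\<pi> x))"
    unfolding dp_loop_def by (intro pt elim assms assms[THEN feasible_compose])
  show ?thesis unfolding forest_sizes_def by (intro pt join loop assms assms[THEN feasible_compose])
qed

section \<open>Bounds and invariant of the tables\<close>

definition pattern_bound :: "nat \<Rightarrow> nat \<Rightarrow> nat" where
  "pattern_bound n k = (n + 1) ^ 6 * 2 ^ (15 * k + 6)"

definition coord_bound :: "nat \<Rightarrow> nat \<Rightarrow> nat" where
  "coord_bound n k = (n + 2) ^ 3 * (pattern_bound n k * 2 ^ (15 * k + 12))"

definition table_bound :: "nat \<Rightarrow> nat \<Rightarrow> nat" where
  "table_bound n k = coord_bound n k * Suc (coord_bound n k * Suc (4 * (n + 2) ^ 2))"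

text \<open>Collects what has to survive clipping: a reduced table, the lists of triangle-free sets
  and of colourings, and the whole state with up to \<open>n\<close> tables.\<close>

definition large :: "nat \<Rightarrow> nat \<Rightarrow> nat \<Rightarrow> bool" where
  "large p n k \<longleftrightarrow> table_bound n k \<le> p \<and> pattern_bound n k * Suc (n * Suc n) \<le> p \<and>
     2 ^ (15 * k + 12) * Suc (n * (n + 2)) \<le> p \<and>
     Suc (n * Suc (Suc (n * Suc n + table_bound n k)) + n * Suc n) \<le> p"

definition few_patterns :: "bool list list \<Rightarrow> nat \<Rightarrow> nat set \<Rightarrow> bool" where
  "few_patterns m k W \<longleftrightarrow> W \<subseteq> {..<length m} \<and> card {S. S \<subseteq> W \<and> tfree m S} \<le> pattern_bound (length m) k \<and>
     (\<forall>S. S \<subseteq> W \<longrightarrow> tfree m S \<longrightarrow> card S \<le> 15 * k + 12)"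

lemma few_patterns_subset: assumes "few_patterns m k W" "W' \<subseteq> W" shows "few_patterns m k W'"
proof -
  have "finite W" using assms(1) finite_subset unfolding few_patterns_def by blast
  then have "card {S. S \<subseteq> W' \<and> tfree m S} \<le> card {S. S \<subseteq> W \<and> tfree m S}"
    using assms(2) by (intro card_mono finite_subset[of "{S. S \<subseteq> W \<and> tfree m S}" "Pow W"]) auto
  then show ?thesis using assms unfolding few_patterns_def by (meson le_trans subset_trans)
qed

definition vectors_ok :: "bool list list \<Rightarrow> nat set \<Rightarrow> nat set \<Rightarrow> nat set \<Rightarrow> coord list list \<Rightarrow> bool" where
  "vectors_ok m A D W T \<longleftrightarrow> represents m A D W T \<and> (\<forall>u \<in> set T. set u \<subseteq> coords m A D W)"

lemma reduce_ok:
  assumes p: "large p (length m) k" and W: "few_patterns m k W" and D: "D \<subseteq> {..<length m}"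
    and T: "vectors_ok m A D W T"
  shows "vectors_ok m A D W (reduce p T)" "\<And>u. u \<in> set (reduce p T) \<Longrightarrow> distinct u"
    "sz (reduce p T) \<le> table_bound (length m) k"
proof -
  let ?X = "coords m A D W"
  have Wn: "W \<subseteq> {..<length m}" and N: "card {S. S \<subseteq> W \<and> tfree m S} \<le> pattern_bound (length m) k"
    and s: "\<And>S. S \<subseteq> W \<Longrightarrow> tfree m S \<Longrightarrow> card S \<le> 15 * k + 12"
    using W unfolding few_patterns_def by blast+
  have b: "finite ?X" "card ?X \<le> coord_bound (length m) k" "\<And>x. x \<in> ?X \<Longrightarrow> sz x \<le> 4 * (length m + 2) ^ 2"
    unfolding coord_bound_def by (rule coords_bounds[OF Wn D N s]; assumption)+
  have tb: "card ?X * Suc (card ?X * Suc (4 * (length m + 2) ^ 2)) \<le> table_bound (length m) k"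
    unfolding table_bound_def using b(2) by (intro mult_le_mono Suc_le_mono[THEN iffD2]) auto
  have p': "card ?X * Suc (card ?X * Suc (4 * (length m + 2) ^ 2)) \<le> p"
    using tb p unfolding large_def by simp
  have sub: "set u \<subseteq> ?X" if "u \<in> set T" for u using T that by (simp add: vectors_ok_def)
  note red = reduce_correct[OF b(1,3) p' sub]
  show "vectors_ok m A D W (reduce p T)"
    using T red(1,2) unfolding vectors_ok_def represents_def by auto
  show "u \<in> set (reduce p T) \<Longrightarrow> distinct u" for u using red(2) by blast
  have "sz (reduce p T) \<le> card ?X * Suc (card ?X * Suc (4 * (length m + 2) ^ 2))"
    by (rule sz_vectors_le[OF b(1,3) _ red(3)]) (use red(2) in auto)
  then show "sz (reduce p T) \<le> table_bound (length m) k" using tb by simp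
qed

text \<open>The set \<open>D\<close> is not stored by the program. It records which decided vertices
  a table speaks of; its connectedness is what makes \<open>thin_order\<close> applicable to the
  scope, which is the neighbourhood of \<open>D\<close> among the remaining vertices.\<close>

definition table_ok :: "bool list list \<Rightarrow> nat \<Rightarrow> nat set \<Rightarrow> nat set \<Rightarrow> vtable \<times> nat set \<Rightarrow> bool" where
  "table_ok m k A E z \<longleftrightarrow> (case z of (t, D) \<Rightarrow> D \<noteq> {} \<and> D \<subseteq> E \<and> connected_in (edge m) D \<and>
     set (fst t) = {u \<in> {..<length m} - E. \<exists>d \<in> D. edge m d u} \<and> sz (fst t) \<le> length m * Suc (length m) \<and>
     vectors_ok m A D (set (fst t)) (snd t) \<and> sz (snd t) \<le> table_bound (length m) k)"

definition apart :: "bool list list \<Rightarrow> nat set \<Rightarrow> nat set \<Rightarrow> bool" where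
  "apart m D D' \<longleftrightarrow> D \<inter> D' = {} \<and> (\<forall>x \<in> D. \<forall>y \<in> D'. \<not> edge m x y)"

text \<open>The union of the sets joined so far stays apart from each remaining one, as the next
  join demands. Freedom from duplicates is tracked because the final test reads coefficients as
  membership.\<close>

lemma join_tables_ok:
  assumes und: "undirected (edge m)" and p: "large p (length m) k" and W: "few_patterns m k W"
    and cur: "vectors_ok m A D W cur" "D \<subseteq> {..<length m} - W"
    and zs: "\<And>t D'. (t, D') \<in> set zs \<Longrightarrow> vectors_ok m A D' (set (fst t)) (snd t) \<and> set (fst t) \<subseteq> W \<and>
      D' \<subseteq> {..<length m} - W \<and> apart m D D' \<and> (\<forall>d \<in> D'. \<forall>u \<in> W. edge m d u \<longrightarrow> u \<in> set (fst t))"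
    and pair: "sorted_wrt (\<lambda>z z'. apart m (snd z) (snd z')) zs"
  shows "vectors_ok m A (D \<union> \<Union> (snd ` set zs)) W (join_tables p (map fst zs) cur)"
    "(\<And>u. u \<in> set cur \<Longrightarrow> distinct u) \<Longrightarrow> u \<in> set (join_tables p (map fst zs) cur) \<Longrightarrow> distinct u"
proof -
  interpret undirected "edge m" by (rule und)
  have "vectors_ok m A (D \<union> \<Union> (snd ` set zs)) W (join_tables p (map fst zs) cur) \<and>
    ((\<forall>u \<in> set cur. distinct u) \<longrightarrow> (\<forall>u \<in> set (join_tables p (map fst zs) cur). distinct u))"
    using cur zs pair
  proof (induction zs arbitrary: D cur)
    case Nil
    then show ?case by (simp add: join_tables_def)
  next
    case (Cons z zs)
    obtain t D' where z: "z = (t, D')" by (rule that[OF prod.collapse[symmetric]])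
    have t: "vectors_ok m A D' (set (fst t)) (snd t)" "set (fst t) \<subseteq> W" "D' \<subseteq> {..<length m} - W" "apart m D D'"
      "\<forall>d \<in> D'. \<forall>u \<in> W. edge m d u \<longrightarrow> u \<in> set (fst t)" using Cons.prems(3)[of t D'] z by auto
    have Wn: "W \<subseteq> {..<length m}" using W by (simp add: few_patterns_def)
    let ?T = "concat (map (\<lambda>u. map (\<lambda>w. join_vec (fst t) u w) (snd t)) cur)"
    have fin: "finite D" "finite D'" using Cons.prems(2) t(3) by (auto intro: finite_subset)
    have "represents m A (D \<union> D') W ?T"
    proof (rule represents_join[OF und])
      show "represents m A D W cur" "represents m A D' (set (fst t)) (snd t)"
        using Cons.prems(1) t(1) by (auto simp: vectors_ok_def)
    qed (use Cons.prems(2) t Wn in \<open>auto simp: apart_def\<close>)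
    moreover have "set u \<subseteq> coords m A (D \<union> D') W" if "u \<in> set ?T" for u
    proof -
      obtain u' w where u': "u' \<in> set cur" "w \<in> set (snd t)" "u = join_vec (fst t) u' w" using \<open>u \<in> set ?T\<close> by auto
      have 1: "set u' \<subseteq> coords m A D W" using Cons.prems(1) u'(1) by (simp add: vectors_ok_def)
      have 2: "set w \<subseteq> coords m A D' (set (fst t))" using t(1) u'(2) by (simp add: vectors_ok_def)
      have "D \<inter> D' = {}" using t(4) by (simp add: apart_def)
      from join_coords[OF 1 2 this fin] show ?thesis unfolding u'(3) .
    qed
    ultimately have ok: "vectors_ok m A (D \<union> D') W ?T" by (simp add: vectors_ok_def)
    have DD: "D \<union> D' \<subseteq> {..<length m}" using Cons.prems(2) t(3) by blast
    note red = reduce_ok[OF p W DD ok]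
    have clip: "clip p [] (join_step p t cur) = reduce p ?T"
      unfolding join_step_def using red(3) p by (intro clip_id) (simp add: large_def)
    have ap: "apart m (D \<union> D') D''" if "(t', D'') \<in> set zs" for t' D''
      using Cons.prems(3)[of t' D''] Cons.prems(4) that z unfolding apart_def by fastforce
    have IH: "vectors_ok m A (D \<union> D' \<union> \<Union> (snd ` set zs)) W (join_tables p (map fst zs) (reduce p ?T)) \<and>
      ((\<forall>u \<in> set (reduce p ?T). distinct u) \<longrightarrow> (\<forall>u \<in> set (join_tables p (map fst zs) (reduce p ?T)). distinct u))"
    proof (rule Cons.IH[OF red(1)])
      show "D \<union> D' \<subseteq> {..<length m} - W" using Cons.prems(2) t(3) by blast
      show "sorted_wrt (\<lambda>z z'. apart m (snd z) (snd z')) zs" using Cons.prems(4) by simp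
      show "vectors_ok m A D'' (set (fst t')) (snd t') \<and> set (fst t') \<subseteq> W \<and>
        D'' \<subseteq> {..<length m} - W \<and> apart m (D \<union> D') D'' \<and> (\<forall>d \<in> D''. \<forall>u \<in> W. edge m d u \<longrightarrow> u \<in> set (fst t'))"
        if "(t', D'') \<in> set zs" for t' D''
        using Cons.prems(3)[of t' D''] ap[OF that] that by simp
    qed
    have "join_tables p (map fst (z # zs)) cur = join_tables p (map fst zs) (reduce p ?T)"
      using clip by (simp add: join_tables_def z)
    moreover have "D \<union> \<Union> (snd ` set (z # zs)) = D \<union> D' \<union> \<Union> (snd ` set zs)" by (auto simp: z)
    ultimately show ?case using IH red(2) by simp
  qed
  then show "vectors_ok m A (D \<union> \<Union> (snd ` set zs)) W (join_tables p (map fst zs) cur)"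
    "(\<And>u. u \<in> set cur \<Longrightarrow> distinct u) \<Longrightarrow> u \<in> set (join_tables p (map fst zs) cur) \<Longrightarrow> distinct u"
    by blast+
qed

definition dp_inv :: "bool list list \<Rightarrow> nat \<Rightarrow> nat set \<Rightarrow> vtable list \<times> nat list \<Rightarrow> bool" where
  "dp_inv m k A s \<longleftrightarrow> distinct (snd s) \<and> set (snd s) \<subseteq> {..<length m} \<and>
     (\<exists>zs. fst s = map fst zs \<and> (\<forall>z \<in> set zs. table_ok m k A (set (snd s)) z) \<and>
       sorted_wrt (\<lambda>z z'. apart m (snd z) (snd z')) zs \<and> \<Union> (snd ` set zs) = set (snd s))"

lemma connected_star:
  assumes und: "undirected (edge m)"
    and D: "\<And>D. D \<in> \<D> \<Longrightarrow> connected_in (edge m) D \<and> (\<exists>d \<in> D. edge m v d)"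
  shows "connected_in (edge m) (insert v (\<Union>\<D>))"
proof -
  interpret undirected "edge m" by (rule und)
  let ?D = "insert v (\<Union>\<D>)"
  have all: "y \<in> component (edge m) ?D v" if y: "y \<in> ?D" for y
  proof (cases "y = v")
    case False
    then obtain D' where D': "D' \<in> \<D>" "y \<in> D'" using y by auto
    obtain d where d: "d \<in> D'" "edge m v d" using D[OF D'(1)] by blast
    have dD: "d \<in> ?D" using d D' by blast
    have "d \<in> component (edge m) ?D v"
      by (rule component_closed[OF component_self[of v "edge m" ?D] insertI1 dD d(2)])
    then have eq: "component (edge m) ?D d = component (edge m) ?D v" by (rule component_eq)
    have "component (edge m) D' d \<subseteq> component (edge m) ?D d"
      by (rule component_mono[OF d(1)]) (use D' in blast)
    moreover have "component (edge m) D' d = D'" using D[OF D'(1)] d(1) by (simp add: connected_in_def)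
    ultimately show ?thesis using eq D'(2) by blast
  qed (simp add: component_self)
  have "component (edge m) ?D v = ?D" using all component_subset[of v ?D "edge m"] by blast
  then show ?thesis unfolding connected_in_def using component_eq all by blast
qed

text \<open>The tables with \<open>v\<close> in their scope are those whose set has an edge to
  \<open>v\<close>. Together with \<open>v\<close> these sets are connected, so their common
  remaining neighbourhood, the new scope, lies in the thin set \<open>B\<close>. The other sets have
  no edge to \<open>v\<close> and stay apart.\<close>

lemma eliminate_inv:
  assumes und: "undirected (edge m)" and p: "large p (length m) k"
    and inv: "dp_inv m k (set A) (ts, gone)" and v: "v < length m" "v \<notin> set gone"
    and thin: "thin m k B" "\<And>D. connected_in (edge m) D \<Longrightarrow> v \<in> D \<Longrightarrow> D \<subseteq> insert v (set gone) \<Longrightarrow>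
      {u \<in> {..<length m} - insert v (set gone). \<exists>d \<in> D. edge m d u} \<subseteq> B"
  shows "dp_inv m k (set A) (eliminate p m A v gone ts, v # gone)"
proof -
  interpret undirected "edge m" by (rule und)
  let ?n = "length m"
  let ?E = "set gone"
  obtain zs where zs: "ts = map fst zs" "\<And>z. z \<in> set zs \<Longrightarrow> table_ok m k (set A) ?E z"
    "sorted_wrt (\<lambda>z z'. apart m (snd z) (snd z')) zs" "\<Union> (snd ` set zs) = ?E" "distinct gone" "?E \<subseteq> {..<?n}"
    using inv by (auto simp: dp_inv_def)
  have tok: "D \<noteq> {}" "D \<subseteq> ?E" "connected_in (edge m) D" "set (fst t) = {u \<in> {..<?n} - ?E. \<exists>d \<in> D. edge m d u}"
    "sz (fst t) \<le> ?n * Suc ?n" "vectors_ok m (set A) D (set (fst t)) (snd t)" "sz (snd t) \<le> table_bound ?n k"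
    if "(t, D) \<in> set zs" for t D using zs(2)[OF that] by (auto simp: table_ok_def)
  define rel where "rel = filter (\<lambda>z. v \<in> set (fst (fst z))) zs"
  define rest where "rest = filter (\<lambda>z. v \<notin> set (fst (fst z))) zs"
  have frel: "filter (\<lambda>t. v \<in> set (fst t)) ts = map fst rel" and frest: "filter (\<lambda>t. v \<notin> set (fst t)) ts = map fst rest"
    by (simp_all add: zs(1) rel_def rest_def filter_map comp_def)
  define sc where "sc = new_scope m v gone (map fst rel)"
  define D where "D = insert v (\<Union> (snd ` set rel))"
  have relD: "D' \<subseteq> ?E" "(\<exists>d \<in> D'. edge m d v)" if "(t, D') \<in> set rel" for t D'
    using tok(2,4)[of t D'] that by (auto simp: rel_def)
  have DE: "\<Union> (snd ` set rel) \<subseteq> ?E" using relD by fastforce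
  have conn: "connected_in (edge m) D"
    unfolding D_def
  proof (rule connected_star[OF und])
    fix D' assume "D' \<in> snd ` set rel"
    then obtain t where t: "(t, D') \<in> set rel" by auto
    then have "connected_in (edge m) D'" using tok(3)[of t D'] by (simp add: rel_def)
    then show "connected_in (edge m) D' \<and> (\<exists>d \<in> D'. edge m v d)" using relD(2)[OF t] sym by blast
  qed
  have scset: "set sc = {u \<in> {..<?n} - insert v ?E. \<exists>d \<in> D. edge m d u}"
  proof -
    have "(\<exists>t \<in> set (map fst rel). u \<in> set (fst t)) \<longleftrightarrow> (\<exists>d \<in> \<Union> (snd ` set rel). edge m d u)"
      if u: "u \<in> {..<?n} - insert v ?E" for u
    proof
      assume "\<exists>t \<in> set (map fst rel). u \<in> set (fst t)"
      then obtain t D' where t: "(t, D') \<in> set rel" "u \<in> set (fst t)" by auto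
      then have "\<exists>d \<in> D'. edge m d u" using tok(4)[of t D'] by (simp add: rel_def)
      then show "\<exists>d \<in> \<Union> (snd ` set rel). edge m d u" using t(1) by force
    next
      assume "\<exists>d \<in> \<Union> (snd ` set rel). edge m d u"
      then obtain t D' d where t: "(t, D') \<in> set rel" "d \<in> D'" "edge m d u" by auto
      then have "u \<in> set (fst t)" using tok(4)[of t D'] u by (auto simp: rel_def)
      then show "\<exists>t \<in> set (map fst rel). u \<in> set (fst t)" using t(1) by force
    qed
    then show ?thesis unfolding sc_def new_scope_def D_def by auto
  qed
  have scB: "set sc \<subseteq> B" unfolding scset
    by (rule thin(2)[OF conn]) (use DE in \<open>auto simp: D_def\<close>)
  let ?W = "insert v (set sc)"
  have Wn: "?W \<subseteq> {..<?n}" using v scset by auto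
  have few: "few_patterns m k ?W"
    unfolding few_patterns_def pattern_bound_def
    using thin_count[OF und thin(1) _ Wn, of v] scB Wn by blast
  have few_sc: "few_patterns m k (set sc)" by (rule few_patterns_subset[OF few]) blast
  define U where "U = filter (\<lambda>u. (u = v \<or> u \<in> set sc) \<and> u \<in> set A) [0..<?n]"
  have U: "U = sublist_of m (?W \<inter> set A)" by (simp add: U_def sublist_of_def)
  have pN: "card {S. S \<subseteq> ?W \<inter> set A \<and> tfree m S} * Suc (?n * Suc ?n) \<le> p"
  proof -
    have "few_patterns m k (?W \<inter> set A)" by (rule few_patterns_subset[OF few]) blast
    then have "card {S. S \<subseteq> ?W \<inter> set A \<and> tfree m S} * Suc (?n * Suc ?n) \<le> pattern_bound ?n k * Suc (?n * Suc ?n)"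
      unfolding few_patterns_def by (intro mult_le_mono1) blast
    then show ?thesis using p unfolding large_def by linarith
  qed
  have pq: "2 ^ card S * Suc (?n * (?n + 2)) \<le> p" if "S \<subseteq> ?W \<inter> set A" "tfree m S" for S
  proof -
    have "card S \<le> 15 * k + 12" using few that unfolding few_patterns_def by blast
    then have "2 ^ card S * Suc (?n * (?n + 2)) \<le> 2 ^ (15 * k + 12) * Suc (?n * (?n + 2))"
      by (intro mult_le_mono1 power_increasing) auto
    then show ?thesis using p unfolding large_def by linarith
  qed
  have start: "vectors_ok m (set A) {} ?W (start_vectors p m U)"
    unfolding vectors_ok_def U
    using represents_start(1)[OF und Wn pN pq] start_coords[OF und Wn pN pq] by blast
  define cur where "cur = join_tables p (map fst rel) (start_vectors p m U)"
  have cur: "vectors_ok m (set A) (\<Union> (snd ` set rel)) ?W cur"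
  proof -
    have "vectors_ok m (set A) ({} \<union> \<Union> (snd ` set rel)) ?W cur"
      unfolding cur_def
    proof (rule join_tables_ok(1)[OF und p few start])
      show "sorted_wrt (\<lambda>z z'. apart m (snd z) (snd z')) rel"
        unfolding rel_def by (rule sorted_wrt_filter[OF zs(3)])
      fix t D' assume t: "(t, D') \<in> set rel"
      then have tz: "(t, D') \<in> set zs" by (simp add: rel_def)
      have "set (fst t) \<subseteq> ?W"
      proof
        fix u assume u: "u \<in> set (fst t)"
        then have uE: "u \<in> {..<?n} - ?E" using tok(4)[OF tz] by simp
        show "u \<in> ?W"
        proof (cases "u = v")
          case False
          then show ?thesis using u uE t unfolding sc_def new_scope_def by force
        qed simp
      qed
      moreover have "u \<in> set (fst t)" if "d \<in> D'" "u \<in> ?W" "edge m d u" for d u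
        using that tok(4)[OF tz] Wn v scset by auto
      moreover have "D' \<subseteq> {..<?n} - ?W" using relD(1)[OF t] zs(6) v scset by auto
      ultimately show "vectors_ok m (set A) D' (set (fst t)) (snd t) \<and> set (fst t) \<subseteq> ?W \<and>
        D' \<subseteq> {..<?n} - ?W \<and> apart m {} D' \<and> (\<forall>d \<in> D'. \<forall>u \<in> ?W. edge m d u \<longrightarrow> u \<in> set (fst t))"
        using tok(6)[OF tz] by (simp add: apart_def)
    qed simp
    then show ?thesis by simp
  qed
  let ?F = "concat (map (\<lambda>u. [forget_out v u, forget_in m v u, forget_root m v u]) cur)"
  have vD: "v \<notin> \<Union> (snd ` set rel)" "v \<notin> set sc" using DE v scset by auto
  have "represents m (set A) D (set sc) ?F"
    unfolding D_def
  proof (rule represents_forget[OF und])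
    show "represents m (set A) (\<Union> (snd ` set rel)) ?W cur" using cur by (simp add: vectors_ok_def)
    show "\<Union> (snd ` set rel) \<union> ?W \<subseteq> {..<?n}" using DE zs(6) Wn by blast
    show "\<Union> (snd ` set rel) \<inter> set sc = {}" using DE scset by blast
  qed (use vD in auto)
  moreover have "set u \<subseteq> coords m (set A) D (set sc)" if "u \<in> set ?F" for u
  proof -
    obtain u' where u': "u' \<in> set cur" "u = forget_out v u' \<or> u = forget_in m v u' \<or> u = forget_root m v u'"
      using \<open>u \<in> set ?F\<close> by auto
    have "set u' \<subseteq> coords m (set A) (\<Union> (snd ` set rel)) ?W" using cur u'(1) by (simp add: vectors_ok_def)
    moreover have "finite (\<Union> (snd ` set rel))" using DE finite_subset by blast
    ultimately show ?thesis using forget_coords[OF und _ vD(1) _ Wn vD(2)] u'(2) unfolding D_def by blast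
  qed
  ultimately have okF: "vectors_ok m (set A) D (set sc) ?F" by (simp add: vectors_ok_def)
  have Dn: "D \<subseteq> {..<?n}" using DE zs(6) v by (auto simp: D_def)
  note red = reduce_ok[OF p few_sc Dn okF]
  let ?new = "((sc, reduce p ?F), D)"
  have elim: "eliminate p m A v gone ts = map fst (?new # rest)"
    unfolding eliminate_def frel frest by (simp add: sc_def[symmetric] U_def[symmetric] cur_def[symmetric])
  have new_ok: "table_ok m k (set A) (insert v ?E) ?new"
  proof -
    have "sz sc \<le> ?n * Suc ?n"
      by (rule sz_nat_list_le) (auto simp: sc_def new_scope_def)
    then show ?thesis using red(1,3) conn scset DE by (auto simp: table_ok_def D_def)
  qed
  have rest_ok: "table_ok m k (set A) (insert v ?E) z" if z: "z \<in> set rest" for z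
  proof -
    obtain t D' where tz: "z = (t, D')" by (rule that[OF prod.collapse[symmetric]])
    have z': "(t, D') \<in> set zs" "v \<notin> set (fst t)" using z by (auto simp: rest_def tz)
    have "set (fst t) = {u \<in> {..<?n} - insert v ?E. \<exists>d \<in> D'. edge m d u}" using tok(4)[OF z'(1)] z'(2) by blast
    then show ?thesis using tok[OF z'(1)] by (auto simp: table_ok_def tz)
  qed
  have ap: "apart m D (snd z)" if z: "z \<in> set rest" for z
  proof -
    obtain t D' where tz: "z = (t, D')" by (rule that[OF prod.collapse[symmetric]])
    have z': "(t, D') \<in> set zs" "v \<notin> set (fst t)" using z by (auto simp: rest_def tz)
    have 1: "v \<notin> D'" using tok(2)[OF z'(1)] v by blast
    have 2: "\<not> edge m v y" if "y \<in> D'" for y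
      using tok(4)[OF z'(1)] z'(2) v sym that by blast
    have 3: "apart m D'' D'" if "(t'', D'') \<in> set rel" for t'' D''
    proof -
      \<comment> \<open>The two tables differ, as only one scope contains \<open>v\<close>; hence
        they have different positions, and apartness is symmetric.\<close>
      have "(t'', D'') \<in> set zs" "(t'', D'') \<noteq> (t, D')" using that z' by (auto simp: rel_def)
      then obtain i j where ij: "i < length zs" "j < length zs" "zs ! i = (t'', D'')" "zs ! j = (t, D')" "i \<noteq> j"
        using z'(1) by (metis in_set_conv_nth)
      have s: "apart m (snd (zs ! a)) (snd (zs ! b))" if "a < b" "b < length zs" for a b
        using zs(3) that by (simp add: sorted_wrt_iff_nth_less)
      show ?thesis
      proof (cases "i < j")
        case True
        then show ?thesis using s[of i j] ij by simp
      next
        case False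
        then have "apart m D' D''" using s[of j i] ij by simp
        then show ?thesis using sym unfolding apart_def by blast
      qed
    qed
    show ?thesis using 1 2 3 unfolding apart_def D_def tz snd_conv by fastforce
  qed
  show ?thesis
    unfolding dp_inv_def fst_conv snd_conv
  proof (intro conjI exI[of _ "?new # rest"])
    show "eliminate p m A v gone ts = map fst (?new # rest)" by (rule elim)
    show "\<forall>z \<in> set (?new # rest). table_ok m k (set A) (set (v # gone)) z"
      using new_ok rest_ok by simp
    show "sorted_wrt (\<lambda>z z'. apart m (snd z) (snd z')) (?new # rest)"
      using ap sorted_wrt_filter[OF zs(3)] by (simp add: rest_def)
    have "set zs = set rel \<union> set rest" by (auto simp: rel_def rest_def)
    then show "\<Union> (snd ` set (?new # rest)) = set (v # gone)" using zs(4) by (auto simp: D_def)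
  qed (use zs v in auto)
qed

text \<open>The decided sets are nonempty and disjoint, so there are at most \<open>length m\<close>
  tables.\<close>

lemma sz_dp_state:
  assumes inv: "dp_inv m k A s" and p: "large p (length m) k" shows "sz s \<le> p"
proof -
  let ?n = "length m"
  obtain zs where zs: "fst s = map fst zs" "\<And>z. z \<in> set zs \<Longrightarrow> table_ok m k A (set (snd s)) z"
    "sorted_wrt (\<lambda>z z'. apart m (snd z) (snd z')) zs" "\<Union> (snd ` set zs) = set (snd s)"
    "distinct (snd s)" "set (snd s) \<subseteq> {..<?n}"
    using inv by (auto simp: dp_inv_def)
  have ne: "snd z \<noteq> {}" "snd z \<subseteq> {..<?n}" if "z \<in> set zs" for z using zs(2)[OF that] zs(6) by (auto simp: table_ok_def)
  have "length zs \<le> card (\<Union> (snd ` set zs))"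
    using zs(3) ne
  proof (induction zs)
    case (Cons z zs)
    have "finite (snd z')" if "z' \<in> set (z # zs)" for z' using Cons.prems(3)[OF that] finite_subset by blast
    then have fin: "finite (\<Union> (snd ` set (z # zs)))" by simp
    obtain x where x: "x \<in> snd z" using Cons.prems(2)[of z] by auto
    have "x \<notin> \<Union> (snd ` set zs)" using Cons.prems(1) x by (auto simp: apart_def)
    then have "card (insert x (\<Union> (snd ` set zs))) = Suc (card (\<Union> (snd ` set zs)))" using fin by simp
    moreover have "card (insert x (\<Union> (snd ` set zs))) \<le> card (\<Union> (snd ` set (z # zs)))"
      using x fin by (intro card_mono) auto
    ultimately show ?case using Cons by simp
  qed simp
  also have "\<dots> \<le> ?n" unfolding zs(4) using card_mono[OF finite_lessThan zs(6)] by simp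
  finally have len: "length (fst s) \<le> ?n" using zs(1) by simp
  have "sz (fst s) \<le> ?n * Suc (Suc (?n * Suc ?n + table_bound ?n k))"
  proof (rule sz_list_le[OF _ len])
    fix t assume "t \<in> set (fst s)"
    then obtain D where "(t, D) \<in> set zs" using zs(1) by auto
    then have "sz (fst t) \<le> ?n * Suc ?n" "sz (snd t) \<le> table_bound ?n k"
      using zs(2) by (fastforce simp: table_ok_def)+
    then show "sz t \<le> Suc (?n * Suc ?n + table_bound ?n k)" by (simp add: sz_prod)
  qed
  moreover have "sz (snd s) \<le> ?n * Suc ?n" by (rule sz_nat_list_le[OF zs(6,5)])
  ultimately have "sz s \<le> Suc (?n * Suc (Suc (?n * Suc ?n + table_bound ?n k)) + ?n * Suc ?n)"
    unfolding sz_prod by linarith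
  then show ?thesis using p unfolding large_def by linarith
qed

lemma dp_loop_inv:
  assumes und: "undirected (edge m)" and p: "large p (length m) k"
    and ord: "thin_order m k \<pi>" "distinct \<pi>" "set \<pi> = {..<length m}"
  shows "dp_inv m k (set A) (dp_loop p m A \<pi>)" "set (snd (dp_loop p m A \<pi>)) = {..<length m}"
proof -
  let ?f = "\<lambda>v s. clip p ([], []) (eliminate p m A v (snd s) (fst s), v # snd s)"
  \<comment> \<open>Elimination runs backwards, so after treating a suffix of the order the
    remaining vertices are the prefix before it, the one that \<open>thin_order\<close> refers
    to.\<close>
  have "dp_inv m k (set A) (fold ?f (rev \<sigma>) ([], [])) \<and> snd (fold ?f (rev \<sigma>) ([], [])) = \<sigma>"
    if "\<rho> @ \<sigma> = \<pi>" for \<rho> \<sigma>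
    using that
  proof (induction \<sigma> arbitrary: \<rho>)
    case Nil
    then show ?case by (simp add: dp_inv_def)
  next
    case (Cons v \<sigma>)
    obtain ts where st: "fold ?f (rev \<sigma>) ([], []) = (ts, \<sigma>)" and inv: "dp_inv m k (set A) (ts, \<sigma>)"
      using Cons.IH[of "\<rho> @ [v]"] Cons.prems by (cases "fold ?f (rev \<sigma>) ([], [])") auto
    have \<pi>: "\<pi> = \<rho> @ v # \<sigma>" using Cons.prems by simp
    have v: "v < length m" "v \<notin> set \<sigma>" using ord(2,3) unfolding \<pi> by auto
    have nth: "\<pi> ! length \<rho> = v" "take (length \<rho>) \<pi> = \<rho>" "length \<rho> < length \<pi>" unfolding \<pi> by simp_all
    obtain B where B: "thin m k B" "\<And>D. connected_in (edge m) D \<Longrightarrow> v \<in> D \<Longrightarrow> D \<inter> set \<rho> = {} \<Longrightarrow>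
        {u \<in> set \<rho>. \<exists>d \<in> D. edge m d u} \<subseteq> B"
    proof -
      from ord(1)[unfolded thin_order_def, rule_format, OF nth(3)]
      obtain B where "thin m k B" "\<forall>D. connected_in (edge m) D \<longrightarrow> v \<in> D \<longrightarrow> D \<inter> set \<rho> = {} \<longrightarrow>
        {u \<in> set \<rho>. \<exists>d \<in> D. edge m d u} \<subseteq> B" unfolding nth(1,2) by (elim exE conjE)
      then show ?thesis using that[of B] by (simp only: simp_thms)
    qed
    have \<rho>: "set \<rho> = {..<length m} - insert v (set \<sigma>)" using ord(2,3) unfolding \<pi> by auto
    have inv': "dp_inv m k (set A) (eliminate p m A v \<sigma> ts, v # \<sigma>)"
    proof (rule eliminate_inv[OF und p inv v B(1)])
      fix D assume "connected_in (edge m) D" "v \<in> D" "D \<subseteq> insert v (set \<sigma>)"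
      then show "{u \<in> {..<length m} - insert v (set \<sigma>). \<exists>d \<in> D. edge m d u} \<subseteq> B"
        using B(2)[of D] unfolding \<rho> by blast
    qed
    have "?f v (ts, \<sigma>) = (eliminate p m A v \<sigma> ts, v # \<sigma>)"
      using sz_dp_state[OF inv' p] by (simp add: clip_id)
    then show ?case using st inv' by simp
  qed
  from this[of "[]" \<pi>] show "dp_inv m k (set A) (dp_loop p m A \<pi>)" "set (snd (dp_loop p m A \<pi>)) = {..<length m}"
    using ord(3) by (simp_all add: dp_loop_def)
qed

text \<open>Reading a coefficient is a linear functional. Since the table has the span of all
  solution vectors, the coefficient is nonzero on some basis vector iff it is nonzero on the vector
  of some single solution; different solutions cannot cancel.\<close>

lemma forest_sizes_iff:
  assumes und: "undirected (edge m)" and p: "large p (length m) k"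
    and ord: "thin_order m k \<pi>" "distinct \<pi>" "set \<pi> = {..<length m}"
  shows "a \<in> set (forest_sizes p m A \<pi>) \<longleftrightarrow>
    (\<exists>F R. F \<subseteq> {..<length m} \<inter> set A \<and> R \<subseteq> F \<and> tfree m F \<and> card F = a \<and> card (edge_set m F {}) + card R = a \<and>
      odd (card (colour_sets m F R {})))"
proof -
  interpret undirected "edge m" by (rule und)
  let ?n = "length m"
  obtain zs where zs: "fst (dp_loop p m A \<pi>) = map fst zs" "\<And>z. z \<in> set zs \<Longrightarrow> table_ok m k (set A) {..<?n} z"
    "sorted_wrt (\<lambda>z z'. apart m (snd z) (snd z')) zs" "\<Union> (snd ` set zs) = {..<?n}"
    using dp_loop_inv[OF assms] unfolding dp_inv_def by (metis (no_types, lifting))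
  have only: "{S. S = {} \<and> tfree m S} = {{}}" by (auto simp: tfree_def)
  have few: "few_patterns m k {}"
    by (auto simp: few_patterns_def pattern_bound_def only)
  have start: "vectors_ok m (set A) {} {} [[(0, 0, [])]]"
  proof -
    have part: "partials m (set A) {} {} = {({}, {}, {})}" by (auto simp: partials_def tfree_def)
    have "colour_sets m {} {} {} = {{}}" "edge_set m {} {} = {}" "tag m {} {} = []"
      by (auto simp: colour_sets_def edge_set_def tag_def sublist_of_def)
    then have "represents m (set A) {} {} [[(0, 0, [])]]"
      by (simp add: represents_def part val_def coord_of_def)
    moreover have "(0, 0, []) \<in> coords m (set A) {} {}"
      by (auto simp: coords_iff tfree_def tag_def sublist_of_def)
    ultimately show ?thesis by (simp add: vectors_ok_def)
  qed
  define cur where "cur = join_tables p (map fst zs) [[(0, 0, [])]]"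
  have zok: "vectors_ok m (set A) D' (set (fst t)) (snd t) \<and> set (fst t) \<subseteq> {} \<and>
      D' \<subseteq> {..<?n} - {} \<and> apart m {} D' \<and> (\<forall>d \<in> D'. \<forall>u \<in> {}. edge m d u \<longrightarrow> u \<in> set (fst t))"
    if "(t, D') \<in> set zs" for t D'
    using zs(2)[OF that] by (auto simp: table_ok_def apart_def)
  note join = join_tables_ok[OF und p few start _ zok zs(3)]
  have cur: "vectors_ok m (set A) {..<?n} {} cur" using join(1) zs(4) by (simp add: cur_def)
  have dist: "distinct u" if "u \<in> set cur" for u
    by (rule join(2)) (use that in \<open>auto simp: cur_def\<close>)
  let ?\<phi> = "\<lambda>x. of_bool (x = (a, a, [])) :: bit"
  have "a \<in> set (forest_sizes p m A \<pi>) \<longleftrightarrow> (\<exists>u \<in> set cur. (a, a, []) \<in> set u)"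
    by (force simp: forest_sizes_def zs(1) cur_def)
  also have "\<dots> \<longleftrightarrow> (\<exists>u \<in> set cur. sm ?\<phi> u = 1)"
    using sm_indicator[OF dist] by auto
  also have "\<dots> \<longleftrightarrow> (\<exists>(F, R, S) \<in> partials m (set A) {..<?n} {}. val m ?\<phi> F R S = 1)"
    using cur by (simp add: vectors_ok_def represents_def)
  also have "\<dots> \<longleftrightarrow> (\<exists>F R. F \<subseteq> {..<?n} \<inter> set A \<and> R \<subseteq> F \<and> tfree m F \<and> val m ?\<phi> F R {} = 1)"
    by (auto simp: partials_def)
  also have "\<dots> \<longleftrightarrow> (\<exists>F R. F \<subseteq> {..<?n} \<inter> set A \<and> R \<subseteq> F \<and> tfree m F \<and> card F = a \<and> card (edge_set m F {}) + card R = a \<and>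
      odd (card (colour_sets m F R {})))"
  proof -
    have "val m ?\<phi> F R {} = 1 \<longleftrightarrow> card F = a \<and> card (edge_set m F {}) + card R = a \<and> odd (card (colour_sets m F R {}))" for F R
    proof -
      have "tag m {} X = []" for X by (simp add: tag_def sublist_of_def)
      then have "val m ?\<phi> F R {} = of_nat (card (colour_sets m F R {})) * of_bool (card F = a \<and> card (edge_set m F {}) + card R = a)"
        unfolding val_def coord_of_def by simp
      moreover have "(of_nat c :: bit) = 1 \<longleftrightarrow> odd c" for c by (induction c) auto
      ultimately show ?thesis by auto
    qed
    then show ?thesis by auto
  qed
  finally show ?thesis .
qed

section \<open>Forests\<close>

definition acyclic_on :: "('a \<Rightarrow> 'a \<Rightarrow> bool) \<Rightarrow> 'a set \<Rightarrow> bool" where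
  "acyclic_on E F \<longleftrightarrow> (\<nexists>vs. 3 \<le> length vs \<and> distinct vs \<and> set vs \<subseteq> F \<and>
     (\<forall>i < length vs. E (vs ! i) (vs ! (Suc i mod length vs))))"

definition closed_under :: "('a \<times> 'a) set \<Rightarrow> 'a set \<Rightarrow> bool" where
  "closed_under P X \<longleftrightarrow> (\<forall>e \<in> P. fst e \<in> X \<longleftrightarrow> snd e \<in> X)"

text \<open>Removing an edge splits at most one component, which is repaired by one more root at a
  suitable end of the edge. Without edges, every vertex must be a root.\<close>

lemma card_le_edges_roots:
  assumes "finite P" "finite F" "R \<subseteq> F" "\<And>X. X \<subseteq> F \<Longrightarrow> X \<noteq> {} \<Longrightarrow> closed_under P X \<Longrightarrow> X \<inter> R \<noteq> {}"
    "\<And>e. e \<in> P \<Longrightarrow> fst e \<in> F \<and> snd e \<in> F"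
  shows "card F \<le> card P + card R"
  using assms
proof (induction P arbitrary: R rule: finite_induct)
  case empty
  have "F \<subseteq> R"
  proof
    fix x assume "x \<in> F"
    then show "x \<in> R" using empty.prems(3)[of "{x}"] by (auto simp: closed_under_def)
  qed
  then show ?case using empty.prems by simp
next
  case (insert e P)
  have finR: "finite R" using insert.prems(1,2) finite_subset by blast
  \<comment> \<open>If neither end worked, there would be rootless closed sets \<open>X\<close> and
    \<open>Y\<close>, one containing only \<open>snd e\<close> and the other only
    \<open>fst e\<close>. Their union is closed under \<open>e\<close> too and still has no
    root.\<close>
  have "\<exists>z \<in> {fst e, snd e}. \<forall>X. X \<subseteq> F \<longrightarrow> X \<noteq> {} \<longrightarrow> closed_under P X \<longrightarrow> X \<inter> insert z R \<noteq> {}"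
  proof (rule ccontr)
    assume c: "\<not> ?thesis"
    obtain X where X: "X \<subseteq> F" "X \<noteq> {}" "closed_under P X" "X \<inter> insert (fst e) R = {}" using c by auto
    obtain Y where Y: "Y \<subseteq> F" "Y \<noteq> {}" "closed_under P Y" "Y \<inter> insert (snd e) R = {}" using c by auto
    have no: "\<not> closed_under (insert e P) Z" if "Z \<subseteq> F" "Z \<noteq> {}" "Z \<inter> R = {}" for Z
      using insert.prems(3) that by blast
    have "snd e \<in> X" using no[OF X(1,2)] X(3,4) unfolding closed_under_def by blast
    moreover have "fst e \<in> Y" using no[OF Y(1,2)] Y(3,4) unfolding closed_under_def by blast
    ultimately have "closed_under (insert e P) (X \<union> Y)" using X(3) Y(3) unfolding closed_under_def by blast
    moreover have "X \<union> Y \<subseteq> F" "X \<union> Y \<noteq> {}" "(X \<union> Y) \<inter> R = {}" using X Y by blast+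
    ultimately show False using no by blast
  qed
  then obtain z where z: "z \<in> {fst e, snd e}"
    "\<And>X. X \<subseteq> F \<Longrightarrow> X \<noteq> {} \<Longrightarrow> closed_under P X \<Longrightarrow> X \<inter> insert z R \<noteq> {}" by blast
  have zF: "insert z R \<subseteq> F" using z(1) insert.prems(2) insert.prems(4)[of e] by auto
  have "card F \<le> card P + card (insert z R)"
    by (rule insert.IH[OF insert.prems(1) zF z(2)]) (use insert.prems(4) in blast)+
  also have "card (insert z R) \<le> Suc (card R)" using finR by (simp add: card_insert_if)
  finally show ?case using insert.hyps by simp
qed

context
  fixes m :: "bool list list"
  assumes und: "undirected (edge m)"
begin

interpretation undirected "edge m" by (rule und)

lemma finite_edge_set: "finite F \<Longrightarrow> finite (edge_set m F {})"
  by (rule finite_subset[of _ "F \<times> F"]) (auto simp: edge_set_def mem_Times_iff)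

lemma closed_edge_set: "closed_under (edge_set m F {}) X \<longleftrightarrow> (\<forall>u \<in> F. \<forall>w \<in> F. edge m u w \<longrightarrow> (u \<in> X \<longleftrightarrow> w \<in> X))"
proof
  assume c: "closed_under (edge_set m F {}) X"
  show "\<forall>u \<in> F. \<forall>w \<in> F. edge m u w \<longrightarrow> (u \<in> X \<longleftrightarrow> w \<in> X)"
  proof (intro ballI impI)
    fix u w assume uw: "u \<in> F" "w \<in> F" "edge m u w"
    then have "(u, w) \<in> edge_set m F {} \<or> (w, u) \<in> edge_set m F {}"
      using irrefl sym by (auto simp: edge_set_def) (metis linorder_neqE_nat)
    then show "u \<in> X \<longleftrightarrow> w \<in> X" using c unfolding closed_under_def by fastforce
  qed
qed (auto simp: closed_under_def edge_set_def)

lemma odd_colour_sets_iff: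
  assumes F: "finite F"
  shows "odd (card (colour_sets m F R {})) \<longleftrightarrow>
    (\<forall>X \<subseteq> F. X \<noteq> {} \<longrightarrow> closed_under (edge_set m F {}) X \<longrightarrow> X \<inter> R \<noteq> {})"
proof -
  have C: "colour_sets m F R {} = {X. X \<subseteq> F \<and> X \<inter> R = {} \<and> closed_under (edge_set m F {}) X}"
    unfolding colour_sets_def closed_edge_set by auto
  let ?C = "colour_sets m F R {}"
  \<comment> \<open>symmetric difference with a nonempty colouring pairs up all colourings\<close>
  have fin: "finite ?C" using F by (simp add: finite_colour_sets)
  have e: "{} \<in> ?C" by (simp add: C closed_under_def)
  show ?thesis
  proof (cases "?C = {{}}")
    case True
    then have "X \<inter> R \<noteq> {}" if "X \<subseteq> F" "X \<noteq> {}" "closed_under (edge_set m F {}) X" for X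
      using that unfolding C by blast
    then show ?thesis using True by simp
  next
    case False
    then obtain Y y where Y: "Y \<in> ?C" "y \<in> Y" using e by blast
    let ?d = "\<lambda>X. (X - Y) \<union> (Y - X)"
    have dC: "?d X \<in> ?C" if "X \<in> ?C" for X using that Y(1) unfolding C closed_under_def by blast
    have "bij_betw ?d {X \<in> ?C. y \<in> X} {X \<in> ?C. y \<notin> X}"
      by (rule bij_betw_byWitness[where f' = ?d]) (use dC Y(2) in auto)
    then have "card {X \<in> ?C. y \<in> X} = card {X \<in> ?C. y \<notin> X}" by (rule bij_betw_same_card)
    moreover have "card ?C = card {X \<in> ?C. y \<in> X} + card {X \<in> ?C. y \<notin> X}"
      using fin by (subst card_Un_disjoint[symmetric]) (auto intro: arg_cong[where f = card])
    ultimately have "even (card ?C)" by simp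
    moreover have "Y \<subseteq> F" "Y \<noteq> {}" "closed_under (edge_set m F {}) Y" "Y \<inter> R = {}" using Y unfolding C by auto
    ultimately show ?thesis by blast
  qed
qed

text \<open>An edge of a cycle is redundant for connectivity: the roots still hit every closed set
  without it. Then one edge less would suffice for the count, contradicting equality.\<close>

lemma acyclic_if_rooted:
  assumes F: "finite F" and R: "R \<subseteq> F" "card (edge_set m F {}) + card R = card F"
    "\<And>X. X \<subseteq> F \<Longrightarrow> X \<noteq> {} \<Longrightarrow> closed_under (edge_set m F {}) X \<Longrightarrow> X \<inter> R \<noteq> {}"
  shows "acyclic_on (edge m) F"
  unfolding acyclic_on_def
proof
  let ?P = "edge_set m F {}"
  assume "\<exists>vs. 3 \<le> length vs \<and> distinct vs \<and> set vs \<subseteq> F \<and> (\<forall>i < length vs. edge m (vs ! i) (vs ! (Suc i mod length vs)))"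
  then obtain vs where vs: "3 \<le> length vs" "distinct vs" "set vs \<subseteq> F"
    and edge: "\<And>i. i < length vs \<Longrightarrow> edge m (vs ! i) (vs ! (Suc i mod length vs))" by blast
  let ?L = "length vs"
  let ?a = "vs ! 0" and ?b = "vs ! (?L - 1)"
  have inF: "vs ! i \<in> F" if "i < ?L" for i using vs(3) that nth_mem by blast
  have ab: "?a \<in> F" "?b \<in> F" by (rule inF; use vs(1) in linarith)+
  have "edge m ?b ?a" using edge[of "?L - 1"] vs(1) by (cases vs) simp_all
  define e where "e = (min ?a ?b, max ?a ?b)"
  have "0 < ?L" "?L - 1 < ?L" "0 \<noteq> ?L - 1" using vs(1) by linarith+
  then have ne: "?a \<noteq> ?b" using nth_eq_iff_index_eq[OF vs(2), of 0 "?L - 1"] by simp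
  have eP: "e \<in> ?P"
    using ab ne \<open>edge m ?b ?a\<close> sym unfolding e_def edge_set_def by (auto simp: min_def max_def)
  \<comment> \<open>Membership in \<open>X\<close> is passed along the other edges of the cycle from
    one end of \<open>e\<close> to the other.\<close>
  have closed: "closed_under ?P X" if X: "closed_under (?P - {e}) X" for X
  proof -
    have step: "vs ! i \<in> X \<longleftrightarrow> vs ! Suc i \<in> X" if i: "Suc i < ?L" for i
    proof -
      have E: "edge m (vs ! i) (vs ! Suc i)" using edge[of i] i by simp
      define f where "f = (min (vs ! i) (vs ! Suc i), max (vs ! i) (vs ! Suc i))"
      have "vs ! i \<noteq> vs ! Suc i" using vs(2) i by (simp add: nth_eq_iff_index_eq)
      then have "f \<in> ?P" using inF[of i] inF[of "Suc i"] i E sym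
        unfolding f_def edge_set_def by (auto simp: min_def max_def)
      \<comment> \<open>Consecutive positions are the first and the last one only in a list of
        length two.\<close>
      moreover have "f \<noteq> e"
      proof
        assume "f = e"
        then have "{vs ! i, vs ! Suc i} = {?a, ?b}"
          unfolding f_def e_def by (auto simp: min_def max_def split: if_splits)
        then have "(vs ! i = ?a \<and> vs ! Suc i = ?b) \<or> (vs ! i = ?b \<and> vs ! Suc i = ?a)" by (simp add: doubleton_eq_iff)
        moreover have "vs ! Suc i \<noteq> ?a" using nth_eq_iff_index_eq[OF vs(2), of "Suc i" 0] i vs(1) by linarith
        ultimately have "vs ! i = ?a" "vs ! Suc i = ?b" by blast+
        moreover have "i < ?L" "0 < ?L" "?L - 1 < ?L" using i by linarith+
        ultimately have "i = 0" "Suc i = ?L - 1" using i by (simp_all add: nth_eq_iff_index_eq[OF vs(2)])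
        then show False using vs(1) by simp
      qed
      ultimately have "f \<in> ?P - {e}" by simp
      then have "fst f \<in> X \<longleftrightarrow> snd f \<in> X" using X unfolding closed_under_def by blast
      then show ?thesis unfolding f_def by (auto simp: min_def max_def split: if_splits)
    qed
    have "vs ! i \<in> X \<longleftrightarrow> ?a \<in> X" if "i < ?L" for i using that
    proof (induction i)
      case (Suc i)
      then show ?case using step[of i] by simp
    qed simp
    then have "?b \<in> X \<longleftrightarrow> ?a \<in> X" using vs(1) by simp
    then have "fst e \<in> X \<longleftrightarrow> snd e \<in> X" unfolding e_def by (auto simp: min_def max_def)
    then show ?thesis using X unfolding closed_under_def by blast
  qed
  have "card F \<le> card (?P - {e}) + card R"
  proof (rule card_le_edges_roots)
    show "X \<inter> R \<noteq> {}" if "X \<subseteq> F" "X \<noteq> {}" "closed_under (?P - {e}) X" for X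
      using R(3)[OF that(1,2) closed[OF that(3)]] .
    show "fst f \<in> F \<and> snd f \<in> F" if "f \<in> ?P - {e}" for f using that by (auto simp: edge_set_def)
  qed (use F R finite_edge_set in auto)
  moreover have "card (?P - {e}) < card ?P" using eP finite_edge_set[OF F] by (rule card_Diff1_less[rotated])
  ultimately show False using R(2) by simp
qed

text \<open>The start of a longest path has all its neighbours on the path. A neighbour beyond the
  second vertex closes a cycle.\<close>

lemma acyclic_leaf:
  assumes F: "finite F" "F \<noteq> {}" and ac: "acyclic_on (edge m) F"
  shows "\<exists>v \<in> F. \<forall>x \<in> F. \<forall>y \<in> F. edge m v x \<longrightarrow> edge m v y \<longrightarrow> x = y"
proof (rule ccontr)
  assume "\<not> ?thesis"
  then have two: "\<And>v. v \<in> F \<Longrightarrow> \<exists>x \<in> F. \<exists>y \<in> F. edge m v x \<and> edge m v y \<and> x \<noteq> y" by blast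
  define W where "W p \<longleftrightarrow> p \<noteq> [] \<and> distinct p \<and> set p \<subseteq> F \<and> successively (edge m) p" for p
  obtain v where "v \<in> F" using F(2) by blast
  then have "W [v]" by (simp add: W_def)
  moreover have "\<forall>p. W p \<longrightarrow> length p < Suc (card F)"
    using length_le_card_distinct F(1) unfolding W_def by (metis less_Suc_eq_le)
  ultimately obtain p where p: "W p" and longest: "\<And>q. W q \<Longrightarrow> length q \<le> length p"
    using ex_has_greatest_nat[of W "[v]" length "Suc (card F)"] by blast
  obtain x q where xq: "p = x # q" using p by (cases p) (auto simp: W_def)
  have P: "distinct p" "set p \<subseteq> F" "successively (edge m) p" using p by (auto simp: W_def)
  have xF: "x \<in> F" using P(2) xq by simp
  have mem: "y \<in> set p" if y: "y \<in> F" "edge m x y" for y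
  proof (rule ccontr)
    assume "y \<notin> set p"
    then have "W (y # p)" using P y sym xq by (simp add: W_def)
    from longest[OF this] show False by simp
  qed
  obtain y where y: "y \<in> F" "edge m x y" "q \<noteq> [] \<longrightarrow> y \<noteq> hd q" using two[OF xF] by metis
  have "y \<in> set p" by (rule mem[OF y(1,2)])
  then obtain j where j: "j < length p" "p ! j = y" by (auto simp: in_set_conv_nth)
  have "j \<noteq> 0" using j y(2) irrefl xq by (metis nth_Cons_0)
  moreover have "j \<noteq> 1" using j y(3) xq by (cases q) auto
  ultimately have j2: "2 \<le> j" by simp
  let ?c = "take (Suc j) p"
  have len: "length ?c = Suc j" using j by simp
  have "edge m (?c ! i) (?c ! (Suc i mod length ?c))" if i: "i < length ?c" for i
  proof (cases "i = j")
    case True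
    have "?c ! j = y" "?c ! 0 = x" using j xq by (simp_all del: take_Suc_Cons)
    then show ?thesis using True len sym[OF y(2)] by simp
  next
    case False
    then have "Suc i < length p" "i < j" using i j by auto
    then show ?thesis using P(3) len by (simp add: successively_conv_nth)
  qed
  moreover have "distinct ?c" "set ?c \<subseteq> F" using P set_take_subset[of "Suc j" p] by auto
  ultimately show False using ac j2 len unfolding acyclic_on_def by (metis Suc_le_mono eval_nat_numeral(3))
qed

lemma acyclic_on_subset: "acyclic_on E F \<Longrightarrow> F' \<subseteq> F \<Longrightarrow> acyclic_on E F'"
  unfolding acyclic_on_def by blast

text \<open>Removing a vertex \<open>v\<close> of degree at most one: if it is isolated it becomes a
  root, otherwise it adds exactly one edge and shares the root of its neighbour.\<close>

lemma rooted_if_acyclic: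
  assumes "finite F" "acyclic_on (edge m) F"
  shows "\<exists>R \<subseteq> F. card (edge_set m F {}) + card R = card F \<and>
    (\<forall>X \<subseteq> F. X \<noteq> {} \<longrightarrow> closed_under (edge_set m F {}) X \<longrightarrow> X \<inter> R \<noteq> {})"
  using assms
proof (induction "card F" arbitrary: F)
  case 0
  then have "F = {}" by simp
  then show ?case by (intro exI[of _ "{}"]) (auto simp: edge_set_def)
next
  case (Suc n)
  have "F \<noteq> {}" using Suc.hyps(2) by auto
  then obtain v where v: "v \<in> F" "\<forall>x \<in> F. \<forall>y \<in> F. edge m v x \<longrightarrow> edge m v y \<longrightarrow> x = y"
    using acyclic_leaf Suc.prems by blast
  let ?F = "F - {v}"
  have cF: "card F = Suc (card ?F)" using v(1) Suc.prems(1) by (rule card.remove[rotated])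
  have "n = card ?F" using cF Suc.hyps(2) by simp
  then obtain R where R: "R \<subseteq> ?F" "card (edge_set m ?F {}) + card R = card ?F"
    "\<And>X. X \<subseteq> ?F \<Longrightarrow> X \<noteq> {} \<Longrightarrow> closed_under (edge_set m ?F {}) X \<Longrightarrow> X \<inter> R \<noteq> {}"
    using Suc.hyps(1)[of ?F] Suc.prems acyclic_on_subset[of "edge m" F ?F] by auto
  have finR: "finite R" using R(1) Suc.prems(1) finite_subset by blast
  have old: "edge_set m ?F {} \<subseteq> edge_set m F {}" by (auto simp: edge_set_def)
  have cl: "closed_under (edge_set m ?F {}) (X - {v})" if "closed_under (edge_set m F {}) X" for X
    using that by (auto simp: closed_under_def edge_set_def)
  have hit: "X = {v}" if X: "X \<subseteq> F" "X \<noteq> {}" "closed_under (edge_set m F {}) X" "X \<inter> R = {}" for X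
  proof (rule ccontr)
    assume "X \<noteq> {v}"
    then have "X - {v} \<noteq> {}" using X(2) by blast
    then have "(X - {v}) \<inter> R \<noteq> {}" using R(3)[of "X - {v}"] X(1) cl[OF X(3)] by blast
    then show False using X(4) by blast
  qed
  show ?case
  proof (cases "\<exists>w \<in> F. edge m v w")
    case False
    have "edge_set m F {} = edge_set m ?F {}"
    proof
      show "edge_set m F {} \<subseteq> edge_set m ?F {}"
      proof
        fix f assume f: "f \<in> edge_set m F {}"
        then have "fst f \<noteq> v" "snd f \<noteq> v" using False sym[of "fst f" "snd f"] by (auto simp: edge_set_def)
        then show "f \<in> edge_set m ?F {}" using f by (auto simp: edge_set_def)
      qed
    qed (rule old)
    moreover have "card (insert v R) = Suc (card R)" using finR R(1) by (intro card_insert_disjoint) auto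
    moreover have "X \<inter> insert v R \<noteq> {}" if "X \<subseteq> F" "X \<noteq> {}" "closed_under (edge_set m F {}) X" for X
      using hit[OF that] by blast
    moreover have "insert v R \<subseteq> F" using R(1) v(1) by blast
    moreover have "card (edge_set m F {}) + card (insert v R) = card F" using R(2) cF calculation(1,2) by simp
    ultimately show ?thesis by (intro exI[of _ "insert v R"]) blast
  next
    case True
    then obtain w where w: "w \<in> F" "edge m v w" by blast
    have uniq: "x = w" if "x \<in> F" "edge m v x" for x using v(2) w that by blast
    have vw: "v \<noteq> w" using w irrefl by auto
    define e where "e = (min v w, max v w)"
    have "edge_set m F {} = insert e (edge_set m ?F {})"
    proof
      show "insert e (edge_set m ?F {}) \<subseteq> edge_set m F {}"
        using old v(1) w vw sym by (auto simp: e_def edge_set_def min_def max_def)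
      show "edge_set m F {} \<subseteq> insert e (edge_set m ?F {})"
      proof
        fix f assume f: "f \<in> edge_set m F {}"
        show "f \<in> insert e (edge_set m ?F {})"
        proof (cases "fst f = v \<or> snd f = v")
          case True
          then have "f = e"
          proof
            assume "fst f = v"
            then have "snd f = w" using f uniq by (auto simp: edge_set_def)
            then show ?thesis using f \<open>fst f = v\<close> by (auto simp: e_def edge_set_def prod_eq_iff)
          next
            assume "snd f = v"
            then have "fst f = w" using f uniq sym by (auto simp: edge_set_def)
            then show ?thesis using f \<open>snd f = v\<close> by (auto simp: e_def edge_set_def prod_eq_iff)
          qed
          then show ?thesis by simp
        next
          case False
          then show ?thesis using f by (auto simp: edge_set_def)
        qed
      qed
    qed
    moreover have "e \<notin> edge_set m ?F {}" by (auto simp: e_def edge_set_def min_def max_def)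
    ultimately have card: "card (edge_set m F {}) = Suc (card (edge_set m ?F {}))"
      using finite_edge_set[of ?F] Suc.prems(1) by simp
    have "X \<inter> R \<noteq> {}" if X: "X \<subseteq> F" "X \<noteq> {}" "closed_under (edge_set m F {}) X" for X
    proof
      assume "X \<inter> R = {}"
      then have "X = {v}" by (rule hit[OF X])
      then show False using X(3) v(1) w vw unfolding closed_edge_set by blast
    qed
    moreover have "R \<subseteq> F" using R(1) by blast
    ultimately show ?thesis using R(2) card cF by (intro exI[of _ R] conjI allI impI) simp_all
  qed
qed

text \<open>Translates what the tables can observe of a set, namely two counts and a parity, into
  acyclicity.\<close>

lemma acyclic_iff:
  assumes F: "finite F"
  shows "(\<exists>R \<subseteq> F. tfree m F \<and> card (edge_set m F {}) + card R = card F \<and> odd (card (colour_sets m F R {}))) \<longleftrightarrow>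
    acyclic_on (edge m) F"
proof
  assume "\<exists>R \<subseteq> F. tfree m F \<and> card (edge_set m F {}) + card R = card F \<and> odd (card (colour_sets m F R {}))"
  then show "acyclic_on (edge m) F" unfolding odd_colour_sets_iff[OF F] using acyclic_if_rooted[OF F] by blast
next
  assume ac: "acyclic_on (edge m) F"
  have "tfree m F"
    unfolding tfree_def
  proof
    assume "\<exists>a \<in> F. \<exists>b \<in> F. \<exists>c \<in> F. edge m a b \<and> edge m a c \<and> edge m b c"
    then obtain a b c where abc: "a \<in> F" "b \<in> F" "c \<in> F" "edge m a b" "edge m a c" "edge m b c" by blast
    have "edge m ([a, b, c] ! i) ([a, b, c] ! (Suc i mod length [a, b, c]))" if "i < length [a, b, c]" for i
    proof -
      have "i = 0 \<or> i = 1 \<or> i = 2" using that by auto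
      then show ?thesis using abc sym by auto
    qed
    moreover have "distinct [a, b, c]" using abc irrefl by auto
    moreover have "3 \<le> length [a, b, c]" "set [a, b, c] \<subseteq> F" using abc by auto
    ultimately show False using ac unfolding acyclic_on_def by blast
  qed
  then show "\<exists>R \<subseteq> F. tfree m F \<and> card (edge_set m F {}) + card R = card F \<and> odd (card (colour_sets m F R {}))"
    unfolding odd_colour_sets_iff[OF F] using rooted_if_acyclic[OF F ac] by blast
qed

end

section \<open>The algorithm\<close>

definition max_list :: "nat list \<Rightarrow> nat" where
  "max_list xs = fold (\<lambda>a b. if b \<le> a then a else b) xs 0"

text \<open>The tables report only sizes of induced forests, so a largest forest is found by
  dropping every vertex that some maximum forest in the current set can spare.\<close>

definition shrink :: "nat \<Rightarrow> bool list list \<Rightarrow> nat list \<Rightarrow> nat list" where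
  "shrink p m \<pi> = fold (\<lambda>v U. if max_list (forest_sizes p m (filter (\<lambda>u. u \<noteq> v) U) \<pi>) =
       max_list (forest_sizes p m [0..<length m] \<pi>) then filter (\<lambda>u. u \<noteq> v) U else U) [0..<length m] [0..<length m]"

definition solve :: "nat \<Rightarrow> bool list list \<Rightarrow> nat \<Rightarrow> nat list option" where
  "solve p m k = (case elimination_order p m k of None \<Rightarrow> None
     | Some \<pi> \<Rightarrow> Some (filter (\<lambda>v. v \<notin> set (shrink p m \<pi>)) [0..<length m]))"

lemma ptime_solve [pt]:
  assumes "ptime p" "ptime m" "ptime k" shows "ptime (\<lambda>x. solve (p x) (m x) (k x))"
proof -
  have maxl: "ptime (\<lambda>x. max_list (l x))" if l: "ptime l" for l :: "'y::enc \<Rightarrow> nat list"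
    unfolding max_list_def
  proof (rule ptime_fold[OF _ l _ feasible_pbounded[OF l]])
    have *: "fold (\<lambda>a b. if b \<le> a then a else b) xs s \<le> sz xs + s" for xs and s :: nat
    proof (induction xs arbitrary: s)
      case (Cons x xs)
      show ?case using Cons.IH[of x] Cons.IH[of s] by auto
    qed simp
    show "sz (fold (\<lambda>a b. if b \<le> a then a else b) (take i (l x)) 0) \<le> sz (l x)" for x i
      using *[of "take i (l x)" 0] sz_take_le[of i "l x"] by simp
  qed (intro pt)+
  have shrink: "ptime (\<lambda>x. shrink (p x) (m x) (\<pi> x))" if p: "ptime p" and m: "ptime m" and \<pi>: "ptime \<pi>"
    for p :: "'y::enc \<Rightarrow> _" and m \<pi>
    unfolding shrink_def
  proof (rule ptime_fold)
    have *: "sz (fold (\<lambda>v U. if P v U then filter (\<lambda>u. u \<noteq> v) U else U) vs U) \<le> sz U" for P vs and U :: "nat list"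
      by (induction vs arbitrary: U) (auto intro: order.trans[OF _ sz_filter_le])
    show "pbounded sz (\<lambda>x. sz [0..<length (m x)])" by (intro feasible_pbounded pt m)
    show "sz (fold (\<lambda>v U. if max_list (forest_sizes (p x) (m x) (filter (\<lambda>u. u \<noteq> v) U) (\<pi> x)) =
       max_list (forest_sizes (p x) (m x) [0..<length (m x)] (\<pi> x)) then filter (\<lambda>u. u \<noteq> v) U else U)
       (take i [0..<length (m x)]) [0..<length (m x)]) \<le> sz [0..<length (m x)]" for x i by (rule *)
  qed (intro pt maxl that that[THEN feasible_compose])+
  show ?thesis unfolding solve_def by (intro pt shrink assms assms[THEN feasible_compose])
qed

lemma max_list_eq: "xs \<noteq> [] \<Longrightarrow> max_list xs = Max (set xs)"
proof -
  assume "xs \<noteq> []"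
  have "fold (\<lambda>a b. if b \<le> a then a else b) xs s = Max (insert s (set xs))" for s :: nat
  proof (induction xs arbitrary: s)
    case (Cons x xs)
    have "Max (insert s (set (x # xs))) = max s (max x (Max (insert x (set xs))))" if "xs \<noteq> []"
      using that by (simp add: Max_insert)
    then show ?case using Cons by (cases "xs = []") (auto simp: max_def)
  qed simp
  then have "max_list xs = Max (insert 0 (set xs))" by (simp add: max_list_def)
  also have "\<dots> = Max (set xs)" using \<open>xs \<noteq> []\<close> by simp
  finally show ?thesis .
qed

text \<open>A vertex that could not be spared stays indispensable when the set shrinks further. So a
  maximum forest inside the final set contains all its vertices, and the set itself is that
  forest.\<close>

lemma shrink_correct:
  assumes und: "undirected (edge m)" and p: "large p (length m) k"
    and ord: "thin_order m k \<pi>" "distinct \<pi>" "set \<pi> = {..<length m}"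
  shows "acyclic_on (edge m) (set (shrink p m \<pi>))" "set (shrink p m \<pi>) \<subseteq> {..<length m}"
    "\<And>F. F \<subseteq> {..<length m} \<Longrightarrow> acyclic_on (edge m) F \<Longrightarrow> card F \<le> card (set (shrink p m \<pi>))"
proof -
  let ?n = "length m"
  let ?ac = "acyclic_on (edge m)"
  have sizes: "set (forest_sizes p m A \<pi>) = card ` {F. F \<subseteq> {..<?n} \<inter> set A \<and> ?ac F}" for A
  proof -
    have "a \<in> set (forest_sizes p m A \<pi>) \<longleftrightarrow> (\<exists>F. F \<subseteq> {..<?n} \<inter> set A \<and> ?ac F \<and> card F = a)" for a
    proof -
      have fin: "finite F" if "F \<subseteq> {..<?n} \<inter> set A" for F using that finite_subset by blast
      have "a \<in> set (forest_sizes p m A \<pi>) \<longleftrightarrow> (\<exists>F. F \<subseteq> {..<?n} \<inter> set A \<and> (\<exists>R \<subseteq> F. tfree m F \<and>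
          card (edge_set m F {}) + card R = card F \<and> odd (card (colour_sets m F R {}))) \<and> card F = a)"
        unfolding forest_sizes_iff[OF und p ord] by (intro ex_cong1) auto
      also have "\<dots> \<longleftrightarrow> (\<exists>F. F \<subseteq> {..<?n} \<inter> set A \<and> ?ac F \<and> card F = a)"
        by (intro ex_cong1 conj_cong refl acyclic_iff[OF und fin])
      finally show ?thesis .
    qed
    then show ?thesis by auto
  qed
  define b where "b = max_list (forest_sizes p m [0..<?n] \<pi>)"
  have ac0: "?ac {}" by (simp add: acyclic_on_def)
  have fin: "finite {F. F \<subseteq> {..<?n} \<inter> set A \<and> ?ac F}" for A
    by (rule finite_subset[of _ "Pow {..<?n}"]) auto
  have ml: "max_list (forest_sizes p m A \<pi>) = Max (card ` {F. F \<subseteq> {..<?n} \<inter> set A \<and> ?ac F})" for A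
  proof -
    have "0 \<in> card ` {F. F \<subseteq> {..<?n} \<inter> set A \<and> ?ac F}" using ac0 by force
    then have "forest_sizes p m A \<pi> \<noteq> []" using sizes[of A] by force
    then show ?thesis using max_list_eq sizes[of A] by simp
  qed
  have le_b: "card F \<le> b" if "F \<subseteq> {..<?n}" "?ac F" for F
    unfolding b_def ml by (rule Max_ge, intro finite_imageI fin, rule imageI) (use that in \<open>simp add: atLeast0LessThan\<close>)
  have test: "max_list (forest_sizes p m A \<pi>) = b \<longleftrightarrow> (\<exists>F. F \<subseteq> {..<?n} \<inter> set A \<and> ?ac F \<and> card F = b)" for A
  proof
    assume "max_list (forest_sizes p m A \<pi>) = b"
    moreover have "Max (card ` {F. F \<subseteq> {..<?n} \<inter> set A \<and> ?ac F}) \<in> card ` {F. F \<subseteq> {..<?n} \<inter> set A \<and> ?ac F}"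
      by (rule Max_in, intro finite_imageI fin) (use ac0 in auto)
    ultimately have "b \<in> card ` {F. F \<subseteq> {..<?n} \<inter> set A \<and> ?ac F}" unfolding ml by simp
    then show "\<exists>F. F \<subseteq> {..<?n} \<inter> set A \<and> ?ac F \<and> card F = b" by auto
  next
    assume "\<exists>F. F \<subseteq> {..<?n} \<inter> set A \<and> ?ac F \<and> card F = b"
    then have "b \<in> card ` {F. F \<subseteq> {..<?n} \<inter> set A \<and> ?ac F}" by auto
    then show "max_list (forest_sizes p m A \<pi>) = b" unfolding ml
      by (intro Max_eqI finite_imageI fin) (use le_b in auto)
  qed
  let ?f = "\<lambda>v U. if max_list (forest_sizes p m (filter (\<lambda>u. u \<noteq> v) U) \<pi>) = b then filter (\<lambda>u. u \<noteq> v) U else U"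
  have mono: "\<nexists>F. F \<subseteq> A \<and> ?ac F \<and> card F = b \<Longrightarrow> B \<subseteq> A \<Longrightarrow> \<nexists>F. F \<subseteq> B \<and> ?ac F \<and> card F = b" for A B
    by blast
  have has0: "\<exists>F. F \<subseteq> {..<?n} \<inter> set [0..<?n] \<and> ?ac F \<and> card F = b"
    using test[of "[0..<?n]"] b_def by simp
  have inv: "set (fold ?f [0..<i] [0..<?n]) \<subseteq> {..<?n} \<and> (\<exists>F \<subseteq> set (fold ?f [0..<i] [0..<?n]). ?ac F \<and> card F = b) \<and>
      (\<forall>v < i. v \<in> set (fold ?f [0..<i] [0..<?n]) \<longrightarrow> (\<nexists>F. F \<subseteq> set (fold ?f [0..<i] [0..<?n]) - {v} \<and> ?ac F \<and> card F = b))" for i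
  proof (induction i)
    case 0
    show ?case using has0 by auto
  next
    case (Suc i)
    let ?U = "fold ?f [0..<i] [0..<?n]"
    have U: "set ?U \<subseteq> {..<?n}" "\<exists>F \<subseteq> set ?U. ?ac F \<and> card F = b"
      "\<And>v. v < i \<Longrightarrow> v \<in> set ?U \<Longrightarrow> (\<nexists>F. F \<subseteq> set ?U - {v} \<and> ?ac F \<and> card F = b)" using Suc by auto
    have eq: "fold ?f [0..<Suc i] [0..<?n] = ?f i ?U" by simp
    have set: "set (filter (\<lambda>u. u \<noteq> i) ?U) = set ?U - {i}" by auto
    have t: "max_list (forest_sizes p m (filter (\<lambda>u. u \<noteq> i) ?U) \<pi>) = b \<longleftrightarrow> (\<exists>F. F \<subseteq> set ?U - {i} \<and> ?ac F \<and> card F = b)"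
    proof -
      have "{..<?n} \<inter> set (filter (\<lambda>u. u \<noteq> i) ?U) = set ?U - {i}" unfolding set using U(1) by auto
      then show ?thesis by (subst test) (simp only:)
    qed
    show ?case
    proof (cases "\<exists>F. F \<subseteq> set ?U - {i} \<and> ?ac F \<and> card F = b")
      case True
      then have e: "?f i ?U = filter (\<lambda>u. u \<noteq> i) ?U" using t by (simp only: if_True)
      show ?thesis unfolding eq e set
      proof (intro conjI allI impI)
        show "set ?U - {i} \<subseteq> {..<?n}" using U(1) by blast
        show "\<exists>F \<subseteq> set ?U - {i}. ?ac F \<and> card F = b" using True by simp
        fix v assume "v < Suc i" "v \<in> set ?U - {i}"
        then have "v < i" "v \<in> set ?U" by auto
        then have "\<nexists>F. F \<subseteq> set ?U - {v} \<and> ?ac F \<and> card F = b" by (rule U(3))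
        moreover have "set ?U - {i} - {v} \<subseteq> set ?U - {v}" by auto
        ultimately show "\<nexists>F. F \<subseteq> set ?U - {i} - {v} \<and> ?ac F \<and> card F = b" by (rule mono)
      qed
    next
      case False
      then have e: "?f i ?U = ?U" using t by (simp only: if_False)
      show ?thesis unfolding eq e
      proof (intro conjI allI impI)
        fix v assume "v < Suc i" "v \<in> set ?U"
        then show "\<nexists>F. F \<subseteq> set ?U - {v} \<and> ?ac F \<and> card F = b"
          using U(3)[of v] False by (cases "v = i") (simp_all add: less_Suc_eq)
      qed (fact U(1,2))+
    qed
  qed
  define U where "U = shrink p m \<pi>"
  have Uf: "U = fold ?f [0..<?n] [0..<?n]" by (simp add: U_def shrink_def b_def)
  obtain F where U: "set U \<subseteq> {..<?n}" and F: "F \<subseteq> set U" "?ac F" "card F = b"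
    and crit: "\<And>v. v < ?n \<Longrightarrow> v \<in> set U \<Longrightarrow> (\<nexists>F. F \<subseteq> set U - {v} \<and> ?ac F \<and> card F = b)"
    using inv[of ?n] unfolding Uf[symmetric] by blast
  have "F = set U"
  proof (rule ccontr)
    assume "F \<noteq> set U"
    then obtain v where "v \<in> set U" "v \<notin> F" using F(1) by blast
    then show False using crit[of v] U F by blast
  qed
  then show "?ac (set (shrink p m \<pi>))" "set (shrink p m \<pi>) \<subseteq> {..<?n}"
    "\<And>F. F \<subseteq> {..<?n} \<Longrightarrow> ?ac F \<Longrightarrow> card F \<le> card (set (shrink p m \<pi>))"
    using F U le_b unfolding U_def by auto
qed

section \<open>Size of the padding\<close>

lemma le_power_Suc: "2 \<le> b \<Longrightarrow> x \<le> b ^ i \<Longrightarrow> Suc x \<le> b ^ Suc i" for b :: nat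
proof -
  assume b: "2 \<le> b" and x: "x \<le> b ^ i"
  have "1 \<le> b ^ i" "2 * b ^ i \<le> b ^ Suc i" using b by simp_all
  then show ?thesis using x by linarith
qed

lemma le_power_add: "2 \<le> b \<Longrightarrow> x \<le> b ^ i \<Longrightarrow> y \<le> b ^ i \<Longrightarrow> x + y \<le> b ^ Suc i" for b :: nat
proof -
  assume b: "2 \<le> b" and x: "x \<le> b ^ i" "y \<le> b ^ i"
  have "2 * b ^ i \<le> b ^ Suc i" using b by simp
  then show ?thesis using x by linarith
qed

lemma le_power_mult: "x \<le> b ^ i \<Longrightarrow> y \<le> b ^ j \<Longrightarrow> x * y \<le> b ^ (i + j)" for b :: nat
  by (simp add: power_add mult_le_mono)

text \<open>With \<open>b\<close> above \<open>2 ^ k\<close> and \<open>n + 2\<close>, patterns and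
  their colourings need \<open>b ^ 27\<close> each and coordinates \<open>b ^ 57\<close>. A table
  needs \<open>b ^ 120\<close>. The state with all tables raises this to \<open>b ^ 126\<close>,
  which exceeds all other requirements.\<close>

lemma pad_large:
  fixes b n k :: nat
  assumes k: "2 ^ k \<le> b" and n: "n + 2 \<le> b"
  shows "large (b ^ 126) n k" "16 * (n + 2) ^ 3 \<le> b ^ 126" "2 ^ k * (n + 2) ^ 3 \<le> b ^ 126"
    "3 ^ (12 * k + 4) * (2 * (n + 2) ^ 2) \<le> b ^ 126"
proof -
  have b: "2 \<le> b" using n by simp
  note S = le_power_Suc[OF b] and A = le_power_add[OF b] and X = le_power_mult[of _ b]
  have up: "x \<le> b ^ i \<Longrightarrow> i \<le> j \<Longrightarrow> x \<le> b ^ j" for x i j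
    using b by (meson le_trans power_increasing one_le_numeral)
  have two: "2 ^ i \<le> b ^ i" for i using b by (rule power_mono) simp
  have n2: "(n + 2) ^ i \<le> b ^ i" and n1: "(n + 1) ^ i \<le> b ^ i" for i using n by (auto intro: power_mono)
  have nn: "n \<le> b ^ 1" "Suc n \<le> b ^ 1" "n + 2 \<le> b ^ 1" using n by auto
  have pk: "2 ^ (i * k) \<le> b ^ i" for i
    using power_mono[OF k, of i] by (simp add: power_mult[symmetric] mult.commute)
  have exp: "2 ^ (i * k + j) \<le> b ^ (i + j)" for i j
    unfolding power_add[of 2] by (rule X[OF pk two])
  have pat: "pattern_bound n k \<le> b ^ 27"
    using X[OF n1[of 6] exp[of 15 6]] by (simp add: pattern_bound_def)
  have coord: "coord_bound n k \<le> b ^ 57"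
    using X[OF n2[of 3] X[OF pat exp[of 15 12]]] by (simp add: coord_bound_def)
  have four: "4 * (n + 2) ^ 2 \<le> b ^ 4" using X[OF two[of 2] n2[of 2]] by simp
  have tab: "table_bound n k \<le> b ^ 120"
    using X[OF coord S[OF X[OF coord S[OF four]]]] by (simp add: table_bound_def)
  have sq: "n * Suc n \<le> b ^ 2" using X[OF nn(1,2)] by (simp add: numeral_2_eq_2)
  have "pattern_bound n k * Suc (n * Suc n) \<le> b ^ 126"
    by (rule up[OF X[OF pat S[OF sq]]]) simp
  moreover have "2 ^ (15 * k + 12) * Suc (n * (n + 2)) \<le> b ^ 126"
    by (rule up[OF X[OF exp S[OF X[OF nn(1,3)]]]]) simp
  moreover have "Suc (n * Suc (Suc (n * Suc n + table_bound n k)) + n * Suc n) \<le> b ^ 126"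
  proof -
    have "n * Suc n + table_bound n k \<le> b ^ Suc 120" by (rule A[OF up[OF sq] tab]) simp
    then have "n * Suc (Suc (n * Suc n + table_bound n k)) \<le> b ^ (1 + Suc (Suc (Suc 120)))"
      by (intro X nn(1) S)
    then have "n * Suc (Suc (n * Suc n + table_bound n k)) + n * Suc n \<le> b ^ Suc (1 + Suc (Suc (Suc 120)))"
      by (rule A[OF _ up[OF sq]]) simp
    from S[OF this] show ?thesis by (rule up) simp
  qed
  ultimately show "large (b ^ 126) n k" unfolding large_def using up[OF tab] by simp
  show "16 * (n + 2) ^ 3 \<le> b ^ 126" using up[OF X[OF two[of 4] n2[of 3]], of 126] by simp
  show "2 ^ k * (n + 2) ^ 3 \<le> b ^ 126" using up[OF X[OF pk[of 1] n2[of 3]], of 126] by simp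
  have "(3 :: nat) ^ (12 * k + 4) \<le> 4 ^ (12 * k + 4)" by (rule power_mono) simp_all
  also have "\<dots> = (2 ^ 2) ^ (12 * k + 4)" by simp
  also have "\<dots> = 2 ^ (24 * k + 8)" unfolding power_mult[symmetric] by simp
  also have "\<dots> \<le> b ^ 32" using exp[of 24 8] by simp
  finally have three: "3 ^ (12 * k + 4) \<le> b ^ 32" .
  have "2 * (n + 2) ^ 2 \<le> b ^ (1 + 2)" by (rule X[OF _ n2]) (use b in simp)
  from up[OF X[OF three this], of 126] show "3 ^ (12 * k + 4) * (2 * (n + 2) ^ 2) \<le> b ^ 126" by simp
qed

definition fvs :: "bool list list \<times> nat \<Rightarrow> nat list option" where
  "fvs x = solve ((2 ^ snd x * (length (fst x) + 2)) ^ 126) (fst x) (snd x)"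

text \<open>The unary number \<open>2 ^ k\<close> is built by \<open>k\<close> doublings, the only
  loop with exponential output. Everything else, including the power 126, is polynomial in the pair
  of this number and the input.\<close>

lemma feasible_fvs: "feasible (\<lambda>x. 2 ^ snd x * (sz (fst x) + 2)) fvs"
proof -
  let ?\<mu> = "\<lambda>x :: bool list list \<times> nat. 2 ^ snd x * (sz (fst x) + 2)"
  have double: "fold (\<lambda>y s. s + s) xs (s :: nat) = 2 ^ length xs * s" for xs :: "nat list" and s
    by (induction xs arbitrary: s) simp_all
  have le: "2 ^ snd x \<le> ?\<mu> x" for x :: "bool list list \<times> nat" by simp
  have id: "pbounded ?\<mu> sz"
  proof (rule pboundedI[of _ 1 _ 1])
    fix x :: "bool list list \<times> nat"
    obtain m k where x: "x = (m, k)" by fastforce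
    have "k + sz m \<le> 2 ^ k * (sz m + 2)"
    proof -
      have "k \<le> 2 ^ k" by (rule less_imp_le) (rule less_exp)
      moreover have "sz m \<le> 2 ^ k * sz m" by simp
      ultimately show ?thesis unfolding distrib_left by linarith
    qed
    then show "sz x \<le> 1 * Suc (?\<mu> x) ^ 1" using x by simp
  qed
  have "feasible ?\<mu> (\<lambda>x. fold (\<lambda>y s. (\<lambda>z. snd (snd z) + snd (snd z)) (x, y, s)) [0..<snd x] (1 :: nat))"
  proof (rule feasible_fold[OF _ _ _ id pbounded_id])
    show "ptime (\<lambda>z :: (bool list list \<times> nat) \<times> nat \<times> nat. snd (snd z) + snd (snd z))" by (intro pt)
    show "feasible ?\<mu> (\<lambda>x. [0..<snd x])" by (rule feasible_compose[OF _ feasible_id[OF id]]) (intro pt)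
    show "feasible ?\<mu> (\<lambda>x. 1 :: nat)" by (rule feasible_const)
    fix x :: "bool list list \<times> nat" and i
    have "(2 :: nat) ^ length (take i [0..<snd x]) \<le> 2 ^ snd x" by (intro power_increasing) auto
    then show "sz (fold (\<lambda>y s. (\<lambda>z. snd (snd z) + snd (snd z)) (x, y, s)) (take i [0..<snd x]) (1 :: nat)) \<le> ?\<mu> x"
      unfolding snd_conv double using le[of x] by (simp only: sz_nat mult_1_right)
  qed
  then have "feasible ?\<mu> (\<lambda>x. 2 ^ snd x :: nat)" unfolding snd_conv double by simp
  then have "feasible ?\<mu> (\<lambda>x. (2 ^ snd x :: nat, x))" by (rule feasible_Pair[OF _ feasible_id[OF id]])
  moreover have "ptime (\<lambda>y :: nat \<times> bool list list \<times> nat.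
      solve ((fst y * (length (fst (snd y)) + 2)) ^ 126) (fst (snd y)) (snd (snd y)))"
    by (intro pt)
  ultimately have "feasible ?\<mu> (\<lambda>x. (\<lambda>y. solve ((fst y * (length (fst (snd y)) + 2)) ^ 126) (fst (snd y)) (snd (snd y))) (2 ^ snd x, x))"
    by (rule feasible_compose[rotated])
  then show ?thesis unfolding fst_conv snd_conv fvs_def[abs_def] .
qed

section \<open>Adjacency matrices and the final time bound\<close>

context
  fixes G :: "nat graph" and n :: nat
  assumes G: "simple_graph G" "verts G = {..<n}"
begin

lemma length_adjacency_matrix: "length (adjacency_matrix G) = n"
  using G(2) by (simp add: adjacency_matrix_def)

lemma edge_adjacency_matrix: "edge (adjacency_matrix G) i j \<longleftrightarrow> {i, j} \<in> edges G"
proof -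
  have "i < n" "j < n" if "{i, j} \<in> edges G" using G that unfolding simple_graph_def by auto
  then show ?thesis using G(2) by (auto simp: edge_def nthd_def adjacency_matrix_def)
qed

lemma undirected_adjacency_matrix: "undirected (edge (adjacency_matrix G))"
proof
  show "edge (adjacency_matrix G) x y \<Longrightarrow> edge (adjacency_matrix G) y x" for x y
    by (simp add: edge_adjacency_matrix insert_commute)
  show "\<not> edge (adjacency_matrix G) x x" for x
    using G(1) unfolding edge_adjacency_matrix simple_graph_def by fastforce
qed

lemma forest_delete_verts: "forest (delete_verts G X) \<longleftrightarrow> acyclic_on (edge (adjacency_matrix G)) ({..<n} - X)"
proof -
  have "is_cycle (delete_verts G X) vs \<longleftrightarrow> 3 \<le> length vs \<and> distinct vs \<and> set vs \<subseteq> {..<n} - X \<and>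
     (\<forall>i < length vs. edge (adjacency_matrix G) (vs ! i) (vs ! (Suc i mod length vs)))" (is "_ \<longleftrightarrow> ?R") for vs
  proof -
    have "{vs ! i, vs ! (Suc i mod length vs)} \<inter> X = {}" if "set vs \<subseteq> {..<n} - X" "i < length vs" for i
    proof -
      have "Suc i mod length vs < length vs" using that(2) by (intro mod_less_divisor) linarith
      then have "vs ! i \<in> set vs" "vs ! (Suc i mod length vs) \<in> set vs" using that(2) by auto
      then show ?thesis using that(1) by blast
    qed
    then show ?thesis using G(2) unfolding is_cycle_def edge_adjacency_matrix by (auto simp: delete_verts_def)
  qed
  then show ?thesis by (simp add: forest_def acyclic_on_def)
qed

text \<open>The summand 3 absorbs the additive constants of the measure in the final
  estimate.\<close>

lemma sz_adjacency_matrix: "sz (adjacency_matrix G) + 3 \<le> 4 * (n + 1) ^ 2"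
proof -
  have row: "sz (map f xs) \<le> 2 * length xs" for f :: "nat \<Rightarrow> bool" and xs
  proof (induction xs)
    case (Cons x xs)
    then show ?case using sz_bool_le[of "f x"] by simp
  qed simp
  have "sz (map (\<lambda>i. map (f i) [0..<n]) xs) \<le> length xs * (2 * n + 1)" for f :: "nat \<Rightarrow> nat \<Rightarrow> bool" and xs
  proof (induction xs)
    case (Cons x xs)
    then show ?case using row[of "f x" "[0..<n]"] by simp
  qed simp
  from this[of "\<lambda>i j. {i, j} \<in> edges G" "[0..<n]"] have "sz (adjacency_matrix G) \<le> n * (2 * n + 1)"
    using G(2) by (simp add: adjacency_matrix_def)
  then show ?thesis by (simp add: power2_eq_square algebra_simps)
qed

text \<open>Complements of feedback vertex sets are the induced forests, so a largest forest leaves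
  a minimum feedback vertex set. A missing order refutes all deletion sets of size at most
  \<open>k\<close>.\<close>

lemma fvs_correct:
  "correct_answer G k (case fvs (adjacency_matrix G, k) of None \<Rightarrow> No_CVD_Set | Some xs \<Rightarrow> FVS xs)"
proof -
  let ?m = "adjacency_matrix G"
  let ?b = "2 ^ k * (n + 2)"
  note und = undirected_adjacency_matrix
  have "1 * (n + 2) \<le> ?b" by (rule mult_le_mono1) simp
  then have "n + 2 \<le> ?b" "2 ^ k \<le> ?b" by simp_all
  note pad = pad_large[OF this(2,1), folded length_adjacency_matrix]
  let ?p = "(2 ^ k * (length ?m + 2)) ^ 126"
  have fvs: "fvs (?m, k) = solve ?p ?m k" by (simp add: fvs_def)
  show ?thesis
  proof (cases "elimination_order ?p ?m k")
    case None
    have False if S: "S \<subseteq> verts G" "chordal (delete_verts G S)" "card S \<le> k" for S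
    proof -
      have "edge ?m x y \<longleftrightarrow> x \<in> verts G \<and> y \<in> verts G \<and> {x, y} \<in> edges G" for x y
        using G(1) unfolding edge_adjacency_matrix simple_graph_def by auto
      from chordal_on_delete_verts[OF S(2) this] have "chordal_on (edge ?m) ({..<length ?m} - S)"
        by (simp add: length_adjacency_matrix G(2))
      moreover have "S \<subseteq> {..<length ?m}" using S(1) by (simp add: length_adjacency_matrix G(2))
      ultimately show False using elimination_order_exists[OF und pad(2-4), of S] S(3) None by simp
    qed
    then show ?thesis using None by (auto simp: fvs solve_def chordal_vertex_deletion_set_def)
  next
    case (Some \<pi>)
    let ?U = "shrink ?p ?m \<pi>"
    let ?xs = "filter (\<lambda>v. v \<notin> set ?U) [0..<length ?m]"
    note U = shrink_correct[OF und pad(1) elimination_order_thin[OF und pad(2) Some], unfolded length_adjacency_matrix]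
    have xs: "set ?xs = {..<n} - set (shrink ((2 ^ k * (n + 2)) ^ 126) ?m \<pi>)" by (auto simp: length_adjacency_matrix)
    have compl: "{..<n} - ({..<n} - A) = A" if "A \<subseteq> {..<n}" for A :: "nat set" using that by blast
    have "feedback_vertex_set G (set ?xs)"
      unfolding feedback_vertex_set_def forest_delete_verts xs using U(1) compl[OF U(2)] G(2) by simp
    moreover have "card (set ?xs) \<le> card Y" if Y: "feedback_vertex_set G Y" for Y
    proof -
      have sub: "Y \<subseteq> {..<n}" and ac: "acyclic_on (edge ?m) ({..<n} - Y)"
        using Y G(2) unfolding feedback_vertex_set_def forest_delete_verts by auto
      have "card ({..<n} - Y) \<le> card (set (shrink ((2 ^ k * (n + 2)) ^ 126) ?m \<pi>))" by (rule U(3)[OF _ ac]) blast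
      moreover have "card ({..<n} - Y) = n - card Y" "card Y \<le> n"
        using sub card_Diff_subset[of Y "{..<n}"] card_mono[OF _ sub] finite_subset[OF sub] by auto
      moreover have "card (set ?xs) = n - card (set (shrink ((2 ^ k * (n + 2)) ^ 126) ?m \<pi>))"
        unfolding xs using U(2) card_Diff_subset[of "set (shrink ((2 ^ k * (n + 2)) ^ 126) ?m \<pi>)" "{..<n}"] by simp
      ultimately show ?thesis by linarith
    qed
    moreover have "distinct ?xs" by simp
    moreover have "fvs (?m, k) = Some ?xs" using Some by (simp add: fvs solve_def)
    ultimately show ?thesis by (simp only: minimum_feedback_vertex_set_def correct_answer.simps option.simps) blast
  qed
qed

end

theorem theorem4p2:
  shows "\<exists>(P :: program) (a :: nat) (b :: nat) (c :: nat). \<forall>(n :: nat) (G :: nat graph) (k :: nat).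
    simple_graph G \<and> verts G = {..<n} \<longrightarrow>
    (\<exists>r t. runs P (enc_input G k) (enc_answer r) t \<and>
       t \<le> a * 2 ^ (b * k) * (n + 1) ^ c \<and> correct_answer G k r)"
proof -
  obtain P e T where T: "implements P e fvs T" "pbounded (\<lambda>x. 2 ^ snd x * (sz (fst x) + 2)) T"
    using feasible_fvs unfolding feasible_def by blast
  from T(2) obtain A c where A: "\<And>x. T x \<le> A * Suc (2 ^ snd x * (sz (fst x) + 2)) ^ c"
    unfolding pbounded_def by blast
  \<comment> \<open>Execution starts with function 0, so the main expression is put in front and all
    calls move by one.\<close>
  let ?P = "[shift 1 e] @ map (shift 1) P"
  show ?thesis
  \<comment> \<open>The constants come from raising \<open>2 ^ k * (4 * (n + 1) ^ 2)\<close> to the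
    power \<open>c\<close>.\<close>
  proof (rule exI[of _ ?P], rule exI[of _ "A * 4 ^ c"], rule exI[of _ c], rule exI[of _ "2 * c"], intro allI impI)
    fix n :: nat and G :: "nat graph" and k :: nat
    assume "simple_graph G \<and> verts G = {..<n}"
    then have G: "simple_graph G" "verts G = {..<n}" by auto
    let ?m = "adjacency_matrix G"
    let ?r = "case fvs (?m, k) of None \<Rightarrow> No_CVD_Set | Some xs \<Rightarrow> FVS xs"
    obtain t where t: "t \<le> T (?m, k)" "eval P [enc (?m, k)] e (enc (fvs (?m, k))) t"
      using T(1) unfolding implements_def by blast
    have "enc (?m, k) = enc_input G k" by (simp add: enc_input_def)
    moreover have "enc (fvs (?m, k)) = enc_answer ?r" by (simp split: option.split)
    moreover have "eval ?P [enc (?m, k)] (shift 1 e) (enc (fvs (?m, k))) t"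
      using eval_program_shift(1)[OF t(2), of "[shift 1 e]"] by simp
    ultimately have run: "runs ?P (enc_input G k) (enc_answer ?r) t" unfolding runs_def by simp
    have "Suc (2 ^ k * (sz ?m + 2)) \<le> 2 ^ k * (4 * (n + 1) ^ 2)"
    proof -
      have "Suc (2 ^ k * (sz ?m + 2)) \<le> 2 ^ k + 2 ^ k * (sz ?m + 2)" by simp
      also have "\<dots> = 2 ^ k * (sz ?m + 3)" by (simp add: algebra_simps)
      also have "\<dots> \<le> 2 ^ k * (4 * (n + 1) ^ 2)" by (rule mult_le_mono2) (rule sz_adjacency_matrix[OF G])
      finally show ?thesis .
    qed
    then have "T (?m, k) \<le> A * (2 ^ k * (4 * (n + 1) ^ 2)) ^ c"
      using A[of "(?m, k)"] by (auto intro: order.trans mult_le_mono2 power_mono)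
    also have "\<dots> = A * 4 ^ c * 2 ^ (c * k) * (n + 1) ^ (2 * c)"
      by (simp add: power_mult_distrib power_mult[symmetric] ac_simps)
    finally have "t \<le> A * 4 ^ c * 2 ^ (c * k) * (n + 1) ^ (2 * c)" using t(1) by simp
    then show "\<exists>r t. runs ?P (enc_input G k) (enc_answer r) t \<and>
        t \<le> A * 4 ^ c * 2 ^ (c * k) * (n + 1) ^ (2 * c) \<and> correct_answer G k r"
      using run fvs_correct[OF G] by blast
  qed
qed

end
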